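(* Let $d\in\mathbb{N}$ and $\delta>0$. Let $\alpha=O(1)$ and assume that $C\varepsilon\sqrt{\log(1/\varepsilon)}\le\alpha$ for a sufficiently large absolute constant $C$, and \[ n\ge\Omega\!\left(\frac{\sqrt d\log(1/\delta)}{\alpha^2}+\frac{d\varepsilon^2\log(1/\delta)}{\alpha^4}\,\mathrm{polylog}(d,1/\varepsilon,1/\alpha,\log(1/\delta))\right). \] Then there is an algorithm which runs in time $O(\varepsilon n^2 d\min(n,d)+nd)$ with the following guarantees: (1) for every $\mu\in\mathbb{R}^d$ with $\|\mu\|=\alpha$, with probability $1-\delta$ over $n$ independent samples $X_1,\dots,X_n$ from $\mathcal{N}(\mu,I)$, given any adaptive $\varepsilon$-corruption of $X_1,\dots,X_n$, the algorithm outputs YES; (2) with probability $1-\delta$ over $n$ independent samples $X_1,\dots,X_n$ from $\mathcal{N}(0,I)$, given any adaptive $\varepsilon$-corruption of $X_1,\dots,X_n$, the algorithm outputs NO.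
   Context: An adaptive $\varepsilon$-corruption of $X_1,\dots,X_n$ is any dataset obtained by an adversary who sees $X_1,\dots,X_n$ and replaces $\varepsilon n$ of them (chosen adaptively) by arbitrary vectors.
   Formalization: Logarithms are read as max(1, log), since with the plain log the hypotheses degenerate as ε or δ tends to 1 (at ε=1 all samples may be replaced, yet Cε√log(1/ε)=0≤α); for ε, δ ≤ 1/2 this only changes constants. Also d ≥ 1, ε > 0, and C and the implied constants depend on the O(1) bound on α. *)

theory Defs
  imports "HOL-Probability.Probability"
begin

section \<open>Real RAM\<close>

text \<open>
  Running time is measured on a deterministic unit-cost real RAM, presented as a structured
  language.  A state has integer (\<open>nat\<close>) and real registers, and integer and real arrays.
  Registers and arrays are named by the literals occurring in the program, so a program uses
  finitely many of each; array cells are addressed indirectly, through an integer register.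
  Reals have exact arithmetic, square roots and comparisons.  There are no real constants in
  programs and there is no conversion from reals to integers.  Integers only have addition and
  truncated subtraction.  HOL's conventions \<open>x / 0 = 0\<close> and \<open>sqrt (-x) = - sqrt x\<close>
  make every instruction total.
\<close>

record state =
  ireg :: "nat \<Rightarrow> nat"
  rreg :: "nat \<Rightarrow> real"
  iarr :: "nat \<Rightarrow> nat \<Rightarrow> nat"
  rarr :: "nat \<Rightarrow> nat \<Rightarrow> real"

datatype instr =
    IConst nat nat
  | IAdd nat nat nat
  | ISub nat nat nat
  | ILoad nat nat nat
  | IStore nat nat nat
  | RCast nat nat
  | RAdd nat nat nat
  | RSub nat nat nat
  | RMul nat nat nat
  | RDiv nat nat nat
  | RSqrt nat nat
  | RLoad nat nat nat
  | RStore nat nat nat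

fun step :: "instr \<Rightarrow> state \<Rightarrow> state" where
  "step (IConst r c) s = s\<lparr>ireg := (ireg s)(r := c)\<rparr>"
| "step (IAdd r p q) s = s\<lparr>ireg := (ireg s)(r := ireg s p + ireg s q)\<rparr>"
| "step (ISub r p q) s = s\<lparr>ireg := (ireg s)(r := ireg s p - ireg s q)\<rparr>"
| "step (ILoad r a i) s = s\<lparr>ireg := (ireg s)(r := iarr s a (ireg s i))\<rparr>"
| "step (IStore a i r) s = s\<lparr>iarr := (iarr s)(a := (iarr s a)(ireg s i := ireg s r))\<rparr>"
| "step (RCast r i) s = s\<lparr>rreg := (rreg s)(r := real (ireg s i))\<rparr>"
| "step (RAdd r p q) s = s\<lparr>rreg := (rreg s)(r := rreg s p + rreg s q)\<rparr>"
| "step (RSub r p q) s = s\<lparr>rreg := (rreg s)(r := rreg s p - rreg s q)\<rparr>"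
| "step (RMul r p q) s = s\<lparr>rreg := (rreg s)(r := rreg s p * rreg s q)\<rparr>"
| "step (RDiv r p q) s = s\<lparr>rreg := (rreg s)(r := rreg s p / rreg s q)\<rparr>"
| "step (RSqrt r p) s = s\<lparr>rreg := (rreg s)(r := sqrt (rreg s p))\<rparr>"
| "step (RLoad r a i) s = s\<lparr>rreg := (rreg s)(r := rarr s a (ireg s i))\<rparr>"
| "step (RStore a i r) s = s\<lparr>rarr := (rarr s)(a := (rarr s a)(ireg s i := rreg s r))\<rparr>"

datatype test = ILess nat nat | RLess nat nat

fun holds :: "test \<Rightarrow> state \<Rightarrow> bool" where
  "holds (ILess p q) s \<longleftrightarrow> ireg s p < ireg s q"
| "holds (RLess p q) s \<longleftrightarrow> rreg s p < rreg s q"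

datatype program =
    Instr instr
  | Seq program program
  | Cond test program program
  | While test program

text \<open>
  \<open>exec P s t s'\<close>: started in \<open>s\<close>, the program \<open>P\<close> halts in \<open>s'\<close> after exactly \<open>t\<close> steps,
  where every instruction and every evaluation of a test counts as one step.
\<close>

inductive exec :: "program \<Rightarrow> state \<Rightarrow> nat \<Rightarrow> state \<Rightarrow> bool" where
  Instr: "exec (Instr c) s 1 (step c s)"
| Seq: "exec P s t s' \<Longrightarrow> exec Q s' u s'' \<Longrightarrow> exec (Seq P Q) s (t + u) s''"
| CondT: "holds b s \<Longrightarrow> exec P s t s' \<Longrightarrow> exec (Cond b P Q) s (t + 1) s'"
| CondF: "\<not> holds b s \<Longrightarrow> exec Q s t s' \<Longrightarrow> exec (Cond b P Q) s (t + 1) s'"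
| WhileF: "\<not> holds b s \<Longrightarrow> exec (While b P) s 1 s"
| WhileT: "holds b s \<Longrightarrow> exec P s t s' \<Longrightarrow> exec (While b P) s' u s''
    \<Longrightarrow> exec (While b P) s (t + u + 1) s''"

lemma exec_deterministic:
  "exec P s t s' \<Longrightarrow> exec P s u s'' \<Longrightarrow> u = t \<and> s'' = s'"
proof (induction arbitrary: u s'' rule: exec.induct)
  case (Instr c s)
  from Instr.prems show ?case by (cases rule: exec.cases) simp_all
next
  case (Seq P s t s' Q v s2)
  from Seq.prems obtain t1 v1 s1 where "exec P s t1 s1" "exec Q s1 v1 s''" "u = t1 + v1"
    by (cases rule: exec.cases) simp_all
  with Seq.IH(1)[of t1 s1] Seq.IH(2)[of v1 s''] show ?case by simp
next
  case (CondT b s P t s' Q)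
  from CondT.prems CondT.hyps obtain t1 where "exec P s t1 s''" "u = t1 + 1"
    by (cases rule: exec.cases) simp_all
  with CondT.IH[of t1 s''] show ?case by simp
next
  case (CondF b s Q t s' P)
  from CondF.prems CondF.hyps obtain t1 where "exec Q s t1 s''" "u = t1 + 1"
    by (cases rule: exec.cases) simp_all
  with CondF.IH[of t1 s''] show ?case by simp
next
  case (WhileF b s P)
  from WhileF.prems WhileF.hyps show ?case by (cases rule: exec.cases) simp_all
next
  case (WhileT b s P t s' v s2)
  from WhileT.prems WhileT.hyps obtain t1 v1 s1
    where "exec P s t1 s1" "exec (While b P) s1 v1 s''" "u = t1 + v1 + 1"
    by (cases rule: exec.cases) simp_all
  with WhileT.IH(1)[of t1 s1] WhileT.IH(2)[of v1 s''] show ?case by simp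
qed

definition runs_within :: "program \<Rightarrow> state \<Rightarrow> real \<Rightarrow> bool" where
  "runs_within P s B \<longleftrightarrow> (\<exists>t s'. exec P s t s' \<and> real t \<le> B)"

datatype verdict = YES | NO

text \<open>The answer is read off integer register 0 when the program halts.\<close>

definition outputs :: "program \<Rightarrow> state \<Rightarrow> verdict \<Rightarrow> bool" where
  "outputs P s v \<longleftrightarrow> (\<exists>t s'. exec P s t s' \<and> v = (if ireg s' 0 = 0 then NO else YES))"


section \<open>Datasets, corruptions and Gaussian samples\<close>

text \<open>
  A dataset of \<open>n\<close> vectors in dimension \<open>d\<close> is a function \<open>X\<close> of which only the values
  \<open>X i j\<close> with \<open>i < n\<close> and \<open>j < d\<close> matter.  It is stored row by row in real array 0; the
  parameters of the problem are given in registers.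
\<close>

definition input ::
  "nat \<Rightarrow> nat \<Rightarrow> real \<Rightarrow> real \<Rightarrow> real \<Rightarrow> (nat \<Rightarrow> nat \<Rightarrow> real) \<Rightarrow> state" where
  "input n d \<epsilon> \<alpha> \<delta> X =
    \<lparr> ireg = (\<lambda>_. 0)(0 := n, 1 := d),
      rreg = (\<lambda>_. 0)(0 := \<epsilon>, 1 := \<alpha>, 2 := \<delta>),
      iarr = (\<lambda>_ _. 0),
      rarr = (\<lambda>a k. if a = 0 \<and> k < n * d then X (k div d) (k mod d) else 0) \<rparr>"

definition corruption ::
  "nat \<Rightarrow> nat \<Rightarrow> real \<Rightarrow> (nat \<Rightarrow> nat \<Rightarrow> real) \<Rightarrow> (nat \<Rightarrow> nat \<Rightarrow> real) \<Rightarrow> bool" where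
  "corruption n d \<epsilon> X Y \<longleftrightarrow> real (card {i. i < n \<and> (\<exists>j<d. Y i j \<noteq> X i j)}) \<le> \<epsilon> * real n"

definition gaussian :: "nat \<Rightarrow> (nat \<Rightarrow> real) \<Rightarrow> (nat \<Rightarrow> real) measure" where
  "gaussian d \<mu> = (\<Pi>\<^sub>M j\<in>{..<d}. density lborel (normal_density (\<mu> j) 1))"

definition samples :: "nat \<Rightarrow> nat \<Rightarrow> (nat \<Rightarrow> real) \<Rightarrow> (nat \<Rightarrow> nat \<Rightarrow> real) measure" where
  "samples n d \<mu> = (\<Pi>\<^sub>M i\<in>{..<n}. gaussian d \<mu>)"

text \<open>
  Because the adversary sees the samples, one event of probability at least \<open>1 - \<delta>\<close> has to
  work for all corruptions simultaneously.  The event is quantified explicitly since the set of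
  all samples that are good for every corruption is not Borel by construction.
\<close>

definition robustly_outputs ::
  "program \<Rightarrow> nat \<Rightarrow> nat \<Rightarrow> real \<Rightarrow> real \<Rightarrow> real \<Rightarrow> (nat \<Rightarrow> real) \<Rightarrow> verdict \<Rightarrow> bool" where
  "robustly_outputs P n d \<epsilon> \<alpha> \<delta> \<mu> v \<longleftrightarrow>
    (\<exists>E \<in> sets (samples n d \<mu>). measure (samples n d \<mu>) E \<ge> 1 - \<delta> \<and>
      (\<forall>X\<in>E. \<forall>Y. corruption n d \<epsilon> X Y \<longrightarrow> outputs P (input n d \<epsilon> \<alpha> \<delta> Y) v))"


section \<open>Logarithms in asymptotic bounds\<close>

text \<open>
  The usual convention that logarithms in asymptotic bounds are bounded away from 0.  It only
  matters for arguments below \<open>e\<close>.  With the plain logarithm the bounds would degenerate as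
  \<open>\<epsilon>\<close> or \<open>\<delta>\<close> tends to 1: for instance \<open>\<epsilon> * sqrt (ln (1/\<epsilon>))\<close> tends to 0 there, although
  almost all of the data may then be replaced.
\<close>

definition lg :: "real \<Rightarrow> real" where
  "lg x = max 1 (ln x)"

text \<open>
  Every factor is at least 1, so up to a constant factor the powers of this product dominate
  every polynomial in the four logarithms.
\<close>

definition polylog :: "nat \<Rightarrow> real \<Rightarrow> real \<Rightarrow> real \<Rightarrow> real \<Rightarrow> real" where
  "polylog k w x y z = (lg w * lg x * lg y * lg z) ^ k"

end

theory Submission
  imports Defs
begin

text \<open>
  The test thresholds the squared norm of the sum of the surviving samples, minus its mean under the
  null hypothesis; each sample whose inner product with that sum is abnormally large is counted
  with the opposite sign, so that the remaining corruptions can only contribute a small amount.  The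
  survivors are found by spectral filtering: if a high power of the empirical covariance (for
  \<open>n \<ge> d\<close>) or of the Gram matrix (for \<open>n < d\<close>) is too large, then most of its mass is carried by
  corrupted samples, so removing the heaviest ones costs few good samples and shrinks a trace
  potential geometrically.  When there are few corruptions, filtering by norms or by pairs suffices,
  which keeps the running time within the budget.
\<close>

text \<open>Two constraints shape the construction. The time bound has no logarithms, whereas the
  spectral filter takes \<open>48 * p^2\<close> rounds of about \<open>p\<close> matrix products,
  with \<open>p\<close> about \<open>log2 n\<close>. It therefore runs only if
  \<open>n < be^4\<close> for \<open>be = \<epsilon> * n\<close>: then \<open>p^12 = O(n)\<close>
  yields \<open>p^3 = O(be)\<close>, so the surplus is paid for by the factor
  \<open>\<epsilon> * n\<close> of the bound. Otherwise \<open>\<epsilon>^4 * n^3 <= 1\<close>, and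
  entrywise bounds on the Gram matrix are strong enough. The sample bound, likewise, has no
  logarithm of \<open>n\<close>; \<open>log n\<close> is bounded through the ratio of
  \<open>n\<close> to the second term of that bound. With \<open>N = n * \<alpha>\<close> the
  statistic should be near \<open>N^2\<close> in one case and near 0 in the other. Every error term
  is held below \<open>N^2 / 50\<close>; the thresholds come from the budget equations
  \<open>be * ta = N^2 / 100\<close> and \<open>be^2 * th = N^2 / 10^8\<close>. All randomness is
  confined to one event, \<open>good\<close>, on which every corruption is handled
  deterministically.\<close>

lemmas sq_eq = power2_eq_square

section \<open>Linear algebra in explicit dimension, up to the spectral theorem\<close>

text \<open>Vectors are functions on \<open>nat\<close> read up to an explicit \<open>m\<close>,
  because both \<open>n\<close> and \<open>d\<close> occur as dimensions and are run-time data, not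
  types.\<close>

definition ip :: "nat => (nat => real) => (nat => real) => real" where
 "ip m x y = (SUM i<m. x i * y i)"

definition bil :: "nat => (nat => nat => real) => (nat => real) => (nat => real) => real" where
 "bil m A x y = (SUM i<m. SUM j<m. A i j * x i * y j)"

definition symm :: "nat => (nat => nat => real) => bool" where
 "symm m A \<longleftrightarrow> (ALL i<m. ALL j<m. A i j = A j i)"

definition orthonormal :: "nat => nat => (nat => nat => real) => bool" where
 "orthonormal m k U \<longleftrightarrow> (ALL a<k. ALL b<k. ip m (U a) (U b) = (if a = b then 1 else 0))"

lemma ip_commute: "ip m x y = ip m y x" by (simp add: ip_def mult.commute)

lemma ip_add_left: "ip m (%i. x i + y i) z = ip m x z + ip m y z"
 and ip_add_right: "ip m z (%i. x i + y i) = ip m z x + ip m z y"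
 and ip_diff_left: "ip m (%i. x i - y i) z = ip m x z - ip m y z"
 and ip_diff_right: "ip m z (%i. x i - y i) = ip m z x - ip m z y"
 and ip_scale_left: "ip m (%i. c * x i) z = c * ip m x z"
 and ip_scale_right: "ip m z (%i. c * x i) = c * ip m z x" by (simp_all add: ip_def algebra_simps sum.distrib sum_subtractf sum_distrib_left)

lemma ip_sum_left: "ip m (%i. SUM a:S. f a i) z = (SUM a:S. ip m (f a) z)" unfolding ip_def sum_distrib_right by (rule sum.swap)

lemma ip_sum_right: "ip m z (%i. SUM a:S. f a i) = (SUM a:S. ip m z (f a))" using ip_sum_left[of m f S z] by (simp add: ip_commute)

lemma ip_nonneg: "0 <= ip m x x" by (simp add: ip_def sum_nonneg)

lemma ip_Cauchy_Schwarz: "(ip m x y)\<^sup>2 <= ip m x x * ip m y y" using Cauchy_Schwarz_ineq_sum[of x y "{..<m}"] by (simp add: ip_def sq_eq)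

lemma bil_commute: "symm m A ==> bil m A x y = bil m A y x" unfolding bil_def by (subst sum.swap) (auto simp: symm_def intro!: sum.cong)

lemma bil_add_left: "bil m A (%i. x i + y i) z = bil m A x z + bil m A y z"
 and bil_add_right: "bil m A z (%i. x i + y i) = bil m A z x + bil m A z y"
 and bil_diff_left: "bil m A (%i. x i - y i) z = bil m A x z - bil m A y z"
 and bil_diff_right: "bil m A z (%i. x i - y i) = bil m A z x - bil m A z y"
 and bil_scale_left: "bil m A (%i. c * x i) z = c * bil m A x z"
 and bil_scale_right: "bil m A z (%i. c * x i) = c * bil m A z x" by (simp_all add: bil_def algebra_simps sum.distrib sum_subtractf sum_distrib_left)

lemma bil_outer:
 assumes "!!i j. i < m ==> j < m ==> A i j = (SUM a:S. c a * U a i * U a j)"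
 shows "bil m A x y = (SUM a:S. c a * ip m (U a) x * ip m (U a) y)"
proof -
 have "bil m A x y = (SUM i<m. SUM j<m. SUM a:S. c a * (U a i * x i) * (U a j * y j))"
  unfolding bil_def by (intro sum.cong refl) (simp add: assms sum_distrib_right, simp add: mult_ac)
 also have "... = (SUM i<m. SUM a:S. SUM j<m. c a * (U a i * x i) * (U a j * y j))" by (intro sum.cong refl) (rule sum.swap)
 also have "... = (SUM a:S. SUM i<m. SUM j<m. c a * (U a i * x i) * (U a j * y j))" by (rule sum.swap)
 also have "... = (SUM a:S. c a * ip m (U a) x * ip m (U a) y)" by (simp add: ip_def sum_distrib_left sum_distrib_right mult_ac)
 finally show ?thesis .
qed

text \<open>With \<open>y\<close> the projection of \<open>x\<close> to the span, expand
  \<open>|x - y|^2 >= 0\<close>. Stated for incomplete families, so that eigenvectors of eigenvalue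
  0 can be left out of all decompositions.\<close>

lemma Bessel:
 assumes "orthonormal m k U"
 shows "(SUM a<k. (ip m (U a) x)\<^sup>2) <= ip m x x"
proof -
 define y where "y = (%i. SUM a<k. ip m (U a) x * U a i)"
 have Uy: "ip m (U a) y = ip m (U a) x" if "a < k" for a
 proof -
  have "ip m (U a) y = (SUM b<k. ip m (U b) x * ip m (U a) (U b))" unfolding y_def ip_sum_right ip_scale_right ..
  also have "... = (SUM b<k. if b = a then ip m (U b) x else 0)" using assms that by (intro sum.cong) (auto simp: orthonormal_def)
  also have "... = ip m (U a) x" using that by simp
  finally show ?thesis .
 qed
 have xy: "ip m y x = (SUM a<k. (ip m (U a) x)\<^sup>2)" unfolding y_def ip_sum_left ip_scale_left sq_eq ..
 have yy: "ip m y y = (SUM a<k. (ip m (U a) x)\<^sup>2)"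
 proof -
  have "ip m y y = (SUM a<k. ip m (U a) x * ip m (U a) y)" by (subst (1) y_def) (simp only: ip_sum_left ip_scale_left)
  thus ?thesis by (simp add: Uy sq_eq)
 qed
 have "0 <= ip m (%i. x i - y i) (%i. x i - y i)" by (rule ip_nonneg)
 also have "... = ip m x x - 2 * ip m y x + ip m y y" by (simp add: ip_diff_left ip_diff_right ip_commute)
 finally show ?thesis using xy yy by simp
qed

text \<open>Double counting of squared coordinates: each vector contributes 1, and each coordinate
  at most 1 by \<open>Bessel\<close> at a unit vector.\<close>

lemma orthonormal_card_le:
 assumes "orthonormal m k U"
 shows "k <= m"
proof -
 have "real k = (SUM a<k. ip m (U a) (U a))" using assms by (simp add: orthonormal_def)
 also have "... = (SUM a<k. SUM i<m. (U a i)\<^sup>2)" by (simp add: ip_def sq_eq)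
 also have "... = (SUM i<m. SUM a<k. (U a i)\<^sup>2)" by (rule sum.swap)
 also have "... <= (SUM i<m. 1)"
 proof (rule sum_mono)
  fix i assume i: "i : {..<m}"
  let ?e = "%j. if j = i then 1 else (0::real)"
  have "ip m (U a) ?e = U a i" for a using i by (simp add: ip_def if_distrib[of "%z. _ * z"] cong: if_cong)
  moreover have "ip m ?e ?e = 1" using i by (simp add: ip_def if_distrib[of "%z. _ * z"] cong: if_cong)
  ultimately show "(SUM a<k. (U a i)\<^sup>2) <= 1" using Bessel[OF assms, of ?e] by simp
 qed
 finally show ?thesis by simp
qed

lemma linear_coefficient_zero:
 fixes b c :: real
 assumes "!!t. 0 <= b * t + c * t\<^sup>2"
 shows "b = 0"
proof (rule ccontr)
 assume "b ~= 0"
 define w where "w = 1 + \<bar>c\<bar>"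
 have w: "w > 0" "c < w" unfolding w_def by linarith+
 define t where "t = - b / w"
 have "b * t + c * t\<^sup>2 = - (b\<^sup>2 * (w - c) / w\<^sup>2)" unfolding t_def using w by (simp add: field_simps sq_eq)
 moreover have "b\<^sup>2 * (w - c) / w\<^sup>2 > 0" using \<open>b ~= 0\<close> w by simp
 ultimately have "b * t + c * t\<^sup>2 < 0" by simp
 thus False using assms[of t] by simp
qed

text \<open>\<open>nat => real\<close> carries the product topology. Vanishing from \<open>m\<close>
  on puts the sphere into a product of compact sets (Tychonoff), in which it is closed.\<close>

lemma compact_unit_sphere_fun:
 "compact {x :: nat => real. (ALL i>=m. x i = 0) & ip m x x = 1}"
proof -
 let ?B = "PiE UNIV (%i. if i < m then {-1..1::real} else {0})"
 let ?C = "{x :: nat => real. ip m x x = 1}"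
 have "compactin (product_topology (%i::nat. euclidean :: real topology) UNIV) ?B" by (subst compactin_PiE) auto
 hence B: "compact ?B" by (simp add: euclidean_product_topology)
 have "continuous_on UNIV (%x :: nat => real. ip m x x)" unfolding ip_def by (intro continuous_intros continuous_on_product_coordinates)
 hence C: "closed ?C" using continuous_closed_vimage[of "{1}" "%x. ip m x x"] by (auto simp: vimage_def continuous_on_eq_continuous_at)
 have "{x. (ALL i>=m. x i = 0) & ip m x x = 1} = ?B \<inter> ?C"
 proof (intro set_eqI iffI)
  fix x :: "nat => real" assume x: "x : {x. (ALL i>=m. x i = 0) & ip m x x = 1}"
  have "x i : {-1..1}" if "i < m" for i
  proof -
   have "x i * x i <= ip m x x" unfolding ip_def using that by (intro member_le_sum) auto
   hence "(x i)\<^sup>2 <= 1" using x by (simp add: sq_eq)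
   thus ?thesis by (auto simp: abs_square_le_1 abs_le_iff)
  qed
  with x show "x : ?B \<inter> ?C" by (auto simp: PiE_def Pi_def)
 next
  fix x :: "nat => real" assume x: "x : ?B \<inter> ?C"
  have "x i = 0" if "i >= m" for i
  proof -
   have "x i : (if i < m then {-1..1::real} else {0})" using x by (auto simp: PiE_def Pi_def)
   thus ?thesis using that by simp
  qed
  thus "x : {x. (ALL i>=m. x i = 0) & ip m x x = 1}" using x by auto
 qed
 thus ?thesis using compact_Int_closed[OF B C] by simp
qed

lemma ip_unit_left: "i < m ==> ip m (%j. if j = i then 1 else 0) x = x i" by (simp add: ip_def if_distrib[of "%z. z * _"] cong: if_cong)

lemma bil_unit_left:
 assumes "i < m"
 shows "bil m A (%j. if j = i then 1 else 0) x = (SUM j<m. A i j * x j)"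
proof -
 have "bil m A (%j. if j = i then 1 else 0) x = (SUM k<m. if k = i then (SUM j<m. A k j * x j) else 0)" unfolding bil_def by (intro sum.cong refl) auto
 thus ?thesis using assms by simp
qed

lemma bil_restrict: "bil m A (%i. if i < m then x i else 0) (%i. if i < m then y i else 0) = bil m A x y"
 and ip_restrict: "ip m (%i. if i < m then x i else 0) (%i. if i < m then y i else 0) = ip m x y" by (simp_all add: bil_def ip_def)

text \<open>Maximise \<open>|bil m A x x|\<close> on the unit sphere. Because of the absolute value
  the maximum is nonzero as soon as \<open>A\<close> is: otherwise polarisation on unit vectors
  kills every entry. The eigenvector equation is the first-order condition in each coordinate
  direction.\<close>

lemma exists_eigenvector:
 assumes sym: "symm m A" and nz: "i0 < m" "j0 < m" "A i0 j0 ~= 0"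
 shows "EX x \<nu>. ip m x x = 1 & \<nu> ~= 0 & (ALL i<m. (SUM j<m. A i j * x j) = \<nu> * x i)"
proof -
 let ?S = "{x :: nat => real. (ALL i>=m. x i = 0) & ip m x x = 1}"
 have "(%j. if j = i0 then 1 else 0) : ?S" using nz by (auto simp: ip_unit_left)
 hence "?S ~= {}" by (rule ex_in_conv[THEN iffD1, OF exI])
 moreover have "continuous_on ?S (%x. \<bar>bil m A x x\<bar>)"
 proof (rule continuous_on_subset)
  show "continuous_on UNIV (%x :: nat => real. \<bar>bil m A x x\<bar>)"
   unfolding bil_def by (intro continuous_intros continuous_on_product_coordinates)
 qed simp
 ultimately obtain x where x: "x : ?S" and max: "!!y. y : ?S ==> \<bar>bil m A y y\<bar> <= \<bar>bil m A x x\<bar>"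
  using continuous_attains_sup[OF compact_unit_sphere_fun, of m "%x. \<bar>bil m A x x\<bar>"] by blast
 define \<nu> where "\<nu> = bil m A x x"
 have bound: "\<bar>bil m A y y\<bar> <= \<bar>\<nu>\<bar> * ip m y y" for y
 proof (cases "ip m y y = 0")
  case True
  hence "ALL i<m. y i = 0" by (simp add: ip_def sum_nonneg_eq_0_iff)
  hence "bil m A y y = 0" by (simp add: bil_def)
  thus ?thesis using True by simp
 next
  case False
  hence pos: "ip m y y > 0" using ip_nonneg[of m y] by linarith
  define c where "c = 1 / sqrt (ip m y y)"
  define z where "z = (%i. if i < m then c * y i else 0)"
  have cc: "c * c * ip m y y = 1" unfolding c_def using pos by simp
  have "ip m z z = c * c * ip m y y" and bz: "bil m A z z = c * c * bil m A y y"
   unfolding z_def ip_restrict bil_restrict ip_scale_left ip_scale_right bil_scale_left bil_scale_right by (simp_all add: mult.assoc)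
  hence "ip m z z = 1" using cc by simp
  hence "z : ?S" unfolding z_def by simp
  from max[OF this] have "\<bar>c * c * bil m A y y\<bar> <= \<bar>\<nu>\<bar>" unfolding bz \<nu>_def .
  hence "c * c * \<bar>bil m A y y\<bar> <= \<bar>\<nu>\<bar>" by (simp add: abs_mult)
  hence "c * c * \<bar>bil m A y y\<bar> * ip m y y <= \<bar>\<nu>\<bar> * ip m y y" using pos by (simp add: mult_right_mono)
  moreover have "c * c * \<bar>bil m A y y\<bar> * ip m y y = (c * c * ip m y y) * \<bar>bil m A y y\<bar>" by simp
  ultimately show ?thesis using cc by simp
 qed
 have \<nu>0: "\<nu> ~= 0"
 proof
  assume "\<nu> = 0"
  hence z: "bil m A y y = 0" for y using bound[of y] by simp
  let ?e = "%j. if j = i0 then 1 else (0::real)" and ?f = "%j. if j = j0 then 1 else (0::real)"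
  have "bil m A (%i. ?e i + ?f i) (%i. ?e i + ?f i) = bil m A ?e ?e + 2 * bil m A ?e ?f + bil m A ?f ?f"
   using bil_commute[OF sym, of ?e ?f] by (simp only: bil_add_left bil_add_right)
  hence "bil m A ?e ?f = 0" using z by simp
  hence "A i0 j0 = 0" using nz by (simp only: bil_unit_left) (simp add: if_distrib[of "%z. _ * z"] cong: if_cong)
  thus False using nz by simp
 qed
 define s where "s = sgn \<nu>"
 have s: "s * \<nu> = \<bar>\<nu>\<bar>" "s * s = 1" "s ~= 0" using \<nu>0 by (auto simp: s_def sgn_real_def)
 have "(SUM j<m. A i j * x j) = \<nu> * x i" if i: "i < m" for i
 proof -
  let ?e = "%j. if j = i then 1 else (0::real)"
  let ?y = "%t j. x j + t * ?e j"
  \<comment> \<open>The inequality \<open>s * bil m A y y <= |\<nu>| * ip m y y\<close> is an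
    equality at \<open>t = 0\<close>, so along \<open>x + t * e_i\<close> the difference is a
    quadratic in \<open>t\<close> without constant term. As it is nonnegative, its linear
    coefficient vanishes.\<close>
  have "0 <= (2 * (\<bar>\<nu>\<bar> * x i - s * (SUM j<m. A i j * x j))) * t
     + (\<bar>\<nu>\<bar> - s * bil m A ?e ?e) * t\<^sup>2" for t
  proof -
   have b: "bil m A (?y t) (?y t) = \<nu> + 2 * t * bil m A ?e x + t * t * bil m A ?e ?e" unfolding \<nu>_def
    by (simp only: bil_add_left bil_add_right bil_scale_left bil_scale_right)
     (simp add: bil_commute[OF sym, of x ?e])
   have p: "ip m (?y t) (?y t) = 1 + 2 * t * x i + t * t" using x i unfolding ip_add_left ip_add_right ip_scale_left ip_scale_right ip_commute[of m x ?e]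
    by (simp add: ip_unit_left)
   have s1: "\<bar>s\<bar> = 1" using \<nu>0 by (simp add: s_def abs_sgn_eq)
   have "s * bil m A (?y t) (?y t) <= \<bar>s * bil m A (?y t) (?y t)\<bar>" by simp
   also have "... = \<bar>bil m A (?y t) (?y t)\<bar>" by (simp add: abs_mult s1)
   also have "... <= \<bar>\<nu>\<bar> * ip m (?y t) (?y t)" by (rule bound)
   finally have "s * (\<nu> + 2 * t * bil m A ?e x + t * t * bil m A ?e ?e) <= \<bar>\<nu>\<bar> * (1 + 2 * t * x i + t * t)" unfolding b p .
   thus ?thesis using s(1) bil_unit_left[OF i, of A x] by (simp add: algebra_simps sq_eq)
  qed
  hence "2 * (\<bar>\<nu>\<bar> * x i - s * (SUM j<m. A i j * x j)) = 0" by (rule linear_coefficient_zero)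
  hence "s * (SUM j<m. A i j * x j) = s * \<nu> * x i" using s by simp
  thus ?thesis using s(3) by simp
 qed
 moreover have "ip m x x = 1" using x by simp
 ultimately show ?thesis using \<nu>0 by metis
qed

text \<open>Only nonzero eigenvalues are listed, so the zeroth power, the identity, is not of this
  form; this is why the power and trace lemmas below ask for exponents at least 1.\<close>

definition spectral_decomp ::
 "nat => (nat => nat => real) => nat => (nat => nat => real) => (nat => real) => bool" where
 "spectral_decomp m A k U lam \<longleftrightarrow> orthonormal m k U & (ALL a<k. lam a ~= 0) &
  (ALL i<m. ALL j<m. A i j = (SUM a<k. lam a * U a i * U a j))"

text \<open>Take a largest orthonormal family of eigenvectors with nonzero eigenvalues; the
  dimension bounds its size. If the residual \<open>B\<close> had a nonzero entry, an eigenvector of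
  \<open>B\<close> would extend the family.\<close>

lemma spectral_theorem:
 assumes sym: "symm m A"
 shows "EX k U lam. spectral_decomp m A k U lam"
proof -
 define P where "P = (%k. EX U lam. orthonormal m k U &
  (ALL a<k. lam a ~= 0 & (ALL i<m. (SUM j<m. A i j * U a j) = lam a * U a i)))"
 have "P 0" by (simp add: P_def orthonormal_def)
 moreover have "!!k. P k ==> k <= m" by (auto simp: P_def dest: orthonormal_card_le)
 ultimately obtain k where k: "P k" and kmax: "!!j. P j ==> j <= k" using GreatestI_nat[of P 0 m] Greatest_le_nat[of P _ m] by blast
 obtain U lam where U: "orthonormal m k U" and ev: "!!a. a < k ==> lam a ~= 0"
  "!!a i. a < k ==> i < m ==> (SUM j<m. A i j * U a j) = lam a * U a i" using k unfolding P_def by metis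
 define B where "B = (%i j. A i j - (SUM a<k. lam a * U a i * U a j))"
 have symB: "symm m B" using sym by (simp add: symm_def B_def mult_ac)
 have Bv: "(SUM j<m. B i j * x j) = (SUM j<m. A i j * x j) - (SUM a<k. lam a * U a i * ip m (U a) x)" for i x
 proof -
  have "(SUM j<m. (SUM a<k. lam a * U a i * U a j) * x j) = (SUM j<m. SUM a<k. lam a * U a i * (U a j * x j))" by (simp add: sum_distrib_right mult.assoc)
  also have "... = (SUM a<k. SUM j<m. lam a * U a i * (U a j * x j))" by (rule sum.swap)
  also have "... = (SUM a<k. lam a * U a i * ip m (U a) x)" by (simp add: ip_def sum_distrib_left)
  finally show ?thesis by (simp add: B_def left_diff_distrib sum_subtractf)
 qed
 have BU: "(SUM j<m. B i j * U a j) = 0" if "a < k" "i < m" for a i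
 proof -
  have "(SUM b<k. lam b * U b i * ip m (U b) (U a)) = (SUM b<k. if b = a then lam b * U b i else 0)" using U that by (intro sum.cong) (auto simp: orthonormal_def)
  thus ?thesis unfolding Bv using ev(2)[OF that] that by simp
 qed
 have "B i j = 0" if ij: "i < m" "j < m" for i j
 proof (rule ccontr)
  assume "B i j ~= 0"
  from exists_eigenvector[OF symB ij this] obtain x \<nu> where x: "ip m x x = 1" "\<nu> ~= 0"
   and xe: "!!i. i < m ==> (SUM j<m. B i j * x j) = \<nu> * x i" by blast
  \<comment> \<open>\<open>B\<close> annihilates every \<open>U a\<close>, so its eigenvectors for
    \<open>\<nu> ~= 0\<close> are orthogonal to them; on vectors orthogonal to all
    \<open>U a\<close> the matrices \<open>A\<close> and \<open>B\<close> agree.\<close>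
  have orth: "ip m (U a) x = 0" if a: "a < k" for a
  proof -
   have "\<nu> * ip m (U a) x = (SUM i<m. U a i * (SUM j<m. B i j * x j))" by (simp add: ip_def sum_distrib_left xe mult.left_commute)
   also have "... = bil m B (U a) x" by (simp add: bil_def sum_distrib_left, simp add: mult_ac)
   also have "... = bil m B x (U a)" by (rule bil_commute[OF symB])
   also have "... = (SUM i<m. x i * (SUM j<m. B i j * U a j))" by (simp add: bil_def sum_distrib_left, simp add: mult_ac)
   also have "... = 0" using BU[OF a] by simp
   finally show ?thesis using x by simp
  qed
  define U' where "U' = (%a. if a < k then U a else x)"
  define lam' where "lam' = (%a. if a < k then lam a else \<nu>)"
  have "orthonormal m (Suc k) U'" using U x orth unfolding orthonormal_def U'_def less_Suc_eq by (auto simp: ip_commute[of m x "U _"])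
  moreover have "lam' a ~= 0 & (ALL i<m. (SUM j<m. A i j * U' a j) = lam' a * U' a i)" if "a < Suc k" for a
  proof (cases "a < k")
   case True thus ?thesis using ev by (simp add: U'_def lam'_def)
  next
   case False
   have "(SUM j<m. A i j * x j) = \<nu> * x i" if "i < m" for i using xe[OF that] unfolding Bv using orth by simp
   thus ?thesis using False x by (simp add: U'_def lam'_def)
  qed
  ultimately have "P (Suc k)" unfolding P_def by blast
  thus False using kmax[of "Suc k"] by simp
 qed
 hence "ALL i<m. ALL j<m. A i j = (SUM a<k. lam a * U a i * U a j)" by (simp add: B_def)
 thus ?thesis using U ev unfolding spectral_decomp_def by blast
qed

section \<open>Matrix powers and the trace potentials behind the filters\<close>

primrec mpow :: "nat => (nat => nat => real) => nat => nat => nat => real" where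
 "mpow m N 0 = (%i j. if i = j then 1 else 0)"
| "mpow m N (Suc k) = (%i j. SUM l<m. mpow m N k i l * N l j)"

definition trpow :: "nat => (nat => nat => real) => nat => real" where
 "trpow m N k = (SUM i<m. mpow m N k i i)"

definition psd :: "nat => (nat => nat => real) => bool" where
 "psd m A \<longleftrightarrow> (ALL x. 0 <= bil m A x x)"

lemma spectral_orthonormal: "spectral_decomp m N r U lam ==> orthonormal m r U" by (simp add: spectral_decomp_def)

lemma ip_orthonormal:
 "orthonormal m r U ==> a < r ==> b < r ==> ip m (U a) (U b) = (if a = b then 1 else 0)" by (simp add: orthonormal_def)

lemma spectral_bil:
 "spectral_decomp m N r U lam ==> bil m N x y = (SUM a<r. lam a * ip m (U a) x * ip m (U a) y)" by (rule bil_outer) (simp add: spectral_decomp_def)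

lemma spectral_bil_eigenvector:
 assumes "spectral_decomp m N r U lam" "a < r"
 shows "bil m N (U a) y = lam a * ip m (U a) y"
proof -
 have "bil m N (U a) y = (SUM b<r. if b = a then lam b * ip m (U b) y else 0)" unfolding spectral_bil[OF assms(1)] using assms
  by (intro sum.cong) (auto simp: ip_orthonormal[OF spectral_orthonormal[OF assms(1)]])
 thus ?thesis using assms by simp
qed

lemma spectral_eigenvalue:
 "spectral_decomp m N r U lam ==> a < r ==> bil m N (U a) (U a) = lam a"
 by (simp add: spectral_bil_eigenvector ip_orthonormal[OF spectral_orthonormal])

lemma spectral_card_le: "spectral_decomp m N r U lam ==> r <= m" by (rule orthonormal_card_le[OF spectral_orthonormal])

lemma sum_orthonormal_pairs:
 assumes "orthonormal m r U"
 shows "(SUM a<r. SUM b<r. f a b * ip m (U a) (U b)) = (SUM a<r. f a a)"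
proof -
 have "(SUM b<r. f a b * ip m (U a) (U b)) = f a a" if "a < r" for a
 proof -
  have "(SUM b<r. f a b * ip m (U a) (U b)) = (SUM b<r. if b = a then f a b else 0)" using assms that by (intro sum.cong) (auto simp: ip_orthonormal)
  thus ?thesis using that by simp
 qed
 thus ?thesis by simp
qed

lemma Parseval:
 assumes "orthonormal m r U"
 shows "(SUM i<m. (SUM a<r. c a * U a i)\<^sup>2) = (SUM a<r. (c a)\<^sup>2)"
proof -
 have "(SUM i<m. (SUM a<r. c a * U a i)\<^sup>2) = ip m (%i. SUM a<r. c a * U a i) (%i. SUM a<r. c a * U a i)"
  by (simp add: ip_def sq_eq)
 also have "... = (SUM a<r. SUM b<r. (c a * c b) * ip m (U a) (U b))" unfolding ip_sum_left ip_sum_right ip_scale_left ip_scale_right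
  by (simp add: sum_distrib_left mult_ac)
 also have "... = (SUM a<r. (c a)\<^sup>2)" unfolding sum_orthonormal_pairs[OF assms] by (simp add: sq_eq)
 finally show ?thesis .
qed

lemma mpow_spectral:
 assumes "spectral_decomp m N r U lam" "i < m" "j < m"
 shows "mpow m N (Suc k) i j = (SUM a<r. lam a ^ Suc k * U a i * U a j)" using assms(3)
proof (induction k arbitrary: j)
 case 0
 have "mpow m N (Suc 0) i j = (SUM l<m. if l = i then N l j else 0)" unfolding mpow.simps by (intro sum.cong) auto
 thus ?case using assms 0 by (simp add: spectral_decomp_def)
next
 case (Suc k)
 have "mpow m N (Suc (Suc k)) i j = (SUM l<m. (SUM a<r. lam a ^ Suc k * U a i * U a l) * (SUM b<r. lam b * U b l * U b j))"
  using assms Suc by (subst mpow.simps(2)) (auto simp: spectral_decomp_def intro!: sum.cong)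
 also have "... = ip m (%l. SUM a<r. (lam a ^ Suc k * U a i) * U a l) (%l. SUM b<r. (lam b * U b j) * U b l)" by (simp add: ip_def mult_ac)
 also have "... = (SUM a<r. SUM b<r. (lam a ^ Suc k * U a i * (lam b * U b j)) * ip m (U a) (U b))"
  unfolding ip_sum_left ip_sum_right ip_scale_left ip_scale_right by (simp add: sum_distrib_left mult_ac)
 also have "... = (SUM a<r. lam a ^ Suc (Suc k) * U a i * U a j)" unfolding sum_orthonormal_pairs[OF spectral_orthonormal[OF assms(1)]] by (simp add: mult_ac)
 finally show ?case .
qed

lemma mpow_apply_norm:
 assumes "spectral_decomp m N r U lam" "s >= 1"
 shows "(SUM i<m. (SUM j<m. mpow m N s i j * y j)\<^sup>2) = (SUM a<r. lam a ^ (2 * s) * (ip m (U a) y)\<^sup>2)"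
proof -
 obtain k where s: "s = Suc k" using assms(2) by (cases s) auto
 have "(SUM j<m. mpow m N s i j * y j) = (SUM a<r. (lam a ^ s * ip m (U a) y) * U a i)" if "i < m" for i
 proof -
  have "(SUM j<m. mpow m N s i j * y j) = (SUM j<m. SUM a<r. lam a ^ s * U a i * (U a j * y j))" using mpow_spectral[OF assms(1) that] unfolding s
   by (intro sum.cong refl) (simp add: sum_distrib_right mult.assoc)
  also have "... = (SUM a<r. SUM j<m. lam a ^ s * U a i * (U a j * y j))" by (rule sum.swap)
  finally show ?thesis by (simp add: ip_def sum_distrib_left sum_distrib_right mult_ac)
 qed
 hence "(SUM i<m. (SUM j<m. mpow m N s i j * y j)\<^sup>2)
   = (SUM i<m. (SUM a<r. (lam a ^ s * ip m (U a) y) * U a i)\<^sup>2)" by simp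
 also have "... = (SUM a<r. (lam a ^ s * ip m (U a) y)\<^sup>2)" by (rule Parseval[OF spectral_orthonormal[OF assms(1)]])
 finally show ?thesis by (simp add: power_mult_distrib power_mult mult.commute[of 2] flip: power_mult)
qed

lemma mpow_row_norm:
 assumes "spectral_decomp m N r U lam" "s >= 1" "i < m"
 shows "(SUM j<m. (mpow m N s i j)\<^sup>2) = (SUM a<r. lam a ^ (2 * s) * (U a i)\<^sup>2)"
proof -
 obtain k where s: "s = Suc k" using assms(2) by (cases s) auto
 have "(SUM j<m. (mpow m N s i j)\<^sup>2) = (SUM j<m. (SUM a<r. (lam a ^ s * U a i) * U a j)\<^sup>2)" using mpow_spectral[OF assms(1,3)] unfolding s by simp
 also have "... = (SUM a<r. (lam a ^ s * U a i)\<^sup>2)" by (rule Parseval[OF spectral_orthonormal[OF assms(1)]])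
 finally show ?thesis by (simp add: power_mult_distrib mult.commute[of 2] flip: power_mult)
qed

lemma spectral_unit: "spectral_decomp m N r U lam ==> a < r ==> (SUM i<m. (U a i)\<^sup>2) = 1"
 using ip_orthonormal[OF spectral_orthonormal, of m N r U lam a a] by (simp add: ip_def sq_eq)

lemma mpow_norm:
 assumes "spectral_decomp m N r U lam" "s >= 1"
 shows "(SUM i<m. SUM j<m. (mpow m N s i j)\<^sup>2) = (SUM a<r. lam a ^ (2 * s))"
proof -
 have "(SUM i<m. SUM j<m. (mpow m N s i j)\<^sup>2) = (SUM i<m. SUM a<r. lam a ^ (2 * s) * (U a i)\<^sup>2)" using mpow_row_norm[OF assms] by simp
 also have "... = (SUM a<r. SUM i<m. lam a ^ (2 * s) * (U a i)\<^sup>2)" by (rule sum.swap)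
 also have "... = (SUM a<r. lam a ^ (2 * s))" using spectral_unit[OF assms(1)] by (simp flip: sum_distrib_left)
 finally show ?thesis .
qed

lemma trpow_spectral:
 assumes "spectral_decomp m N r U lam" "k >= 1"
 shows "trpow m N k = (SUM a<r. lam a ^ k)"
proof -
 obtain k' where k: "k = Suc k'" using assms(2) by (cases k) auto
 have "trpow m N k = (SUM i<m. SUM a<r. lam a ^ k * (U a i)\<^sup>2)" unfolding trpow_def k using mpow_spectral[OF assms(1)]
  by (auto simp: sq_eq mult.assoc intro!: sum.cong)
 also have "... = (SUM a<r. SUM i<m. lam a ^ k * (U a i)\<^sup>2)" by (rule sum.swap)
 also have "... = (SUM a<r. lam a ^ k)" using spectral_unit[OF assms(1)] by (simp flip: sum_distrib_left)
 finally show ?thesis .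
qed

text \<open>Weighted AM-GM with integer exponents only, by induction from
  \<open>x^q * (x - y)^2 >= 0\<close>.\<close>

lemma Young_power:
 fixes x y :: real
 assumes "0 <= x" "0 <= y"
 shows "real (Suc q) * (x ^ q * y) <= real q * x ^ Suc q + y ^ Suc q"
proof (induction q)
 case (Suc q)
 have "0 <= real (Suc q) * (x ^ q * (x - y)\<^sup>2)" using assms by simp
 hence "2 * real (Suc q) * (x ^ Suc q * y) <= real (Suc q) * x ^ Suc (Suc q) + real (Suc q) * (x ^ q * y) * y" by (simp add: algebra_simps sq_eq)
 also have "real (Suc q) * (x ^ q * y) * y <= (real q * x ^ Suc q + y ^ Suc q) * y" using Suc assms by (intro mult_right_mono) auto
 finally show ?case by (simp add: algebra_simps)
qed simp

lemma Young_even: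
 fixes z w :: real
 assumes "q >= 1"
 shows "real (2 * q) * \<bar>z ^ (2 * q - 1) * w\<bar> <= real (2 * q - 1) * z ^ (2 * q) + w ^ (2 * q)"
proof -
 have e: "Suc (2 * q - 1) = 2 * q" using assms by simp
 have "real (2 * q) * (\<bar>z\<bar> ^ (2 * q - 1) * \<bar>w\<bar>) <= real (2 * q - 1) * \<bar>z\<bar> ^ (2 * q) + \<bar>w\<bar> ^ (2 * q)"
  using Young_power[of "\<bar>z\<bar>" "\<bar>w\<bar>" "2 * q - 1"] unfolding e by simp
 thus ?thesis by (simp add: abs_mult power_abs power_even_abs)
qed

lemma psd_eigenvalue: "psd m N ==> spectral_decomp m N r U lam ==> a < r ==> 0 <= lam a"
 using spectral_eigenvalue[of m N r U lam a] unfolding psd_def by metis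

text \<open>This is \<open>tr V'^(q+1) <= tr (V^q V')\<close> for \<open>V' <= V\<close>. Powers are
  not operator monotone, so the comparison runs through the squared overlaps \<open>c a b\<close> of
  the two eigenbases: \<open>x a <= SUM b. y b * c a b\<close>, and Young's inequality splits
  \<open>x^q * y\<close> into a multiple of \<open>x^(q+1)\<close>, absorbed on the left, and
  \<open>x * y^q\<close>.\<close>

lemma trpow_le_mixed:
 assumes V: "spectral_decomp m V r U y" "psd m V" and V': "spectral_decomp m V' r' U' x" "psd m V'"
  and le: "!!u. bil m V' u u <= bil m V u u" and q: "q >= 1"
 shows "(SUM a<r'. x a ^ Suc q) <= (SUM b<r. y b ^ q * bil m V' (U b) (U b))"
proof -
 define c where "c = (%a b. (ip m (U b) (U' a))\<^sup>2)"
 have x0: "0 <= x a" if "a < r'" for a using psd_eigenvalue V' that by blast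
 have y0: "0 <= y b" if "b < r" for b using psd_eigenvalue V that by blast
 have c1: "(SUM b<r. c a b) <= 1" if "a < r'" for a
  using Bessel[OF spectral_orthonormal[OF V(1)], of "U' a"] ip_orthonormal[OF spectral_orthonormal[OF V'(1)] that that] by (simp add: c_def)
 let ?S = "SUM a<r'. x a ^ Suc q" and ?T = "SUM a<r'. SUM b<r. c a b * (x a * y b ^ q)"
 have "real q * ?S <= real q * (SUM a<r'. x a ^ q * (SUM b<r. y b * c a b))"
 proof (intro mult_left_mono sum_mono)
  fix a assume "a : {..<r'}"
  hence a: "a < r'" by simp
  have "x a = bil m V' (U' a) (U' a)" using spectral_eigenvalue[OF V'(1) a] by simp
  also have "... <= bil m V (U' a) (U' a)" by (rule le)
  also have "... = (SUM b<r. y b * c a b)" unfolding spectral_bil[OF V(1)] c_def by (simp add: sq_eq mult.assoc)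
  finally show "x a ^ Suc q <= x a ^ q * (SUM b<r. y b * c a b)" using x0[OF a] unfolding power_Suc2 by (intro mult_left_mono) auto
 qed simp
 also have "... = (SUM a<r'. SUM b<r. c a b * (real q * (x a ^ q * y b)))" by (simp add: sum_distrib_left mult_ac)
 also have "... <= (SUM a<r'. SUM b<r. c a b * (real (q - 1) * x a ^ Suc q + x a * y b ^ q))"
 proof (intro sum_mono mult_left_mono)
  fix a b assume ab: "a : {..<r'}" "b : {..<r}"
  obtain q' where q': "q = Suc q'" using q by (cases q) auto
  have "real q * (x a ^ q' * y b) <= real q' * x a ^ q + y b ^ q" using Young_power[of "x a" "y b" q'] x0 y0 ab unfolding q' by simp
  hence "x a * (real q * (x a ^ q' * y b)) <= x a * (real q' * x a ^ q + y b ^ q)" using x0 ab by (intro mult_left_mono) auto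
  thus "real q * (x a ^ q * y b) <= real (q - 1) * x a ^ Suc q + x a * y b ^ q" unfolding q' by (simp add: algebra_simps)
 qed (simp add: c_def)
 also have "... = (SUM a<r'. real (q - 1) * x a ^ Suc q * (SUM b<r. c a b)) + ?T" by (simp add: distrib_left sum.distrib sum_distrib_left, simp add: mult_ac)
 also have "(SUM a<r'. real (q - 1) * x a ^ Suc q * (SUM b<r. c a b)) <= (SUM a<r'. real (q - 1) * x a ^ Suc q * 1)"
  using c1 x0 by (intro sum_mono mult_left_mono) auto
 also have "... = real (q - 1) * ?S" by (simp add: sum_distrib_left)
 finally have "real q * ?S <= real (q - 1) * ?S + ?T" by simp
 hence "?S <= ?T" using q by (simp add: of_nat_diff algebra_simps)
 also have "?T = (SUM b<r. SUM a<r'. c a b * (x a * y b ^ q))" by (rule sum.swap)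
 also have "... = (SUM b<r. y b ^ q * bil m V' (U b) (U b))" unfolding spectral_bil[OF V'(1)] c_def sum_distrib_left
  by (intro sum.cong refl) (simp add: sq_eq ip_commute mult_ac)
 finally show ?thesis .
qed

text \<open>\<open>small\<close> says \<open>tr (V^s V' V^s) <= ka * tr V^(2s)\<close>, and its left
  side is what \<open>trpow_le_mixed\<close> produces for \<open>q = 2 * s\<close>. An eigenvalue
  \<open>y >= 4 * ka\<close> of \<open>V\<close> satisfies
  \<open>ka * y^(2s) <= y^(2s+1) / 4\<close>; a smaller one contributes at most the floor
  \<open>(4 * ka)^(2s+1) / 4\<close>.\<close>

lemma trpow_round:
 assumes sym: "symm m V" "symm m V'" and psd: "psd m V" "psd m V'"
  and le: "!!u. bil m V' u u <= bil m V u u" and s: "s >= 1" and ka: "ka >= 0"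
  and small: "(SUM a<m. bil m V' (mpow m V s a) (mpow m V s a)) <= ka * (SUM a<m. SUM b<m. (mpow m V s a b)\<^sup>2)"
 shows "trpow m V' (2 * s + 1) <= trpow m V (2 * s + 1) / 4 + real m * (4 * ka) ^ (2 * s + 1) / 4"
  and "trpow m V' (2 * s + 1) <= trpow m V (2 * s + 1)"
proof -
 obtain r U y where V: "spectral_decomp m V r U y" using spectral_theorem[OF sym(1)] by blast
 obtain r' U' x where V': "spectral_decomp m V' r' U' x" using spectral_theorem[OF sym(2)] by blast
 have y0: "0 <= y b" if "b < r" for b using psd_eigenvalue V psd that by blast
 have mixed: "trpow m V' (2 * s + 1) <= (SUM b<r. y b ^ (2 * s) * bil m V' (U b) (U b))" using trpow_le_mixed[OF V psd(1) V' psd(2) le, of "2 * s"] s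
  by (simp add: trpow_spectral[OF V'])
 have "(SUM b<r. y b ^ (2 * s) * bil m V' (U b) (U b)) <= (SUM b<r. y b ^ (2 * s) * bil m V (U b) (U b))" by (intro sum_mono mult_left_mono le) simp
 also have "... = (SUM b<r. y b ^ (2 * s + 1))" using spectral_eigenvalue[OF V] by (simp add: mult.commute)
 finally show "trpow m V' (2 * s + 1) <= trpow m V (2 * s + 1)" using mixed by (simp add: trpow_spectral[OF V])
 have "(SUM a<m. bil m V' (mpow m V s a) (mpow m V s a))
   = (SUM a<m. SUM c<r'. x c * (ip m (U' c) (mpow m V s a))\<^sup>2)" unfolding spectral_bil[OF V'] by (simp add: sq_eq mult.assoc)
 also have "... = (SUM c<r'. SUM a<m. x c * (ip m (U' c) (mpow m V s a))\<^sup>2)" by (rule sum.swap)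
 also have "... = (SUM c<r'. x c * (SUM a<m. (SUM j<m. mpow m V s a j * U' c j)\<^sup>2))" by (simp add: ip_def sum_distrib_left mult.commute)
 also have "... = (SUM c<r'. SUM b<r. x c * (y b ^ (2 * s) * (ip m (U b) (U' c))\<^sup>2))" unfolding mpow_apply_norm[OF V s] by (simp add: sum_distrib_left)
 also have "... = (SUM b<r. SUM c<r'. x c * (y b ^ (2 * s) * (ip m (U b) (U' c))\<^sup>2))" by (rule sum.swap)
 also have "... = (SUM b<r. y b ^ (2 * s) * bil m V' (U b) (U b))" unfolding spectral_bil[OF V'] sum_distrib_left
  by (intro sum.cong refl) (simp add: sq_eq ip_commute mult_ac)
 finally have "trpow m V' (2 * s + 1) <= ka * (SUM b<r. y b ^ (2 * s))" using mixed small unfolding mpow_norm[OF V s] by simp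
 also have "... <= (SUM b<r. y b ^ (2 * s + 1) / 4 + (4 * ka) ^ (2 * s + 1) / 4)" unfolding sum_distrib_left
 proof (rule sum_mono)
  fix b assume "b : {..<r}"
  hence b: "0 <= y b" using y0 by simp
  have e: "y b ^ (2 * s + 1) = y b * y b ^ (2 * s)" "(4 * ka) ^ (2 * s + 1) = 4 * ka * (4 * ka) ^ (2 * s)" by simp_all
  show "ka * y b ^ (2 * s) <= y b ^ (2 * s + 1) / 4 + (4 * ka) ^ (2 * s + 1) / 4"
  proof (cases "4 * ka <= y b")
   case True
   hence "4 * ka * y b ^ (2 * s) <= y b * y b ^ (2 * s)" using b by (intro mult_right_mono) auto
   moreover have "0 <= (4 * ka) ^ (2 * s + 1)" using ka by simp
   ultimately show ?thesis unfolding e by linarith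
  next
   case False
   hence "4 * ka * y b ^ (2 * s) <= 4 * ka * (4 * ka) ^ (2 * s)" using b ka by (intro mult_left_mono power_mono) auto
   moreover have "0 <= y b ^ (2 * s + 1)" using b by simp
   ultimately show ?thesis unfolding e by linarith
  qed
 qed
 also have "... = trpow m V (2 * s + 1) / 4 + real r * ((4 * ka) ^ (2 * s + 1) / 4)" by (simp add: sum.distrib trpow_spectral[OF V] sum_divide_distrib)
 also have "... <= trpow m V (2 * s + 1) / 4 + real m * ((4 * ka) ^ (2 * s + 1) / 4)"
  using spectral_card_le[OF V] ka by (intro add_left_mono mult_right_mono) auto
 finally show "trpow m V' (2 * s + 1) <= trpow m V (2 * s + 1) / 4 + real m * (4 * ka) ^ (2 * s + 1) / 4" by simp
qed

text \<open>Each eigenvalue satisfies \<open>y^p <= m * b^p <= (2 * b)^p\<close>: with an exponent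
  of order \<open>log2 m\<close>, trace and operator norm differ only by a factor 2.\<close>

lemma trpow_bound_psd:
 assumes "symm m V" "psd m V" "trpow m V p <= real m * b ^ p" "p >= 1" "m <= 2 ^ p" "b >= 0"
 shows "bil m V u u <= 2 * b * ip m u u"
proof -
 obtain r U y where V: "spectral_decomp m V r U y" using spectral_theorem[OF assms(1)] by blast
 have y0: "0 <= y a" if "a < r" for a using psd_eigenvalue V assms(2) that by blast
 have y2: "y a <= 2 * b" if "a < r" for a
 proof -
  have "y a ^ p <= (SUM a<r. y a ^ p)" using that y0 by (intro member_le_sum) auto
  also have "... <= real m * b ^ p" using assms(3) by (simp add: trpow_spectral[OF V \<open>p >= 1\<close>])
  also have "... <= 2 ^ p * b ^ p"
  proof (rule mult_right_mono)
   show "real m <= 2 ^ p" using assms(5) by (metis of_nat_le_iff of_nat_numeral of_nat_power)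
  qed (use assms in simp)
  finally have "y a ^ p <= (2 * b) ^ p" by (simp add: power_mult_distrib)
  thus ?thesis using assms(4,6) power_le_imp_le_base[of "y a" "p - 1" "2 * b"] by simp
 qed
 have "bil m V u u = (SUM a<r. y a * (ip m (U a) u)\<^sup>2)" unfolding spectral_bil[OF V] by (simp add: sq_eq mult.assoc)
 also have "... <= (SUM a<r. 2 * b * (ip m (U a) u)\<^sup>2)" using y2 by (intro sum_mono mult_right_mono) auto
 also have "... = 2 * b * (SUM a<r. (ip m (U a) u)\<^sup>2)" by (simp add: sum_distrib_left)
 also have "... <= 2 * b * ip m u u" using Bessel[OF spectral_orthonormal[OF V]] assms(6) by (intro mult_left_mono) auto
 finally show ?thesis .
qed

text \<open>The even exponent controls eigenvalues of either sign, as required for the centred Gram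
  matrix, which is in general indefinite.\<close>

lemma trpow_bound_even:
 assumes "symm m N" "trpow m N (2 * s) <= real m * b ^ (2 * s)" "s >= 1" "m <= 2 ^ (2 * s)" "b >= 0"
 shows "\<bar>bil m N u v\<bar> <= 2 * b * (sqrt (ip m u u) * sqrt (ip m v v))"
proof -
 obtain r U y where V: "spectral_decomp m N r U y" using spectral_theorem[OF assms(1)] by blast
 have y2: "\<bar>y a\<bar> <= 2 * b" if "a < r" for a
 proof -
  have "y a ^ (2 * s) <= (SUM a<r. y a ^ (2 * s))" using that by (intro member_le_sum) auto
  also have "... <= real m * b ^ (2 * s)" using assms(2,3) by (simp add: trpow_spectral[OF V])
  also have "... <= 2 ^ (2 * s) * b ^ (2 * s)"
  proof (rule mult_right_mono)
   show "real m <= 2 ^ (2 * s)" using assms(4) by (metis of_nat_le_iff of_nat_numeral of_nat_power)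
  qed (use assms in simp)
  finally have "\<bar>y a\<bar> ^ (2 * s) <= (2 * b) ^ (2 * s)" by (simp add: power_mult_distrib power_even_abs)
  thus ?thesis using assms(3,5) power_le_imp_le_base[of "\<bar>y a\<bar>" "2 * s - 1" "2 * b"] by simp
 qed
 have "\<bar>bil m N u v\<bar> <= (SUM a<r. \<bar>y a * ip m (U a) u * ip m (U a) v\<bar>)" unfolding spectral_bil[OF V] by (rule sum_abs)
 also have "... <= (SUM a<r. 2 * b * (\<bar>ip m (U a) u\<bar> * \<bar>ip m (U a) v\<bar>))"
 proof (rule sum_mono)
  fix a assume "a : {..<r}"
  hence "\<bar>y a\<bar> * (\<bar>ip m (U a) u\<bar> * \<bar>ip m (U a) v\<bar>) <= 2 * b * (\<bar>ip m (U a) u\<bar> * \<bar>ip m (U a) v\<bar>)"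
   using y2 by (intro mult_right_mono) auto
  thus "\<bar>y a * ip m (U a) u * ip m (U a) v\<bar> <= 2 * b * (\<bar>ip m (U a) u\<bar> * \<bar>ip m (U a) v\<bar>)" by (simp add: abs_mult mult.assoc)
 qed
 also have "... = 2 * b * (SUM a<r. \<bar>ip m (U a) u\<bar> * \<bar>ip m (U a) v\<bar>)" by (simp add: sum_distrib_left)
 also have "... <= 2 * b * (sqrt (ip m u u) * sqrt (ip m v v))"
 proof (rule mult_left_mono)
  have "(SUM a<r. \<bar>ip m (U a) u\<bar> * \<bar>ip m (U a) v\<bar>)
    <= sqrt (SUM a<r. \<bar>ip m (U a) u\<bar>\<^sup>2) * sqrt (SUM a<r. \<bar>ip m (U a) v\<bar>\<^sup>2)"
   using L2_set_mult_ineq[of "%a. ip m (U a) u" "%a. ip m (U a) v" "{..<r}"] by (simp add: L2_set_def)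
  also have "... <= sqrt (ip m u u) * sqrt (ip m v v)" using Bessel[OF spectral_orthonormal[OF V]] by (intro mult_mono) (auto simp: sum_nonneg ip_nonneg)
  finally show "(SUM a<r. \<bar>ip m (U a) u\<bar> * \<bar>ip m (U a) v\<bar>) <= sqrt (ip m u u) * sqrt (ip m v v)" .
 qed (use assms in simp)
 finally show ?thesis .
qed

text \<open>An eigenvalue of the submatrix is a combination of the \<open>lam b\<close> with
  nonnegative weights \<open>c a b\<close> of sum at most 1, so Jensen's inequality for the even
  power applies (through \<open>Young_even\<close>). Summed over \<open>a\<close>, the weights give
  at most the part of \<open>U b\<close> inside \<open>W\<close>, which turns the bound into row
  mass of \<open>N^s\<close>.\<close>

lemma trpow_principal_submatrix:
 assumes sym: "symm m N" and s: "s >= 1"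
 shows "trpow m (%i j. if i : W & j : W then N i j else 0) (2 * s)
  <= (SUM i:W \<inter> {..<m}. SUM j<m. (mpow m N s i j)\<^sup>2)"
proof -
 define N' where "N' = (%i j. if i : W & j : W then N i j else 0)"
 define E where "E = (%x i. if i : W then x i else (0::real))"
 have sym': "symm m N'" using sym by (auto simp: symm_def N'_def)
 obtain r U lam where N: "spectral_decomp m N r U lam" using spectral_theorem[OF sym] by blast
 obtain r' U' x where N': "spectral_decomp m N' r' U' x" using spectral_theorem[OF sym'] by blast
 define c where "c = (%a b. (ip m (U b) (U' a))\<^sup>2)"
 \<comment> \<open>Eigenvectors of nonzero eigenvalue live on \<open>W\<close>, where
   \<open>N'\<close> and \<open>N\<close> have the same quadratic form.\<close>
 have supp: "U' a i = 0" if "a < r'" "i < m" "i \<notin> W" for a i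
 proof -
  have "x a * U' a i = bil m N' (U' a) (%j. if j = i then 1 else 0)" unfolding spectral_bil_eigenvector[OF N' that(1)] using that
   by (simp add: ip_commute[of _ _ "%j. if j = i then 1 else 0"] ip_unit_left)
  also have "... = bil m N' (%j. if j = i then 1 else 0) (U' a)" by (rule bil_commute[OF sym'])
  also have "... = 0" using that by (simp add: bil_unit_left N'_def)
  finally show ?thesis using N' that by (auto simp: spectral_decomp_def)
 qed
 have xa: "x a = (SUM b<r. lam b * c a b)" if a: "a < r'" for a
 proof -
  have "x a = bil m N' (U' a) (U' a)" using spectral_eigenvalue[OF N' a] by simp
  also have "... = bil m N (U' a) (U' a)" unfolding bil_def N'_def using supp[OF a] by (intro sum.cong refl) auto
  also have "... = (SUM b<r. lam b * c a b)" unfolding spectral_bil[OF N] c_def by (simp add: sq_eq mult.assoc)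
  finally show ?thesis .
 qed
 have "x a ^ (2 * s) <= (SUM b<r. c a b * lam b ^ (2 * s))" if a: "a < r'" for a
 proof -
  let ?z = "x a"
  have c1: "(SUM b<r. c a b) <= 1" using Bessel[OF spectral_orthonormal[OF N], of "U' a"] ip_orthonormal[OF spectral_orthonormal[OF N'] a a] by (simp add: c_def)
  have "(SUM b<r. c a b * (real (2 * s) * (?z ^ (2 * s - 1) * lam b)))
    <= (SUM b<r. c a b * (real (2 * s - 1) * ?z ^ (2 * s) + lam b ^ (2 * s)))"
  proof (intro sum_mono mult_left_mono)
   fix b
   have "real (2 * s) * (?z ^ (2 * s - 1) * lam b) <= real (2 * s) * \<bar>?z ^ (2 * s - 1) * lam b\<bar>" by (intro mult_left_mono) auto
   thus "real (2 * s) * (?z ^ (2 * s - 1) * lam b) <= real (2 * s - 1) * ?z ^ (2 * s) + lam b ^ (2 * s)" using Young_even[OF s, of ?z "lam b"] by linarith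
  qed (simp add: c_def)
  also have "... = real (2 * s - 1) * ?z ^ (2 * s) * (SUM b<r. c a b) + (SUM b<r. c a b * lam b ^ (2 * s))"
   by (simp add: distrib_left sum.distrib sum_distrib_left, simp add: mult_ac)
  also have "real (2 * s - 1) * ?z ^ (2 * s) * (SUM b<r. c a b) <= real (2 * s - 1) * ?z ^ (2 * s) * 1" using c1 by (intro mult_left_mono) auto
  finally have "(SUM b<r. c a b * (real (2 * s) * (?z ^ (2 * s - 1) * lam b)))
    <= real (2 * s - 1) * ?z ^ (2 * s) + (SUM b<r. c a b * lam b ^ (2 * s))" by simp
  moreover have "(SUM b<r. c a b * (real (2 * s) * (?z ^ (2 * s - 1) * lam b)))
    = real (2 * s) * ?z ^ (2 * s - 1) * (SUM b<r. lam b * c a b)" by (simp add: sum_distrib_left, simp add: mult_ac)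
  moreover have "?z ^ (2 * s - 1) * ?z = ?z ^ (2 * s)" using s by (metis Suc_diff_1 One_nat_def mult_pos_pos pos2 power_Suc2 less_eq_Suc_le)
  ultimately have "real (2 * s) * ?z ^ (2 * s) <= real (2 * s - 1) * ?z ^ (2 * s) + (SUM b<r. c a b * lam b ^ (2 * s))" using xa[OF a] by (simp add: mult.assoc)
  moreover have "real (2 * s) = real (2 * s - 1) + 1" using s by simp
  ultimately show ?thesis by (simp only: distrib_right)
 qed
 hence "trpow m N' (2 * s) <= (SUM a<r'. SUM b<r. c a b * lam b ^ (2 * s))" using s by (auto simp: trpow_spectral[OF N'] intro: sum_mono)
 also have "... = (SUM b<r. lam b ^ (2 * s) * (SUM a<r'. c a b))" by (subst sum.swap) (simp add: sum_distrib_left, simp add: mult.commute)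
 also have "... <= (SUM b<r. lam b ^ (2 * s) * (SUM i:W \<inter> {..<m}. (U b i)\<^sup>2))"
 proof (intro sum_mono mult_left_mono)
  fix b
  have "ip m (U b) (U' a) = ip m (U' a) (E (U b))" if "a < r'" for a unfolding ip_def E_def using supp[OF that] by (intro sum.cong) auto
  hence "(SUM a<r'. c a b) = (SUM a<r'. (ip m (U' a) (E (U b)))\<^sup>2)" by (simp add: c_def)
  also have "... <= ip m (E (U b)) (E (U b))" by (rule Bessel[OF spectral_orthonormal[OF N']])
  also have "... = (SUM i<m. if i : W then (U b i)\<^sup>2 else 0)" unfolding ip_def E_def by (intro sum.cong) (auto simp: sq_eq)
  also have "... = (SUM i:W \<inter> {..<m}. (U b i)\<^sup>2)" by (subst sum.inter_restrict[symmetric]) (auto simp: Int_commute)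
  finally show "(SUM a<r'. c a b) <= (SUM i:W \<inter> {..<m}. (U b i)\<^sup>2)" .
 qed simp
 also have "... = (SUM i:W \<inter> {..<m}. SUM b<r. lam b ^ (2 * s) * (U b i)\<^sup>2)" unfolding sum_distrib_left by (rule sum.swap)
 also have "... = (SUM i:W \<inter> {..<m}. SUM j<m. (mpow m N s i j)\<^sup>2)" by (rule sum.cong) (auto simp: mpow_row_norm[OF N s])
 finally show ?thesis unfolding N'_def .
qed

text \<open>Split each eigenvector as \<open>P + Q\<close> along \<open>S\<close> and
  \<open>B\<close>, with squared norms \<open>p + q = 1\<close>. Subtracting the eigenvector
  equation tested on \<open>Q\<close> from the one tested on \<open>P\<close> cancels the cross
  terms: \<open>lam * (p - q) = bil N P P - bil N Q Q\<close>. Weighted by \<open>lam^(2s-1)\<close>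
  and summed, the \<open>P\<close> terms are at most a quarter of the trace, since \<open>N\<close>
  is small on \<open>S\<close>, and the \<open>Q\<close> terms at most \<open>?q\<close>. So
  \<open>?p - ?q <= ?f / 4 + ?q\<close>, that is \<open>?f <= 4 * ?q\<close>.\<close>

lemma bad_mass:
 assumes sym: "symm m N" and s: "s >= 1" and SB: "S \<inter> B = {}" "S <= {..<m}" "B <= {..<m}"
  and supp: "!!i j. i < m ==> j < m ==> i \<notin> S \<union> B ==> N i j = 0"
  and small: "!!x. (!!i. i \<notin> S ==> x i = 0) ==> \<bar>bil m N x x\<bar> <= rh * ip m x x" and rh: "rh >= 0"
  and large: "real m * (8 * rh) ^ (2 * s) <= trpow m N (2 * s)"
 shows "trpow m N (2 * s) / 4 <= (SUM i:B. SUM j<m. (mpow m N s i j)\<^sup>2)"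
proof -
 obtain r U lam where N: "spectral_decomp m N r U lam" using spectral_theorem[OF sym] by blast
 define P where "P = (%x i. if i : S then x i else (0::real))"
 define Q where "Q = (%x i. if i : B then x i else (0::real))"
 define p where "p = (%a. ip m (P (U a)) (P (U a)))"
 define q where "q = (%a. ip m (Q (U a)) (Q (U a)))"
 let ?f = "trpow m N (2 * s)"
 have f: "?f = (SUM a<r. lam a ^ (2 * s))" using s by (simp add: trpow_spectral[OF N])
 have Uz: "U a i = 0" if "a < r" "i < m" "i \<notin> S \<union> B" for a i
 proof -
  have "lam a * U a i = bil m N (U a) (%j. if j = i then 1 else 0)" unfolding spectral_bil_eigenvector[OF N that(1)] using that
   by (simp add: ip_commute[of _ _ "%j. if j = i then 1 else 0"] ip_unit_left)
  also have "... = bil m N (%j. if j = i then 1 else 0) (U a)" by (rule bil_commute[OF sym])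
  also have "... = 0" using that supp by (simp add: bil_unit_left)
  finally show ?thesis using N that by (auto simp: spectral_decomp_def)
 qed
 have dec: "ip m (%i. P (U a) i + Q (U a) i) y = ip m (U a) y" "bil m N (%i. P (U a) i + Q (U a) i) y = bil m N (U a) y"
  if "a < r" for a y unfolding ip_def bil_def P_def Q_def using Uz[OF that] SB by (auto intro!: sum.cong)
 have PQ: "ip m (P x) (Q y) = 0" for x y unfolding ip_def P_def Q_def using SB by (intro sum.neutral) auto
 have pU: "ip m (U a) (P (U a)) = p a" and qU: "ip m (U a) (Q (U a)) = q a" for a unfolding p_def q_def ip_def P_def Q_def by (auto intro!: sum.cong)
 have pq: "p a + q a = 1" if "a < r" for a
 proof -
  have "1 = ip m (U a) (U a)" using ip_orthonormal[OF spectral_orthonormal[OF N] that that] by simp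
  also have "... = ip m (P (U a)) (U a) + ip m (Q (U a)) (U a)" using dec(1)[OF that, of "U a"] by (simp add: ip_add_left)
  finally show ?thesis using pU[of a] qU[of a] by (simp add: ip_commute)
 qed
 have diff: "lam a * (p a - q a) = bil m N (P (U a)) (P (U a)) - bil m N (Q (U a)) (Q (U a))" if "a < r" for a
 proof -
  have "lam a * p a = bil m N (P (U a)) (P (U a)) + bil m N (Q (U a)) (P (U a))"
   using spectral_bil_eigenvector[OF N that, of "P (U a)"] dec(2)[OF that, of "P (U a)"] pU[of a] by (simp add: bil_add_left)
  moreover have "lam a * q a = bil m N (P (U a)) (Q (U a)) + bil m N (Q (U a)) (Q (U a))"
   using spectral_bil_eigenvector[OF N that, of "Q (U a)"] dec(2)[OF that, of "Q (U a)"] qU[of a] by (simp add: bil_add_left)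
  ultimately show ?thesis using bil_commute[OF sym, of "P (U a)" "Q (U a)"] by (simp add: algebra_simps)
 qed
 have pow: "lam a ^ (2 * s) = lam a ^ (2 * s - 1) * lam a" for a using s by (metis Suc_diff_1 One_nat_def mult_pos_pos pos2 power_Suc2 less_eq_Suc_le)
 let ?p = "SUM a<r. lam a ^ (2 * s) * p a" and ?q = "SUM a<r. lam a ^ (2 * s) * q a"
 have fpq: "?f = ?p + ?q" unfolding f using pq by (simp flip: sum.distrib distrib_left)
 have "?p - ?q = (SUM a<r. lam a ^ (2 * s - 1) * (lam a * (p a - q a)))" unfolding pow by (simp add: sum_subtractf algebra_simps)
 also have "... = (SUM a<r. lam a ^ (2 * s - 1) * bil m N (P (U a)) (P (U a)))
   - (SUM a<r. lam a ^ (2 * s - 1) * bil m N (Q (U a)) (Q (U a)))" using diff by (simp add: right_diff_distrib flip: sum_subtractf)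
 finally have pq_eq: "?p - ?q = (SUM a<r. lam a ^ (2 * s - 1) * bil m N (P (U a)) (P (U a)))
   - (SUM a<r. lam a ^ (2 * s - 1) * bil m N (Q (U a)) (Q (U a)))" .
 have "(SUM a<r. lam a ^ (2 * s - 1) * bil m N (P (U a)) (P (U a)))
   <= (SUM a<r. lam a ^ (2 * s) / 8 + (8 * rh) ^ (2 * s) / 8)"
 proof (rule sum_mono)
  fix a assume "a : {..<r}"
  hence a: "a < r" by simp
  have "\<bar>bil m N (P (U a)) (P (U a))\<bar> <= rh * p a" unfolding p_def by (rule small) (simp add: P_def)
  also have "p a <= 1" using pq[OF a] ip_nonneg[of m "Q (U a)"] by (simp add: q_def)
  finally have b: "\<bar>bil m N (P (U a)) (P (U a))\<bar> <= rh" using rh by (simp add: mult_left_mono)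
  have "lam a ^ (2 * s - 1) * bil m N (P (U a)) (P (U a)) <= \<bar>lam a ^ (2 * s - 1) * bil m N (P (U a)) (P (U a))\<bar>" by simp
  also have "... = \<bar>lam a\<bar> ^ (2 * s - 1) * \<bar>bil m N (P (U a)) (P (U a))\<bar>" by (simp add: abs_mult power_abs)
  also have "... <= \<bar>lam a\<bar> ^ (2 * s - 1) * rh" using b by (intro mult_left_mono) auto
  also have "... <= \<bar>lam a\<bar> ^ (2 * s) / 8 + (8 * rh) ^ (2 * s) / 8"
  proof -
   have pw: "!!z::real. z ^ (2 * s) = z ^ (2 * s - 1) * z" using s by (metis Suc_diff_1 One_nat_def mult_pos_pos pos2 power_Suc2 less_eq_Suc_le)
   show ?thesis
   proof (cases "8 * rh <= \<bar>lam a\<bar>")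
    case True
    hence "\<bar>lam a\<bar> ^ (2 * s - 1) * (8 * rh) <= \<bar>lam a\<bar> ^ (2 * s - 1) * \<bar>lam a\<bar>" by (intro mult_left_mono) auto
    moreover have "0 <= (8 * rh) ^ (2 * s)" using rh by simp
    ultimately show ?thesis unfolding pw[of "\<bar>lam a\<bar>"] by linarith
   next
    case False
    hence "\<bar>lam a\<bar> ^ (2 * s - 1) * (8 * rh) <= (8 * rh) ^ (2 * s - 1) * (8 * rh)" using rh by (intro mult_right_mono power_mono) auto
    moreover have "0 <= \<bar>lam a\<bar> ^ (2 * s)" by simp
    ultimately show ?thesis unfolding pw[of "8 * rh"] by linarith
   qed
  qed
  finally show "lam a ^ (2 * s - 1) * bil m N (P (U a)) (P (U a)) <= lam a ^ (2 * s) / 8 + (8 * rh) ^ (2 * s) / 8" by (simp add: power_even_abs)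
 qed
 also have "... = ?f / 8 + real r * (8 * rh) ^ (2 * s) / 8" by (simp add: sum.distrib f sum_divide_distrib)
 also have "... <= ?f / 8 + ?f / 8"
 proof -
  have "real r * (8 * rh) ^ (2 * s) <= real m * (8 * rh) ^ (2 * s)" using spectral_card_le[OF N] by (intro mult_right_mono) auto
  thus ?thesis using large by linarith
 qed
 finally have first: "(SUM a<r. lam a ^ (2 * s - 1) * bil m N (P (U a)) (P (U a))) <= ?f / 4" by simp
 define c where "c = (%a b. (ip m (U a) (Q (U b)))\<^sup>2)"
 \<comment> \<open>By this symmetry both terms that Young's inequality yields sum to the same
   expression, with total coefficient 1.\<close>
 have csym: "c a b = c b a" for a b unfolding c_def ip_def Q_def by (auto intro!: arg_cong[where f = "%x. x\<^sup>2"] sum.cong)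
 have cq: "(SUM a<r. c a b) <= q b" for b unfolding c_def q_def by (rule Bessel[OF spectral_orthonormal[OF N]])
 have "- (SUM b<r. lam b ^ (2 * s - 1) * bil m N (Q (U b)) (Q (U b)))
   = (SUM b<r. SUM a<r. c a b * (- (lam b ^ (2 * s - 1) * lam a)))" unfolding spectral_bil[OF N] c_def
  by (simp add: sum_negf sum_distrib_left sq_eq mult_ac)
 also have "... <= (SUM b<r. SUM a<r. c a b * ((real (2 * s - 1) * lam b ^ (2 * s) + lam a ^ (2 * s)) / real (2 * s)))"
 proof (intro sum_mono mult_left_mono)
  fix a b
  have "real (2 * s) * (- (lam b ^ (2 * s - 1) * lam a)) <= real (2 * s) * \<bar>lam b ^ (2 * s - 1) * lam a\<bar>" by (intro mult_left_mono) auto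
  also have "... <= real (2 * s - 1) * lam b ^ (2 * s) + lam a ^ (2 * s)" by (rule Young_even[OF s])
  finally show "- (lam b ^ (2 * s - 1) * lam a) <= (real (2 * s - 1) * lam b ^ (2 * s) + lam a ^ (2 * s)) / real (2 * s)" using s by (simp add: field_simps)
 qed (simp add: c_def)
 also have "... = (real (2 * s - 1) * (SUM b<r. lam b ^ (2 * s) * (SUM a<r. c a b))
   + (SUM b<r. SUM a<r. lam a ^ (2 * s) * c a b)) / real (2 * s)"
 proof -
  have "c a b * ((real (2 * s - 1) * lam b ^ (2 * s) + lam a ^ (2 * s)) / real (2 * s))
    = (real (2 * s - 1) * (lam b ^ (2 * s) * c a b) + lam a ^ (2 * s) * c a b) / real (2 * s)" for a b by (simp add: algebra_simps)
  thus ?thesis by (simp only: sum_divide_distrib[symmetric] sum.distrib sum_distrib_left)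
 qed
 also have "(SUM b<r. SUM a<r. lam a ^ (2 * s) * c a b) = (SUM b<r. lam b ^ (2 * s) * (SUM a<r. c a b))" by (subst sum.swap) (simp add: csym sum_distrib_left)
 also have "(real (2 * s - 1) * (SUM b<r. lam b ^ (2 * s) * (SUM a<r. c a b))
   + (SUM b<r. lam b ^ (2 * s) * (SUM a<r. c a b))) / real (2 * s) = (SUM b<r. lam b ^ (2 * s) * (SUM a<r. c a b))" using s by (simp add: field_simps of_nat_diff)
 also have "... <= ?q" using cq by (intro sum_mono mult_left_mono) auto
 finally have "?f <= 4 * ?q" using fpq pq_eq first by linarith
 also have "?q = (SUM a<r. SUM i:B. lam a ^ (2 * s) * (U a i)\<^sup>2)"
 proof (intro sum.cong refl)
  fix a
  have "q a = (SUM i<m. if i : B then (U a i)\<^sup>2 else 0)" unfolding q_def ip_def Q_def by (intro sum.cong) (auto simp: sq_eq)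
  also have "... = (SUM i:B. (U a i)\<^sup>2)" using SB(3) by (subst sum.inter_restrict[symmetric]) (auto simp: Int_absorb1)
  finally show "lam a ^ (2 * s) * q a = (SUM i:B. lam a ^ (2 * s) * (U a i)\<^sup>2)" by (simp add: sum_distrib_left)
 qed
 also have "... = (SUM i:B. SUM a<r. lam a ^ (2 * s) * (U a i)\<^sup>2)" by (rule sum.swap)
 also have "... = (SUM i:B. SUM j<m. (mpow m N s i j)\<^sup>2)" using SB(3) by (intro sum.cong refl mpow_row_norm[OF N s, symmetric]) auto
 finally show ?thesis by simp
qed

section \<open>Gaussian product measures and Chernoff bounds\<close>

definition std_gauss :: "real measure" where
 "std_gauss = density lborel std_normal_density"

text \<open>All coordinates of all samples as one family over index pairs: rows, columns and the
  whole grid then are equally available as blocks of independent variables, unlike in the nested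
  product \<open>samples\<close>.\<close>

definition flat :: "(nat \<times> nat) set => (nat \<times> nat => real) measure" where
 "flat I = (\<Pi>\<^sub>M p\<in>I. std_gauss)"

lemma sets_std_gauss [simp, measurable_cong]: "sets std_gauss = sets borel" by (simp add: std_gauss_def)

lemma space_std_gauss [simp]: "space std_gauss = UNIV" by (simp add: std_gauss_def)

lemma prob_space_std_gauss: "prob_space std_gauss" unfolding std_gauss_def by (rule prob_space_normal_density) simp

lemma prob_space_flat: "prob_space (flat I)" unfolding flat_def by (intro prob_space_PiM prob_space_std_gauss)

lemma component_measurable_flat: "p : I ==> (%g. g p) : borel_measurable (flat I)"
 unfolding flat_def using measurable_component_singleton[of p I "%_. std_gauss"] by (simp add: measurable_cong_sets[OF refl sets_std_gauss])

lemma linear_measurable_flat: "K <= I ==> (%g. SUM p:K. a p * g p) : borel_measurable (flat I)"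
 by (intro borel_measurable_sum borel_measurable_times borel_measurable_const component_measurable_flat) auto

lemma distr_flat_component:
 assumes "p : I"
 shows "distr (flat I) borel (%g. g p) = std_gauss"
proof -
 have "distr (flat I) borel (%g. g p) = distr (flat I) std_gauss (%g. g p)" by (rule distr_cong) simp_all
 also have "... = std_gauss" unfolding flat_def using distr_PiM_component[of I "%_. std_gauss" p] assms prob_space_std_gauss by simp
 finally show ?thesis .
qed

lemma distributed_flat_component:
 assumes "p : I"
 shows "distributed (flat I) lborel (%g. g p) std_normal_density"
proof -
 have "distr (flat I) lborel (%g. g p) = distr (flat I) borel (%g. g p)" by (rule distr_cong) simp_all
 thus ?thesis using assms unfolding distributed_def by (simp add: distr_flat_component std_gauss_def component_measurable_flat)
qed

lemma indep_vars_flat: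
 assumes "I ~= {}"
 shows "prob_space.indep_vars (flat I) (%_. borel) (%p g. g p) I"
proof -
 interpret prob_space "flat I" by (rule prob_space_flat)
 have eq: "sets (flat I) = sets (\<Pi>\<^sub>M p\<in>I. borel)" unfolding flat_def by (intro sets_PiM_cong) simp_all
 have "distr (flat I) (\<Pi>\<^sub>M p\<in>I. borel) (%x. \<lambda>p\<in>I. x p) = distr (flat I) (flat I) (%x. x)"
 proof (rule distr_cong)
  fix x assume "x : space (flat I)"
  thus "(\<lambda>p\<in>I. x p) = x" by (simp add: flat_def space_PiM PiE_restrict)
 qed (simp_all add: eq)
 also have "... = flat I" by simp
 also have "... = (\<Pi>\<^sub>M p\<in>I. distr (flat I) borel (%g. g p))"
  unfolding flat_def by (intro PiM_cong refl) (simp add: distr_flat_component[unfolded flat_def])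
 finally show ?thesis using assms by (subst indep_vars_iff_distr_eq_PiM') (auto simp: component_measurable_flat)
qed

lemma block_normal:
 assumes "finite I" "K \<subseteq> I" "(\<Sum>p\<in>K. (a p)\<^sup>2) = 1"
 shows "distr (flat I) borel (\<lambda>g. \<Sum>p\<in>K. a p * g p) = std_gauss"
proof -
 interpret prob_space "flat I" by (rule prob_space_flat)
 \<comment> \<open>Zero coefficients are dropped because the normal laws being summed must have
   positive standard deviation.\<close>
 define K' where "K' = {p \<in> K. a p \<noteq> 0}"
 have finK: "finite K" using assms finite_subset by blast
 have fin: "finite K'" "K' \<subseteq> I" using assms finK by (auto simp: K'_def)
 have sq: "(\<Sum>p\<in>K'. (a p)\<^sup>2) = 1" using assms(3) by (subst assms(3)[symmetric], intro sum.mono_neutral_left) (use finK in \<open>auto simp: K'_def\<close>)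
 hence ne: "K' \<noteq> {}" by auto
 hence "I \<noteq> {}" using fin by auto
 have "indep_vars (\<lambda>_. borel) (\<lambda>p g. g p) K'" using indep_vars_subset[OF indep_vars_flat[OF \<open>I \<noteq> {}\<close>]] fin by blast
 hence ind: "indep_vars (\<lambda>_. borel) (\<lambda>p g. a p * g p) K'" by (rule indep_vars_compose2) simp
 have nrm: "distributed (flat I) lborel (\<lambda>g. a p * g p) (normal_density 0 \<bar>a p\<bar>)" if "p \<in> K'" for p
 proof -
  have "p \<in> I" "a p \<noteq> 0" using that fin by (auto simp: K'_def)
  thus ?thesis using normal_density_affine[OF distributed_flat_component[of p I], where \<alpha> = "a p" and \<beta> = 0] by simp
 qed
 have "distributed (flat I) lborel (\<lambda>g. \<Sum>p\<in>K'. a p * g p)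
   (normal_density (\<Sum>p\<in>K'. 0) (sqrt (\<Sum>p\<in>K'. \<bar>a p\<bar>\<^sup>2)))" by (rule sum_indep_normal[OF fin(1) ne ind]) (auto simp: nrm, simp add: K'_def)
 hence "distributed (flat I) lborel (\<lambda>g. \<Sum>p\<in>K'. a p * g p) std_normal_density" using sq by simp
 hence "distr (flat I) lborel (\<lambda>g. \<Sum>p\<in>K'. a p * g p) = std_gauss" by (simp add: distributed_def std_gauss_def)
 moreover have "(\<lambda>g. \<Sum>p\<in>K'. a p * g p) = (\<lambda>g. \<Sum>p\<in>K. a p * g p)"
  by (intro ext sum.mono_neutral_left) (use finK in \<open>auto simp: K'_def\<close>)
 moreover have "distr (flat I) lborel (\<lambda>g. \<Sum>p\<in>K. a p * g p) = distr (flat I) borel (\<lambda>g. \<Sum>p\<in>K. a p * g p)" by (rule distr_cong) simp_all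
 ultimately show ?thesis by simp
qed

text \<open>Linear forms of unit norm on disjoint blocks are independent standard normals, so the
  moment generating function factors over \<open>L\<close>; Markov's inequality does the rest.
  Integrals of \<open>ennreal\<close> functions keep integrability out of the argument. It is
  applied to centred squares and to truncated squares.\<close>

lemma block_Chernoff:
 assumes I: "finite I" and L: "finite L" and K: "!!l. l : L ==> K l <= I" "disjoint_family_on K L"
  and a: "!!l. l : L ==> (SUM p:K l. (a p)\<^sup>2) = 1"
  and h [measurable]: "h : borel_measurable borel"
  and mgf: "(\<integral>\<^sup>+x. ennreal (exp (h x)) \<partial>std_gauss) <= ennreal (exp c)"
 shows "measure (flat I) {g : space (flat I). s <= (SUM l:L. h (SUM p:K l. a p * g p))}
  <= exp (real (card L) * c - s)"
proof -
 interpret prob_space "flat I" by (rule prob_space_flat)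
 let ?\<eta> = "%l g. SUM p:K l. a p * g p"
 have meas: "?\<eta> l : borel_measurable (flat I)" if "l : L" for l using K(1)[OF that] by (rule linear_measurable_flat)
 have mh: "(%g. h (?\<eta> l g)) : borel_measurable (flat I)" if "l : L" for l using measurable_compose[OF meas[OF that] h] .
 have msum: "(%g. SUM l:L. h (?\<eta> l g)) : borel_measurable (flat I)" by (intro borel_measurable_sum mh)
 have "(\<integral>\<^sup>+g. ennreal (exp (SUM l:L. h (?\<eta> l g))) \<partial>flat I) <= ennreal (exp (real (card L) * c))"
 proof (cases "L = {}")
  case True
  thus ?thesis using emeasure_space_1 by simp
 next
  case False
  then obtain l0 where l0: "l0 : L" by auto
  have "I ~= {}" using K(1)[OF l0] a[OF l0] by auto
  have "indep_vars (%l. PiM (K l) (%_. borel)) (%l g. restrict (%p. g p) (K l)) L"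
   by (rule indep_vars_restrict[OF indep_vars_flat[OF \<open>I ~= {}\<close>] K])
  hence "indep_vars (%_. borel) (%l g. (%f. ennreal (exp (h (SUM p:K l. a p * f p)))) (restrict (%p. g p) (K l))) L"
  proof (rule indep_vars_compose2)
   fix l assume "l : L"
   have "(%f. SUM p:K l. a p * f p) : borel_measurable (PiM (K l) (%_. borel))"
    by (intro borel_measurable_sum borel_measurable_times borel_measurable_const measurable_component_singleton)
   from measurable_compose[OF this h]
   show "(%f. ennreal (exp (h (SUM p:K l. a p * f p)))) : borel_measurable (PiM (K l) (%_. borel))" by measurable
  qed
  hence ind: "indep_vars (%_. borel) (%l g. ennreal (exp (h (?\<eta> l g)))) L" by (simp cong: sum.cong)
  have "(\<integral>\<^sup>+g. ennreal (exp (SUM l:L. h (?\<eta> l g))) \<partial>flat I)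
    = (\<integral>\<^sup>+g. (\<Prod>l\<in>L. ennreal (exp (h (?\<eta> l g)))) \<partial>flat I)" by (simp add: exp_sum[OF L] prod_ennreal)
  also have "... = (\<Prod>l\<in>L. \<integral>\<^sup>+g. ennreal (exp (h (?\<eta> l g))) \<partial>flat I)" by (rule indep_vars_nn_integral[OF L ind]) simp
  also have "... <= (\<Prod>l\<in>L. ennreal (exp c))"
  proof -
   have mono: "(!!l. l : L ==> f l <= f' l) ==> prod f L <= prod f' L" for f f' :: "'a => ennreal"
    using L by (induction L rule: finite_induct) (auto intro: mult_mono)
   show ?thesis
  proof (rule mono)
   fix l assume l: "l : L"
   have "(\<integral>\<^sup>+g. ennreal (exp (h (?\<eta> l g))) \<partial>flat I)
     = (\<integral>\<^sup>+x. ennreal (exp (h x)) \<partial>distr (flat I) borel (?\<eta> l))" using meas[OF l] by (subst nn_integral_distr) auto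
   also have "... <= ennreal (exp c)" using block_normal[OF I K(1)[OF l] a[OF l]] mgf by simp
   finally show "(\<integral>\<^sup>+g. ennreal (exp (h (?\<eta> l g))) \<partial>flat I) <= ennreal (exp c)" .
  qed
  qed
  also have "... = ennreal (exp (real (card L) * c))" by (simp add: ennreal_power exp_of_nat_mult)
  finally show ?thesis .
 qed
 moreover have "ennreal (exp s) * emeasure (flat I) {g : space (flat I). s <= (SUM l:L. h (?\<eta> l g))}
   <= (\<integral>\<^sup>+g. ennreal (exp (SUM l:L. h (?\<eta> l g))) \<partial>flat I)"
 proof -
  let ?A = "{g : space (flat I). s <= (SUM l:L. h (?\<eta> l g))}"
  have A: "?A : sets (flat I)" using msum by measurable
  have "ennreal (exp s) * emeasure (flat I) ?A = (\<integral>\<^sup>+g. ennreal (exp s) * indicator ?A g \<partial>flat I)"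
   using A by (simp add: nn_integral_cmult_indicator)
  also have "... <= (\<integral>\<^sup>+g. ennreal (exp (SUM l:L. h (?\<eta> l g))) \<partial>flat I)"
   by (intro nn_integral_mono) (auto simp: indicator_def intro!: ennreal_leI)
  finally show ?thesis .
 qed
 ultimately have "ennreal (exp s) * emeasure (flat I) {g : space (flat I). s <= (SUM l:L. h (?\<eta> l g))}
   <= ennreal (exp (real (card L) * c))" by (rule order_trans[rotated])
 hence "exp s * measure (flat I) {g : space (flat I). s <= (SUM l:L. h (?\<eta> l g))} <= exp (real (card L) * c)"
  by (simp add: emeasure_eq_measure flip: ennreal_mult'')
 thus ?thesis by (simp add: exp_diff field_simps)
qed

lemma gauss_mgf_square:
 assumes "t < 1 / 2"
 shows "(\<integral>\<^sup>+x. ennreal (exp (t * x\<^sup>2)) \<partial>std_gauss) = ennreal (1 / sqrt (1 - 2 * t))"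
proof -
 define si where "si = 1 / sqrt (1 - 2 * t)"
 have si: "si > 0" "si\<^sup>2 = 1 / (1 - 2 * t)" using assms by (simp_all add: si_def power_divide)
 have eq: "std_normal_density x * exp (t * x\<^sup>2) = si * normal_density 0 si x" for x
 proof -
  have "- x\<^sup>2 / 2 + t * x\<^sup>2 = - x\<^sup>2 / (2 * si\<^sup>2)" unfolding si(2) using assms by (simp add: field_simps)
  hence "exp (- x\<^sup>2 / 2) * exp (t * x\<^sup>2) = exp (- x\<^sup>2 / (2 * si\<^sup>2))" by (metis exp_add)
  thus ?thesis unfolding std_normal_density_def normal_density_def using si(1) by (simp add: real_sqrt_mult field_simps)
 qed
 have "(\<integral>\<^sup>+x. ennreal (exp (t * x\<^sup>2)) \<partial>std_gauss)
   = (\<integral>\<^sup>+x. ennreal (std_normal_density x) * ennreal (exp (t * x\<^sup>2)) \<partial>lborel)" unfolding std_gauss_def by (rule nn_integral_density) auto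
 also have "... = (\<integral>\<^sup>+x. ennreal si * ennreal (normal_density 0 si x) \<partial>lborel)"
 proof (rule nn_integral_cong)
  fix x
  have "ennreal (std_normal_density x) * ennreal (exp (t * x\<^sup>2)) = ennreal (std_normal_density x * exp (t * x\<^sup>2))" by (simp add: ennreal_mult')
  also have "... = ennreal si * ennreal (normal_density 0 si x)" unfolding eq using si by (simp add: ennreal_mult')
  finally show "ennreal (std_normal_density x) * ennreal (exp (t * x\<^sup>2)) = ennreal si * ennreal (normal_density 0 si x)" .
 qed
 also have "... = ennreal si * (\<integral>\<^sup>+x. ennreal (normal_density 0 si x) \<partial>lborel)" by (rule nn_integral_cmult) auto
 also have "(\<integral>\<^sup>+x. ennreal (normal_density 0 si x) \<partial>lborel) = 1"
  using nn_integral_eq_integral[OF integrable_normal_density[OF si(1), of 0]] integral_normal_density[OF si(1), of 0] by simp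
 finally show ?thesis by (simp add: si_def)
qed

text \<open>The value is \<open>exp (- t) / sqrt (1 - 2 * t)\<close>, and
  \<open>- ln (1 - 2 * t) / 2 <= t + 4 * t^2\<close> in the given range.\<close>

lemma gauss_mgf_centered:
 assumes "\<bar>t\<bar> <= 1 / 4"
 shows "(\<integral>\<^sup>+x. ennreal (exp (t * (x\<^sup>2 - 1))) \<partial>std_gauss) <= ennreal (exp (4 * t\<^sup>2))"
proof -
 have t: "t < 1 / 2" "1 - 2 * t > 0" using assms by auto
 have "\<bar>ln (1 + (- 2 * t)) - (- 2 * t)\<bar> <= 2 * (- 2 * t)\<^sup>2" by (rule abs_ln_one_plus_x_minus_x_bound) (use assms in auto)
 hence "- ln (1 - 2 * t) / 2 <= t + 4 * t\<^sup>2" by (simp add: sq_eq)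
 hence "exp (- ln (1 - 2 * t) / 2) <= exp (t + 4 * t\<^sup>2)" by simp
 moreover have "exp (- ln (1 - 2 * t) / 2) = 1 / sqrt (1 - 2 * t)"
 proof -
  have "- ln (1 - 2 * t) / 2 = - ln (sqrt (1 - 2 * t))" using ln_sqrt[of "1 - 2 * t"] t by simp
  hence "exp (- ln (1 - 2 * t) / 2) = exp (- ln (sqrt (1 - 2 * t)))" by (rule arg_cong)
  also have "... = inverse (sqrt (1 - 2 * t))" unfolding exp_minus using t by (subst exp_ln) auto
  finally show ?thesis by (simp add: inverse_eq_divide)
 qed
 ultimately have le: "1 / sqrt (1 - 2 * t) <= exp (t + 4 * t\<^sup>2)" by (simp only:)
 have "(\<integral>\<^sup>+x. ennreal (exp (t * (x\<^sup>2 - 1))) \<partial>std_gauss) = (\<integral>\<^sup>+x. ennreal (exp (- t)) * ennreal (exp (t * x\<^sup>2)) \<partial>std_gauss)"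
 proof (rule nn_integral_cong)
  fix x :: real
  have "exp (t * (x\<^sup>2 - 1)) = exp (- t) * exp (t * x\<^sup>2)" unfolding exp_add[symmetric] by (simp add: algebra_simps)
  thus "ennreal (exp (t * (x\<^sup>2 - 1))) = ennreal (exp (- t)) * ennreal (exp (t * x\<^sup>2))" by (simp add: ennreal_mult')
 qed
 also have "... = ennreal (exp (- t)) * ennreal (1 / sqrt (1 - 2 * t))"
 proof -
  have "(%x. ennreal (exp (t * x\<^sup>2))) : borel_measurable std_gauss" by measurable
  thus ?thesis using gauss_mgf_square[OF t(1)] by (simp add: nn_integral_cmult)
 qed
 also have "... <= ennreal (exp (- t)) * ennreal (exp (t + 4 * t\<^sup>2))" using le by (intro mult_left_mono ennreal_leI) auto
 also have "... = ennreal (exp (4 * t\<^sup>2))" by (simp flip: ennreal_mult' exp_add)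
 finally show ?thesis .
qed

text \<open>\<open>exp (max 0 z) <= 1 + exp z\<close> reduces this to the square at rate
  \<open>1/4\<close>, below the critical rate \<open>1/2\<close>, where the moment generating
  function is \<open>sqrt 2\<close>.\<close>

lemma gauss_mgf_truncated:
 "(\<integral>\<^sup>+x. ennreal (exp (max 0 (x\<^sup>2 - t) / 4)) \<partial>std_gauss) <= ennreal (exp (2 * exp (- t / 4)))"
proof -
 interpret prob_space std_gauss by (rule prob_space_std_gauss)
 have "(\<integral>\<^sup>+x. ennreal (exp (max 0 (x\<^sup>2 - t) / 4)) \<partial>std_gauss)
   <= (\<integral>\<^sup>+x. 1 + ennreal (exp (- t / 4)) * ennreal (exp (1 / 4 * x\<^sup>2)) \<partial>std_gauss)"
 proof (intro nn_integral_mono)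
  fix x :: real
  have "exp (max 0 (x\<^sup>2 - t) / 4) <= 1 + exp (- t / 4) * exp (1 / 4 * x\<^sup>2)" by (auto simp: max_def field_simps simp flip: exp_add)
  thus "ennreal (exp (max 0 (x\<^sup>2 - t) / 4)) <= 1 + ennreal (exp (- t / 4)) * ennreal (exp (1 / 4 * x\<^sup>2))"
   by (simp flip: ennreal_mult' ennreal_1 ennreal_plus add: ennreal_leI)
 qed
 also have "... = 1 + ennreal (exp (- t / 4)) * ennreal (1 / sqrt (1 / 2))"
 proof -
  have "(%x. ennreal (exp (1 / 4 * x\<^sup>2))) : borel_measurable std_gauss" by measurable
  thus ?thesis using gauss_mgf_square[of "1 / 4"] emeasure_space_1 by (subst nn_integral_add, simp, simp) (subst nn_integral_cmult, simp_all)
 qed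
 also have "... = ennreal (1 + exp (- t / 4) * (1 / sqrt (1 / 2)))" by (simp flip: ennreal_mult' ennreal_1 ennreal_plus)
 also have "... <= ennreal (exp (2 * exp (- t / 4)))"
 proof (rule ennreal_leI)
  have "1 / sqrt (1 / 2) <= (2::real)" by (simp add: real_sqrt_divide real_le_lsqrt)
  hence "1 + exp (- t / 4) * (1 / sqrt (1 / 2)) <= 1 + exp (- t / 4) * 2" by (intro add_left_mono mult_left_mono) auto
  also have "... <= exp (2 * exp (- t / 4))" using exp_ge_add_one_self[of "2 * exp (- t / 4)"] by (simp only: mult.commute)
  finally show "1 + exp (- t / 4) * (1 / sqrt (1 / 2)) <= exp (2 * exp (- t / 4))" .
 qed
 finally show ?thesis .
qed

lemma chi_square_tail:
 assumes I: "finite I" and L: "finite L" "card L = k" and K: "!!l. l : L ==> K l <= I" "disjoint_family_on K L"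
  and a: "!!l. l : L ==> (SUM p:K l. (a p)\<^sup>2) = v" and v: "v > 0" and x: "x > 0"
 shows "measure (flat I) {g : space (flat I).
   5 * (sqrt (real k * x) + x) * v <= \<bar>(SUM l:L. (SUM p:K l. a p * g p)\<^sup>2) - real k * v\<bar>} <= 2 * exp (- x)"
proof -
 interpret prob_space "flat I" by (rule prob_space_flat)
 define b where "b = (%p. a p / sqrt v)"
 define s where "s = 5 * (sqrt (real k * x) + x)"
 have b1: "(SUM p:K l. (b p)\<^sup>2) = 1" if "l : L" for l using a[OF that] v by (simp add: b_def power_divide flip: sum_divide_distrib)
 \<comment> \<open>The best Chernoff rate is of order \<open>sqrt (x / k)\<close>, capped at the
   \<open>1/4\<close> up to which \<open>gauss_mgf_centered\<close> holds; the two regimes account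
   for the two terms of the deviation.\<close>
 obtain t where t: "0 < t" "t <= 1 / 4" "real k * (4 * t\<^sup>2) - t * s <= - x"
 proof (cases "x <= real k")
  case True
  hence k: "real k > 0" using x by linarith
  define t where "t = sqrt (x / real k) / 4"
  have "t\<^sup>2 = x / real k / 16" using x k by (simp add: t_def power_divide)
  hence 1: "real k * (4 * t\<^sup>2) = x / 4" using k by simp
  have "sqrt (x / real k) * sqrt (real k * x) = x" using k x by (simp flip: real_sqrt_mult add: sq_eq[symmetric])
  hence "t * (5 * sqrt (real k * x)) = 5 * x / 4" by (simp add: t_def)
  moreover have "0 < t" using x k by (simp add: t_def)
  moreover have "t * s = t * (5 * sqrt (real k * x)) + 5 * (t * x)" by (simp add: s_def algebra_simps)
  moreover have "t * x > 0" using \<open>0 < t\<close> x by simp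
  ultimately have "t * s >= 5 * x / 4" by linarith
  moreover have "t <= 1 / 4" using True k by (simp add: t_def)
  ultimately show ?thesis using that[of t] \<open>0 < t\<close> 1 by simp
 next
  case False
  have "s >= 5 * x" using x by (simp add: s_def)
  thus ?thesis using that[of "1 / 4"] False by (simp add: sq_eq)
 qed
 have tail: "measure (flat I) {g : space (flat I). t * s <= (SUM l:L. ta * ((SUM p:K l. b p * g p)\<^sup>2 - 1))} <= exp (- x)"
  if "\<bar>ta\<bar> = t" for ta
 proof -
  have "measure (flat I) {g : space (flat I). t * s <= (SUM l:L. ta * ((SUM p:K l. b p * g p)\<^sup>2 - 1))}
    <= exp (real (card L) * (4 * ta\<^sup>2) - t * s)" using I L K b1 gauss_mgf_centered[of ta] t that
   by (intro block_Chernoff[where h = "%x. ta * (x\<^sup>2 - 1)"]) auto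
  also have "ta\<^sup>2 = t\<^sup>2" using that by (metis power2_abs)
  finally show ?thesis using t(3) L(2) by (meson exp_le_cancel_iff order_trans)
 qed
 have scale: "(SUM l:L. (SUM p:K l. a p * g p)\<^sup>2) - real k * v = v * (SUM l:L. (SUM p:K l. b p * g p)\<^sup>2 - 1)" for g
 proof -
  have "(SUM p:K l. b p * g p) = (SUM p:K l. a p * g p) / sqrt v" for l by (simp add: b_def sum_divide_distrib)
  hence "v * (SUM p:K l. b p * g p)\<^sup>2 = (SUM p:K l. a p * g p)\<^sup>2" for l using v by (simp add: power_divide)
  thus ?thesis using L(2) by (simp add: sum_subtractf right_diff_distrib sum_distrib_left mult.commute)
 qed
 let ?A = "%ta. {g : space (flat I). t * s <= (SUM l:L. ta * ((SUM p:K l. b p * g p)\<^sup>2 - 1))}"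
 have meas: "?A ta : sets (flat I)" for ta
 proof -
  have "(%g. SUM l:L. ta * ((SUM p:K l. b p * g p)\<^sup>2 - 1)) : borel_measurable (flat I)"
   by (intro borel_measurable_sum borel_measurable_times borel_measurable_const borel_measurable_diff
     borel_measurable_power linear_measurable_flat K)
  thus ?thesis by measurable
 qed
 have "{g : space (flat I). s * v <= \<bar>(SUM l:L. (SUM p:K l. a p * g p)\<^sup>2) - real k * v\<bar>} <= ?A t \<union> ?A (- t)"
 proof
  fix g assume g: "g : {g : space (flat I). s * v <= \<bar>(SUM l:L. (SUM p:K l. a p * g p)\<^sup>2) - real k * v\<bar>}"
  define S where "S = (SUM l:L. (SUM p:K l. b p * g p)\<^sup>2 - 1)"
  have "s * v <= \<bar>v * S\<bar>" using g unfolding scale S_def by blast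
  hence "v * s <= v * \<bar>S\<bar>" using v by (simp add: abs_mult mult.commute)
  hence "s <= \<bar>S\<bar>" using v by simp
  hence "t * s <= t * \<bar>S\<bar>" using t(1) by (intro mult_left_mono) auto
  hence "t * s <= t * S | t * s <= - t * S" by (cases "S >= 0") auto
  thus "g : ?A t \<union> ?A (- t)" using g unfolding S_def sum_distrib_left by blast
 qed
 hence "measure (flat I) {g : space (flat I). s * v <= \<bar>(SUM l:L. (SUM p:K l. a p * g p)\<^sup>2) - real k * v\<bar>}
   <= measure (flat I) (?A t \<union> ?A (- t))" by (rule finite_measure_mono[OF _ sets.Un[OF meas meas]])
 also have "... <= measure (flat I) (?A t) + measure (flat I) (?A (- t))" by (rule measure_Un_le[OF meas meas])
 also have "... <= exp (- x) + exp (- x)" using t by (intro add_mono tail) auto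
 finally show ?thesis by (simp add: s_def)
qed

definition grid :: "nat => nat => (nat \<times> nat) set" where
 "grid n d = {..<n} \<times> {..<d}"

lemma finite_grid [simp]: "finite (grid n d)" by (simp add: grid_def)

lemma normal_shift:
 assumes [measurable]: "A : sets borel"
 shows "emeasure (density lborel (normal_density m 1)) {x. x - m : A} = emeasure std_gauss A"
proof -
 have "emeasure (density lborel (normal_density m 1)) {x. x - m : A}
   = (\<integral>\<^sup>+x. ennreal (normal_density m 1 x) * indicator {x. x - m : A} x \<partial>lborel)" by (subst emeasure_density) auto
 also have "... = (\<integral>\<^sup>+x. ennreal (normal_density m 1 (m + 1 * x)) * indicator {x. x - m : A} (m + 1 * x) \<partial>lborel)"
  by (subst nn_integral_real_affine[where c = 1 and t = m]) auto
 also have "... = (\<integral>\<^sup>+x. ennreal (std_normal_density x) * indicator A x \<partial>lborel)"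
  by (intro nn_integral_cong) (simp add: normal_density_def indicator_def)
 also have "... = emeasure std_gauss A" unfolding std_gauss_def by (subst emeasure_density) auto
 finally show ?thesis .
qed

lemma prob_space_gaussian: "prob_space (gaussian d mm)" unfolding gaussian_def by (intro prob_space_PiM prob_space_normal_density) simp

definition noise :: "nat => nat => (nat => real) => (nat => nat => real) => nat \<times> nat => real" where
 "noise n d mm X = (\<lambda>p\<in>grid n d. X (fst p) (snd p) - mm (snd p))"

lemma noise_measurable: "noise n d mm : samples n d mm \<rightarrow>\<^sub>M flat (grid n d)" unfolding noise_def flat_def
proof (rule measurable_restrict)
 fix p assume "p : grid n d"
 hence p: "fst p : {..<n}" "snd p : {..<d}" by (auto simp: grid_def)
 have "(%X. X (fst p)) : samples n d mm \<rightarrow>\<^sub>M gaussian d mm" unfolding samples_def by (rule measurable_component_singleton[OF p(1)])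
 moreover have "(%x. x (snd p)) : gaussian d mm \<rightarrow>\<^sub>M density lborel (normal_density (mm (snd p)) 1)"
  unfolding gaussian_def by (rule measurable_component_singleton[OF p(2)])
 ultimately have "(%X. X (fst p) (snd p)) : samples n d mm \<rightarrow>\<^sub>M density lborel (normal_density (mm (snd p)) 1)"
  by (rule measurable_compose)
 hence "(%X. X (fst p) (snd p)) : borel_measurable (samples n d mm)" by simp
 hence "(%X. X (fst p) (snd p) - mm (snd p)) : borel_measurable (samples n d mm)" by measurable
 thus "(%X. X (fst p) (snd p) - mm (snd p)) : samples n d mm \<rightarrow>\<^sub>M std_gauss"
  by (simp add: measurable_cong_sets[OF refl sets_std_gauss])
qed

text \<open>It suffices to compare the measures on rectangles, where the nested product over rows
  and coordinates becomes one product over the grid.\<close>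

lemma distr_noise: "distr (samples n d mm) (flat (grid n d)) (noise n d mm) = flat (grid n d)"
proof -
 interpret F: product_sigma_finite "%p :: nat \<times> nat. std_gauss"
  unfolding product_sigma_finite_def by (intro allI prob_space_imp_sigma_finite prob_space_std_gauss)
 interpret S: product_sigma_finite "%i :: nat. gaussian d mm"
  unfolding product_sigma_finite_def by (intro allI prob_space_imp_sigma_finite prob_space_gaussian)
 interpret G: product_sigma_finite "%j :: nat. density lborel (normal_density (mm j) 1)"
  unfolding product_sigma_finite_def by (intro allI prob_space_imp_sigma_finite prob_space_normal_density) simp
 show ?thesis unfolding flat_def
 proof (rule F.PiM_eqI)
  fix A :: "nat \<times> nat => real set" assume A: "!!p. p : grid n d ==> A p : sets std_gauss"
  define B where "B = (%i j. {x. x - mm j : A (i, j)})"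
  have B: "B i j : sets (density lborel (normal_density (mm j) 1))" if "i < n" "j < d" for i j
  proof -
   have [measurable]: "A (i, j) : sets borel" using A[of "(i, j)"] that by (simp add: grid_def)
   have "{x : space borel. x - mm j : A (i, j)} : sets borel" by measurable
   thus ?thesis by (simp add: B_def)
  qed
  have G: "Pi\<^sub>E {..<d} (B i) : sets (gaussian d mm)" if "i < n" for i unfolding gaussian_def using B[OF that] by (intro sets_PiM_I_finite) auto
  have pre: "noise n d mm -` Pi\<^sub>E (grid n d) A \<inter> space (samples n d mm) = Pi\<^sub>E {..<n} (%i. Pi\<^sub>E {..<d} (B i))"
   by (auto simp: noise_def grid_def B_def samples_def gaussian_def space_PiM PiE_iff)
  have "emeasure (distr (samples n d mm) (Pi\<^sub>M (grid n d) (%p. std_gauss)) (noise n d mm)) (Pi\<^sub>E (grid n d) A)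
    = emeasure (samples n d mm) (Pi\<^sub>E {..<n} (%i. Pi\<^sub>E {..<d} (B i)))" unfolding pre[symmetric] using noise_measurable[of n d mm] A
   by (intro emeasure_distr) (auto simp: flat_def intro!: sets_PiM_I_finite)
  also have "... = (\<Prod>i<n. emeasure (gaussian d mm) (Pi\<^sub>E {..<d} (B i)))" unfolding samples_def using G by (intro S.emeasure_PiM) auto
  also have "... = (\<Prod>i<n. \<Prod>j<d. emeasure (density lborel (normal_density (mm j) 1)) (B i j))"
   unfolding gaussian_def using B by (intro prod.cong refl G.emeasure_PiM) auto
  also have "... = (\<Prod>i<n. \<Prod>j<d. emeasure std_gauss (A (i, j)))" unfolding B_def using A by (intro prod.cong refl normal_shift) (auto simp: grid_def)
  also have "... = (\<Prod>p\<in>grid n d. emeasure std_gauss (A p))" unfolding grid_def by (simp add: prod.cartesian_product case_prod_beta')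
  finally show "emeasure (distr (samples n d mm) (Pi\<^sub>M (grid n d) (%p. std_gauss)) (noise n d mm)) (Pi\<^sub>E (grid n d) A)
    = (\<Prod>p\<in>grid n d. emeasure std_gauss (A p))" .
 qed simp_all
qed

lemma noise_event:
 assumes "G : sets (flat (grid n d))"
 shows "EX E:sets (samples n d mm). measure (samples n d mm) E = measure (flat (grid n d)) G &
  (ALL X:E. noise n d mm X : G)"
proof -
 let ?E = "noise n d mm -` G \<inter> space (samples n d mm)"
 have "measure (flat (grid n d)) G = measure (distr (samples n d mm) (flat (grid n d)) (noise n d mm)) G" by (simp add: distr_noise)
 also have "... = measure (samples n d mm) ?E" using assms by (intro measure_distr noise_measurable)
 finally show ?thesis using measurable_sets[OF noise_measurable assms] by (intro bexI[of _ ?E]) auto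
qed

lemma truncated_tail:
 assumes I: "finite I" and L: "finite L" and K: "!!l. l : L ==> K l <= I" "disjoint_family_on K L"
  and a: "!!l. l : L ==> (SUM p:K l. (a p)\<^sup>2) = 1"
 shows "measure (flat I) {g : space (flat I).
   2 * real (card L) * exp (- t / 4) + x <= (SUM l:L. max 0 ((SUM p:K l. a p * g p)\<^sup>2 - t) / 4)} <= exp (- x)"
proof -
 have "measure (flat I) {g : space (flat I).
   2 * real (card L) * exp (- t / 4) + x <= (SUM l:L. (%y. max 0 (y\<^sup>2 - t) / 4) (SUM p:K l. a p * g p))}
   <= exp (real (card L) * (2 * exp (- t / 4)) - (2 * real (card L) * exp (- t / 4) + x))" using I L K a gauss_mgf_truncated[of t] by (intro block_Chernoff) auto
 also have "real (card L) * (2 * exp (- t / 4)) - (2 * real (card L) * exp (- t / 4) + x) = - x" by simp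
 finally show ?thesis by simp
qed

section \<open>Nets of the unit sphere\<close>

lemma sum_half_powers: "(SUM k = - int K..int K. (1 / 2 :: real) ^ nat \<bar>k\<bar>) = 3 - 2 * (1 / 2) ^ K"
proof (induction K)
 case (Suc K)
 have "{- int (Suc K)..int (Suc K)} = insert (int (Suc K)) (insert (- int (Suc K)) {- int K..int K})" by auto
 hence "(SUM k = - int (Suc K)..int (Suc K). (1 / 2 :: real) ^ nat \<bar>k\<bar>)
   = (1 / 2) ^ nat \<bar>int (Suc K)\<bar> + ((1 / 2) ^ nat \<bar>- int (Suc K)\<bar> + (SUM k = - int K..int K. (1 / 2) ^ nat \<bar>k\<bar>))" by simp
 moreover have "nat \<bar>int (Suc K)\<bar> = Suc K" "nat \<bar>- int (Suc K)\<bar> = Suc K" by auto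
 ultimately show ?case using Suc by simp
qed simp

text \<open>Gaussian weights do the counting: every counted \<open>z\<close> satisfies
  \<open>1 <= PROD j. exp (25 - z_j^2)\<close>, and the sum of these products over the box factors
  into a \<open>d\<close>-th power whose base is bounded independently of \<open>K\<close>.\<close>

lemma integer_points_card:
 fixes d K :: nat
 defines "Z == {z : Pi\<^sub>E {..<d} (%_. {- int K..int K}). (SUM j<d. (z j)\<^sup>2) <= int (25 * d)}"
 shows "finite Z" "real (card Z) <= exp (27 * real d)"
proof -
 let ?P = "Pi\<^sub>E {..<d} (%_. {- int K..int K})"
 have finP: "finite ?P" by (intro finite_PiE) auto
 thus finZ: "finite Z" unfolding Z_def by simp
 have "real (card Z) = (SUM z:Z. 1)" by simp
 also have "... <= (SUM z:Z. \<Prod>j<d. exp (25 - (real_of_int (z j))\<^sup>2))"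
 proof (rule sum_mono)
  fix z assume "z : Z"
  hence "real_of_int (SUM j<d. (z j)\<^sup>2) <= real_of_int (int (25 * d))" unfolding Z_def of_int_le_iff by simp
  hence "0 <= (SUM j<d. 25 - (real_of_int (z j))\<^sup>2)" by (simp add: sum_subtractf)
  hence "1 <= exp (SUM j<d. 25 - (real_of_int (z j))\<^sup>2)" by simp
  thus "1 <= (\<Prod>j<d. exp (25 - (real_of_int (z j))\<^sup>2))" by (simp add: exp_sum)
 qed
 also have "... <= (SUM z:?P. \<Prod>j<d. exp (25 - (real_of_int (z j))\<^sup>2))" using finP by (intro sum_mono2) (auto simp: Z_def prod_nonneg)
 also have "... = (\<Prod>j<d. SUM k = - int K..int K. exp (25 - (real_of_int k)\<^sup>2))" by (subst prod_sum_PiE) auto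
 also have "... = (SUM k = - int K..int K. exp (25 - (real_of_int k)\<^sup>2)) ^ d" by simp
 also have "... <= (exp 27) ^ d"
 proof (rule power_mono)
  have "exp (25 - (real_of_int k)\<^sup>2) <= exp 25 * (1 / 2) ^ nat \<bar>k\<bar>" for k :: int
  proof -
   have "real (nat \<bar>k\<bar>) <= (real_of_int k)\<^sup>2"
   proof (cases "k = 0")
    case False
    hence "1 <= \<bar>real_of_int k\<bar>" by linarith
    hence "\<bar>real_of_int k\<bar> * 1 <= \<bar>real_of_int k\<bar> * \<bar>real_of_int k\<bar>" by (intro mult_left_mono) auto
    thus ?thesis by (simp add: sq_eq abs_mult[symmetric])
   qed simp
   hence "exp (- (real_of_int k)\<^sup>2) <= exp (- real (nat \<bar>k\<bar>))" by simp
   also have "... = exp (- 1) ^ nat \<bar>k\<bar>" unfolding exp_of_nat_mult[symmetric] by simp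
   also have "... <= (1 / 2) ^ nat \<bar>k\<bar>"
   proof (rule power_mono)
    have "(2::real) <= exp 1" using exp_ge_add_one_self[of 1] by simp
    thus "exp (- 1) <= (1 / 2 :: real)" by (simp add: exp_minus field_simps)
   qed simp
   finally have "exp 25 * exp (- (real_of_int k)\<^sup>2) <= exp 25 * (1 / 2) ^ nat \<bar>k\<bar>" by (intro mult_left_mono) auto
   thus ?thesis unfolding exp_add[symmetric] by simp
  qed
  hence "(SUM k = - int K..int K. exp (25 - (real_of_int k)\<^sup>2))
    <= (SUM k = - int K..int K. exp 25 * (1 / 2) ^ nat \<bar>k\<bar>)" by (intro sum_mono)
  also have "... = exp 25 * (3 - 2 * (1 / 2) ^ K)" by (simp only: sum_distrib_left[symmetric] sum_half_powers)
  also have "... <= exp 25 * 3" by (intro mult_left_mono) auto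
  also have "... <= exp 25 * exp (2::real)" using exp_ge_add_one_self[of 2] by (intro mult_left_mono) auto
  also have "... = exp 27" by (simp flip: exp_add)
  finally show "(SUM k = - int K..int K. exp (25 - (real_of_int k)\<^sup>2)) <= exp 27" .
 qed (simp add: sum_nonneg)
 also have "... = exp (27 * real d)" by (simp add: exp_of_nat_mult[symmetric] mult.commute)
 finally show "real (card Z) <= exp (27 * real d)" .
qed

lemma ip_eq_L2: "ip m x x = (L2_set x {..<m})\<^sup>2" by (simp add: ip_def L2_set_def sq_eq sum_nonneg)

lemma L2_eq_sqrt_ip: "L2_set x {..<m} = sqrt (ip m x x)" by (simp add: ip_def L2_set_def sq_eq)

text \<open>The net consists of integer points divided by \<open>r = 4 * sqrt d\<close>. Rounding
  moves each coordinate by at most \<open>1/r\<close>, so the vector by at most \<open>1/4\<close>.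
  The rounded vector has norm at most \<open>5/4\<close>, which is squared norm
  \<open>25/16 * r^2 = 25 * d\<close> for the integer point.\<close>

lemma unit_sphere_net:
 assumes "d >= 1"
 shows "EX T. finite T & real (card T) <= exp (27 * real d) &
  (ALL u. ip d u u = 1 --> (EX v:T. ip d (%i. u i - v i) (%i. u i - v i) <= 1 / 16))"
proof -
 define r where "r = 4 * sqrt (real d)"
 have r: "r > 0" "r\<^sup>2 = 16 * real d" using assms by (simp_all add: r_def power_mult_distrib)
 define Z where "Z = {z : Pi\<^sub>E {..<d} (%_. {- int (25 * d)..int (25 * d)}). (SUM j<d. (z j)\<^sup>2) <= int (25 * d)}"
 have Z: "finite Z" "real (card Z) <= exp (27 * real d)" unfolding Z_def by (rule integer_points_card)+
 define T where "T = (%z j. real_of_int (z j) / r) ` Z"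
 have "EX v:T. ip d (%i. u i - v i) (%i. u i - v i) <= 1 / 16" if u: "ip d u u = 1" for u
 proof -
  define z where "z = (\<lambda>j\<in>{..<d}. \<lfloor>r * u j\<rfloor>)"
  define v where "v = (%j. real_of_int (z j) / r)"
  have diff: "ip d (%i. u i - v i) (%i. u i - v i) <= 1 / 16"
  proof -
   have "(u j - v j) * (u j - v j) <= 1 / r\<^sup>2" if "j < d" for j
   proof -
    have "\<bar>r * u j - real_of_int \<lfloor>r * u j\<rfloor>\<bar> <= 1" by linarith
    hence "(r * u j - real_of_int \<lfloor>r * u j\<rfloor>)\<^sup>2 <= 1" by (simp add: abs_square_le_1)
    moreover have "(u j - v j) * (u j - v j) = (r * u j - real_of_int \<lfloor>r * u j\<rfloor>)\<^sup>2 / r\<^sup>2"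
     using r that by (simp add: v_def z_def sq_eq field_simps)
    ultimately show ?thesis by (simp add: divide_right_mono)
   qed
   hence "ip d (%i. u i - v i) (%i. u i - v i) <= (SUM j<d. 1 / r\<^sup>2)" unfolding ip_def by (intro sum_mono) auto
   also have "... = 1 / 16" using r assms by simp
   finally show ?thesis .
  qed
  have "L2_set v {..<d} <= L2_set u {..<d} + L2_set (%i. v i - u i) {..<d}" using L2_set_triangle_ineq[of u "%i. v i - u i" "{..<d}"] by simp
  also have "L2_set (%i. v i - u i) {..<d} = L2_set (%i. u i - v i) {..<d}" by (simp add: L2_set_def power2_commute)
  also have "... <= 1 / 4"
  proof -
   have "sqrt (ip d (%i. u i - v i) (%i. u i - v i)) <= sqrt (1 / 16)" using diff by simp
   also have "sqrt (1 / 16) = (1 / 4 :: real)" by (rule real_sqrt_unique) (simp_all add: sq_eq)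
   finally show ?thesis by (simp add: L2_eq_sqrt_ip)
  qed
  also have "L2_set u {..<d} = 1" using u by (simp add: L2_eq_sqrt_ip)
  finally have "L2_set v {..<d} <= 5 / 4" by simp
  hence "(L2_set v {..<d})\<^sup>2 <= (5 / 4)\<^sup>2" by (intro power_mono) (auto simp: L2_set_nonneg)
  hence "ip d v v <= 25 / 16" by (simp add: ip_eq_L2 sq_eq)
  moreover have "ip d v v = (SUM j<d. (real_of_int (z j))\<^sup>2) / r\<^sup>2" by (simp add: ip_def v_def sq_eq sum_divide_distrib)
  ultimately have "(SUM j<d. (real_of_int (z j))\<^sup>2) <= 25 * real d" unfolding r(2) using assms by (simp add: field_simps)
  hence sq: "(SUM j<d. (z j)\<^sup>2) <= int (25 * d)" by (simp flip: of_int_power of_int_sum add: of_int_le_iff[where 'a = real, symmetric])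
  have "z j : {- int (25 * d)..int (25 * d)}" if "j < d" for j
  proof -
   have "(z j)\<^sup>2 <= (SUM j<d. (z j)\<^sup>2)" using that by (intro member_le_sum) auto
   hence "(z j)\<^sup>2 <= int (25 * d)" using sq by simp
   moreover have "\<bar>z j\<bar> <= (z j)\<^sup>2"
   proof (cases "z j = 0")
    case False
    hence "\<bar>z j\<bar> * 1 <= \<bar>z j\<bar> * \<bar>z j\<bar>" by (intro mult_left_mono) auto
    thus ?thesis by (simp add: sq_eq abs_mult[symmetric])
   qed simp
   ultimately show ?thesis by auto
  qed
  hence "z : Z" unfolding Z_def using sq by (auto simp: z_def)
  hence "v : T" unfolding T_def v_def by auto
  thus ?thesis using diff by blast
 qed
 moreover have "finite T" "real (card T) <= exp (27 * real d)" unfolding T_def using Z card_image_le[OF Z(1), of "%z j. real_of_int (z j) / r"]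
  by (auto intro: order_trans[rotated])
 ultimately show ?thesis by blast
qed

text \<open>Let \<open>S\<close> be the largest absolute eigenvalue, \<open>u\<close> its
  eigenvector, \<open>v\<close> a net point near \<open>u\<close> and \<open>w = u - v\<close>.
  Expanding \<open>bil u u = bil v v + bil w u + bil v w\<close> gives
  \<open>S <= 25/16 * D + (1/4 + 5/16) * S\<close>, hence \<open>S <= 25/7 * D\<close>.\<close>

lemma net_quadratic_bound:
 assumes sym: "symm m A" and D: "D >= 0"
  and net: "!!u. ip m u u = 1 ==> EX v:T. ip m (%i. u i - v i) (%i. u i - v i) <= 1 / 16"
  and T: "!!v. v : T ==> \<bar>bil m A v v\<bar> <= D * ip m v v"
 shows "\<bar>bil m A u u\<bar> <= 4 * D * ip m u u"
proof -
 obtain r U lam where A: "spectral_decomp m A r U lam" using spectral_theorem[OF sym] by blast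
 note on = spectral_orthonormal[OF A]
 define S where "S = Max (insert 0 ((%a. \<bar>lam a\<bar>) ` {..<r}))"
 have S0: "S >= 0" unfolding S_def by (intro Max_ge) auto
 have Sb: "\<bar>lam a\<bar> <= S" if "a < r" for a unfolding S_def using that by (intro Max_ge) auto
 have bound: "\<bar>bil m A x y\<bar> <= S * (L2_set x {..<m} * L2_set y {..<m})" for x y
 proof -
  have "\<bar>bil m A x y\<bar> <= (SUM a<r. \<bar>lam a * ip m (U a) x * ip m (U a) y\<bar>)" unfolding spectral_bil[OF A] by (rule sum_abs)
  also have "... <= (SUM a<r. S * (\<bar>ip m (U a) x\<bar> * \<bar>ip m (U a) y\<bar>))"
  proof (rule sum_mono)
   fix a assume "a : {..<r}"
   hence "\<bar>lam a\<bar> * (\<bar>ip m (U a) x\<bar> * \<bar>ip m (U a) y\<bar>) <= S * (\<bar>ip m (U a) x\<bar> * \<bar>ip m (U a) y\<bar>)"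
    using Sb by (intro mult_right_mono) auto
   thus "\<bar>lam a * ip m (U a) x * ip m (U a) y\<bar> <= S * (\<bar>ip m (U a) x\<bar> * \<bar>ip m (U a) y\<bar>)" by (simp add: abs_mult mult.assoc)
  qed
  also have "... = S * (SUM a<r. \<bar>ip m (U a) x\<bar> * \<bar>ip m (U a) y\<bar>)" by (simp add: sum_distrib_left)
  also have "... <= S * (L2_set x {..<m} * L2_set y {..<m})"
  proof (rule mult_left_mono[OF _ S0])
   have "(SUM a<r. \<bar>ip m (U a) x\<bar> * \<bar>ip m (U a) y\<bar>)
     <= L2_set (%a. ip m (U a) x) {..<r} * L2_set (%a. ip m (U a) y) {..<r}"
    using L2_set_mult_ineq[of "%a. ip m (U a) x" "%a. ip m (U a) y" "{..<r}"] by simp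
   also have "... <= L2_set x {..<m} * L2_set y {..<m}" unfolding L2_eq_sqrt_ip using Bessel[OF on]
    by (intro mult_mono) (auto simp: ip_def sq_eq sum_nonneg)
   finally show "(SUM a<r. \<bar>ip m (U a) x\<bar> * \<bar>ip m (U a) y\<bar>) <= L2_set x {..<m} * L2_set y {..<m}" .
  qed
  finally show ?thesis .
 qed
 have "S <= 4 * D"
 proof (cases "S = 0")
  case False
  have "S : insert 0 ((%a. \<bar>lam a\<bar>) ` {..<r})" unfolding S_def by (intro Max_in) auto
  then obtain a where a: "a < r" "S = \<bar>lam a\<bar>" using False by auto
  let ?u = "U a"
  have u1: "ip m ?u ?u = 1" using ip_orthonormal[OF on a(1) a(1)] by simp
  obtain v where v: "v : T" "ip m (%i. ?u i - v i) (%i. ?u i - v i) <= 1 / 16" using net[OF u1] by blast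
  let ?w = "%i. ?u i - v i"
  have Lw: "L2_set ?w {..<m} <= 1 / 4"
  proof -
   have "sqrt (ip m ?w ?w) <= sqrt (1 / 16)" using v(2) by simp
   also have "sqrt (1 / 16) = (1 / 4 :: real)" by (rule real_sqrt_unique) (simp_all add: sq_eq)
   finally show ?thesis by (simp add: L2_eq_sqrt_ip)
  qed
  have Lu: "L2_set ?u {..<m} = 1" using u1 by (simp add: L2_eq_sqrt_ip)
  have Lv: "L2_set v {..<m} <= 5 / 4"
  proof -
   have "L2_set v {..<m} <= L2_set ?u {..<m} + L2_set (%i. v i - ?u i) {..<m}" using L2_set_triangle_ineq[of ?u "%i. v i - ?u i" "{..<m}"] by simp
   also have "L2_set (%i. v i - ?u i) {..<m} = L2_set ?w {..<m}" by (simp add: L2_set_def power2_commute)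
   finally show ?thesis using Lw Lu by simp
  qed
  have "ip m v v <= 25 / 16"
  proof -
   have "(L2_set v {..<m})\<^sup>2 <= (5 / 4)\<^sup>2" using Lv by (intro power_mono) auto
   thus ?thesis by (simp add: ip_eq_L2 sq_eq)
  qed
  hence Dv: "D * ip m v v <= D * (25 / 16)" using D by (intro mult_left_mono)
  have "lam a = bil m A ?u ?u" using spectral_eigenvalue[OF A a(1)] by simp
  also have "... = bil m A v v + bil m A ?w ?u + bil m A v ?w" by (simp add: bil_diff_left bil_diff_right)
  finally have "\<bar>lam a\<bar> <= \<bar>bil m A v v\<bar> + \<bar>bil m A ?w ?u\<bar> + \<bar>bil m A v ?w\<bar>" by linarith
  also have "... <= D * (25 / 16) + S * (1 / 4 * 1) + S * (5 / 4 * (1 / 4))"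
  proof (intro add_mono)
   show "\<bar>bil m A v v\<bar> <= D * (25 / 16)" using T[OF v(1)] Dv by linarith
   have "L2_set ?w {..<m} * L2_set ?u {..<m} <= 1 / 4 * 1" using Lw Lu by (intro mult_mono) auto
   thus "\<bar>bil m A ?w ?u\<bar> <= S * (1 / 4 * 1)" using bound[of ?w ?u] mult_left_mono[OF _ S0] by (meson order_trans)
   have "L2_set v {..<m} * L2_set ?w {..<m} <= 5 / 4 * (1 / 4)" using Lw Lv by (intro mult_mono) auto
   thus "\<bar>bil m A v ?w\<bar> <= S * (5 / 4 * (1 / 4))" using bound[of v ?w] mult_left_mono[OF _ S0] by (meson order_trans)
  qed
  finally have "S <= D * (25 / 16) + S * (9 / 16)" using a by simp
  thus ?thesis using D by linarith
 qed (use D in simp)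
 have "\<bar>bil m A u u\<bar> <= S * ip m u u" using bound[of u u] by (simp add: ip_eq_L2 sq_eq)
 also have "... <= 4 * D * ip m u u" using \<open>S <= 4 * D\<close> by (intro mult_right_mono) (auto simp: ip_nonneg)
 finally show ?thesis .
qed

section \<open>The probabilistic event behind the test\<close>

text \<open>Only the exceptional set is asked to be measurable: the uniform properties below
  quantify over all vectors and all index sets, so their own measurability is left out of
  consideration.\<close>

definition fails :: "'a measure => real => ('a => bool) => bool" where
 "fails M e P \<longleftrightarrow> (EX B:sets M. measure M B <= e & (ALL g:space M - B. P g))"

lemma fails_mono:
 "fails M e P ==> e <= e' ==> (!!g. g : space M ==> P g ==> Q g) ==> fails M e' Q"
 unfolding fails_def by (meson DiffD1 order_trans)

lemma fails_conj:
 assumes "fails M e P" "fails M e' Q"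
 shows "fails M (e + e') (%g. P g & Q g)"
proof -
 obtain B B' where B: "B : sets M" "measure M B <= e" "!!g. g : space M - B ==> P g"
  and B': "B' : sets M" "measure M B' <= e'" "!!g. g : space M - B' ==> Q g" using assms unfolding fails_def by metis
 have "measure M (B \<union> B') <= e + e'" using measure_Un_le[OF B(1) B'(1)] B(2) B'(2) by linarith
 thus ?thesis unfolding fails_def using B B' by (intro bexI[of _ "B \<union> B'"]) auto
qed

lemma fails_ball:
 assumes "finite S" "!!s. s : S ==> fails M e (P s)"
 shows "fails M (real (card S) * e) (%g. ALL s:S. P s g)" using assms
proof (induction S rule: finite_induct)
 case empty
 thus ?case unfolding fails_def by (intro bexI[of _ "{}"]) auto
next
 case (insert s S)
 have "fails M (e + real (card S) * e) (%g. P s g & (ALL s:S. P s g))" using insert by (intro fails_conj) auto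
 thus ?case using insert by (simp add: algebra_simps)
qed

lemma fails_trivial: "0 <= e ==> (!!g. g : space M ==> P g) ==> fails M e P"
 unfolding fails_def by (intro bexI[of _ "{}"]) auto

lemma fails_complement:
 assumes "B : sets M" "measure M B <= e" "!!g. g : space M ==> g \<notin> B ==> P g"
 shows "fails M e P" using assms unfolding fails_def by blast

lemma fails_event:
 assumes "prob_space M" "fails M e P"
 shows "EX G:sets M. measure M G >= 1 - e & (ALL g:G. P g)"
proof -
 interpret prob_space M by fact
 obtain B where B: "B : sets M" "measure M B <= e" "ALL g:space M - B. P g" using assms(2) unfolding fails_def by blast
 thus ?thesis using prob_compl[OF B(1)] by (intro bexI[of _ "space M - B"]) auto
qed

text \<open>Extends the tail bound to \<open>v = 0\<close>, where all forms vanish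
  identically.\<close>

lemma chi_square_fails:
 assumes I: "finite I" and L: "finite L" "card L = k" and K: "!!l. l : L ==> K l <= I" "disjoint_family_on K L"
  and a: "!!l. l : L ==> (SUM p:K l. (a p)\<^sup>2) = v" and v: "v >= 0" and x: "x > 0"
 shows "fails (flat I) (2 * exp (- x)) (%g.
   \<bar>(SUM l:L. (SUM p:K l. a p * g p)\<^sup>2) - real k * v\<bar> <= 5 * (sqrt (real k * x) + x) * v)"
proof (cases "v > 0")
 case True
 let ?B = "{g : space (flat I).
   5 * (sqrt (real k * x) + x) * v <= \<bar>(SUM l:L. (SUM p:K l. a p * g p)\<^sup>2) - real k * v\<bar>}"
 have "(%g. \<bar>(SUM l:L. (SUM p:K l. a p * g p)\<^sup>2) - real k * v\<bar>) : borel_measurable (flat I)"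
  by (intro borel_measurable_abs borel_measurable_diff borel_measurable_const borel_measurable_sum
    borel_measurable_power linear_measurable_flat K)
 hence "?B : sets (flat I)" by measurable
 moreover have "measure (flat I) ?B <= 2 * exp (- x)" using I L K a True x by (intro chi_square_tail) auto
 ultimately show ?thesis by (rule fails_complement) auto
next
 case False
 hence v0: "v = 0" using v by simp
 show ?thesis
 proof (rule fails_trivial)
  fix g
  have "a p = 0" if "l : L" "p : K l" for l p using a[OF that(1)] v0 that finite_subset[OF K(1)[OF that(1)] I] by (simp add: sum_nonneg_eq_0_iff)
  thus "\<bar>(SUM l:L. (SUM p:K l. a p * g p)\<^sup>2) - real k * v\<bar> <= 5 * (sqrt (real k * x) + x) * v" using v0 by simp
 qed simp
qed

lemma column_fails:
 assumes "y > 0"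
 shows "fails (flat (grid n d)) (2 * exp (- y)) (%g.
  \<bar>(SUM j<d. (SUM i<n. x i * g (i, j))\<^sup>2) - real d * ip n x x\<bar> <= 5 * (sqrt (real d * y) + y) * ip n x x)"
proof -
 define K where "K = (%j :: nat. (%i. (i, j)) ` {..<n})"
 have re: "(SUM p:K j. f p) = (SUM i<n. f (i, j))" for j and f :: "nat \<times> nat => real"
  unfolding K_def by (subst sum.reindex) (auto simp: inj_on_def)
 have "fails (flat (grid n d)) (2 * exp (- y)) (%g.
   \<bar>(SUM j<d. (SUM p:K j. x (fst p) * g p)\<^sup>2) - real d * ip n x x\<bar> <= 5 * (sqrt (real d * y) + y) * ip n x x)" using assms
  by (intro chi_square_fails[where a = "%p. x (fst p)"])
   (auto simp: grid_def K_def disjoint_family_on_def re[unfolded K_def] ip_def sq_eq sum_nonneg)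
 thus ?thesis unfolding re by simp
qed

lemma row_fails:
 assumes "y > 0"
 shows "fails (flat (grid n d)) (2 * exp (- y)) (%g.
  \<bar>(SUM i<n. (SUM j<d. u j * g (i, j))\<^sup>2) - real n * ip d u u\<bar> <= 5 * (sqrt (real n * y) + y) * ip d u u)"
proof -
 define K where "K = (%i :: nat. (%j. (i, j)) ` {..<d})"
 have re: "(SUM p:K j. f p) = (SUM i<d. f (j, i))" for j and f :: "nat \<times> nat => real"
  unfolding K_def by (subst sum.reindex) (auto simp: inj_on_def)
 have "fails (flat (grid n d)) (2 * exp (- y)) (%g.
   \<bar>(SUM i<n. (SUM p:K i. u (snd p) * g p)\<^sup>2) - real n * ip d u u\<bar> <= 5 * (sqrt (real n * y) + y) * ip d u u)" using assms
  by (intro chi_square_fails[where a = "%p. u (snd p)"])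
   (auto simp: grid_def K_def disjoint_family_on_def re[unfolded K_def] ip_def sq_eq sum_nonneg)
 thus ?thesis unfolding re by simp
qed

lemma linear_fails:
 assumes "y > 0"
 shows "fails (flat (grid n d)) (2 * exp (- y)) (%g.
  \<bar>(SUM i<n. SUM j<d. x i * u j * g (i, j))\<^sup>2 - ip n x x * ip d u u\<bar> <= 5 * (sqrt y + y) * (ip n x x * ip d u u))"
proof -
 have "fails (flat (grid n d)) (2 * exp (- y)) (%g.
   \<bar>(SUM l:{0::nat}. (SUM p:(%_. grid n d) l. (x (fst p) * u (snd p)) * g p)\<^sup>2) - real 1 * (ip n x x * ip d u u)\<bar>
    <= 5 * (sqrt (real 1 * y) + y) * (ip n x x * ip d u u))"
 proof (rule chi_square_fails)
  have "(SUM p:grid n d. (x (fst p) * u (snd p))\<^sup>2) = (SUM i<n. SUM j<d. (x i * u j)\<^sup>2)"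
   unfolding grid_def by (simp add: sum.cartesian_product case_prod_beta')
  also have "... = ip n x x * ip d u u" unfolding ip_def sum_product by (intro sum.cong refl) (simp add: sq_eq)
  finally show "(SUM p:grid n d. (x (fst p) * u (snd p))\<^sup>2) = ip n x x * ip d u u" .
 qed (use assms in \<open>auto simp: disjoint_family_on_def ip_nonneg\<close>)
 thus ?thesis unfolding grid_def by (simp add: sum.cartesian_product case_prod_beta')
qed

text \<open>A square is at most \<open>t\<close> plus its excess over \<open>t\<close>, so the sum
  over \<open>R\<close> is at most \<open>card R * t\<close> plus the total excess over all rows.
  The latter is a single random variable that does not depend on \<open>R\<close>, which makes the
  bound uniform over subsets without a union bound.\<close>

lemma truncated_row_fails:
 assumes "ip d u u > 0"
 shows "fails (flat (grid n d)) (exp (- y)) (%g. ALL R<={..<n}.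
  (SUM i:R. (SUM j<d. u j * g (i, j))\<^sup>2) <= (real (card R) * t + 8 * real n * exp (- t / 4) + 4 * y) * ip d u u)"
proof -
 define K where "K = (%i :: nat. (%j. (i, j)) ` {..<d})"
 define v where "v = ip d u u"
 have v: "v > 0" using assms by (simp add: v_def)
 have re: "(SUM p:K j. f p) = (SUM i<d. f (j, i))" for j and f :: "nat \<times> nat => real"
  unfolding K_def by (subst sum.reindex) (auto simp: inj_on_def)
 define a where "a = (%p :: nat \<times> nat. u (snd p) / sqrt v)"
 let ?h = "%g i. max 0 ((SUM p:K i. a p * g p)\<^sup>2 - t) / 4"
 let ?B = "{g : space (flat (grid n d)). 2 * real (card {..<n}) * exp (- t / 4) + y <= (SUM i<n. ?h g i)}"
 have Ksub: "K i <= grid n d" if "i : {..<n}" for i using that by (auto simp: K_def grid_def)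
 have "(%g. SUM i<n. ?h g i) : borel_measurable (flat (grid n d))"
  by (intro borel_measurable_sum borel_measurable_divide borel_measurable_max borel_measurable_const
    borel_measurable_diff borel_measurable_power linear_measurable_flat Ksub)
 hence "?B : sets (flat (grid n d))" by measurable
 moreover have "measure (flat (grid n d)) ?B <= exp (- y)"
 proof (rule truncated_tail)
  fix i
  have "(SUM p:K i. (a p)\<^sup>2) = ip d u u / v" unfolding re a_def using v by (simp add: ip_def sq_eq sum_divide_distrib)
  thus "(SUM p:K i. (a p)\<^sup>2) = 1" using v by (simp add: v_def)
 qed (use Ksub in \<open>auto simp: disjoint_family_on_def K_def\<close>)
 ultimately show ?thesis
 proof (rule fails_complement)
  fix g assume "g : space (flat (grid n d))" "g \<notin> ?B"
  hence small: "(SUM i<n. ?h g i) <= 2 * real n * exp (- t / 4) + y" by auto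
  show "ALL R<={..<n}. (SUM i:R. (SUM j<d. u j * g (i, j))\<^sup>2)
    <= (real (card R) * t + 8 * real n * exp (- t / 4) + 4 * y) * ip d u u"
  proof (intro allI impI)
   fix R assume R: "R <= {..<n}"
   let ?\<eta> = "%i. SUM p:K i. a p * g p"
   have eta: "(SUM j<d. u j * g (i, j))\<^sup>2 = v * (?\<eta> i)\<^sup>2" for i
   proof -
    have "?\<eta> i = (SUM j<d. u j * g (i, j)) / sqrt v" unfolding re a_def by (simp add: sum_divide_distrib)
    thus ?thesis using v by (simp add: power_divide)
   qed
   have "(SUM i:R. (?\<eta> i)\<^sup>2) <= (SUM i:R. t + 4 * ?h g i)" by (intro sum_mono) auto
   also have "... = real (card R) * t + 4 * (SUM i:R. ?h g i)" by (simp add: sum.distrib sum_distrib_left)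
   also have "(SUM i:R. ?h g i) <= (SUM i<n. ?h g i)" using R by (intro sum_mono2) auto
   finally have "(SUM i:R. (?\<eta> i)\<^sup>2) <= real (card R) * t + 8 * real n * exp (- t / 4) + 4 * y" using small by simp
   hence "v * (SUM i:R. (?\<eta> i)\<^sup>2) <= v * (real (card R) * t + 8 * real n * exp (- t / 4) + 4 * y)" using v by (intro mult_left_mono) auto
   thus "(SUM i:R. (SUM j<d. u j * g (i, j))\<^sup>2)
     <= (real (card R) * t + 8 * real n * exp (- t / 4) + 4 * y) * ip d u u" unfolding eta by (simp add: v_def sum_distrib_left mult.commute)
  qed
 qed
qed

lemma sum_of_squares_bil:
 "(SUM i:R. (SUM j<d. v j * ga i j)\<^sup>2) - c * ip d v v
  = bil d (%a b. (SUM i:R. ga i a * ga i b) - (if a = b then c else 0)) v v"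
proof -
 have 1: "(SUM i:R. (SUM j<d. v j * ga i j)\<^sup>2) = bil d (%a b. SUM i:R. 1 * ga i a * ga i b) v v"
  by (subst bil_outer[where c = "%_. 1" and U = ga and S = R])
   (auto simp: ip_def sq_eq mult.commute)
 have "bil d (%a b. if a = b then c else 0) v v = (SUM a<d. SUM b<d. if b = a then c * v a * v b else 0)" unfolding bil_def by (intro sum.cong) auto
 also have "... = c * ip d v v" by (simp add: ip_def sum_distrib_left mult.assoc)
 finally have 2: "bil d (%a b. if a = b then c else 0) v v = c * ip d v v" .
 have "bil d (%a b. (SUM i:R. ga i a * ga i b) - (if a = b then c else 0)) v v
   = bil d (%a b. SUM i:R. 1 * ga i a * ga i b) v v - bil d (%a b. if a = b then c else 0) v v"
  unfolding bil_def by (simp add: left_diff_distrib sum_subtractf)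
 thus ?thesis using 1 2 by simp
qed

text \<open>The summand \<open>27 * d\<close> in \<open>l\<close> pays for the union bound over the
  net; the constant 20 is 5 times the loss 4 of \<open>net_quadratic_bound\<close>.\<close>

lemma row_uniform_fails:
 assumes "d >= 1" "y > 0"
 defines "l == 27 * real d + y"
 shows "fails (flat (grid n d)) (2 * exp (- y)) (%g. ALL u.
  \<bar>(SUM i<n. (SUM j<d. u j * g (i, j))\<^sup>2) - real n * ip d u u\<bar> <= 20 * (sqrt (real n * l) + l) * ip d u u)"
proof -
 obtain T where T: "finite T" "real (card T) <= exp (27 * real d)"
  and net: "!!u. ip d u u = 1 ==> EX v:T. ip d (%i. u i - v i) (%i. u i - v i) <= 1 / 16"
  using unit_sphere_net[OF assms(1)] by blast
 have l: "l > 0" using assms by (simp add: l_def)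
 have "fails (flat (grid n d)) (real (card T) * (2 * exp (- l))) (%g. ALL u:T.
  \<bar>(SUM i<n. (SUM j<d. u j * g (i, j))\<^sup>2) - real n * ip d u u\<bar> <= 5 * (sqrt (real n * l) + l) * ip d u u)" by (intro fails_ball T row_fails l)
 thus ?thesis
 proof (rule fails_mono)
  have "real (card T) * (2 * exp (- l)) <= exp (27 * real d) * (2 * exp (- l))" using T by (intro mult_right_mono) auto
  also have "... = 2 * exp (- y)" by (simp add: l_def flip: exp_add)
  finally show "real (card T) * (2 * exp (- l)) <= 2 * exp (- y)" .
 next
  fix g :: "nat \<times> nat => real"
  assume T1: "ALL u:T. \<bar>(SUM i<n. (SUM j<d. u j * g (i, j))\<^sup>2) - real n * ip d u u\<bar> <= 5 * (sqrt (real n * l) + l) * ip d u u"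
  show "ALL u. \<bar>(SUM i<n. (SUM j<d. u j * g (i, j))\<^sup>2) - real n * ip d u u\<bar> <= 20 * (sqrt (real n * l) + l) * ip d u u"
  proof
   fix u
   let ?A = "%a b. (SUM i<n. g (i, a) * g (i, b)) - (if a = b then real n else 0)"
   have "\<bar>bil d ?A u u\<bar> <= 4 * (5 * (sqrt (real n * l) + l)) * ip d u u"
   proof (rule net_quadratic_bound)
    show "symm d ?A" by (auto simp: symm_def mult.commute)
    show "\<bar>bil d ?A v v\<bar> <= 5 * (sqrt (real n * l) + l) * ip d v v" if "v : T" for v
     using T1 that unfolding sum_of_squares_bil[of v "%i j. g (i, j)", symmetric] by blast
   qed (use net l in auto)
   thus "\<bar>(SUM i<n. (SUM j<d. u j * g (i, j))\<^sup>2) - real n * ip d u u\<bar> <= 20 * (sqrt (real n * l) + l) * ip d u u"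
    unfolding sum_of_squares_bil[of u "%i j. g (i, j)", symmetric] by simp
  qed
 qed
qed

lemma column_uniform_fails:
 assumes "n >= 1" "y > 0"
 defines "l == 27 * real n + y"
 shows "fails (flat (grid n d)) (2 * exp (- y)) (%g. ALL x.
  \<bar>(SUM j<d. (SUM i<n. x i * g (i, j))\<^sup>2) - real d * ip n x x\<bar> <= 20 * (sqrt (real d * l) + l) * ip n x x)"
proof -
 obtain T where T: "finite T" "real (card T) <= exp (27 * real n)"
  and net: "!!u. ip n u u = 1 ==> EX v:T. ip n (%i. u i - v i) (%i. u i - v i) <= 1 / 16"
  using unit_sphere_net[OF assms(1)] by blast
 have l: "l > 0" using assms by (simp add: l_def)
 have "fails (flat (grid n d)) (real (card T) * (2 * exp (- l))) (%g. ALL x:T.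
  \<bar>(SUM j<d. (SUM i<n. x i * g (i, j))\<^sup>2) - real d * ip n x x\<bar> <= 5 * (sqrt (real d * l) + l) * ip n x x)" by (intro fails_ball T column_fails l)
 thus ?thesis
 proof (rule fails_mono)
  have "real (card T) * (2 * exp (- l)) <= exp (27 * real n) * (2 * exp (- l))" using T by (intro mult_right_mono) auto
  also have "... = 2 * exp (- y)" by (simp add: l_def flip: exp_add)
  finally show "real (card T) * (2 * exp (- l)) <= 2 * exp (- y)" .
 next
  fix g :: "nat \<times> nat => real"
  assume T1: "ALL x:T. \<bar>(SUM j<d. (SUM i<n. x i * g (i, j))\<^sup>2) - real d * ip n x x\<bar> <= 5 * (sqrt (real d * l) + l) * ip n x x"
  show "ALL x. \<bar>(SUM j<d. (SUM i<n. x i * g (i, j))\<^sup>2) - real d * ip n x x\<bar> <= 20 * (sqrt (real d * l) + l) * ip n x x"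
  proof
   fix u
   let ?A = "%a b. (SUM j<d. g (a, j) * g (b, j)) - (if a = b then real d else 0)"
   have "\<bar>bil n ?A u u\<bar> <= 4 * (5 * (sqrt (real d * l) + l)) * ip n u u"
   proof (rule net_quadratic_bound)
    show "symm n ?A" by (auto simp: symm_def mult.commute)
    show "\<bar>bil n ?A v v\<bar> <= 5 * (sqrt (real d * l) + l) * ip n v v" if "v : T" for v
     using T1 that unfolding sum_of_squares_bil[of v "%j i. g (i, j)", symmetric] by blast
   qed (use net l in auto)
   thus "\<bar>(SUM j<d. (SUM i<n. u i * g (i, j))\<^sup>2) - real d * ip n u u\<bar> <= 20 * (sqrt (real d * l) + l) * ip n u u"
    unfolding sum_of_squares_bil[of u "%j i. g (i, j)", symmetric] by simp
  qed
 qed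
qed

lemma truncated_uniform_fails:
 assumes "d >= 1" "y > 0" "t >= 0"
 defines "l == 27 * real d + y"
 shows "fails (flat (grid n d)) (exp (- y)) (%g. ALL R<={..<n}. ALL u. (SUM i:R. (SUM j<d. u j * g (i, j))\<^sup>2)
  <= 4 * (real (card R) * t + 8 * real n * exp (- t / 4) + 4 * l) * ip d u u)"
proof -
 obtain T0 where T0: "finite T0" "real (card T0) <= exp (27 * real d)"
  and net0: "!!u. ip d u u = 1 ==> EX v:T0. ip d (%i. u i - v i) (%i. u i - v i) <= 1 / 16"
  using unit_sphere_net[OF assms(1)] by blast
 \<comment> \<open>\<open>truncated_row_fails\<close> divides by the norm. Vectors that vanish on
   all \<open>d\<close> coordinates can be discarded, being at distance 1 from the sphere.\<close>
 define T where "T = {v : T0. ip d v v > 0}"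
 have T: "finite T" "real (card T) <= exp (27 * real d)"
 proof -
  show "finite T" using T0 by (simp add: T_def)
  have "card T <= card T0" using T0 by (intro card_mono) (auto simp: T_def)
  thus "real (card T) <= exp (27 * real d)" using T0(2) by linarith
 qed
 have net: "EX v:T. ip d (%i. u i - v i) (%i. u i - v i) <= 1 / 16" if u: "ip d u u = 1" for u
 proof -
  obtain v where v: "v : T0" "ip d (%i. u i - v i) (%i. u i - v i) <= 1 / 16" using net0[OF u] by blast
  have "ip d v v > 0"
  proof (rule ccontr)
   assume "~ ip d v v > 0"
   hence "ip d v v = 0" using ip_nonneg[of d v] by linarith
   hence "!!i. i < d ==> v i = 0" by (simp add: ip_def sum_nonneg_eq_0_iff)
   hence "ip d (%i. u i - v i) (%i. u i - v i) = ip d u u" by (simp add: ip_def)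
   thus False using v u by simp
  qed
  thus ?thesis using v by (auto simp: T_def)
 qed
 have l: "l > 0" using assms by (simp add: l_def)
 have "fails (flat (grid n d)) (real (card T) * exp (- l)) (%g. ALL u:T. ALL R<={..<n}.
  (SUM i:R. (SUM j<d. u j * g (i, j))\<^sup>2) <= (real (card R) * t + 8 * real n * exp (- t / 4) + 4 * l) * ip d u u)"
  by (intro fails_ball T truncated_row_fails) (simp add: T_def)
 thus ?thesis
 proof (rule fails_mono)
  have "real (card T) * exp (- l) <= exp (27 * real d) * exp (- l)" using T by (intro mult_right_mono) auto
  also have "... = exp (- y)" by (simp add: l_def flip: exp_add)
  finally show "real (card T) * exp (- l) <= exp (- y)" .
 next
  fix g :: "nat \<times> nat => real"
  assume T1: "ALL u:T. ALL R<={..<n}. (SUM i:R. (SUM j<d. u j * g (i, j))\<^sup>2)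
    <= (real (card R) * t + 8 * real n * exp (- t / 4) + 4 * l) * ip d u u"
  show "ALL R<={..<n}. ALL u. (SUM i:R. (SUM j<d. u j * g (i, j))\<^sup>2)
    <= 4 * (real (card R) * t + 8 * real n * exp (- t / 4) + 4 * l) * ip d u u"
  proof (intro allI impI)
   fix R u assume R: "R <= {..<n}"
   let ?D = "real (card R) * t + 8 * real n * exp (- t / 4) + 4 * l"
   let ?A = "%a b. (SUM i:R. g (i, a) * g (i, b)) - (if a = b then 0 else 0)"
   have sq: "bil d ?A v v = (SUM i:R. (SUM j<d. v j * g (i, j))\<^sup>2)" for v
    unfolding sum_of_squares_bil[of v "%i j. g (i, j)" d R 0, symmetric] by simp
   have "\<bar>bil d ?A u u\<bar> <= 4 * ?D * ip d u u"
   proof (rule net_quadratic_bound)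
    show "symm d ?A" by (auto simp: symm_def mult.commute)
    show "\<bar>bil d ?A v v\<bar> <= ?D * ip d v v" if "v : T" for v using T1 that R unfolding sq by (simp add: sum_nonneg)
    show "0 <= ?D" using assms l by simp
   qed (use net in auto)
   thus "(SUM i:R. (SUM j<d. u j * g (i, j))\<^sup>2) <= 4 * ?D * ip d u u" unfolding sq by simp
  qed
 qed
qed

text \<open>Deviation scale, up to the constant 5, of a chi-square variable with \<open>a\<close>
  degrees of freedom at failure probability \<open>2 * exp (- y)\<close>.\<close>

definition dev :: "real => real => real" where
 "dev a y = sqrt (a * y) + y"

text \<open>All that is used later about the noise \<open>ga\<close>. What is added to
  \<open>y\<close> pays for union bounds: \<open>2 * ln n\<close> for pairs of samples,
  \<open>27 * d\<close> and \<open>27 * n\<close> for nets in the two spaces, \<open>ln ka\<close>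
  for the \<open>ka\<close> truncation levels \<open>t k\<close>.\<close>

definition good :: "nat => nat => (nat => real) => real => nat => (nat => real) => (nat => nat => real) => bool" where
 "good n d mm y ka t ga \<longleftrightarrow>
  \<bar>ip d (%j. SUM i<n. ga i j) (%j. SUM i<n. ga i j) - real n * real d\<bar> <= 5 * real n * dev (real d) y &
  (ip d mm (%j. SUM i<n. ga i j))\<^sup>2 <= real n * ip d mm mm * (1 + 5 * dev 1 y) &
  (ALL i<n. ALL j<n. \<bar>ip d (ga i) (ga j) - (if i = j then real d else 0)\<bar> <= 5 * dev (real d) (y + 2 * ln (real n))) &
  (ALL i<n. \<bar>ip d (%j. SUM k<n. ga k j) (ga i) - real d\<bar> <= 5 * sqrt (real n) * dev (real d) (y + 2 * ln (real n))) &
  (ALL i<n. (ip d mm (ga i))\<^sup>2 <= ip d mm mm * (1 + 5 * dev 1 (y + 2 * ln (real n)))) &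
  (ALL u. \<bar>(SUM i<n. (ip d u (ga i))\<^sup>2) - real n * ip d u u\<bar> <= 20 * dev (real n) (27 * real d + y) * ip d u u) &
  (ALL k<ka. ALL R<={..<n}. ALL u. (SUM i:R. (ip d u (ga i))\<^sup>2)
   <= 4 * (real (card R) * t k + 8 * real n * exp (- t k / 4) + 4 * (27 * real d + (y + ln (real ka)))) * ip d u u) &
  (ALL x. \<bar>ip d (%j. SUM i<n. x i * ga i j) (%j. SUM i<n. x i * ga i j) - real d * ip n x x\<bar>
   <= 20 * dev (real d) (27 * real n + y) * ip n x x)"

lemma ip_square: "ip d (%j. f j) (%j. f j) = (SUM j<d. (f j)\<^sup>2)" by (simp add: ip_def sq_eq)

text \<open>Polarisation: four times the inner product is the difference of the squared norms
  belonging to \<open>x + z\<close> and \<open>x - z\<close>, and \<open>column_fails\<close>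
  controls both.\<close>

lemma pair_fails:
 assumes "y > 0"
 shows "fails (flat (grid n d)) (4 * exp (- y)) (%g.
  \<bar>ip d (%j. SUM i<n. x i * g (i, j)) (%j. SUM i<n. z i * g (i, j)) - real d * ip n x z\<bar>
   <= 5 / 2 * dev (real d) y * (ip n x x + ip n z z))"
proof -
 let ?c = "%w g. (SUM j<d. (SUM i<n. w i * g (i, j))\<^sup>2)"
 let ?p = "%i. x i + z i" and ?m = "%i. x i - z i"
 have "fails (flat (grid n d)) (2 * exp (- y) + 2 * exp (- y)) (%g.
   \<bar>?c ?p g - real d * ip n ?p ?p\<bar> <= 5 * (sqrt (real d * y) + y) * ip n ?p ?p &
   \<bar>?c ?m g - real d * ip n ?m ?m\<bar> <= 5 * (sqrt (real d * y) + y) * ip n ?m ?m)" by (intro fails_conj column_fails assms)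
 thus ?thesis
 proof (rule fails_mono)
  fix g :: "nat \<times> nat => real"
  let ?X = "%j. SUM i<n. x i * g (i, j)" and ?Z = "%j. SUM i<n. z i * g (i, j)"
  assume a: "\<bar>?c ?p g - real d * ip n ?p ?p\<bar> <= 5 * (sqrt (real d * y) + y) * ip n ?p ?p &
   \<bar>?c ?m g - real d * ip n ?m ?m\<bar> <= 5 * (sqrt (real d * y) + y) * ip n ?m ?m"
  have cp: "?c ?p g = ip d ?X ?X + 2 * ip d ?X ?Z + ip d ?Z ?Z"
  proof -
   have "?c ?p g = ip d (%j. ?X j + ?Z j) (%j. ?X j + ?Z j)" unfolding ip_square by (simp add: distrib_right sum.distrib)
   thus ?thesis unfolding ip_add_left ip_add_right using ip_commute[of d ?X ?Z] by simp
  qed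
  have cm: "?c ?m g = ip d ?X ?X - 2 * ip d ?X ?Z + ip d ?Z ?Z"
  proof -
   have "?c ?m g = ip d (%j. ?X j - ?Z j) (%j. ?X j - ?Z j)" unfolding ip_square by (simp add: left_diff_distrib sum_subtractf)
   thus ?thesis unfolding ip_diff_left ip_diff_right using ip_commute[of d ?X ?Z] by simp
  qed
  have ipp: "ip n ?p ?p = ip n x x + 2 * ip n x z + ip n z z" unfolding ip_add_left ip_add_right using ip_commute[of n x z] by simp
  have ipm: "ip n ?m ?m = ip n x x - 2 * ip n x z + ip n z z" unfolding ip_diff_left ip_diff_right using ip_commute[of n x z] by simp
  define D where "D = sqrt (real d * y) + y"
  have "\<bar>4 * (ip d ?X ?Z - real d * ip n x z)\<bar>
    = \<bar>(?c ?p g - real d * ip n ?p ?p) - (?c ?m g - real d * ip n ?m ?m)\<bar>" unfolding cp cm ipp ipm by (simp add: algebra_simps)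
  also have "... <= \<bar>?c ?p g - real d * ip n ?p ?p\<bar> + \<bar>?c ?m g - real d * ip n ?m ?m\<bar>" by (rule abs_triangle_ineq4)
  also have "... <= 5 * D * ip n ?p ?p + 5 * D * ip n ?m ?m" using a unfolding D_def by linarith
  also have "... = 10 * (D * (ip n x x + ip n z z))" unfolding ipp ipm by (simp add: algebra_simps)
  finally have "4 * \<bar>ip d ?X ?Z - real d * ip n x z\<bar> <= 10 * (D * (ip n x x + ip n z z))" by (simp only: abs_mult abs_numeral)
  moreover have "4 * a <= 10 * b ==> a <= 5 / 2 * b" for a b :: real by linarith
  ultimately show "\<bar>ip d ?X ?Z - real d * ip n x z\<bar> <= 5 / 2 * dev (real d) y * (ip n x x + ip n z z)" unfolding dev_def D_def[symmetric] mult.assoc by blast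
 qed simp
qed

lemma sum_unit_scaled:
 fixes n :: nat
 assumes "i < n"
 shows "(SUM k<n. (if k = i then c else 0) * f k) = (c * f i :: real)"
proof -
 have "(SUM k<n. (if k = i then c else 0) * f k) = (SUM k<n. if k = i then c * f k else 0)" by (intro sum.cong) auto
 thus ?thesis using assms by simp
qed

lemma sum_unit: "i < (n::nat) ==> (SUM k<n. (if k = i then 1 else 0) * f k) = (f i :: real)" using sum_unit_scaled[of i n 1 f] by simp

lemma good_fails:
 assumes n: "n >= 1" and d: "d >= 1" and y: "y > 0" and ka: "ka >= 1" and t: "!!k. t k >= 0"
 shows "fails (flat (grid n d)) (20 * exp (- y)) (%g. good n d mm y ka t (%i j. g (i, j)))"
proof -
 let ?F = "fails (flat (grid n d))"
 define l where "l = y + 2 * ln (real n)"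
 have l: "l > 0" using n y by (simp add: l_def add_pos_nonneg)
 have nl: "(real n)\<^sup>2 * exp (- l) = exp (- y)"
 proof -
  have "exp (2 * ln (real n)) = (real n)\<^sup>2" using n by (simp add: exp_double sq_eq)
  moreover have "exp (- l) = exp (- y) * inverse (exp (2 * ln (real n)))" unfolding exp_minus[symmetric] exp_add[symmetric] by (simp add: l_def)
  ultimately show ?thesis using n by simp
 qed
 have n1: "real n * exp (- l) <= exp (- y)"
 proof -
  have "real n * exp (- l) <= (real n)\<^sup>2 * exp (- l)" using n by (intro mult_right_mono) (auto simp: sq_eq)
  thus ?thesis using nl by simp
 qed
 have A: "?F (2 * exp (- y)) (%g. \<bar>ip d (%j. SUM i<n. g (i, j)) (%j. SUM i<n. g (i, j)) - real n * real d\<bar>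
   <= 5 * real n * dev (real d) y)" using column_fails[OF y, of n d "%_. 1"] by (simp add: ip_square dev_def ip_def mult_ac)
 have B: "?F (2 * exp (- y)) (%g. (ip d mm (%j. SUM i<n. g (i, j)))\<^sup>2 <= real n * ip d mm mm * (1 + 5 * dev 1 y))"
 proof (rule fails_mono[OF linear_fails[OF y, of n d "%_. 1" mm]])
  fix g :: "nat \<times> nat => real"
  have e: "(SUM i<n. SUM j<d. 1 * mm j * g (i, j)) = ip d mm (%j. SUM i<n. g (i, j))" unfolding ip_def sum_distrib_left by (subst sum.swap) simp
  assume "\<bar>(SUM i<n. SUM j<d. 1 * mm j * g (i, j))\<^sup>2 - ip n (%_. 1) (%_. 1) * ip d mm mm\<bar>
   <= 5 * (sqrt y + y) * (ip n (%_. 1) (%_. 1) * ip d mm mm)"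
  thus "(ip d mm (%j. SUM i<n. g (i, j)))\<^sup>2 <= real n * ip d mm mm * (1 + 5 * dev 1 y)"
   unfolding e by (simp add: dev_def ip_def[of n] algebra_simps abs_le_iff)
 qed simp
 have C: "?F (real (card ({..<n} \<times> {..<n})) * (4 * exp (- l))) (%g. ALL p:{..<n} \<times> {..<n}.
   \<bar>ip d (%j. g (fst p, j)) (%j. g (snd p, j)) - (if fst p = snd p then real d else 0)\<bar> <= 5 * dev (real d) l)"
 proof (rule fails_ball)
  fix p assume "p : {..<n} \<times> {..<n}"
  hence p: "fst p < n" "snd p < n" by auto
  let ?x = "%k. if k = fst p then 1 else (0::real)" and ?z = "%k. if k = snd p then 1 else (0::real)"
  have "ip n ?x ?z = (if fst p = snd p then 1 else 0)" "ip n ?x ?x = 1" "ip n ?z ?z = 1" using p by (simp_all add: ip_unit_left)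
  thus "?F (4 * exp (- l)) (%g. \<bar>ip d (%j. g (fst p, j)) (%j. g (snd p, j))
    - (if fst p = snd p then real d else 0)\<bar> <= 5 * dev (real d) l)" using pair_fails[OF l, of n d ?x ?z] p by (simp add: sum_unit cong: if_cong)
    (auto elim!: fails_mono split: if_splits)
 qed simp
 have C3: "?F (real (card {..<n}) * (4 * exp (- l))) (%g. ALL i:{..<n}.
   \<bar>ip d (%j. SUM k<n. g (k, j)) (%j. g (i, j)) - real d\<bar> <= 5 * sqrt (real n) * dev (real d) l)"
 proof (rule fails_ball)
  fix i assume "i : {..<n}"
  hence i: "i < n" by simp
  \<comment> \<open>The factor \<open>sqrt n\<close> balances the unit vector against the all-ones
    vector, whose squared norm is \<open>n\<close>. Dividing it out afterwards leaves an error of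
    order \<open>sqrt n\<close> instead of \<open>n\<close>.\<close>
  let ?z = "%k. if k = i then sqrt (real n) else 0"
  have ips: "ip n (%_. 1) ?z = sqrt (real n)" "ip n (%_. 1) (%_. 1) = real n" "ip n ?z ?z = real n"
   using i by (simp_all add: ip_def if_distrib[of "%z. z * _"] if_distrib[of "%z. _ * z"] cong: if_cong)
  show "?F (4 * exp (- l)) (%g. \<bar>ip d (%j. SUM k<n. g (k, j)) (%j. g (i, j)) - real d\<bar>
    <= 5 * sqrt (real n) * dev (real d) l)"
  proof (rule fails_mono[OF pair_fails[OF l, of n d "%_. 1" ?z]])
   fix g :: "nat \<times> nat => real"
   assume h: "\<bar>ip d (%j. SUM i<n. 1 * g (i, j)) (%j. SUM i<n. ?z i * g (i, j)) - real d * ip n (%_. 1) ?z\<bar>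
    <= 5 / 2 * dev (real d) l * (ip n (%_. 1) (%_. 1) + ip n ?z ?z)"
   let ?y = "%j. SUM k<n. g (k, j)"
   have "ip d ?y (%j. SUM i<n. ?z i * g (i, j)) = sqrt (real n) * ip d ?y (%j. g (i, j))" using i by (simp only: sum_unit_scaled ip_scale_right)
   hence "\<bar>sqrt (real n) * (ip d ?y (%j. g (i, j)) - real d)\<bar> <= 5 * dev (real d) l * real n" using h unfolding ips by (simp add: algebra_simps)
   also have "... = sqrt (real n) * (5 * sqrt (real n) * dev (real d) l)" by simp
   finally have "sqrt (real n) * \<bar>ip d ?y (%j. g (i, j)) - real d\<bar> <= sqrt (real n) * (5 * sqrt (real n) * dev (real d) l)"
    by (simp only: abs_mult) simp
   thus "\<bar>ip d ?y (%j. g (i, j)) - real d\<bar> <= 5 * sqrt (real n) * dev (real d) l" using n by (simp only: mult_le_cancel_left) simp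
  qed simp
 qed simp
 have C4: "?F (real (card {..<n}) * (2 * exp (- l))) (%g. ALL i:{..<n}.
   (ip d mm (%j. g (i, j)))\<^sup>2 <= ip d mm mm * (1 + 5 * dev 1 l))"
 proof (rule fails_ball)
  fix i assume "i : {..<n}"
  hence i: "i < n" by simp
  let ?x = "%k. if k = i then 1 else (0::real)"
  have x1: "ip n ?x ?x = 1" using i by (simp add: ip_unit_left)
  show "?F (2 * exp (- l)) (%g. (ip d mm (%j. g (i, j)))\<^sup>2 <= ip d mm mm * (1 + 5 * dev 1 l))"
  proof (rule fails_mono[OF linear_fails[OF l, of n d ?x mm]])
   fix g :: "nat \<times> nat => real"
   have e: "(SUM k<n. SUM j<d. ?x k * mm j * g (k, j)) = ip d mm (%j. g (i, j))"
   proof -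
    have "(SUM k<n. SUM j<d. ?x k * mm j * g (k, j)) = (SUM k<n. ?x k * (SUM j<d. mm j * g (k, j)))" by (simp add: sum_distrib_left mult.assoc)
    thus ?thesis using i by (simp only: sum_unit ip_def)
   qed
   assume "\<bar>(SUM k<n. SUM j<d. ?x k * mm j * g (k, j))\<^sup>2 - ip n ?x ?x * ip d mm mm\<bar>
    <= 5 * (sqrt l + l) * (ip n ?x ?x * ip d mm mm)"
   thus "(ip d mm (%j. g (i, j)))\<^sup>2 <= ip d mm mm * (1 + 5 * dev 1 l)" unfolding e x1 by (simp add: dev_def algebra_simps abs_le_iff)
  qed simp
 qed simp
 have D: "?F (2 * exp (- y)) (%g. ALL u. \<bar>(SUM i<n. (ip d u (%j. g (i, j)))\<^sup>2) - real n * ip d u u\<bar>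
   <= 20 * dev (real n) (27 * real d + y) * ip d u u)" using row_uniform_fails[OF d y, of n] by (simp add: ip_def dev_def)
 have E: "?F (real (card {..<ka}) * exp (- (y + ln (real ka)))) (%g. ALL k:{..<ka}. ALL R<={..<n}. ALL u.
   (SUM i:R. (ip d u (%j. g (i, j)))\<^sup>2)
   <= 4 * (real (card R) * t k + 8 * real n * exp (- t k / 4) + 4 * (27 * real d + (y + ln (real ka)))) * ip d u u)"
 proof (rule fails_ball)
  fix k
  have "y + ln (real ka) > 0" using y ka by (simp add: add_pos_nonneg)
  from truncated_uniform_fails[OF d this t[of k], of n]
  show "?F (exp (- (y + ln (real ka)))) (%g. ALL R<={..<n}. ALL u. (SUM i:R. (ip d u (%j. g (i, j)))\<^sup>2)
   <= 4 * (real (card R) * t k + 8 * real n * exp (- t k / 4) + 4 * (27 * real d + (y + ln (real ka)))) * ip d u u)" by (simp add: ip_def)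
 qed simp
 have F: "?F (2 * exp (- y)) (%g. ALL x. \<bar>ip d (%j. SUM i<n. x i * g (i, j)) (%j. SUM i<n. x i * g (i, j)) - real d * ip n x x\<bar>
   <= 20 * dev (real d) (27 * real n + y) * ip n x x)" using column_uniform_fails[OF n y, of d] by (simp add: ip_square dev_def)
 have kae: "real ka * exp (- (y + ln (real ka))) = exp (- y)" using ka by (simp add: exp_diff)
 have all: "?F (2 * exp (- y) + (2 * exp (- y) + (real (card ({..<n} \<times> {..<n})) * (4 * exp (- l)) +
   (real (card {..<n}) * (4 * exp (- l)) + (real (card {..<n}) * (2 * exp (- l)) + (2 * exp (- y) +
   (real (card {..<ka}) * exp (- (y + ln (real ka))) + 2 * exp (- y)))))))) (%g. good n d mm y ka t (%i j. g (i, j)))"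
  by (rule fails_mono[OF fails_conj[OF A fails_conj[OF B fails_conj[OF C fails_conj[OF C3
    fails_conj[OF C4 fails_conj[OF D fails_conj[OF E F]]]]]]] order_refl])
   (auto simp: good_def l_def)
 show ?thesis
 proof (rule fails_mono[OF all])
  have "real (card ({..<n} \<times> {..<n})) * (4 * exp (- l)) = 4 * exp (- y)" using nl by (simp add: sq_eq card_cartesian_product)
  moreover have "real (card {..<n}) * (4 * exp (- l)) <= 4 * exp (- y)" "real (card {..<n}) * (2 * exp (- l)) <= 2 * exp (- y)" using n1 by simp_all
  moreover have "real (card {..<ka}) * exp (- (y + ln (real ka))) = exp (- y)" using kae by simp
  moreover have "0 <= exp (- y)" by simp
  \<comment> \<open>The eight failure probabilities add up to at most
    \<open>19 * exp (- y)\<close>.\<close>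
  ultimately show "2 * exp (- y) + (2 * exp (- y) + (real (card ({..<n} \<times> {..<n})) * (4 * exp (- l)) +
   (real (card {..<n}) * (4 * exp (- l)) + (real (card {..<n}) * (2 * exp (- l)) + (2 * exp (- y) +
   (real (card {..<ka}) * exp (- (y + ln (real ka))) + 2 * exp (- y))))))) <= 20 * exp (- y)" by linarith
 qed
qed

text \<open>The offset 4 absorbs the factor 20 of \<open>good_fails\<close>, because
  \<open>exp 1 >= 5/2\<close> and \<open>(5/2)^4 >= 20\<close>.\<close>

lemma good_samples:
 assumes "n >= 1" "d >= 1" "ka >= 1" "!!k. t k >= 0" "de > 0"
 shows "EX E:sets (samples n d mm). measure (samples n d mm) E >= 1 - de &
  (ALL X:E. EX ga. good n d mm (lg (1 / de) + 4) ka t ga & (ALL i<n. ALL j<d. X i j = mm j + ga i j))"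
proof -
 let ?y = "lg (1 / de) + 4"
 have y: "?y > 0" by (simp add: lg_def add_nonneg_pos)
 have "fails (flat (grid n d)) (20 * exp (- ?y)) (%g. good n d mm ?y ka t (%i j. g (i, j)))" by (intro good_fails assms y)
 from fails_event[OF prob_space_flat this]
 obtain G where G: "G : sets (flat (grid n d))" "measure (flat (grid n d)) G >= 1 - 20 * exp (- ?y)"
  "ALL g:G. good n d mm ?y ka t (%i j. g (i, j))" by (elim bexE conjE)
 have "20 * exp (- ?y) <= de"
 proof -
  have "exp (- lg (1 / de)) <= exp (- ln (1 / de))" by (simp add: lg_def)
  also have "... = de" using assms(5) by (simp add: ln_div)
  finally have 1: "exp (- lg (1 / de)) <= de" .
  have "(5 / 2 :: real) <= exp 1" using exp_lower_Taylor_quadratic[of "1::real"] by simp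
  hence "(5 / 2 :: real) ^ 4 <= exp 1 ^ 4" by (intro power_mono) auto
  also have "exp 1 ^ 4 = exp (4::real)" by (simp flip: exp_of_nat_mult)
  finally have 2: "20 * exp (- 4 :: real) <= 1" by (simp add: exp_minus field_simps)
  have "20 * exp (- ?y) = (20 * exp (- 4)) * exp (- lg (1 / de))" by (simp add: mult.assoc flip: exp_add)
  also have "... <= 1 * de" using 1 2 assms(5) by (intro mult_mono) auto
  finally show ?thesis by simp
 qed
 moreover obtain E where E: "E : sets (samples n d mm)" "measure (samples n d mm) E = measure (flat (grid n d)) G"
  "ALL X:E. noise n d mm X : G" using noise_event[OF G(1), of mm] by (elim bexE conjE)
 moreover have "EX ga. good n d mm ?y ka t ga & (ALL i<n. ALL j<d. X i j = mm j + ga i j)" if "X : E" for X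
 proof (intro exI conjI)
  show "good n d mm ?y ka t (%i j. noise n d mm X (i, j))" using that E(3) G(3) by blast
 qed (simp add: noise_def grid_def)
 ultimately show ?thesis using G(2) by (intro bexI[of _ E]) auto
qed

section \<open>The test statistic and its error terms\<close>

definition vsum :: "(nat => nat => real) => nat set => nat => real" where
 "vsum Y W = (%j. SUM i:W. Y i j)"

text \<open>Subtracting \<open>d\<close> removes the expected squared norm of a sample's own noise;
  over \<open>W\<close> the scores add up to the centred squared norm of the sum.\<close>

definition score :: "nat => (nat => nat => real) => nat set => nat => real" where
 "score d Y W i = ip d (vsum Y W) (Y i) - real d"

text \<open>The first two terms are the sum of all scores over \<open>W\<close>; subtracting the
  flagged ones twice reverses their sign.\<close>

definition statistic :: "nat => real => (nat => nat => real) => nat set => real" where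
 "statistic d ta Y W = ip d (vsum Y W) (vsum Y W) - real d * real (card W)
  - 2 * (SUM i:W. if ta < \<bar>score d Y W i\<bar> then score d Y W i else 0)"

lemma ip_vsum_left: "ip d (vsum Y W) z = (SUM i:W. ip d (Y i) z)" unfolding vsum_def by (rule ip_sum_left)

lemma ip_vsum_right: "ip d z (vsum Y W) = (SUM i:W. ip d z (Y i))" unfolding vsum_def by (rule ip_sum_right)

lemma ip_cong: "(!!j. j < d ==> x j = x' j) ==> (!!j. j < d ==> y j = y' j) ==> ip d x y = ip d x' y'"
 by (simp add: ip_def)

lemma vsum_disjoint:
 "finite S ==> finite T ==> S \<inter> T = {} ==> vsum Y (S \<union> T) j = vsum Y S j + vsum Y T j"
 by (simp add: vsum_def sum.union_disjoint)

text \<open>The corrupted survivors \<open>B\<close> enter \<open>|v|^2\<close> through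
  \<open>2 * <v, b>\<close>, so their scores count double. Reversing flagged scores, instead of
  dropping them, cancels exactly these doubled terms: of \<open>B\<close> only unflagged scores
  remain, each at most \<open>ta\<close> in size. The price is the flagged scores of the good
  survivors \<open>G\<close>. The set \<open>D\<close> collects the clean samples absent from
  \<open>G\<close>.\<close>

lemma statistic_decomposition:
 assumes W: "W <= {..<n}" and S: "!!i j. i : S ==> j < d ==> Y i j = X i j"
 defines "G == W \<inter> S" and "B == W - S" and "Z == vsum X {..<n}"
 defines "D == {..<n} - G"
 shows "statistic d ta Y W = (ip d Z Z - real n * real d) - 2 * (SUM i:D. ip d Z (X i) - real d)
  + (ip d (vsum X D) (vsum X D) - real d * real (card D))
  + 2 * (SUM i:B. if ta < \<bar>score d Y W i\<bar> then 0 else score d Y W i)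
  - 2 * (SUM i:G. if ta < \<bar>score d Y W i\<bar> then score d Y W i else 0)
  - (ip d (vsum Y B) (vsum Y B) - real d * real (card B))"
proof -
 have fin: "finite W" "finite G" "finite B" "finite D" using W finite_subset by (auto simp: G_def B_def D_def)
 have WGB: "W = G \<union> B" "G \<inter> B = {}" by (auto simp: G_def B_def)
 have nGD: "{..<n} = G \<union> D" "G \<inter> D = {}" using W by (auto simp: G_def D_def)
 have cW: "card W = card G + card B" using WGB fin by (simp add: card_Un_disjoint)
 have "card {..<n} = card G + card D" unfolding nGD(1) using nGD(2) fin by (simp add: card_Un_disjoint)
 hence cn: "n = card G + card D" by simp
 let ?v = "vsum Y W" and ?g = "vsum X G" and ?yb = "vsum Y B" and ?xd = "vsum X D"
 have v: "?v j = ?g j + ?yb j" if "j < d" for j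
 proof -
  have "?v j = vsum Y G j + ?yb j" unfolding WGB(1) by (rule vsum_disjoint[OF fin(2,3) WGB(2)])
  also have "vsum Y G j = ?g j" unfolding vsum_def using S that by (intro sum.cong) (auto simp: G_def)
  finally show ?thesis .
 qed
 have z: "Z j = ?g j + ?xd j" for j unfolding Z_def nGD(1) by (rule vsum_disjoint[OF fin(2,4) nGD(2)])
 have vv: "ip d ?v ?v = ip d ?g ?g + 2 * ip d ?v ?yb - ip d ?yb ?yb"
 proof -
  have "ip d ?v ?v = ip d (%j. ?g j + ?yb j) (%j. ?g j + ?yb j)" "ip d ?v ?yb = ip d (%j. ?g j + ?yb j) ?yb" using v by (auto intro!: ip_cong)
  thus ?thesis by (simp add: ip_add_left ip_add_right ip_commute[of d ?yb ?g])
 qed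
 have zz: "ip d ?g ?g = ip d Z Z - 2 * ip d Z ?xd + ip d ?xd ?xd"
 proof -
  have "ip d Z Z = ip d (%j. ?g j + ?xd j) (%j. ?g j + ?xd j)" "ip d Z ?xd = ip d (%j. ?g j + ?xd j) ?xd" using z by (auto intro!: ip_cong)
  thus ?thesis by (simp add: ip_add_left ip_add_right ip_commute[of d ?xd ?g])
 qed
 have vb: "ip d ?v ?yb = (SUM i:B. score d Y W i) + real d * real (card B)" unfolding ip_vsum_right score_def by (simp add: sum_subtractf)
 have zd: "ip d Z ?xd = (SUM i:D. ip d Z (X i) - real d) + real d * real (card D)" unfolding ip_vsum_right by (simp add: sum_subtractf)
 let ?F = "%i. if ta < \<bar>score d Y W i\<bar> then score d Y W i else 0"
 have flag: "(SUM i:W. ?F i) = (SUM i:G. ?F i) + (SUM i:B. ?F i)"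
  unfolding WGB(1)[THEN arg_cong[where f = "sum ?F"]] by (rule sum.union_disjoint[OF fin(2,3) WGB(2)])
 have unfl: "(SUM i:B. score d Y W i) - (SUM i:B. ?F i) = (SUM i:B. if ta < \<bar>score d Y W i\<bar> then 0 else score d Y W i)"
  unfolding sum_subtractf[symmetric] by (intro sum.cong) auto
 have nd: "real n * real d = real d * real (card G) + real d * real (card D)" by (subst cn) (simp add: algebra_simps)
 show ?thesis unfolding statistic_def vv zz vb zd flag unfl[symmetric] cW nd by (simp add: algebra_simps)
qed

lemma statistic_error:
 assumes W: "W <= {..<n}" and S: "!!i j. i : S ==> j < d ==> Y i j = X i j" and ta: "ta >= 0"
 defines "G == W \<inter> S" and "B == W - S" and "Z == vsum X {..<n}"
 defines "D == {..<n} - G"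
 assumes a: "\<bar>SUM i:D. ip d Z (X i) - real d\<bar> <= e"
  and b: "\<bar>ip d (vsum X D) (vsum X D) - real d * real (card D)\<bar> <= e"
  and c: "real (card B) * ta <= e"
  and f: "(SUM i:G. if ta < \<bar>score d Y W i\<bar> then \<bar>score d Y W i\<bar> else 0) <= e"
  and g: "\<bar>ip d (vsum Y B) (vsum Y B) - real d * real (card B)\<bar> <= e"
  and h: "\<bar>ip d Z Z - real n * real d - q\<bar> <= e"
 shows "\<bar>statistic d ta Y W - q\<bar> <= 9 * e"
proof -
 let ?b = "SUM i:B. if ta < \<bar>score d Y W i\<bar> then 0 else score d Y W i"
 let ?f = "SUM i:G. if ta < \<bar>score d Y W i\<bar> then score d Y W i else 0"
 have "\<bar>?b\<bar> <= (SUM i:B. \<bar>if ta < \<bar>score d Y W i\<bar> then 0 else score d Y W i\<bar>)" by (rule sum_abs)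
 also have "... <= (SUM i:B. ta)" using ta by (intro sum_mono) auto
 finally have b': "\<bar>?b\<bar> <= e" using c by simp
 have "\<bar>?f\<bar> <= (SUM i:G. \<bar>if ta < \<bar>score d Y W i\<bar> then score d Y W i else 0\<bar>)" by (rule sum_abs)
 also have "... = (SUM i:G. if ta < \<bar>score d Y W i\<bar> then \<bar>score d Y W i\<bar> else 0)" by (intro sum.cong) auto
 finally have f': "\<bar>?f\<bar> <= e" using f by simp
 have eq: "statistic d ta Y W = (ip d Z Z - real n * real d) - 2 * (SUM i:D. ip d Z (X i) - real d)
  + (ip d (vsum X D) (vsum X D) - real d * real (card D)) + 2 * ?b - 2 * ?f
  - (ip d (vsum Y B) (vsum Y B) - real d * real (card B))" unfolding G_def B_def Z_def D_def by (rule statistic_decomposition[OF W S])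
 \<comment> \<open>Six errors of size \<open>e\<close> with coefficients 1, 2, 1, 2, 2, 1, nine in
   all.\<close>
 have comb: "\<bar>(u - 2 * x1 + x2 + 2 * x3 - 2 * x4 - x5) - q\<bar> <= 9 * e"
  if "\<bar>u - q\<bar> <= e" "\<bar>x1\<bar> <= e" "\<bar>x2\<bar> <= e" "\<bar>x3\<bar> <= e" "\<bar>x4\<bar> <= e" "\<bar>x5\<bar> <= e" for u x1 x2 x3 x4 x5 :: real
  using that unfolding abs_le_iff by linarith
 show ?thesis unfolding eq by (rule comb[OF h a b b' f' g])
qed

text \<open>Duality between second moments and norms of sums:
  \<open>|w|^2 = SUM i. si i * <w, X i>\<close>, so Cauchy-Schwarz gives
  \<open>|w|^4 <= card R * lam * |w|^2\<close>.\<close>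

lemma signed_sum_bound:
 assumes R: "finite R" and si: "!!i. i : R ==> \<bar>si i\<bar> <= 1" and lam: "lam >= 0"
  and bound: "!!u. (SUM i:R. (ip d u (X i))\<^sup>2) <= lam * ip d u u"
 defines "w == (%j. SUM i:R. si i * X i j)"
 shows "ip d w w <= real (card R) * lam"
proof -
 have "ip d w w = (SUM i:R. si i * ip d w (X i))" by (subst (2) w_def) (simp only: ip_sum_right ip_scale_right)
 hence "(ip d w w)\<^sup>2 <= (SUM i:R. (si i)\<^sup>2) * (SUM i:R. (ip d w (X i))\<^sup>2)" by (simp add: Cauchy_Schwarz_ineq_sum)
 also have "... <= real (card R) * (lam * ip d w w)"
 proof (rule mult_mono)
  have "(SUM i:R. (si i)\<^sup>2) <= (SUM i:R. 1)" using si by (intro sum_mono) (simp add: abs_square_le_1)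
  thus "(SUM i:R. (si i)\<^sup>2) <= real (card R)" by simp
 qed (auto simp: bound sum_nonneg)
 finally have *: "ip d w w * ip d w w <= (real (card R) * lam) * ip d w w" by (simp add: sq_eq)
 show ?thesis
 proof (cases "ip d w w = 0")
  case False
  thus ?thesis using * ip_nonneg[of d w] by (simp add: mult_le_cancel_right)
 qed (use lam in simp)
qed

lemma ip_abs_le: "ip d x x <= a\<^sup>2 ==> ip d y y <= b\<^sup>2 ==> 0 <= a ==> 0 <= b ==> \<bar>ip d x y\<bar> <= a * b"
proof -
 assume h: "ip d x x <= a\<^sup>2" "ip d y y <= b\<^sup>2" "0 <= a" "0 <= b"
 have "(ip d x y)\<^sup>2 <= ip d x x * ip d y y" by (rule ip_Cauchy_Schwarz)
 also have "... <= a\<^sup>2 * b\<^sup>2" using h by (intro mult_mono) (auto simp: ip_nonneg)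
 finally have "\<bar>ip d x y\<bar>\<^sup>2 <= (a * b)\<^sup>2" by (simp add: power_mult_distrib)
 thus ?thesis using h power2_le_imp_le[of "\<bar>ip d x y\<bar>" "a * b"] by simp
qed

lemma ip_add_norm_le:
 assumes "ip d x x <= a\<^sup>2" "ip d y y <= b\<^sup>2" "0 <= a" "0 <= b"
 shows "ip d (%j. x j + y j) (%j. x j + y j) <= (a + b)\<^sup>2"
proof -
 have "ip d (%j. x j + y j) (%j. x j + y j) = ip d x x + 2 * ip d x y + ip d y y" by (simp add: ip_add_left ip_add_right ip_commute[of d y x])
 also have "... <= a\<^sup>2 + 2 * (a * b) + b\<^sup>2" using ip_abs_le[OF assms] assms by linarith
 finally show ?thesis by (simp add: sq_eq algebra_simps)
qed

text \<open>\<open><Z, X i>\<close> is not controlled sample by sample in this regime: the mean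
  contributes \<open>n * <mm, ga i>\<close>. Hence the splitting \<open>Z = y + f\<close>, where
  \<open>y\<close> is tame against every sample and \<open>f\<close>, of norm at most
  \<open>2 * N\<close>, is treated in aggregate by the restricted second moments
  \<open>rs\<close>.\<close>

lemma statistic_tall:
 assumes W: "W <= {..<n}" and S: "!!i j. i : S ==> j < d ==> Y i j = X i j"
 defines "G == W \<inter> S" and "B == W - S" and "Z == vsum X {..<n}"
 defines "D == {..<n} - G"
 assumes pos: "be > 0" "N > 0" "th > 0" "ta > 0" and par: "be * ta = N\<^sup>2 / 100" "be\<^sup>2 * th = N\<^sup>2 / 10 ^ 8"
  and Zdec: "!!j. j < d ==> Z j = y j + f j" and fN: "ip d f f <= (2 * N)\<^sup>2"
  and yX: "!!i. i < n ==> \<bar>ip d y (X i) - real d\<bar> <= ta / 16"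
  and rs: "!!R u. R <= {..<n} ==> (SUM i:R. (ip d u (X i))\<^sup>2) <= (real (card R) * th + be * th / 200) * ip d u u"
  and cD: "real (card D) <= 2 * be" and cB: "real (card B) <= be"
  and YB: "ip d (vsum Y B) (vsum Y B) <= (N / 100)\<^sup>2" and bd: "be * real d <= N\<^sup>2 / 1000"
  and h: "\<bar>ip d Z Z - real n * real d - q\<bar> <= N\<^sup>2 / 50"
 shows "\<bar>statistic d ta Y W - q\<bar> <= 9 * (N\<^sup>2 / 50)"
proof -
 define e where "e = N\<^sup>2 / 50"
 have N2: "N\<^sup>2 > 0" using pos by simp
 have fin: "finite W" "finite G" "finite B" "finite D" using W finite_subset by (auto simp: G_def B_def D_def)
 have GDn: "G <= {..<n}" "D <= {..<n}" using W by (auto simp: G_def D_def)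
 have norm: "ip d (%j. SUM i:R. si i * X i j) (%j. SUM i:R. si i * X i j)
   <= real (card R) * (real (card R) * th + be * th / 200)"
  if "R <= {..<n}" "!!i. i : R ==> \<bar>si i\<bar> <= 1" for R si
  using that pos finite_subset[OF that(1)] by (intro signed_sum_bound rs) auto
 have XD: "ip d (vsum X D) (vsum X D) <= (N / 1000)\<^sup>2"
 proof -
  have "ip d (vsum X D) (vsum X D) <= real (card D) * (real (card D) * th + be * th / 200)"
   using norm[OF GDn(2), of "%_. 1"] by (simp add: vsum_def)
  also have "... <= (2 * be) * ((2 * be) * th + be * th / 200)" using cD pos by (intro mult_mono add_mono) auto
  also have "... = (be\<^sup>2 * th) * (4 + 1 / 100)" by (simp add: sq_eq algebra_simps)
  also have "... <= (N / 1000)\<^sup>2" unfolding par using N2 by (simp add: power_divide)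
  finally show ?thesis .
 qed
 have a: "\<bar>SUM i:D. ip d Z (X i) - real d\<bar> <= e"
 proof -
  have "(SUM i:D. ip d Z (X i) - real d) = (SUM i:D. (ip d y (X i) - real d) + ip d f (X i))"
  proof (rule sum.cong)
   fix i
   have "ip d Z (X i) = ip d (%j. y j + f j) (X i)" using Zdec by (intro ip_cong) auto
   thus "ip d Z (X i) - real d = ip d y (X i) - real d + ip d f (X i)" by (simp add: ip_add_left)
  qed simp
  also have "... = (SUM i:D. ip d y (X i) - real d) + ip d f (vsum X D)" by (simp add: sum.distrib ip_vsum_right)
  finally have 1: "(SUM i:D. ip d Z (X i) - real d) = (SUM i:D. ip d y (X i) - real d) + ip d f (vsum X D)" .
  have "\<bar>SUM i:D. ip d y (X i) - real d\<bar> <= (SUM i:D. ta / 16)" using yX GDn by (intro order_trans[OF sum_abs] sum_mono) auto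
  also have "... = real (card D) * (ta / 16)" by simp
  also have "... <= 2 * be * (ta / 16)" using cD pos by (intro mult_right_mono) auto
  also have "... = N\<^sup>2 / 800" using par(1) by simp
  finally have 2: "\<bar>SUM i:D. ip d y (X i) - real d\<bar> <= N\<^sup>2 / 800" .
  have "\<bar>ip d f (vsum X D)\<bar> <= 2 * N * (N / 1000)" using fN XD pos by (intro ip_abs_le) auto
  hence 3: "\<bar>ip d f (vsum X D)\<bar> <= N\<^sup>2 / 500" by (simp add: sq_eq)
  show ?thesis unfolding 1 e_def using 2 3 N2 unfolding abs_le_iff by linarith
 qed
 have b: "\<bar>ip d (vsum X D) (vsum X D) - real d * real (card D)\<bar> <= e"
 proof -
  have "real d * real (card D) <= real d * (2 * be)" using cD by (intro mult_left_mono) auto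
  also have "... = 2 * (be * real d)" by simp
  finally have "real d * real (card D) <= 2 * (N\<^sup>2 / 1000)" using bd by linarith
  moreover have "0 <= real d * real (card D)" by simp
  moreover have "(N / 1000)\<^sup>2 = N\<^sup>2 / 1000000" by (simp add: power_divide)
  ultimately show ?thesis using XD ip_nonneg[of d "vsum X D"] N2 unfolding e_def abs_le_iff by linarith
 qed
 have c: "real (card B) * ta <= e"
 proof -
  have "real (card B) * ta <= be * ta" using cB pos by (intro mult_right_mono) auto
  thus ?thesis unfolding e_def par using N2 by linarith
 qed
 have g: "\<bar>ip d (vsum Y B) (vsum Y B) - real d * real (card B)\<bar> <= e"
 proof -
  have "real d * real (card B) <= real d * be" using cB by (intro mult_left_mono) auto
  hence "real d * real (card B) <= N\<^sup>2 / 1000" using bd by (simp add: mult.commute)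
  moreover have "0 <= real d * real (card B)" by simp
  moreover have "(N / 100)\<^sup>2 = N\<^sup>2 / 10000" by (simp add: power_divide)
  ultimately show ?thesis using YB ip_nonneg[of d "vsum Y B"] N2 unfolding e_def abs_le_iff by linarith
 qed
 define e' where "e' = (%j. f j + (- 1 * vsum X D j + vsum Y B j))"
 have e'N: "ip d e' e' <= (3 * N)\<^sup>2"
 proof -
  have "ip d (%j. - 1 * vsum X D j) (%j. - 1 * vsum X D j) <= (N / 1000)\<^sup>2" using XD unfolding ip_scale_left ip_scale_right by simp
  hence "ip d (%j. - 1 * vsum X D j + vsum Y B j) (%j. - 1 * vsum X D j + vsum Y B j) <= (N / 1000 + N / 100)\<^sup>2"
   using YB pos by (intro ip_add_norm_le) auto
  from ip_add_norm_le[OF fN this] have "ip d e' e' <= (2 * N + (N / 1000 + N / 100))\<^sup>2" unfolding e'_def using pos by simp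
  also have "... <= (3 * N)\<^sup>2" using pos by (intro power_mono) auto
  finally show ?thesis .
 qed
 have sc: "score d Y W i = (ip d y (X i) - real d) + ip d e' (X i)" if "i : G" for i
 proof -
  have "vsum Y W j = y j + e' j" if j: "j < d" for j
  proof -
   have "W = G \<union> B" "G \<inter> B = {}" by (auto simp: G_def B_def)
   hence "vsum Y W j = vsum Y G j + vsum Y B j" using vsum_disjoint[OF fin(2,3)] by metis
   moreover have "vsum Y G j = vsum X G j" unfolding vsum_def using S j by (intro sum.cong) (auto simp: G_def)
   moreover have "{..<n} = G \<union> D" "G \<inter> D = {}" using W by (auto simp: G_def D_def)
   hence "Z j = vsum X G j + vsum X D j" unfolding Z_def using vsum_disjoint[OF fin(2,4)] by metis
   ultimately show ?thesis using Zdec[OF j] by (simp add: e'_def)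
  qed
  moreover have "Y i j = X i j" if "j < d" for j using S that \<open>i : G\<close> by (auto simp: G_def)
  ultimately have "ip d (vsum Y W) (Y i) = ip d (%j. y j + e' j) (X i)" by (intro ip_cong) auto
  thus ?thesis by (simp add: score_def ip_add_left)
 qed
 have fl: "(SUM i:G. if ta < \<bar>score d Y W i\<bar> then \<bar>score d Y W i\<bar> else 0) <= e"
 proof -
  \<comment> \<open>The number \<open>r\<close> of flagged good samples bounds itself. Each has a
    score above \<open>ta\<close>, of which \<open>y\<close> explains at most
    \<open>ta / 16\<close>, so \<open>e'\<close> has to explain the rest; but \<open>e'\<close> has
    norm at most \<open>3 * N\<close>, and \<open>rs\<close> makes \<open>Q^2\<close> at most a
    multiple of \<open>r * (r + be / 200)\<close>. Comparison with
    \<open>15 * r * ta <= 16 * Q\<close> forces \<open>r <= be / 200\<close>, and then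
    \<open>Q\<close> is small.\<close>
  define R where "R = {i : G. ta < \<bar>score d Y W i\<bar>}"
  define r where "r = real (card R)"
  define Q where "Q = (SUM i:R. \<bar>ip d e' (X i)\<bar>)"
  have R: "R <= {..<n}" "finite R" using GDn fin by (auto simp: R_def)
  have sum: "(SUM i:G. if ta < \<bar>score d Y W i\<bar> then \<bar>score d Y W i\<bar> else 0) = (SUM i:R. \<bar>score d Y W i\<bar>)"
   unfolding R_def using fin by (simp add: sum.inter_filter)
  have le1: "(SUM i:R. \<bar>score d Y W i\<bar>) <= r * (ta / 16) + Q"
  proof -
   have "(SUM i:R. \<bar>score d Y W i\<bar>) <= (SUM i:R. ta / 16 + \<bar>ip d e' (X i)\<bar>)"
   proof (rule sum_mono)
    fix i assume "i : R"
    hence "i : G" "i < n" using R by (auto simp: R_def)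
    thus "\<bar>score d Y W i\<bar> <= ta / 16 + \<bar>ip d e' (X i)\<bar>" using sc[of i] yX[of i] by linarith
   qed
   thus ?thesis by (simp add: sum.distrib Q_def r_def)
  qed
  have ge1: "r * ta <= (SUM i:R. \<bar>score d Y W i\<bar>)"
  proof -
   have "(SUM i:R. ta) <= (SUM i:R. \<bar>score d Y W i\<bar>)" by (intro sum_mono) (auto simp: R_def)
   thus ?thesis by (simp add: r_def)
  qed
  have Qsq: "Q\<^sup>2 <= 9 * N\<^sup>2 * (r * (r * th + be * th / 200))"
  proof -
   let ?w = "%j. SUM i:R. sgn (ip d e' (X i)) * X i j"
   have "Q = ip d e' ?w" unfolding Q_def ip_sum_right ip_scale_right by (intro sum.cong) (auto simp: sgn_if)
   hence "Q\<^sup>2 <= ip d e' e' * ip d ?w ?w" using ip_Cauchy_Schwarz by simp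
   also have "... <= (3 * N)\<^sup>2 * (r * (r * th + be * th / 200))" using e'N norm[OF R(1), of "%i. sgn (ip d e' (X i))"]
    by (intro mult_mono) (auto simp: r_def abs_sgn_eq ip_nonneg)
   finally show ?thesis by (simp add: power_mult_distrib)
  qed
  have r0: "r >= 0" by (simp add: r_def)
  have Q0: "Q >= 0" by (simp add: Q_def sum_nonneg)
  have rQ: "15 * (r * ta) <= 16 * Q" using le1 ge1 by simp
  \<comment> \<open>Eliminates \<open>be\<close> from the two budget equations \<open>par\<close>,
    so that \<open>ta^2\<close> and the bound on \<open>Q^2\<close> share the factor
    \<open>N^2 * th\<close>.\<close>
  have tau2: "ta\<^sup>2 = 10 ^ 4 * N\<^sup>2 * th"
  proof -
   have "be\<^sup>2 * ta\<^sup>2 = (N\<^sup>2 / 100)\<^sup>2" using par(1) by (metis power_mult_distrib)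
   also have "... = 10 ^ 4 * N\<^sup>2 * (N\<^sup>2 / 10 ^ 8)" by (simp add: sq_eq)
   also have "... = be\<^sup>2 * (10 ^ 4 * N\<^sup>2 * th)" unfolding par(2)[symmetric] by simp
   finally show ?thesis using pos by simp
  qed
  have "r * th <= be * th / 200"
  proof (cases "r = 0")
   case False
   hence rp: "r > 0" using r0 by simp
   have "(15 * (r * ta))\<^sup>2 <= (16 * Q)\<^sup>2" using rQ r0 pos by (intro power_mono) auto
   hence "225 * (r\<^sup>2 * ta\<^sup>2) <= 256 * Q\<^sup>2" by (simp add: power_mult_distrib)
   hence "225 * (r\<^sup>2 * (10 ^ 4 * N\<^sup>2 * th)) <= 256 * (9 * N\<^sup>2 * (r * (r * th + be * th / 200)))"
    unfolding tau2 using Qsq by linarith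
   hence "(r * N\<^sup>2) * (2250000 * (r * th)) <= (r * N\<^sup>2) * (2304 * (r * th + be * th / 200))"
    by (simp add: sq_eq algebra_simps)
   hence "2250000 * (r * th) <= 2304 * (r * th + be * th / 200)" using rp N2 by (simp only: mult_le_cancel_left_pos mult_pos_pos)
   moreover have "0 <= r * th" "0 <= be * th" using r0 pos by auto
   moreover have "2250000 * x <= 2304 * (x + z / 200) ==> 0 <= x ==> 0 <= z ==> x <= z / 200" for x z :: real
    by argo
   ultimately show ?thesis by blast
  qed (use pos in simp)
  hence rb: "r <= be / 200" using pos by (simp add: field_simps)
  have "r * (r * th + be * th / 200) <= be / 200 * (be / 200 * th + be * th / 200)"
   using rb r0 pos by (intro mult_mono add_mono) auto
  also have "... = be\<^sup>2 * th / 20000" by (simp add: sq_eq)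
  finally have "Q\<^sup>2 <= 9 * N\<^sup>2 * (be\<^sup>2 * th / 20000)" using Qsq N2 by (meson mult_left_mono order_trans mult_nonneg_nonneg zero_le_numeral less_imp_le)
  also have "... <= (N\<^sup>2 / 1000)\<^sup>2" unfolding par(2) using pos by (simp add: sq_eq)
  finally have "Q <= N\<^sup>2 / 1000" using power2_le_imp_le[of Q "N\<^sup>2 / 1000"] by simp
  thus ?thesis unfolding sum e_def using le1 rQ N2 by linarith
 qed
 show ?thesis
 proof (rule statistic_error[where S = S and X = X, OF W])
  show "!!i j. i : S ==> j < d ==> Y i j = X i j" by (rule S)
  show "0 <= ta" using pos by simp
 qed (use a b c fl g h in \<open>simp_all only: G_def B_def Z_def D_def e_def\<close>)
qed

text \<open>Centring the diagonal by \<open>d\<close> leaves a matrix of small norm for clean data.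
  Padding with zeros keeps the size \<open>n\<close>, so that shrinking \<open>W\<close> amounts to
  passing to a principal submatrix.\<close>

definition gram :: "nat => (nat => nat => real) => nat set => nat => nat => real" where
 "gram d Y W i j = (if i : W & j : W then ip d (Y i) (Y j) - (if i = j then real d else 0) else 0)"

lemma bil_gram:
 assumes "W <= {..<n}" "!!i. i \<notin> W ==> x i = 0" "!!i. i \<notin> W ==> z i = 0"
 shows "bil n (gram d Y W) x z = ip d (%j. SUM i<n. x i * Y i j) (%j. SUM i<n. z i * Y i j) - real d * ip n x z"
proof -
 have "bil n (gram d Y W) x z = (SUM i<n. SUM k<n. x i * (z k * ip d (Y i) (Y k)) - (if k = i then real d * (x i * z k) else 0))"
  unfolding bil_def gram_def using assms by (intro sum.cong refl) (auto simp: algebra_simps)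
 also have "... = (SUM i<n. SUM k<n. x i * (z k * ip d (Y i) (Y k))) - (SUM i<n. real d * (x i * z i))" by (simp add: sum_subtractf)
 also have "(SUM i<n. SUM k<n. x i * (z k * ip d (Y i) (Y k))) = ip d (%j. SUM i<n. x i * Y i j) (%j. SUM i<n. z i * Y i j)"
  unfolding ip_sum_left ip_sum_right ip_scale_left ip_scale_right by (simp add: sum_distrib_left)
 finally show ?thesis by (simp add: ip_def sum_distrib_left)
qed

definition indic :: "nat set => (nat => real) => nat => real" where
 "indic S f i = (if i : S then f i else 0)"

lemma sum_indic: "S <= {..<n} ==> (SUM i<n. indic S f i * g i) = (SUM i:S. f i * g i)"
 unfolding indic_def by (subst sum.mono_neutral_right[of "{..<n}" S]) auto

lemma ip_indic: "S <= {..<n} ==> (!!i. i : S ==> (f i)\<^sup>2 <= 1) ==> ip n (indic S f) (indic S f) <= real (card S)"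
proof -
 assume S: "S <= {..<n}" and f: "!!i. i : S ==> (f i)\<^sup>2 <= 1"
 have "ip n (indic S f) (indic S f) = (SUM i:S. f i * indic S f i)" unfolding ip_def by (rule sum_indic[OF S])
 also have "... <= (SUM i:S. 1)" using f by (intro sum_mono) (auto simp: indic_def sq_eq)
 finally show ?thesis by simp
qed

lemma ip_indic_disjoint: "S \<inter> T = {} ==> ip n (indic S f) (indic T g) = 0" unfolding ip_def indic_def by (intro sum.neutral) auto

lemma vsum_indic: "S <= {..<n} ==> (%j. SUM i<n. indic S (%_. 1) i * Y i j) = vsum Y S"
 unfolding vsum_def by (intro ext) (simp add: sum_indic)

text \<open>In the eigenbasis the quadratic bound says that all eigenvalues are at most
  \<open>rh\<close> in size, so passing to the bilinear form loses no constant.\<close>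

lemma polarize:
 assumes q: "!!x. \<bar>bil n M x x\<bar> <= rh * ip n x x" and sym: "symm n M"
  and "ip n x x <= a\<^sup>2" "ip n z z <= b\<^sup>2" "0 <= a" "0 <= b" "0 <= rh"
 shows "\<bar>bil n M x z\<bar> <= rh * (a * b)"
proof -
 obtain r U lam where A: "spectral_decomp n M r U lam" using spectral_theorem[OF sym] by blast
 note on = spectral_orthonormal[OF A]
 have "\<bar>lam k\<bar> <= rh" if "k < r" for k using q[of "U k"] spectral_eigenvalue[OF A that] ip_orthonormal[OF on that that] by simp
 hence "\<bar>bil n M x z\<bar> <= (SUM k<r. rh * (\<bar>ip n (U k) x\<bar> * \<bar>ip n (U k) z\<bar>))" unfolding spectral_bil[OF A] using assms(7)
  by (intro order_trans[OF sum_abs] sum_mono) (auto simp: abs_mult mult.assoc intro!: mult_mono)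
 also have "... = rh * (SUM k<r. \<bar>ip n (U k) x\<bar> * \<bar>ip n (U k) z\<bar>)" by (simp add: sum_distrib_left)
 also have "... <= rh * (a * b)"
 proof (rule mult_left_mono)
  have "(SUM k<r. \<bar>ip n (U k) x\<bar> * \<bar>ip n (U k) z\<bar>)
    <= L2_set (%k. ip n (U k) x) {..<r} * L2_set (%k. ip n (U k) z) {..<r}"
   using L2_set_mult_ineq[of "%k. ip n (U k) x" "%k. ip n (U k) z" "{..<r}"] by simp
  also have "... <= a * b" unfolding L2_eq_sqrt_ip using Bessel[OF on, of x] Bessel[OF on, of z] assms
   by (intro mult_mono real_le_lsqrt) (auto simp: ip_def sq_eq sum_nonneg)
  finally show "(SUM k<r. \<bar>ip n (U k) x\<bar> * \<bar>ip n (U k) z\<bar>) <= a * b" .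
 qed (use assms in simp)
 finally show ?thesis .
qed

lemma symm_gram: "symm n (gram d Y W)" by (auto simp: symm_def gram_def ip_commute)

text \<open>\<open>M\<close> accounts for the good samples lost over all rounds of the Gram filter,
  which is why closeness to \<open>d\<close> is asked up to \<open>ta / (16 * M)\<close>. The other
  parts of a good score are cross terms between disjoint index sets, where the centring of the Gram
  matrix has no effect.\<close>

lemma statistic_wide:
 assumes W: "W <= {..<n}" and S: "!!i j. i : S ==> j < d ==> Y i j = X i j"
 defines "G == W \<inter> S" and "B == W - S" and "Z == vsum X {..<n}"
 defines "D == {..<n} - G"
 assumes pos: "be > 0" "N > 0" "rh > 0" "ta > 0" "M >= 1" and par: "be * ta = N\<^sup>2 / 100" "rh * (be * M) <= N\<^sup>2 / 3000"
  and ZX: "!!i. i < n ==> \<bar>ip d Z (X i) - real d\<bar> <= ta / (16 * M)"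
  and gX: "!!x. \<bar>bil n (gram d X {..<n}) x x\<bar> <= rh * ip n x x"
  and gY: "!!x. \<bar>bil n (gram d Y W) x x\<bar> <= 16 * rh * ip n x x"
  and cD: "real (card D) <= be * M" and cB: "real (card B) <= be"
  and h: "\<bar>ip d Z Z - real n * real d - q\<bar> <= N\<^sup>2 / 50"
 shows "\<bar>statistic d ta Y W - q\<bar> <= 9 * (N\<^sup>2 / 50)"
proof -
 define e where "e = N\<^sup>2 / 50"
 have N2: "N\<^sup>2 > 0" using pos by simp
 have fin: "finite W" "finite G" "finite B" "finite D" using W finite_subset by (auto simp: G_def B_def D_def)
 have sub: "G <= {..<n}" "D <= {..<n}" "B <= {..<n}" "B <= W" "G <= W" using W by (auto simp: G_def D_def B_def)
 have dis: "G \<inter> D = {}" "G \<inter> B = {}" by (auto simp: G_def D_def B_def)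
 have a: "\<bar>SUM i:D. ip d Z (X i) - real d\<bar> <= e"
 proof -
  have "\<bar>SUM i:D. ip d Z (X i) - real d\<bar> <= (SUM i:D. ta / (16 * M))" using ZX sub by (intro order_trans[OF sum_abs] sum_mono) auto
  also have "... = real (card D) * (ta / (16 * M))" by simp
  also have "... <= be * M * (ta / (16 * M))" using cD pos by (intro mult_right_mono) auto
  also have "... = N\<^sup>2 / 1600" using par(1) pos by (simp add: field_simps)
  finally show ?thesis using N2 by (simp add: e_def)
 qed
 have b: "\<bar>ip d (vsum X D) (vsum X D) - real d * real (card D)\<bar> <= e"
 proof -
  let ?x = "indic D (%_. 1)"
  have ipx: "ip n ?x ?x = real (card D)" unfolding ip_def sum_indic[OF sub(2)] by (simp add: indic_def)
  have "bil n (gram d X {..<n}) ?x ?x = ip d (vsum X D) (vsum X D) - real d * real (card D)"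
   using sub by (subst bil_gram) (auto simp: vsum_indic[OF sub(2)] ipx, auto simp: indic_def)
  hence "\<bar>ip d (vsum X D) (vsum X D) - real d * real (card D)\<bar> <= rh * real (card D)" using gX[of ?x] ipx by simp
  also have "... <= rh * (be * M)" using cD pos by (intro mult_left_mono) auto
  finally show ?thesis unfolding e_def using par(2) N2 by linarith
 qed
 have c: "real (card B) * ta <= e"
 proof -
  have "real (card B) * ta <= be * ta" using cB pos by (intro mult_right_mono) auto
  thus ?thesis unfolding e_def par using N2 by linarith
 qed
 have rhbe: "rh * be <= N\<^sup>2 / 3000"
 proof -
  have "rh * be * 1 <= rh * be * M" using pos by (intro mult_left_mono) auto
  thus ?thesis using par(2) by (simp add: mult.assoc)
 qed
 have g: "\<bar>ip d (vsum Y B) (vsum Y B) - real d * real (card B)\<bar> <= e"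
 proof -
  let ?x = "indic B (%_. 1)"
  have ipx: "ip n ?x ?x = real (card B)" unfolding ip_def sum_indic[OF sub(3)] by (simp add: indic_def)
  have "bil n (gram d Y W) ?x ?x = ip d (vsum Y B) (vsum Y B) - real d * real (card B)"
   using sub W by (subst bil_gram) (auto simp: vsum_indic[OF sub(3)] ipx, auto simp: indic_def)
  hence "\<bar>ip d (vsum Y B) (vsum Y B) - real d * real (card B)\<bar> <= 16 * rh * real (card B)" using gY[of ?x] ipx by simp
  also have "... <= 16 * rh * be" using cB pos by (intro mult_left_mono) auto
  finally show ?thesis unfolding e_def using rhbe N2 by linarith
 qed
 have sc: "score d Y W i = (ip d Z (X i) - real d) - ip d (vsum X D) (X i) + ip d (vsum Y B) (Y i)" if "i : G" for i
 proof -
  have v: "vsum Y W j = Z j - vsum X D j + vsum Y B j" if j: "j < d" for j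
  proof -
   have "W = G \<union> B" by (auto simp: G_def B_def)
   hence "vsum Y W j = vsum Y G j + vsum Y B j" using vsum_disjoint[OF fin(2,3) dis(2)] by metis
   moreover have "vsum Y G j = vsum X G j" unfolding vsum_def using S j by (intro sum.cong) (auto simp: G_def)
   moreover have "{..<n} = G \<union> D" using W by (auto simp: G_def D_def)
   hence "Z j = vsum X G j + vsum X D j" unfolding Z_def using vsum_disjoint[OF fin(2,4) dis(1)] by metis
   ultimately show ?thesis by simp
  qed
  have YX: "Y i j = X i j" if "j < d" for j using S that \<open>i : G\<close> by (auto simp: G_def)
  have "ip d (vsum Y W) (Y i) = ip d (%j. (Z j - vsum X D j) + vsum Y B j) (Y i)" using v by (intro ip_cong) auto
  also have "... = ip d Z (Y i) - ip d (vsum X D) (Y i) + ip d (vsum Y B) (Y i)" by (simp only: ip_add_left ip_diff_left)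
  finally have "ip d (vsum Y W) (Y i) = ip d Z (Y i) - ip d (vsum X D) (Y i) + ip d (vsum Y B) (Y i)" .
  moreover have "ip d Z (Y i) = ip d Z (X i)" "ip d (vsum X D) (Y i) = ip d (vsum X D) (X i)" using YX by (auto intro!: ip_cong)
  ultimately show ?thesis by (simp add: score_def)
 qed
 have fl: "(SUM i:G. if ta < \<bar>score d Y W i\<bar> then \<bar>score d Y W i\<bar> else 0) <= e"
 proof -
  define R where "R = {i : G. ta < \<bar>score d Y W i\<bar>}"
  define r where "r = real (card R)"
  define Q where "Q = (SUM i:R. sgn (score d Y W i) * (- ip d (vsum X D) (X i) + ip d (vsum Y B) (Y i)))"
  have R: "R <= {..<n}" "R <= W" "finite R" "R \<inter> D = {}" "R \<inter> B = {}" using sub fin dis by (auto simp: R_def)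
  have sum: "(SUM i:G. if ta < \<bar>score d Y W i\<bar> then \<bar>score d Y W i\<bar> else 0) = (SUM i:R. \<bar>score d Y W i\<bar>)"
   unfolding R_def using fin by (simp add: sum.inter_filter)
  have le1: "(SUM i:R. \<bar>score d Y W i\<bar>) <= r * (ta / 16) + Q"
  proof -
   have "(SUM i:R. \<bar>score d Y W i\<bar>) <= (SUM i:R. ta / 16 + sgn (score d Y W i) * (- ip d (vsum X D) (X i) + ip d (vsum Y B) (Y i)))"
   proof (rule sum_mono)
    fix i assume "i : R"
    hence i: "i : G" "i < n" using R by (auto simp: R_def)
    have "\<bar>score d Y W i\<bar> = sgn (score d Y W i) * score d Y W i" by (simp add: sgn_mult_self_eq abs_sgn mult.commute)
    also have "... = sgn (score d Y W i) * (ip d Z (X i) - real d)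
      + sgn (score d Y W i) * (- ip d (vsum X D) (X i) + ip d (vsum Y B) (Y i))" by (subst (2) sc[OF i(1)]) (simp add: algebra_simps)
    also have "sgn (score d Y W i) * (ip d Z (X i) - real d) <= \<bar>ip d Z (X i) - real d\<bar>" by (auto simp: sgn_if)
    also have "... <= ta / 16"
    proof -
     have "ta / (16 * M) <= ta / (16 * 1)" using pos by (intro divide_left_mono mult_left_mono) auto
     thus ?thesis using ZX[OF i(2)] by simp
    qed
    finally show "\<bar>score d Y W i\<bar> <= ta / 16 + sgn (score d Y W i) * (- ip d (vsum X D) (X i) + ip d (vsum Y B) (Y i))" by simp
   qed
   thus ?thesis by (simp add: sum.distrib Q_def r_def)
  qed
  have ge1: "r * ta <= (SUM i:R. \<bar>score d Y W i\<bar>)"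
  proof -
   have "(SUM i:R. ta) <= (SUM i:R. \<bar>score d Y W i\<bar>)" by (intro sum_mono) (auto simp: R_def)
   thus ?thesis by (simp add: r_def)
  qed
  let ?s = "indic R (%i. sgn (score d Y W i))"
  have sn: "ip n ?s ?s <= (sqrt r)\<^sup>2" using ip_indic[OF R(1), of "%i. sgn (score d Y W i)"] by (simp add: r_def sgn_if)
  have r0: "r >= 0" by (simp add: r_def)
  have "Q = - bil n (gram d X {..<n}) (indic D (%_. 1)) ?s + bil n (gram d Y W) (indic B (%_. 1)) ?s"
  proof -
   have 1: "bil n (gram d X {..<n}) (indic D (%_. 1)) ?s = (SUM i:R. sgn (score d Y W i) * ip d (vsum X D) (X i))"
   proof -
    have "bil n (gram d X {..<n}) (indic D (%_. 1)) ?s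
      = ip d (%j. SUM i<n. indic D (%_. 1) i * X i j) (%j. SUM i<n. ?s i * X i j) - real d * ip n (indic D (%_. 1)) ?s"
     using sub R by (intro bil_gram) (auto simp: indic_def)
    also have "ip n (indic D (%_. 1)) ?s = 0" using R by (intro ip_indic_disjoint) auto
    finally show ?thesis unfolding vsum_indic[OF sub(2)] sum_indic[OF R(1)] ip_sum_right ip_scale_right by simp
   qed
   have 2: "bil n (gram d Y W) (indic B (%_. 1)) ?s = (SUM i:R. sgn (score d Y W i) * ip d (vsum Y B) (Y i))"
   proof -
    have "bil n (gram d Y W) (indic B (%_. 1)) ?s
      = ip d (%j. SUM i<n. indic B (%_. 1) i * Y i j) (%j. SUM i<n. ?s i * Y i j) - real d * ip n (indic B (%_. 1)) ?s"
     using W sub R by (intro bil_gram) (auto simp: indic_def)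
    also have "ip n (indic B (%_. 1)) ?s = 0" using R by (intro ip_indic_disjoint) auto
    finally show ?thesis unfolding vsum_indic[OF sub(3)] sum_indic[OF R(1)] ip_sum_right ip_scale_right by simp
   qed
   show ?thesis unfolding Q_def 1 2 by (simp add: right_diff_distrib sum_subtractf)
  qed
  also have "... <= rh * (sqrt (be * M) * sqrt r) + 16 * rh * (sqrt (be * M) * sqrt r)"
  proof -
   have bM: "ip n (indic D (%_. 1)) (indic D (%_. 1)) <= (sqrt (be * M))\<^sup>2" using ip_indic[OF sub(2), of "%_. 1"] cD pos by simp
   have bl: "be <= be * M" using pos by simp
   have bB: "ip n (indic B (%_. 1)) (indic B (%_. 1)) <= (sqrt (be * M))\<^sup>2"
   proof -
    have "(sqrt (be * M))\<^sup>2 = be * M" using pos by simp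
    moreover have "ip n (indic B (%_. 1)) (indic B (%_. 1)) <= real (card B)" by (rule ip_indic[OF sub(3)]) simp
    ultimately show ?thesis using cB bl by linarith
   qed
   have "\<bar>bil n (gram d X {..<n}) (indic D (%_. 1)) ?s\<bar> <= rh * (sqrt (be * M) * sqrt r)"
    using pos r0 by (intro polarize[OF gX symm_gram bM sn]) auto
   moreover have "\<bar>bil n (gram d Y W) (indic B (%_. 1)) ?s\<bar> <= 16 * rh * (sqrt (be * M) * sqrt r)"
    using pos r0 by (intro polarize[OF gY symm_gram bB sn]) auto
   ultimately show ?thesis by linarith
  qed
  also have "... = 17 * (rh * (sqrt (be * M) * sqrt r))" by simp
  finally have Qb: "Q <= 17 * (rh * (sqrt (be * M) * sqrt r))" .
  have rQ: "15 * (r * ta) <= 16 * Q" using le1 ge1 by simp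
  hence Q0: "Q >= 0" using r0 pos mult_nonneg_nonneg[of r ta] by linarith
  have "Q\<^sup>2 <= (17 * (rh * (sqrt (be * M) * sqrt r)))\<^sup>2" using Qb Q0 by (intro power_mono) auto
  also have "... = 289 * (rh\<^sup>2 * (be * M * r))" using pos r0 by (simp add: power_mult_distrib)
  finally have Q2: "Q\<^sup>2 <= 289 * (rh\<^sup>2 * (be * M * r))" .
  \<comment> \<open>Multiply the bound on \<open>Q^2\<close> by \<open>15 * be * ta\<close>: then
    \<open>15 * r * ta <= 16 * Q\<close> eliminates \<open>r\<close>, and one factor
    \<open>Q\<close> cancels.\<close>
  have "Q <= N\<^sup>2 / 200"
  proof (cases "Q = 0")
   case False
   hence Qp: "Q > 0" using Q0 by simp
   have "Q * (Q * (15 * (be * ta))) = 15 * (be * ta) * Q\<^sup>2" by (simp add: sq_eq)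
   also have "... <= 15 * (be * ta) * (289 * (rh\<^sup>2 * (be * M * r)))" using Q2 pos by (intro mult_left_mono) auto
   also have "... = 289 * (rh\<^sup>2 * be\<^sup>2 * M) * (15 * (r * ta))" by (simp add: sq_eq)
   also have "... <= 289 * (rh\<^sup>2 * be\<^sup>2 * M) * (16 * Q)" using rQ pos by (intro mult_left_mono) auto
   finally have "Q * (Q * (15 * (be * ta))) <= Q * (4624 * (rh\<^sup>2 * be\<^sup>2 * M))" by (simp add: mult_ac)
   hence "Q * (15 * (be * ta)) <= 4624 * (rh\<^sup>2 * be\<^sup>2 * M)" using Qp by (simp only: mult_le_cancel_left_pos)
   also have "rh\<^sup>2 * be\<^sup>2 * M <= rh\<^sup>2 * be\<^sup>2 * (M * M)" using pos by (intro mult_left_mono) auto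
   also have "rh\<^sup>2 * be\<^sup>2 * (M * M) = (rh * (be * M))\<^sup>2" by (simp add: sq_eq)
   also have "... <= (N\<^sup>2 / 3000)\<^sup>2" using par(2) pos by (intro power_mono) auto
   finally have "Q * (15 * (N\<^sup>2 / 100)) <= 4624 * (N\<^sup>2 / 3000)\<^sup>2" unfolding par(1) by simp
   hence "N\<^sup>2 * (Q * 15 / 100) <= N\<^sup>2 * (4624 * N\<^sup>2 / 9000000)" by (simp add: sq_eq)
   hence "Q * 15 / 100 <= 4624 * N\<^sup>2 / 9000000" using N2 by (simp only: mult_le_cancel_left_pos)
   thus ?thesis using N2 by linarith
  qed (use N2 in simp)
  thus ?thesis unfolding sum e_def using le1 rQ N2 by linarith
 qed
 show ?thesis
 proof (rule statistic_error[where S = S and X = X, OF W])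
  show "!!i j. i : S ==> j < d ==> Y i j = X i j" by (rule S)
  show "0 <= ta" using pos by simp
 qed (use a b c fl g h in \<open>simp_all only: G_def B_def Z_def D_def e_def\<close>)
qed

text \<open>With entrywise bounds a good score differs from \<open><Z, X i> - d\<close> by at most
  \<open>2 * card D * r <= ta / 2\<close>, so no good sample is flagged at all.\<close>

lemma statistic_small:
 assumes W: "W <= {..<n}" and S: "!!i j. i : S ==> j < d ==> Y i j = X i j"
 defines "G == W \<inter> S" and "B == W - S" and "Z == vsum X {..<n}"
 defines "D == {..<n} - G"
 assumes pos: "N > 0" "ta > 0" "r >= 0"
  and ZX: "!!i. i < n ==> \<bar>ip d Z (X i) - real d\<bar> <= ta / 16"
  and eX: "!!i j. i < n ==> j < n ==> \<bar>gram d X {..<n} i j\<bar> <= r"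
  and eY: "!!i j. i : W ==> j : W ==> \<bar>gram d Y W i j\<bar> <= r"
  and cD: "real (card D) * ta <= N\<^sup>2 / 50" "real (card D) * real (card D) * r <= N\<^sup>2 / 50" "real (card D) * r <= ta / 4"
  and cB: "real (card B) <= real (card D)"
  and h: "\<bar>ip d Z Z - real n * real d - q\<bar> <= N\<^sup>2 / 50"
 shows "\<bar>statistic d ta Y W - q\<bar> <= 9 * (N\<^sup>2 / 50)"
proof -
 define e where "e = N\<^sup>2 / 50"
 have N2: "N\<^sup>2 > 0" using pos by simp
 have fin: "finite W" "finite G" "finite B" "finite D" using W finite_subset by (auto simp: G_def B_def D_def)
 have sub: "G <= {..<n}" "D <= {..<n}" "B <= {..<n}" "B <= W" "G <= W" using W by (auto simp: G_def D_def B_def)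
 have dis: "G \<inter> D = {}" "G \<inter> B = {}" by (auto simp: G_def D_def B_def)
 have a: "\<bar>SUM i:D. ip d Z (X i) - real d\<bar> <= e"
 proof -
  have "\<bar>SUM i:D. ip d Z (X i) - real d\<bar> <= (SUM i:D. ta)"
  proof (intro order_trans[OF sum_abs] sum_mono)
   fix i assume "i : D"
   hence "\<bar>ip d Z (X i) - real d\<bar> <= ta / 16" using ZX sub by auto
   thus "\<bar>ip d Z (X i) - real d\<bar> <= ta" using pos by linarith
  qed
  thus ?thesis using cD(1) by (simp add: e_def)
 qed
 have quad: "\<bar>ip d (vsum V T) (vsum V T) - real d * real (card T)\<bar> <= real (card T) * real (card T) * r"
  if T: "T <= U" "finite T" and V: "!!i j. i : U ==> j : U ==> \<bar>gram d V U i j\<bar> <= r" for T U V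
 proof -
  have "ip d (vsum V T) (vsum V T) - real d * real (card T) = (SUM i:T. SUM j:T. ip d (V i) (V j) - (if j = i then real d else 0))"
   unfolding ip_vsum_left ip_vsum_right using T by (simp add: sum_subtractf ip_commute)
  also have "\<bar>...\<bar> <= (SUM i:T. SUM j:T. r)"
  proof (intro order_trans[OF sum_abs] sum_mono)
   fix i j assume ij: "i : T" "j : T"
   thus "\<bar>ip d (V i) (V j) - (if j = i then real d else 0)\<bar> <= r" using V[of i j] T by (auto simp: gram_def subset_eq split: if_splits)
  qed
  also have "... = real (card T) * real (card T) * r" by simp
  finally show ?thesis .
 qed
 have b: "\<bar>ip d (vsum X D) (vsum X D) - real d * real (card D)\<bar> <= e"
 proof -
  have "\<bar>ip d (vsum X D) (vsum X D) - real d * real (card D)\<bar> <= real (card D) * real (card D) * r"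
   by (rule quad[of D "{..<n}" X, OF sub(2) fin(4)]) (use eX in auto)
  thus ?thesis using cD(2) unfolding e_def by linarith
 qed
 have g: "\<bar>ip d (vsum Y B) (vsum Y B) - real d * real (card B)\<bar> <= e"
 proof -
  have "real (card B) * real (card B) * r <= real (card D) * real (card D) * r" using cB pos by (intro mult_right_mono mult_mono) auto
  moreover have "\<bar>ip d (vsum Y B) (vsum Y B) - real d * real (card B)\<bar> <= real (card B) * real (card B) * r"
   by (rule quad[of B W Y, OF sub(4) fin(3)]) (use eY in auto)
  ultimately show ?thesis using cD(2) unfolding e_def by linarith
 qed
 have c: "real (card B) * ta <= e"
 proof -
  have "real (card B) * ta <= real (card D) * ta" using cB pos by (intro mult_right_mono) auto
  thus ?thesis using cD(1) by (simp add: e_def)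
 qed
 have noflag: "~ ta < \<bar>score d Y W i\<bar>" if i: "i : G" for i
 proof -
  have v: "vsum Y W j = Z j - vsum X D j + vsum Y B j" if j: "j < d" for j
  proof -
   have "W = G \<union> B" by (auto simp: G_def B_def)
   hence "vsum Y W j = vsum Y G j + vsum Y B j" using vsum_disjoint[OF fin(2,3) dis(2)] by metis
   moreover have "vsum Y G j = vsum X G j" unfolding vsum_def using S j by (intro sum.cong) (auto simp: G_def)
   moreover have "{..<n} = G \<union> D" using W by (auto simp: G_def D_def)
   hence "Z j = vsum X G j + vsum X D j" unfolding Z_def using vsum_disjoint[OF fin(2,4) dis(1)] by metis
   ultimately show ?thesis by simp
  qed
  have YX: "Y i j = X i j" if "j < d" for j using S that i by (auto simp: G_def)
  have "ip d (vsum Y W) (Y i) = ip d (%j. (Z j - vsum X D j) + vsum Y B j) (Y i)" using v by (intro ip_cong) auto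
  also have "... = ip d Z (Y i) - ip d (vsum X D) (Y i) + ip d (vsum Y B) (Y i)" by (simp only: ip_add_left ip_diff_left)
  finally have "ip d (vsum Y W) (Y i) = ip d Z (Y i) - ip d (vsum X D) (Y i) + ip d (vsum Y B) (Y i)" .
  moreover have "ip d Z (Y i) = ip d Z (X i)" "ip d (vsum X D) (Y i) = ip d (vsum X D) (X i)" using YX by (auto intro!: ip_cong)
  ultimately have sc: "score d Y W i = (ip d Z (X i) - real d) - ip d (vsum X D) (X i) + ip d (vsum Y B) (Y i)" by (simp add: score_def)
  have "\<bar>ip d (vsum X D) (X i)\<bar> <= (SUM k:D. r)" unfolding ip_vsum_left
  proof (intro order_trans[OF sum_abs] sum_mono)
   fix k assume k: "k : D"
   hence "k ~= i" "k < n" "i < n" using i dis sub by auto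
   thus "\<bar>ip d (X k) (X i)\<bar> <= r" using eX[of k i] by (simp add: gram_def)
  qed
  hence 1: "\<bar>ip d (vsum X D) (X i)\<bar> <= ta / 4" using cD(3) by simp
  have "\<bar>ip d (vsum Y B) (Y i)\<bar> <= (SUM k:B. r)" unfolding ip_vsum_left
  proof (intro order_trans[OF sum_abs] sum_mono)
   fix k assume k: "k : B"
   hence "k ~= i" "k : W" "i : W" using i dis sub by auto
   thus "\<bar>ip d (Y k) (Y i)\<bar> <= r" using eY[of k i] by (simp add: gram_def)
  qed
  also have "... <= real (card D) * r" using cB pos by (simp add: mult_right_mono)
  finally have 2: "\<bar>ip d (vsum Y B) (Y i)\<bar> <= ta / 4" using cD(3) by simp
  have "i < n" using i sub by auto
  from ZX[OF this] 1 2 show ?thesis unfolding sc using pos by linarith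
 qed
 have fl: "(SUM i:G. if ta < \<bar>score d Y W i\<bar> then \<bar>score d Y W i\<bar> else 0) <= e" using noflag N2 by (simp add: e_def)
 show ?thesis
 proof (rule statistic_error[where S = S and X = X, OF W])
  show "!!i j. i : S ==> j < d ==> Y i j = X i j" by (rule S)
  show "0 <= ta" using pos by simp
 qed (use a b c fl g h in \<open>simp_all only: G_def B_def Z_def D_def e_def\<close>)
qed

section \<open>Filtering by the covariance matrix, for \<open>d <= n\<close>\<close>

definition cov :: "nat => (nat => nat => real) => real => nat set => nat => nat => real" where
 "cov d Y c W = (%a b. (SUM i:W. Y i a * Y i b) - (if a = b then c else 0))"

definition weight :: "nat => (nat => nat => real) => (nat => nat => real) => nat => real" where
 "weight d Y K i = (SUM a<d. (SUM b<d. K a b * Y i b)\<^sup>2)"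

definition frob :: "nat => (nat => nat => real) => real" where
 "frob d K = (SUM a<d. SUM b<d. (K a b)\<^sup>2)"

text \<open>Dyadic layers of weights. Above \<open>h * 2^k\<close> there can be at most
  \<open>be / (100 * (k+1)^2 * 2^k)\<close> good samples; a layer is cut only if it holds more than
  twice as many, so at least half of what is cut is corrupted. The factor \<open>(k+1)^2\<close>
  makes the mass of the uncut layers summable.\<close>

primrec cuts :: "(nat => real) => real => real => nat set => nat => nat set" where
 "cuts si h be W 0 = W"
| "cuts si h be W (Suc k) = (if be / (50 * (real k + 1)\<^sup>2 * 2 ^ k) < real (card {i : cuts si h be W k. h * 2 ^ k < si i})
  then {i : cuts si h be W k. ~ h * 2 ^ k < si i} else cuts si h be W k)"

text \<open>The shift is \<open>n - 4 * be * th\<close> instead of \<open>n\<close> to keep the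
  matrix positive semidefinite, see \<open>good_part\<close>. The weight of a sample is
  \<open>|K Y_i|^2\<close>, measured against \<open>th\<close> times the squared Frobenius norm of
  \<open>K\<close>.\<close>

definition tall_round :: "nat => nat => (nat => nat => real) => real => real => nat => nat set => nat set" where
 "tall_round n d Y th be p W =
  (let K = mpow d (cov d Y (real n - 4 * (be * th)) W) p
  in cuts (weight d Y K) (th * frob d K) be W (2 * p))"

lemma cuts_subset: "cuts si h be W k <= W" by (induction k) auto

lemma cuts_antimono: "k <= k' ==> cuts si h be W k' <= cuts si h be W k"
 by (induction k' rule: dec_induct) (auto split: if_splits)

lemma cuts_count:
 assumes "finite W" "k < ka" "be >= 0"
 shows "real (card {i : cuts si h be W ka. h * 2 ^ k < si i}) <= be / (50 * (real k + 1)\<^sup>2 * 2 ^ k)"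
proof -
 have "real (card {i : cuts si h be W (Suc k). h * 2 ^ k < si i}) <= be / (50 * (real k + 1)\<^sup>2 * 2 ^ k)"
 proof (cases "be / (50 * (real k + 1)\<^sup>2 * 2 ^ k) < real (card {i : cuts si h be W k. h * 2 ^ k < si i})")
  case True
  hence "{i : cuts si h be W (Suc k). h * 2 ^ k < si i} = {}" by auto
  thus ?thesis using assms(3) by (simp only: card.empty) simp
 next
  case False
  thus ?thesis by simp
 qed
 moreover have "card {i : cuts si h be W ka. h * 2 ^ k < si i} <= card {i : cuts si h be W (Suc k). h * 2 ^ k < si i}"
  using cuts_antimono[of "Suc k" ka si h be W] assms finite_subset[OF cuts_subset assms(1), of si h be "Suc k"] by (intro card_mono) auto
 ultimately show ?thesis by linarith
qed

text \<open>The invariant charges lost good samples to removed corrupted ones. It survives a cut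
  because the good part of the cut set is at most half of it.\<close>

lemma cuts_charge:
 assumes fin: "finite T" "W <= T" and ST: "S <= T"
  and good: "!!R k. k < ka ==> R <= S ==> (!!i. i : R ==> h * 2 ^ k < si i) ==>
   real (card R) <= be / (100 * (real k + 1)\<^sup>2 * 2 ^ k)"
  and inv: "card (S - W) <= card (T - S - W)" and "k <= ka"
 shows "card (S - cuts si h be W k) <= card (T - S - cuts si h be W k)" using \<open>k <= ka\<close>
proof (induction k)
 case (Suc k)
 let ?V = "cuts si h be W k"
 let ?Q = "{i : ?V. h * 2 ^ k < si i}"
 have V: "?V <= T" using cuts_subset fin(2) by blast
 have finV: "finite ?V" "finite S" using finite_subset[OF V fin(1)] finite_subset[OF ST fin(1)] .
 have finQ: "finite ?Q" using finV(1) by simp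
 show ?case
 proof (cases "be / (50 * (real k + 1)\<^sup>2 * 2 ^ k) < real (card ?Q)")
  case True
  hence eq: "cuts si h be W (Suc k) = {i : ?V. ~ h * 2 ^ k < si i}" by simp
  have "real (card (?Q \<inter> S)) <= be / (100 * (real k + 1)\<^sup>2 * 2 ^ k)" using Suc.prems by (intro good) auto
  moreover have "be / (50 * (real k + 1)\<^sup>2 * 2 ^ k) = 2 * (be / (100 * (real k + 1)\<^sup>2 * 2 ^ k))" by simp
  moreover have "card ?Q = card (?Q \<inter> S) + card (?Q - S)" using finQ by (rule card_Int_Diff)
  ultimately have QS: "card (?Q \<inter> S) <= card (?Q - S)" using True by linarith
  have "S - {i : ?V. ~ h * 2 ^ k < si i} = (S - ?V) \<union> (?Q \<inter> S)" by auto
  moreover have "(S - ?V) \<inter> (?Q \<inter> S) = {}" by auto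
  ultimately have 1: "card (S - {i : ?V. ~ h * 2 ^ k < si i}) = card (S - ?V) + card (?Q \<inter> S)" using finV finQ by (simp add: card_Un_disjoint)
  have "T - S - {i : ?V. ~ h * 2 ^ k < si i} = (T - S - ?V) \<union> (?Q - S)" using V by auto
  moreover have "(T - S - ?V) \<inter> (?Q - S) = {}" by auto
  ultimately have 2: "card (T - S - {i : ?V. ~ h * 2 ^ k < si i}) = card (T - S - ?V) + card (?Q - S)" using finQ fin by (simp add: card_Un_disjoint)
  show ?thesis unfolding eq 1 2 using QS Suc by simp
 next
  case False
  thus ?thesis using Suc by simp
 qed
qed (use inv in simp)

lemma sum_inverse_squares: "(SUM k<ka. 1 / (real k + 1)\<^sup>2) <= 2"
proof -
 have "(SUM k<Suc m. 1 / (real k + 1)\<^sup>2) <= 2 - 1 / (real m + 1)" for m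
 proof (induction m)
  case (Suc m)
  have "1 / (real (Suc m) + 1)\<^sup>2 <= 1 / ((real m + 1) * (real m + 2))"
  proof (intro divide_left_mono)
   show "(real m + 1) * (real m + 2) <= (real (Suc m) + 1)\<^sup>2" by (simp add: sq_eq algebra_simps)
   show "0 < (real (Suc m) + 1)\<^sup>2 * ((real m + 1) * (real m + 2))" by (intro mult_pos_pos zero_less_power) auto
  qed simp
  also have "... = 1 / (real m + 1) - 1 / (real (Suc m) + 1)" by (simp add: field_simps)
  finally show ?case using Suc by simp
 qed simp
 note * = this
 show ?thesis
 proof (cases ka)
  case (Suc m)
  have "0 <= 1 / (real m + 1)" by simp
  thus ?thesis unfolding Suc using *[of m] by linarith
 qed simp
qed

lemma layer_cake:
 fixes si h :: real
 assumes "h >= 0" "si <= h * 2 ^ ka"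
 shows "si <= h + (SUM k<ka. if h * 2 ^ k < si then h * 2 ^ Suc k else 0)" using assms(2)
proof (induction ka)
 case (Suc ka)
 show ?case
 proof (cases "h * 2 ^ ka < si")
  case True
  have "0 <= (SUM k<ka. if h * 2 ^ k < si then h * 2 ^ Suc k else 0)" using assms by (intro sum_nonneg) auto
  thus ?thesis using True Suc.prems assms by simp
 next
  case False
  thus ?thesis using Suc by simp
 qed
qed simp

text \<open>Layer cake: at most \<open>be / (50 * (k+1)^2 * 2^k)\<close> samples exceed
  \<open>h * 2^k\<close>, and each adds \<open>h * 2^(k+1)\<close>. Over all layers this is at most
  \<open>2/25 * be * h\<close>, on top of the base \<open>be * h\<close>.\<close>

lemma cuts_mass:
 assumes "finite W" "be >= 0" "h >= 0" "B <= cuts si h be W ka" "real (card B) <= be"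
  and top: "!!i. i : W ==> si i <= h * 2 ^ ka"
 shows "(SUM i:B. si i) <= 11 / 10 * be * h"
proof -
 let ?C = "cuts si h be W ka"
 have "finite ?C" by (rule finite_subset[OF cuts_subset assms(1)])
 note fin = this finite_subset[OF assms(4) this]
 have "(SUM i:B. si i) <= (SUM i:B. h + (SUM k<ka. if h * 2 ^ k < si i then h * 2 ^ Suc k else 0))"
  using assms(3) subsetD[OF assms(4)] subsetD[OF cuts_subset] by (intro sum_mono layer_cake top) blast+
 also have "... = real (card B) * h + (SUM k<ka. SUM i:B. if h * 2 ^ k < si i then h * 2 ^ Suc k else 0)"
  by (simp add: sum.distrib sum.swap[of _ B])
 also have "... <= be * h + (SUM k<ka. be * h / 25 * (1 / (real k + 1)\<^sup>2))"
 proof (intro add_mono sum_mono)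
  show "real (card B) * h <= be * h" using assms by (intro mult_right_mono) auto
  fix k assume "k : {..<ka}"
  hence k: "k < ka" by simp
  have "(SUM i:B. if h * 2 ^ k < si i then h * 2 ^ Suc k else 0) = (SUM i:{i\<in>B. h * 2 ^ k < si i}. h * 2 ^ Suc k)"
   by (rule sum.inter_filter[OF fin(2), symmetric])
  also have "... = real (card {i\<in>B. h * 2 ^ k < si i}) * (h * 2 ^ Suc k)" by simp
  also have "... <= be / (50 * (real k + 1)\<^sup>2 * 2 ^ k) * (h * 2 ^ Suc k)"
  proof (rule mult_right_mono)
   have "card {i\<in>B. h * 2 ^ k < si i} <= card {i\<in>?C. h * 2 ^ k < si i}" using fin assms by (intro card_mono) auto
   thus "real (card {i\<in>B. h * 2 ^ k < si i}) <= be / (50 * (real k + 1)\<^sup>2 * 2 ^ k)"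
    using cuts_count[OF assms(1) k assms(2), of si h] by linarith
  qed (use assms in simp)
  also have "... = be * h / 25 * (1 / (real k + 1)\<^sup>2)" by simp
  finally show "(SUM i:B. if h * 2 ^ k < si i then h * 2 ^ Suc k else 0) <= be * h / 25 * (1 / (real k + 1)\<^sup>2)" .
 qed
 also have "... = be * h + be * h / 25 * (SUM k<ka. 1 / (real k + 1)\<^sup>2)" by (simp only: sum_distrib_left)
 also have "... <= be * h + be * h / 25 * 2" using sum_inverse_squares assms by (intro add_left_mono mult_left_mono) auto
 also have "... <= 11 / 10 * be * h"
 proof -
  have "0 <= be * h" using assms by simp
  thus ?thesis by (simp add: field_simps)
 qed
 finally show ?thesis .
qed

lemma weight_ip: "weight d Y K i = (SUM a<d. (ip d (K a) (Y i))\<^sup>2)" by (simp add: weight_def ip_def)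

lemma frob_ip: "frob d K = (SUM a<d. ip d (K a) (K a))" by (simp add: frob_def ip_def sq_eq)

lemma bil_cov: "bil d (cov d Y c W) u u = (SUM i:W. (ip d u (Y i))\<^sup>2) - c * ip d u u" using sum_of_squares_bil[of u Y d W c] by (simp add: ip_def cov_def)

lemma symm_cov: "symm d (cov d Y c W)" by (auto simp: symm_def cov_def mult.commute)

lemma trpow_le_of_bil:
 assumes "symm m V" "psd m V" "!!u. bil m V u u <= b * ip m u u" "p >= 1" "b >= 0"
 shows "trpow m V p <= real m * b ^ p"
proof -
 obtain r U y where V: "spectral_decomp m V r U y" using spectral_theorem[OF assms(1)] by blast
 have "trpow m V p = (SUM a<r. y a ^ p)" by (rule trpow_spectral[OF V assms(4)])
 also have "... <= (SUM a<r. b ^ p)"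
 proof (intro sum_mono power_mono)
  fix a assume "a : {..<r}"
  hence a: "a < r" by simp
  show "0 <= y a" by (rule psd_eigenvalue[OF assms(2) V a])
  show "y a <= b" using assms(3)[of "U a"] spectral_eigenvalue[OF V a] ip_orthonormal[OF spectral_orthonormal[OF V] a a] by simp
 qed
 also have "... <= real m * b ^ p" using spectral_card_le[OF V] assms(5) by (simp add: mult_right_mono)
 finally show ?thesis .
qed

text \<open>\<open>restricted\<close> has one bound per dyadic layer; the factor one half at
  \<open>card R\<close> lets the number of heavy good samples bound itself. \<open>scale\<close>
  guarantees that \<open>2 * p\<close> layers reach the largest possible weight.\<close>

locale tall_filter =
 fixes n d :: nat and X Y :: "nat => nat => real" and S :: "nat set" and be th :: real and p :: nat
 assumes S: "S <= {..<n}" and XY: "!!i j. i : S ==> j < d ==> Y i j = X i j"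
  and bad: "real (card ({..<n} - S)) <= be" and be: "be > 0" and th: "th > 0" and p: "p >= 1"
  and full: "!!u. \<bar>(SUM i<n. (ip d u (X i))\<^sup>2) - real n * ip d u u\<bar> <= be * th * ip d u u"
  and restricted: "!!k R u. k < 2 * p ==> R <= {..<n} ==> (SUM i:R. (ip d u (X i))\<^sup>2)
   <= (real (card R) * (th * 2 ^ k) / 2 + be * th / (200 * (real k + 1)\<^sup>2)) * ip d u u"
  and scale: "real n * real d <= th * 2 ^ (2 * p)" and dp: "d <= 2 ^ (2 * p + 1)"
begin

definition "charged W \<longleftrightarrow> W <= {..<n} & card (S - W) <= card ({..<n} - S - W) &
 (ALL i:W. ip d (Y i) (Y i) <= real n * real d)"

abbreviation "V W == cov d Y (real n - 4 * (be * th)) W"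

lemma beth: "be * th > 0" using be th by simp

lemma ip_XY: "i : S ==> ip d u (Y i) = ip d u (X i)" using XY by (intro ip_cong) auto

lemma inv_card: "charged W ==> real (card ({..<n} - W \<inter> S)) <= 2 * be" "charged W ==> real (card (W - S)) <= be"
proof -
 assume W: "charged W"
 have finS: "finite S" using S finite_subset by blast
 have "card ({..<n} - W \<inter> S) <= card (({..<n} - S) \<union> (S - W))" using finS by (intro card_mono) auto
 also have "... <= card ({..<n} - S) + card (S - W)" by (rule card_Un_le)
 also have "card (S - W) <= card ({..<n} - S - W)" using W by (simp add: charged_def)
 also have "card ({..<n} - S - W) <= card ({..<n} - S)" by (intro card_mono) auto
 finally show "real (card ({..<n} - W \<inter> S)) <= 2 * be" using bad by linarith
 have "card (W - S) <= card ({..<n} - S)" using W by (intro card_mono) (auto simp: charged_def)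
 thus "real (card (W - S)) <= be" using bad by linarith
qed

text \<open>In any direction the at most \<open>2 * be\<close> missing clean samples cost at most
  \<open>3 * be * th\<close>, by \<open>restricted\<close> at \<open>k = 0\<close>, and
  \<open>full\<close> fluctuates by \<open>be * th\<close>. Their sum is the origin of the shift
  \<open>4 * be * th\<close>.\<close>

lemma good_part:
 assumes W: "charged W"
 shows "0 <= (SUM i:W \<inter> S. (ip d u (Y i))\<^sup>2) - (real n - 4 * (be * th)) * ip d u u"
  and "(SUM i:W \<inter> S. (ip d u (Y i))\<^sup>2) - (real n - 4 * (be * th)) * ip d u u <= 5 * (be * th) * ip d u u"
proof -
 let ?D = "{..<n} - W \<inter> S"
 have sub: "W \<inter> S <= {..<n}" using S by auto
 have eq: "(SUM i:W \<inter> S. (ip d u (Y i))\<^sup>2) = (SUM i:W \<inter> S. (ip d u (X i))\<^sup>2)" using ip_XY by (intro sum.cong) auto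
 have split: "(SUM i<n. (ip d u (X i))\<^sup>2) = (SUM i:W \<inter> S. (ip d u (X i))\<^sup>2) + (SUM i:?D. (ip d u (X i))\<^sup>2)"
  using sub by (metis add.commute finite_lessThan sum.subset_diff)
 have "(SUM i:?D. (ip d u (X i))\<^sup>2) <= (real (card ?D) * (th * 2 ^ 0) / 2 + be * th / (200 * (real 0 + 1)\<^sup>2)) * ip d u u"
  using p by (intro restricted) auto
 also have "... <= (2 * be * th / 2 + be * th / 200) * ip d u u"
  using inv_card(1)[OF W] th by (intro mult_right_mono add_mono divide_right_mono) (auto simp: ip_nonneg)
 also have "... <= 3 * (be * th) * ip d u u" using beth by (intro mult_right_mono) (auto simp: ip_nonneg)
 finally have D: "(SUM i:?D. (ip d u (X i))\<^sup>2) <= 3 * (be * th) * ip d u u" .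
 have D0: "0 <= (SUM i:?D. (ip d u (X i))\<^sup>2)" by (intro sum_nonneg) auto
 show "0 <= (SUM i:W \<inter> S. (ip d u (Y i))\<^sup>2) - (real n - 4 * (be * th)) * ip d u u"
  using full[of u] D unfolding eq split by (simp add: algebra_simps abs_le_iff)
 show "(SUM i:W \<inter> S. (ip d u (Y i))\<^sup>2) - (real n - 4 * (be * th)) * ip d u u <= 5 * (be * th) * ip d u u"
  using full[of u] D0 unfolding eq split by (simp add: algebra_simps abs_le_iff)
qed

lemma split_good: "charged W ==> (SUM i:W. f i) = (SUM i:W \<inter> S. f i) + (SUM i:W - S. f i :: real)"
 by (rule sum.Int_Diff) (auto simp: charged_def intro: finite_subset)

lemma psd_V: assumes "charged W" shows "psd d (V W)" unfolding psd_def bil_cov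
proof
 fix u
 have "0 <= (SUM i:W - S. (ip d u (Y i))\<^sup>2)" by (intro sum_nonneg) auto
 thus "0 <= (SUM i:W. (ip d u (Y i))\<^sup>2) - (real n - 4 * (be * th)) * ip d u u"
  using good_part(1)[OF assms, of u] split_good[OF assms, of "%i. (ip d u (Y i))\<^sup>2"] by linarith
qed

lemma round_inv:
 assumes W: "charged W"
 defines "W' == tall_round n d Y th be p W"
 shows "charged W'" and "trpow d (V W') (2 * p + 1) <= trpow d (V W) (2 * p + 1) / 4 + real d * (28 * (be * th)) ^ (2 * p + 1) / 4"
  and "trpow d (V W') (2 * p + 1) <= trpow d (V W) (2 * p + 1)"
proof -
 define K where "K = mpow d (V W) p"
 define H where "H = frob d K"
 define si where "si = weight d Y K"
 have W': "W' = cuts si (th * H) be W (2 * p)" by (simp add: W'_def tall_round_def K_def H_def si_def Let_def)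
 have sub: "W' <= W" unfolding W' by (rule cuts_subset)
 have finW: "finite W" "W <= {..<n}" using W finite_subset by (auto simp: charged_def)
 have H0: "H >= 0" by (simp add: H_def frob_def sum_nonneg)
 \<comment> \<open>The rows of \<open>K\<close> serve as test directions. Together the samples of
   \<open>R\<close> weigh more than \<open>card R * th * H * 2^k\<close>, while
   \<open>restricted\<close> allows half of this plus a remainder; so the remainder bounds the
   count.\<close>
 have good: "real (card R) <= be / (100 * (real k + 1)\<^sup>2 * 2 ^ k)"
  if k: "k < 2 * p" and R: "R <= S" and big: "!!i. i : R ==> th * H * 2 ^ k < si i" for R k
 proof (cases "R = {}")
  case False
  have finR: "finite R" using R S finite_subset by (meson finite_lessThan)
  have "real (card R) * (th * H * 2 ^ k) = (SUM i:R. th * H * 2 ^ k)" by simp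
  also have "... < (SUM i:R. si i)" using False finR big by (intro sum_strict_mono) auto
  also have "(SUM i:R. si i) = (SUM a<d. SUM i:R. (ip d (K a) (X i))\<^sup>2)"
   unfolding si_def weight_ip using ip_XY R by (subst sum.swap) (auto intro!: sum.cong)
  also have "... <= (SUM a<d. (real (card R) * (th * 2 ^ k) / 2 + be * th / (200 * (real k + 1)\<^sup>2)) * ip d (K a) (K a))"
   using k R S by (intro sum_mono restricted) auto
  also have "... = (real (card R) * (th * 2 ^ k) / 2 + be * th / (200 * (real k + 1)\<^sup>2)) * H"
   unfolding H_def frob_ip by (simp add: sum_distrib_left)
  finally have *: "real (card R) * (th * H * 2 ^ k) < (real (card R) * (th * 2 ^ k) / 2 + be * th / (200 * (real k + 1)\<^sup>2)) * H" .
  hence "H ~= 0" by auto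
  hence "H * th > 0" using H0 th by simp
  moreover have "(H * th) * (real (card R) * 2 ^ k) < (H * th) * (real (card R) * 2 ^ k / 2 + be / (200 * (real k + 1)\<^sup>2))"
   using * by (simp add: algebra_simps)
  ultimately have "real (card R) * 2 ^ k < real (card R) * 2 ^ k / 2 + be / (200 * (real k + 1)\<^sup>2)" by (simp only: mult_less_cancel_left_pos)
  moreover have "be / (100 * (real k + 1)\<^sup>2) = 2 * (be / (200 * (real k + 1)\<^sup>2))" by simp
  ultimately have "real (card R) * 2 ^ k < be / (100 * (real k + 1)\<^sup>2)" by linarith
  hence "real (card R) < be / (100 * (real k + 1)\<^sup>2) / 2 ^ k" by (rule pos_less_divide_eq[THEN iffD2, rotated]) simp
  thus ?thesis unfolding divide_divide_eq_left by (rule less_imp_le)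
 qed (use be in simp)
 have charge: "card (S - W') <= card ({..<n} - S - W')" unfolding W'
  by (rule cuts_charge[where ka = "2 * p"]) (use finW S good W in \<open>auto simp: charged_def\<close>)
 show inv': "charged W'" unfolding charged_def using charge sub W by (auto simp: charged_def)
 have top: "si i <= th * H * 2 ^ (2 * p)" if i: "i : W" for i
 proof -
  have "si i <= (SUM a<d. ip d (K a) (K a) * ip d (Y i) (Y i))" unfolding si_def weight_ip by (intro sum_mono ip_Cauchy_Schwarz)
  also have "... = H * ip d (Y i) (Y i)" by (simp add: H_def frob_ip sum_distrib_right)
  also have "... <= H * (real n * real d)" using W i H0 by (intro mult_left_mono) (auto simp: charged_def)
  also have "... <= H * (th * 2 ^ (2 * p))" using scale H0 by (intro mult_left_mono)
  finally show ?thesis by (simp add: mult_ac)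
 qed
 have mass: "(SUM i:W' - S. si i) <= 11 / 10 * be * (th * H)" unfolding W'
  by (rule cuts_mass) (use finW be th H0 top inv_card(2)[OF inv'] in \<open>auto simp: W'\<close>)
 \<comment> \<open>Good survivors contribute at most \<open>5 * be * th * H\<close> and corrupted
   ones \<open>11/10 * be * th * H\<close>. The total is rounded up to the constant 7, from which
   \<open>trpow_round\<close> makes the floor \<open>28 = 4 * 7\<close>.\<close>
 have "(SUM a<d. bil d (V W') (K a) (K a)) = (SUM a<d. ((SUM i:W' \<inter> S. (ip d (K a) (Y i))\<^sup>2)
   - (real n - 4 * (be * th)) * ip d (K a) (K a)) + (SUM i:W' - S. (ip d (K a) (Y i))\<^sup>2))"
  unfolding bil_cov split_good[OF inv'] by (intro sum.cong) auto
 also have "... <= (SUM a<d. 5 * (be * th) * ip d (K a) (K a) + (SUM i:W' - S. (ip d (K a) (Y i))\<^sup>2))"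
  using good_part(2)[OF inv'] by (intro sum_mono add_mono) auto
 also have "... = 5 * (be * th) * H + (SUM i:W' - S. si i)"
  unfolding sum.distrib H_def frob_ip si_def weight_ip by (simp add: sum_distrib_left sum.swap[of _ "W' - S"])
 also have "... <= 7 * (be * th) * H"
 proof -
  have "11 / 10 * be * (th * H) = 11 / 10 * (be * th * H)" by simp
  moreover have "0 <= be * th * H" using beth H0 by simp
  ultimately show ?thesis using mass by argo
 qed
 finally have small: "(SUM a<d. bil d (V W') (mpow d (V W) p a) (mpow d (V W) p a))
   <= 7 * (be * th) * (SUM a<d. SUM b<d. (mpow d (V W) p a b)\<^sup>2)" unfolding K_def H_def frob_def .
 have le: "bil d (V W') u u <= bil d (V W) u u" for u unfolding bil_cov using sub finW by (intro diff_right_mono sum_mono2) auto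
 have k0: "0 <= 7 * (be * th)" using beth by simp
 note r = trpow_round[OF symm_cov symm_cov psd_V[OF W] psd_V[OF inv'] le p k0 small]
 show "trpow d (V W') (2 * p + 1) <= trpow d (V W) (2 * p + 1) / 4 + real d * (28 * (be * th)) ^ (2 * p + 1) / 4" using r(1) by simp
 show "trpow d (V W') (2 * p + 1) <= trpow d (V W) (2 * p + 1)" by (rule r(2))
qed

text \<open>Above the floor the two quarters in \<open>round_inv\<close> add up to at most one half,
  so the potential is halved until it reaches the floor.\<close>

lemma rounds_inv:
 assumes W: "charged W"
 shows "charged ((tall_round n d Y th be p ^^ J) W) &
  trpow d (V ((tall_round n d Y th be p ^^ J) W)) (2 * p + 1)
   <= max (real d * (28 * (be * th)) ^ (2 * p + 1)) (trpow d (V W) (2 * p + 1) / 2 ^ J)"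
proof (induction J)
 case (Suc J)
 let ?W = "(tall_round n d Y th be p ^^ J) W"
 let ?F = "real d * (28 * (be * th)) ^ (2 * p + 1)" and ?Ph = "%W. trpow d (V W) (2 * p + 1)"
 have i: "charged ?W" and f: "?Ph ?W <= max ?F (?Ph W / 2 ^ J)" using Suc by auto
 note r = round_inv[OF i]
 have "?Ph (tall_round n d Y th be p ?W) <= max ?F (?Ph W / 2 ^ Suc J)"
 proof (cases "?Ph ?W <= ?F")
  case True
  thus ?thesis using r(3) by linarith
 next
  case False
  hence "?Ph ?W <= ?Ph W / 2 ^ J" using f by linarith
  moreover have "?Ph (tall_round n d Y th be p ?W) <= ?Ph ?W / 2" using r(2) False by linarith
  moreover have "x <= z ==> y <= x / 2 ==> y <= z / 2" for x y z :: real by linarith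
  ultimately have "?Ph (tall_round n d Y th be p ?W) <= ?Ph W / 2 ^ J / 2" by blast
  thus ?thesis by (simp add: le_max_iff_disj mult.commute)
 qed
 thus ?case using r(1) by simp
qed (use W in simp)

text \<open>\<open>J\<close> provides enough halvings to reach the floor, where
  \<open>trpow_bound_psd\<close> bounds the shifted covariance by \<open>56 * be * th\<close>. As
  the good part alone is nonnegative, the same bound holds for the second moments of the corrupted
  survivors, and \<open>signed_sum_bound\<close> passes to their sum.\<close>

lemma filter_result:
 assumes W0: "!!i. i : S ==> ip d (X i) (X i) <= real n * real d"
  and J: "(real n * (real n * real d) + 4 * (be * th)) ^ (2 * p + 1) <= 2 ^ J * (28 * (be * th)) ^ (2 * p + 1)"
 defines "W == (tall_round n d Y th be p ^^ J) {i\<in>{..<n}. ip d (Y i) (Y i) <= real n * real d}"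
 shows "W <= {..<n}" "real (card ({..<n} - W \<inter> S)) <= 2 * be" "real (card (W - S)) <= be"
  and "ip d (vsum Y (W - S)) (vsum Y (W - S)) <= 56 * (be\<^sup>2 * th)"
proof -
 let ?W0 = "{i\<in>{..<n}. ip d (Y i) (Y i) <= real n * real d}"
 have "ip d (Y i) (Y i) = ip d (X i) (X i)" if "i : S" for i using XY[OF that] by (intro ip_cong) auto
 hence "S - ?W0 = {}" using S W0 by auto
 hence "card (S - ?W0) <= card ({..<n} - S - ?W0)" by (simp only: card.empty)
 hence i0: "charged ?W0" by (simp add: charged_def subset_eq)
 note r = rounds_inv[OF i0, of J, folded W_def]
 hence iW: "charged W" by blast
 thus "W <= {..<n}" by (simp add: charged_def)
 show "real (card ({..<n} - W \<inter> S)) <= 2 * be" and cB: "real (card (W - S)) <= be" using inv_card[OF iW] .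
 let ?b = "real n * (real n * real d) + 4 * (be * th)"
 have "trpow d (V ?W0) (2 * p + 1) <= real d * ?b ^ (2 * p + 1)"
 proof (rule trpow_le_of_bil[OF symm_cov psd_V[OF i0]])
  fix u
  have "(SUM i:?W0. (ip d u (Y i))\<^sup>2) <= (SUM i:?W0. ip d u u * (real n * real d))"
  proof (rule sum_mono)
   fix i assume i: "i : ?W0"
   have "(ip d u (Y i))\<^sup>2 <= ip d u u * ip d (Y i) (Y i)" by (rule ip_Cauchy_Schwarz)
   also have "... <= ip d u u * (real n * real d)" using i by (intro mult_left_mono) (auto simp: ip_nonneg)
   finally show "(ip d u (Y i))\<^sup>2 <= ip d u u * (real n * real d)" .
  qed
  also have "... = real (card ?W0) * (ip d u u * (real n * real d))" by simp
  also have "... <= real n * (ip d u u * (real n * real d))"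
  proof (rule mult_right_mono)
   have "card ?W0 <= card {..<n}" by (intro card_mono) auto
   thus "real (card ?W0) <= real n" by simp
  qed (simp add: ip_nonneg)
  finally have "(SUM i:?W0. (ip d u (Y i))\<^sup>2) <= real n * (real n * real d) * ip d u u" by (simp add: mult_ac)
  moreover have "0 <= real n * ip d u u" by (simp add: ip_nonneg)
  ultimately show "bil d (V ?W0) u u <= ?b * ip d u u" unfolding bil_cov by (simp add: algebra_simps)
 qed (use beth in auto)
 also have "... <= real d * (2 ^ J * (28 * (be * th)) ^ (2 * p + 1))" using J by (intro mult_left_mono) auto
 finally have "trpow d (V ?W0) (2 * p + 1) / 2 ^ J <= real d * (28 * (be * th)) ^ (2 * p + 1)" by (simp add: field_simps)
 hence tr: "trpow d (V W) (2 * p + 1) <= real d * (28 * (be * th)) ^ (2 * p + 1)" using r by linarith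
 have bd: "bil d (V W) u u <= 2 * (28 * (be * th)) * ip d u u" for u
  by (rule trpow_bound_psd[OF symm_cov psd_V[OF iW] tr _ dp]) (use beth in auto)
 have "(SUM i:W - S. (ip d u (Y i))\<^sup>2) <= (56 * (be * th)) * ip d u u" for u
  using bd[of u] good_part(1)[OF iW, of u] split_good[OF iW, of "%i. (ip d u (Y i))\<^sup>2"] unfolding bil_cov by simp
 hence "ip d (%j. SUM i:W - S. 1 * Y i j) (%j. SUM i:W - S. 1 * Y i j) <= real (card (W - S)) * (56 * (be * th))"
  using beth iW by (intro signed_sum_bound) (auto simp: charged_def intro: finite_subset)
 also have "... <= be * (56 * (be * th))" using cB beth by (intro mult_right_mono) auto
 also have "... = 56 * (be\<^sup>2 * th)" by (simp add: sq_eq)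
 finally show "ip d (vsum Y (W - S)) (vsum Y (W - S)) <= 56 * (be\<^sup>2 * th)" by (simp add: vsum_def)
qed

end

section \<open>Filtering by the Gram matrix, for \<open>n < d\<close>\<close>

definition row_weight :: "nat => (nat => nat => real) => nat => real" where
 "row_weight n K i = (SUM j<n. (K i j)\<^sup>2)"

text \<open>By Markov's inequality at most \<open>8 * be\<close> rows exceed the threshold, good
  ones among them. There is no charging here; the loss accumulates over the rounds and is tolerated
  through \<open>M\<close> in \<open>statistic_wide\<close>.\<close>

definition wide_round :: "nat => nat => (nat => nat => real) => real => nat => nat set => nat set" where
 "wide_round n d Y be p W =
  (let K = mpow n (gram d Y W) p in {i : W. ~ frob n K / (8 * be) < row_weight n K i})"

lemma frob_mpow: "symm m N ==> s >= 1 ==> frob m (mpow m N s) = trpow m N (2 * s)"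
 using spectral_theorem[of m N] mpow_norm[of m N _ _ _ s] trpow_spectral[of m N _ _ _ "2 * s"] by (fastforce simp: frob_def)

lemma trpow_even_le_of_bil:
 assumes "symm m N" "!!u. \<bar>bil m N u u\<bar> <= b * ip m u u" "s >= 1"
 shows "trpow m N (2 * s) <= real m * b ^ (2 * s)"
proof -
 obtain r U y where V: "spectral_decomp m N r U y" using spectral_theorem[OF assms(1)] by blast
 have "trpow m N (2 * s) = (SUM a<r. \<bar>y a\<bar> ^ (2 * s))" using assms(3) by (simp add: trpow_spectral[OF V] power_even_abs)
 also have "... <= (SUM a<r. b ^ (2 * s))"
 proof (intro sum_mono power_mono)
  fix a assume "a : {..<r}"
  hence a: "a < r" by simp
  show "\<bar>y a\<bar> <= b" using assms(2)[of "U a"] spectral_eigenvalue[OF V a] ip_orthonormal[OF spectral_orthonormal[OF V] a a] by simp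
 qed simp
 also have "... = real r * b ^ (2 * s)" by simp
 also have "... <= real m * b ^ (2 * s)" using spectral_card_le[OF V] by (intro mult_right_mono) auto
 finally show ?thesis .
qed

text \<open>Crude, but the initial potential enters only through its logarithm, the number of
  rounds.\<close>

lemma bil_entries_bound:
 assumes "!!i j. i < m ==> j < m ==> \<bar>N i j\<bar> <= c" "c >= 0"
 shows "\<bar>bil m N x x\<bar> <= real m * c * ip m x x"
proof -
 have "\<bar>bil m N x x\<bar> <= (SUM i<m. SUM j<m. \<bar>N i j * x i * x j\<bar>)"
  unfolding bil_def by (rule order_trans[OF sum_abs], rule sum_mono, rule sum_abs)
 also have "... <= (SUM i<m. SUM j<m. c * (\<bar>x i\<bar> * \<bar>x j\<bar>))"
  using assms by (intro sum_mono) (auto simp: abs_mult mult.assoc intro!: mult_right_mono)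
 also have "... = c * (SUM i<m. 1 * \<bar>x i\<bar>)\<^sup>2" unfolding sq_eq sum_product by (simp add: sum_distrib_left)
 also have "... <= c * (real m * ip m x x)"
 proof (rule mult_left_mono[OF _ assms(2)])
  have "(SUM i<m. 1 * \<bar>x i\<bar>)\<^sup>2 <= (SUM i<m. 1\<^sup>2) * (SUM i<m. \<bar>x i\<bar>\<^sup>2)" by (rule Cauchy_Schwarz_ineq_sum)
  thus "(SUM i<m. 1 * \<bar>x i\<bar>)\<^sup>2 <= real m * ip m x x" by (simp add: ip_def sq_eq)
 qed
 finally show ?thesis by (simp add: mult_ac)
qed

locale wide_filter =
 fixes n d :: nat and X Y :: "nat => nat => real" and S :: "nat set" and be rh :: real and p :: nat
 assumes S: "S <= {..<n}" and XY: "!!i j. i : S ==> j < d ==> Y i j = X i j"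
  and bad: "real (card ({..<n} - S)) <= be" and be: "be > 0" and rh: "rh > 0" and p: "p >= 1"
  and gX: "!!x. \<bar>bil n (gram d X {..<n}) x x\<bar> <= rh * ip n x x"
  and np: "n <= 2 ^ (2 * p)"
begin

abbreviation "Ph W == trpow n (gram d Y W) (2 * p)"

text \<open>Above the floor \<open>bad_mass\<close> puts a quarter of the potential on corrupted
  rows. At most \<open>be\<close> of them survive, each with at most \<open>1 / (8 * be)\<close> of
  the potential, so at least an eighth disappears; \<open>trpow_principal_submatrix\<close> converts
  the surviving row mass into the new potential.\<close>

lemma wide_round_step:
 assumes W: "W <= {..<n}"
 defines "W' == wide_round n d Y be p W"
 shows "W' <= W" "real (card (W - W')) <= 8 * be" "Ph W' <= Ph W"
  and "real n * (8 * rh) ^ (2 * p) <= Ph W ==> Ph W' <= 7 / 8 * Ph W"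
proof -
 define N where "N = gram d Y W"
 define K where "K = mpow n N p"
 define si where "si = row_weight n K"
 have symN: "symm n N" unfolding N_def by (rule symm_gram)
 have f: "frob n K = Ph W" unfolding K_def N_def using frob_mpow[OF symm_gram p] .
 have si0: "0 <= si i" for i by (simp add: si_def row_weight_def sum_nonneg)
 have fsi: "Ph W = (SUM i<n. si i)" unfolding f[symmetric] by (simp add: frob_def si_def row_weight_def)
 have f0: "Ph W >= 0" unfolding fsi by (intro sum_nonneg si0)
 have W': "W' = {i : W. ~ Ph W / (8 * be) < si i}" unfolding W'_def wide_round_def Let_def si_def f[symmetric] K_def N_def ..
 show sub: "W' <= W" unfolding W' by auto
 have finW: "finite W" using W finite_subset by blast
 have le: "(SUM i:T. si i) <= Ph W" if "T <= {..<n}" for T unfolding fsi using that si0 by (intro sum_mono2) auto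
 show "real (card (W - W')) <= 8 * be"
 proof (cases "W - W' = {}")
  case False
  have "real (card (W - W')) * (Ph W / (8 * be)) = (SUM i:W - W'. Ph W / (8 * be))" by simp
  also have "... < (SUM i:W - W'. si i)" using False finW by (intro sum_strict_mono) (auto simp: W')
  also have "... <= Ph W" using W by (intro le) auto
  finally have *: "real (card (W - W')) * (Ph W / (8 * be)) < Ph W" .
  hence "Ph W ~= 0" by auto
  hence "Ph W > 0" using f0 by simp
  moreover have "Ph W * real (card (W - W')) < Ph W * (8 * be)" using * be by (simp add: field_simps)
  ultimately show ?thesis by (simp only: mult_less_cancel_left_pos less_imp_le)
 next
  case True
  hence "card (W - W') = 0" by (simp only: card.empty)
  thus ?thesis using be by simp
 qed
 have "gram d Y W' = (%i j. if i : W' & j : W' then N i j else 0)" using sub by (auto simp: gram_def N_def fun_eq_iff)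
 hence "Ph W' <= (SUM i:W' \<inter> {..<n}. SUM j<n. (mpow n N p i j)\<^sup>2)" using trpow_principal_submatrix[OF symN p, of W'] by simp
 also have "W' \<inter> {..<n} = W'" using sub W by auto
 finally have pr: "Ph W' <= (SUM i:W'. si i)" by (simp add: si_def row_weight_def K_def)
 thus "Ph W' <= Ph W" using le[of W'] sub W by (meson order_trans)
 assume large: "real n * (8 * rh) ^ (2 * p) <= Ph W"
 have "Ph W / 4 <= (SUM i:W - S. si i)" unfolding si_def row_weight_def K_def N_def
 proof (rule bad_mass[where S = "W \<inter> S" and rh = rh, OF symm_gram p])
  show "\<bar>bil n (gram d Y W) x x\<bar> <= rh * ip n x x" if x: "!!i. i \<notin> W \<inter> S ==> x i = 0" for x
  proof -
   have "bil n (gram d Y W) x x = bil n (gram d X {..<n}) x x" unfolding bil_def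
   proof (intro sum.cong refl)
    fix i j assume ij: "i : {..<n}" "j : {..<n}"
    show "gram d Y W i j * x i * x j = gram d X {..<n} i j * x i * x j"
    proof (cases "i : W \<inter> S & j : W \<inter> S")
     case True
     hence "ip d (Y i) (Y j) = ip d (X i) (X j)" using XY by (intro ip_cong) auto
     thus ?thesis using True ij by (simp add: gram_def)
    next
     case False
     thus ?thesis using x by auto
    qed
   qed
   thus ?thesis using gX by simp
  qed
 qed (use W large rh in \<open>auto simp: gram_def\<close>)
 moreover have "(SUM i:W'. si i) = (SUM i:W' \<inter> S. si i) + (SUM i:W' - S. si i)"
  using finite_subset[OF sub finW] by (rule sum.Int_Diff)
 moreover have "(SUM i:W' \<inter> S. si i) <= (SUM i:W \<inter> S. si i)" using sub finW si0 by (intro sum_mono2) auto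
 moreover have "(SUM i:W \<inter> S. si i) + (SUM i:W - S. si i) <= Ph W" using le[OF W] sum.Int_Diff[OF finW, of si S] by simp
 moreover have "(SUM i:W' - S. si i) <= Ph W / 8"
 proof -
  have "(SUM i:W' - S. si i) <= (SUM i:W' - S. Ph W / (8 * be))" by (intro sum_mono) (auto simp: W')
  also have "... = real (card (W' - S)) * (Ph W / (8 * be))" by simp
  also have "... <= be * (Ph W / (8 * be))"
  proof (rule mult_right_mono)
   have "card (W' - S) <= card ({..<n} - S)" using sub W by (intro card_mono) auto
   thus "real (card (W' - S)) <= be" using bad by linarith
  qed (use f0 be in simp)
  also have "... = Ph W / 8" using be by simp
  finally show ?thesis .
 qed
 ultimately show "Ph W' <= 7 / 8 * Ph W" using pr by linarith
qed

lemma wide_rounds: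
 assumes W: "W <= {..<n}"
 shows "(wide_round n d Y be p ^^ J) W <= W &
  real (card (W - (wide_round n d Y be p ^^ J) W)) <= 8 * be * real J &
  Ph ((wide_round n d Y be p ^^ J) W) <= max (real n * (8 * rh) ^ (2 * p)) (Ph W * (7 / 8) ^ J)"
proof (induction J)
 case (Suc J)
 let ?W = "(wide_round n d Y be p ^^ J) W" and ?F = "real n * (8 * rh) ^ (2 * p)"
 let ?W' = "wide_round n d Y be p ?W"
 have sub: "?W <= W" using Suc by blast
 hence "?W <= {..<n}" using W by blast
 note r = wide_round_step[OF this]
 have finW: "finite W" using W finite_subset by blast
 have 1: "?W' <= W" using r(1) sub by blast
 have "card (W - ?W') <= card ((W - ?W) \<union> (?W - ?W'))" using finW finite_subset[OF sub finW] by (intro card_mono) auto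
 also have "... <= card (W - ?W) + card (?W - ?W')" by (rule card_Un_le)
 finally have "real (card (W - ?W')) <= 8 * be * real J + 8 * be" using Suc r(2) by linarith
 hence 2: "real (card (W - ?W')) <= 8 * be * real (Suc J)" by (simp add: algebra_simps)
 have 3: "Ph ?W' <= max ?F (Ph W * (7 / 8) ^ Suc J)"
 proof (cases "?F <= Ph ?W")
  case False
  thus ?thesis using r(3) by linarith
 next
  case True
  show ?thesis
  proof (cases "Ph ?W <= ?F")
   case True thus ?thesis using r(3) by linarith
  next
   case False
   hence "Ph ?W <= Ph W * (7 / 8) ^ J" using Suc by linarith
   hence "7 / 8 * Ph ?W <= 7 / 8 * (Ph W * (7 / 8) ^ J)" by (intro mult_left_mono) auto
   hence "Ph ?W' <= Ph W * (7 / 8) ^ Suc J" using r(4)[OF True] by (simp add: mult_ac)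
   thus ?thesis by simp
  qed
 qed
 show ?case using 1 2 3 by simp
qed simp

text \<open>The loss \<open>be * (2 + 8 * J)\<close> collects the corrupted samples and
  \<open>8 * be\<close> removals per round. The constant 16 is the floor constant 8 of
  \<open>bad_mass\<close> times the factor 2 of \<open>trpow_bound_even\<close>.\<close>

lemma wide_filter_result:
 assumes W0: "!!i. i : S ==> ip d (X i) (X i) <= real n * real d"
  and J: "(real n * (real n * real d + real d)) ^ (2 * p) * (7 / 8) ^ J <= (8 * rh) ^ (2 * p)"
 defines "W == (wide_round n d Y be p ^^ J) {i\<in>{..<n}. ip d (Y i) (Y i) <= real n * real d}"
 shows "W <= {..<n}" "real (card ({..<n} - W \<inter> S)) <= be * (2 + 8 * real J)" "real (card (W - S)) <= be"
  and "\<bar>bil n (gram d Y W) x x\<bar> <= 16 * rh * ip n x x"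
proof -
 let ?W0 = "{i\<in>{..<n}. ip d (Y i) (Y i) <= real n * real d}"
 have "ip d (Y i) (Y i) = ip d (X i) (X i)" if "i : S" for i using XY[OF that] by (intro ip_cong) auto
 hence SW: "S <= ?W0" using S W0 by auto
 have w0: "?W0 <= {..<n}" by auto
 note r = wide_rounds[OF w0, of J, folded W_def]
 show Wn: "W <= {..<n}" using r by blast
 have "card ({..<n} - W \<inter> S) <= card (({..<n} - S) \<union> (?W0 - W))" using SW by (intro card_mono) auto
 also have "... <= card ({..<n} - S) + card (?W0 - W)" by (rule card_Un_le)
 finally have "real (card ({..<n} - W \<inter> S)) <= be + 8 * be * real J" using r bad by linarith
 also have "... <= be * (2 + 8 * real J)" using be by (simp add: algebra_simps)
 finally show "real (card ({..<n} - W \<inter> S)) <= be * (2 + 8 * real J)" .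
 have "card (W - S) <= card ({..<n} - S)" using Wn by (intro card_mono) auto
 thus "real (card (W - S)) <= be" using bad by linarith
 let ?c = "real n * real d + real d"
 have ent: "\<bar>gram d Y ?W0 i j\<bar> <= ?c" for i j
 proof (cases "i : ?W0 & j : ?W0")
  case True
  have "\<bar>ip d (Y i) (Y j)\<bar> <= sqrt (real n * real d) * sqrt (real n * real d)" using True by (intro ip_abs_le) auto
  hence "\<bar>ip d (Y i) (Y j)\<bar> <= real n * real d" by simp
  thus ?thesis using True by (auto simp: gram_def abs_le_iff)
 qed (auto simp: gram_def)
 have "Ph ?W0 <= real n * (real n * ?c) ^ (2 * p)" using ent by (intro trpow_even_le_of_bil symm_gram p bil_entries_bound) auto
 hence "Ph ?W0 * (7 / 8) ^ J <= real n * (real n * ?c) ^ (2 * p) * (7 / 8) ^ J" by (intro mult_right_mono) auto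
 also have "... <= real n * (8 * rh) ^ (2 * p)" using J by (simp add: mult.assoc mult_left_mono)
 finally have tr: "Ph W <= real n * (8 * rh) ^ (2 * p)" using r by linarith
 have "\<bar>bil n (gram d Y W) x x\<bar> <= 2 * (8 * rh) * (sqrt (ip n x x) * sqrt (ip n x x))"
  by (rule trpow_bound_even[OF symm_gram tr p np]) (use rh in simp)
 thus "\<bar>bil n (gram d Y W) x x\<bar> <= 16 * rh * ip n x x" by (simp add: ip_nonneg)
qed

end

text \<open>Greedy removal of conflicting pairs: each removed pair contains a corrupted point.\<close>

primrec remove_pairs :: "(nat => nat => bool) => nat set => (nat \<times> nat) list => nat set" where
 "remove_pairs c W [] = W"
| "remove_pairs c W (q # qs) = remove_pairs c
  (if fst q : W & snd q : W & c (fst q) (snd q) then W - {fst q, snd q} else W) qs"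

lemma remove_pairs_subset: "remove_pairs c W qs <= W"
proof (induction qs arbitrary: W)
 case (Cons q qs)
 show ?case using Cons[of "if fst q : W & snd q : W & c (fst q) (snd q) then W - {fst q, snd q} else W"] by (auto split: if_splits)
qed simp

lemma remove_pairs_conflict_free:
 "(i, j) : set qs ==> i : remove_pairs c W qs ==> j : remove_pairs c W qs ==> ~ c i j"
proof (induction qs arbitrary: W)
 case (Cons q qs)
 let ?W = "if fst q : W & snd q : W & c (fst q) (snd q) then W - {fst q, snd q} else W"
 show ?case
 proof (cases "q = (i, j)")
  case True
  have "i : ?W" "j : ?W" using Cons.prems(2,3) subsetD[OF remove_pairs_subset, of _ c ?W qs] by simp_all
  thus ?thesis using True by (auto split: if_splits)
 next
  case False
  thus ?thesis using Cons.IH[of ?W] Cons.prems by simp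
 qed
qed simp

text \<open>Good samples do not conflict with each other, so each removed pair contains a corrupted
  one and costs at most one good sample.\<close>

lemma remove_pairs_charge:
 assumes "finite T" "W <= T" "S <= T" "!!i j. i : S ==> j : S ==> ~ c i j"
  "card (S - W) <= card (T - S - W)"
 shows "card (S - remove_pairs c W qs) <= card (T - S - remove_pairs c W qs)" using assms(2,5)
proof (induction qs arbitrary: W)
 case (Cons q qs)
 show ?case
 proof (cases "fst q : W & snd q : W & c (fst q) (snd q)")
  case True
  let ?W = "W - {fst q, snd q}"
  have "card (S - ?W) <= card (T - S - ?W)"
  proof -
   obtain b g where bg: "{fst q, snd q} = {b, g}" "b \<notin> S" "b : W"
   proof (cases "fst q : S")
    case True
    thus ?thesis using that[of "snd q" "fst q"] assms(4)[of "fst q" "snd q"] \<open>fst q : W & snd q : W & c (fst q) (snd q)\<close>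
     by (auto simp: insert_commute)
   next
    case False
    thus ?thesis using that[of "fst q" "snd q"] \<open>fst q : W & snd q : W & c (fst q) (snd q)\<close> by auto
   qed
   have fin: "finite S" "finite W" using finite_subset[OF assms(3,1)] finite_subset[OF Cons.prems(1) assms(1)] .
   have "card (S - ?W) <= card (insert g (S - W))" using fin bg by (intro card_mono) auto
   also have "... <= Suc (card (S - W))" by (simp add: card_insert_le_m1 card_insert_if fin)
   also have "... <= Suc (card (T - S - W))" using Cons.prems by simp
   also have "... = card (insert b (T - S - W))" using bg assms(1) by simp
   also have "... <= card (T - S - ?W)" using bg assms(1) Cons.prems by (intro card_mono) auto
   finally show ?thesis .
  qed
  thus ?thesis using True Cons.IH[of ?W] Cons.prems by auto
 next
  case False
  thus ?thesis using Cons by auto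
 qed
qed simp

section \<open>A structured language compiled to the real RAM\<close>

definition seti :: "nat => nat => state => state" where
 "seti r x s = s\<lparr>ireg := (ireg s)(r := x)\<rparr>"

lemma seti_simps [simp]:
 "ireg (seti r x s) = (ireg s)(r := x)" "rreg (seti r x s) = rreg s"
 "iarr (seti r x s) = iarr s" "rarr (seti r x s) = rarr s" by (simp_all add: seti_def)

datatype rex = Reg nat | Nt nat | Con nat | Ld nat nat nat
 | Add rex rex | Sub rex rex | Mul rex rex | Dvd rex rex | IfLt rex rex rex rex | Sm nat rex

text \<open>Bound variables are loop counters kept in integer registers: \<open>v\<close> is the first free one, so a
  sum at depth \<open>v\<close> binds register \<open>v\<close>.  Matrices are addressed through the table of row offsets in
  integer array 0.\<close>

primrec eval :: "nat => rex => state => real" where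
 "eval v (Reg x) s = rreg s x"
| "eval v (Nt i) s = real (ireg s i)"
| "eval v (Con c) s = real c"
| "eval v (Ld a i j) s = rarr s a (iarr s 0 (ireg s i) + ireg s j)"
| "eval v (Add e f) s = eval v e s + eval v f s"
| "eval v (Sub e f) s = eval v e s - eval v f s"
| "eval v (Mul e f) s = eval v e s * eval v f s"
| "eval v (Dvd e f) s = eval v e s / eval v f s"
| "eval v (IfLt a b e f) s = (if eval v a s < eval v b s then eval v e s else eval v f s)"
| "eval v (Sm k e) s = (SUM i<ireg s k. eval (Suc v) e (seti v i s))"

text \<open>Register discipline: integer registers below 10 hold parameters and loop bounds, those
  from 10 on loop counters, and 2 is scratch. Real registers below 20 are variables; those from 20
  on form the evaluation stack.\<close>

primrec wfe :: "nat => rex => bool" where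
 "wfe v (Reg x) = (x < 20)"
| "wfe v (Nt i) = (i < v & i ~= 2)"
| "wfe v (Con c) = True"
| "wfe v (Ld a i j) = (i < v & i ~= 2 & j < v & j ~= 2)"
| "wfe v (Add e f) = (wfe v e & wfe v f)"
| "wfe v (Sub e f) = (wfe v e & wfe v f)"
| "wfe v (Mul e f) = (wfe v e & wfe v f)"
| "wfe v (Dvd e f) = (wfe v e & wfe v f)"
| "wfe v (IfLt a b e f) = (wfe v a & wfe v b & wfe v e & wfe v f)"
| "wfe v (Sm k e) = (k < 10 & k ~= 2 & wfe (Suc v) e)"

primrec reads :: "rex => nat set" where
 "reads (Reg x) = {}" | "reads (Nt i) = {}" | "reads (Con c) = {}" | "reads (Ld a i j) = {a}"
| "reads (Add e f) = reads e \<union> reads f" | "reads (Sub e f) = reads e \<union> reads f"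
| "reads (Mul e f) = reads e \<union> reads f" | "reads (Dvd e f) = reads e \<union> reads f"
| "reads (IfLt a b e f) = reads a \<union> reads b \<union> reads e \<union> reads f" | "reads (Sm k e) = reads e"

primrec ebounds :: "rex => nat set" where
 "ebounds (Reg x) = {}" | "ebounds (Nt i) = {}" | "ebounds (Con c) = {}" | "ebounds (Ld a i j) = {}"
| "ebounds (Add e f) = ebounds e \<union> ebounds f" | "ebounds (Sub e f) = ebounds e \<union> ebounds f"
| "ebounds (Mul e f) = ebounds e \<union> ebounds f" | "ebounds (Dvd e f) = ebounds e \<union> ebounds f"
| "ebounds (IfLt a b e f) = ebounds a \<union> ebounds b \<union> ebounds e \<union> ebounds f"
| "ebounds (Sm k e) = insert k (ebounds e)"

primrec ecost :: "rex => (nat => nat) => nat" where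
 "ecost (Reg x) b = 2" | "ecost (Nt i) b = 1" | "ecost (Con c) b = 2" | "ecost (Ld a i j) b = 3"
| "ecost (Add e f) b = ecost e b + ecost f b + 1" | "ecost (Sub e f) b = ecost e b + ecost f b + 1"
| "ecost (Mul e f) b = ecost e b + ecost f b + 1" | "ecost (Dvd e f) b = ecost e b + ecost f b + 1"
| "ecost (IfLt c d e f) b = ecost c b + ecost d b + ecost e b + ecost f b + 1"
| "ecost (Sm k e) b = 3 + b k * (ecost e b + 4)"

text \<open>Addition takes registers only, so the increment 1 is reloaded into scratch register 2 in
  every round.\<close>

definition For :: "nat => nat => program => program" where
 "For v k P = Seq (Instr (IConst v 0))
  (While (ILess v k) (Seq P (Seq (Instr (IConst 2 1)) (Instr (IAdd v v 2)))))"

text \<open>The machine can neither move a real nor load a real constant: a register is cleared by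
  \<open>RSub r r r\<close> and then added to, and constants are cast from the scratch
  integer.\<close>

primrec cmp :: "nat => nat => rex => program" where
 "cmp v r (Reg x) = Seq (Instr (RSub r r r)) (Instr (RAdd r r x))"
| "cmp v r (Nt i) = Instr (RCast r i)"
| "cmp v r (Con c) = Seq (Instr (IConst 2 c)) (Instr (RCast r 2))"
| "cmp v r (Ld a i j) = Seq (Instr (ILoad 2 0 i)) (Seq (Instr (IAdd 2 2 j)) (Instr (RLoad r a 2)))"
| "cmp v r (Add e f) = Seq (cmp v r e) (Seq (cmp v (Suc r) f) (Instr (RAdd r r (Suc r))))"
| "cmp v r (Sub e f) = Seq (cmp v r e) (Seq (cmp v (Suc r) f) (Instr (RSub r r (Suc r))))"
| "cmp v r (Mul e f) = Seq (cmp v r e) (Seq (cmp v (Suc r) f) (Instr (RMul r r (Suc r))))"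
| "cmp v r (Dvd e f) = Seq (cmp v r e) (Seq (cmp v (Suc r) f) (Instr (RDiv r r (Suc r))))"
| "cmp v r (IfLt a b e f) = Seq (cmp v r a) (Seq (cmp v (Suc r) b)
   (Cond (RLess r (Suc r)) (cmp v r e) (cmp v r f)))"
| "cmp v r (Sm k e) = Seq (Instr (RSub r r r))
   (For v k (Seq (cmp (Suc v) (Suc r) e) (Instr (RAdd r r (Suc r)))))"

text \<open>Equality up to everything that compiled code may clobber.\<close>

definition agr :: "nat => nat => state => state => bool" where
 "agr v r s s' \<longleftrightarrow> (ALL i<v. i ~= 2 --> ireg s' i = ireg s i) & (ALL x<r. rreg s' x = rreg s x) &
  iarr s' = iarr s & rarr s' = rarr s"

lemma agr_refl [simp]: "agr v r s s" by (simp add: agr_def)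

lemma agr_trans: "agr v r s s' ==> agr v r s' s'' ==> agr v r s s''" by (simp add: agr_def)

lemma agr_weaken: "agr v r s s' ==> v' <= v ==> r' <= r ==> agr v' r' s s'" by (simp add: agr_def)

lemma agr_seti: "agr v r s s' ==> agr (Suc v) r (seti v i s) (seti v i s')" by (auto simp: agr_def less_Suc_eq)

lemma eval_agr: "wfe v e ==> 10 <= v ==> agr v 20 s s' ==> eval v e s' = eval v e s"
proof (induction e arbitrary: v s s')
 case (Sm k e)
 have k: "ireg s' k = ireg s k" using Sm.prems by (auto simp: agr_def)
 have "eval (Suc v) e (seti v i s') = eval (Suc v) e (seti v i s)" for i using Sm.prems by (intro Sm.IH agr_seti) auto
 thus ?case by (simp add: k)
next
 case (Add e f)
 thus ?case using Add.IH(1)[of v s s'] Add.IH(2)[of v s s'] by simp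
next
 case (Sub e f)
 thus ?case using Sub.IH(1)[of v s s'] Sub.IH(2)[of v s s'] by simp
next
 case (Mul e f)
 thus ?case using Mul.IH(1)[of v s s'] Mul.IH(2)[of v s s'] by simp
next
 case (Dvd e f)
 thus ?case using Dvd.IH(1)[of v s s'] Dvd.IH(2)[of v s s'] by simp
next
 case (IfLt a b e f)
 thus ?case using IfLt.IH(1)[of v s s'] IfLt.IH(2)[of v s s'] IfLt.IH(3)[of v s s'] IfLt.IH(4)[of v s s'] by simp
qed (auto simp: agr_def)

lemma exec_Instr: "exec (Instr c) s 1 (step c s)" by (rule exec.Instr)

text \<open>The invariant counts finished rounds and has to survive any change of the counter and of
  the scratch register. The 3 extra steps per round are the test and the two instructions of the
  increment.\<close>

lemma while_loop:
 assumes body: "!!i s. i < K ==> I i s ==> ireg s v = i ==>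
   EX t s'. exec P s t s' & t <= c & I (Suc i) s' & ireg s' v = i"
  and stable: "!!i s x y. I i s ==> I i (seti v x (seti 2 y s))"
  and bound: "!!i s. I i s ==> ireg s k = K" and v: "v ~= 2"
 shows "m <= K ==> I (K - m) s ==> ireg s v = K - m ==>
  EX t s'. exec (While (ILess v k) (Seq P (Seq (Instr (IConst 2 1)) (Instr (IAdd v v 2))))) s t s'
   & t <= 1 + m * (c + 3) & I K s'"
proof (induction m arbitrary: s)
 case 0
 hence "~ holds (ILess v k) s" using bound by auto
 thus ?case using 0 exec.WhileF by (intro exI[of _ 1] exI[of _ s]) auto
next
 case (Suc m)
 hence h: "holds (ILess v k) s" using bound by auto
 have lt: "K - Suc m < K" using Suc by simp
 obtain t s' where b: "exec P s t s'" "t <= c" "I (Suc (K - Suc m)) s'" "ireg s' v = K - Suc m" using body[OF lt Suc.prems(2,3)] by blast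
 let ?s = "step (IAdd v v 2) (step (IConst 2 1) s')"
 have e: "exec (Seq P (Seq (Instr (IConst 2 1)) (Instr (IAdd v v 2)))) s (t + (1 + 1)) ?s" by (rule exec.Seq[OF b(1) exec.Seq[OF exec_Instr exec_Instr]])
 have "?s = seti v (Suc (K - Suc m)) (seti 2 1 s')" using b(4) v by (simp add: seti_def)
 moreover have "Suc (K - Suc m) = K - m" using Suc.prems by simp
 ultimately have s2: "I (K - m) ?s" "ireg ?s v = K - m" using b(3) stable by auto
 obtain u s'' where r: "exec (While (ILess v k) (Seq P (Seq (Instr (IConst 2 1)) (Instr (IAdd v v 2))))) ?s u s''"
  "u <= 1 + m * (c + 3)" "I K s''" using Suc.IH[OF _ s2] Suc.prems by auto
 have "exec (While (ILess v k) (Seq P (Seq (Instr (IConst 2 1)) (Instr (IAdd v v 2))))) s (t + (1 + 1) + u + 1) s''" by (rule exec.WhileT[OF h e r(1)])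
 moreover have "t + (1 + 1) + u + 1 <= 1 + Suc m * (c + 3)" using b(2) r(2) by simp
 ultimately show ?case using r(3) by blast
qed

lemma for_loop:
 assumes body: "!!i s. i < K ==> I i s ==> ireg s v = i ==>
   EX t s'. exec P s t s' & t <= c & I (Suc i) s' & ireg s' v = i"
  and stable: "!!i s x y. I i s ==> I i (seti v x (seti 2 y s))"
  and bound: "!!i s. I i s ==> ireg s k = K" and v: "v ~= 2" and init: "I 0 s"
 shows "EX t s'. exec (For v k P) s t s' & t <= 2 + K * (c + 3) & I K s'"
proof -
 let ?s = "step (IConst v 0) s"
 have eq: "?s = seti v 0 (seti 2 (ireg s 2) s)" using v by (simp add: seti_def)
 have "I 0 ?s" "ireg ?s v = 0" unfolding eq using stable[OF init] by simp_all
 note i0 = this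
 have "EX t s'. exec (While (ILess v k) (Seq P (Seq (Instr (IConst 2 1)) (Instr (IAdd v v 2))))) ?s t s'
   & t <= 1 + K * (c + 3) & I K s'"
 proof (rule while_loop[where K = K and I = I])
  show "!!i s. i < K ==> I i s ==> ireg s v = i ==>
   EX t s'. exec P s t s' & t <= c & I (Suc i) s' & ireg s' v = i" by (rule body)
  show "!!i s x y. I i s ==> I i (seti v x (seti 2 y s))" by (rule stable)
  show "!!i s. I i s ==> ireg s k = K" by (rule bound)
 qed (use i0 v in simp_all)
 then obtain t s' where w: "exec (While (ILess v k) (Seq P (Seq (Instr (IConst 2 1)) (Instr (IAdd v v 2))))) ?s t s'"
  "t <= 1 + K * (c + 3)" "I K s'" by (elim exE conjE)
 have "exec (For v k P) s (1 + t) s'" unfolding For_def by (rule exec.Seq[OF exec_Instr w(1)])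
 thus ?thesis using w by (intro exI[of _ "1 + t"] exI[of _ s']) simp
qed

lemma ecost_cong: "(!!k. k : ebounds e ==> b k = b' k) ==> ecost e b = ecost e b'" by (induction e) auto

lemma wfe_ebounds: "wfe v e ==> k : ebounds e ==> k < 10 & k ~= 2" by (induction e arbitrary: v) auto

lemma ecost_agr: "wfe v e ==> 10 <= v ==> agr v r s s' ==> ecost e (ireg s') = ecost e (ireg s)"
 by (rule ecost_cong) (auto simp: agr_def dest!: wfe_ebounds)

definition runs :: "program => nat => nat => rex => state => bool" where
 "runs P v r e s \<longleftrightarrow> (EX t s'. exec P s t s' & agr v r s s' & rreg s' r = eval v e s & t <= ecost e (ireg s))"

lemma cmp_binary:
 assumes e: "!!s. runs (cmp v r e) v r e s" and f: "!!s. runs (cmp v (Suc r) f) v (Suc r) f s"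
  and wf: "wfe v e" "wfe v f" "10 <= v" "20 <= r"
 shows "EX t s'. exec (Seq (cmp v r e) (cmp v (Suc r) f)) s t s' & agr v r s s' &
  rreg s' r = eval v e s & rreg s' (Suc r) = eval v f s & t <= ecost e (ireg s) + ecost f (ireg s)"
proof -
 obtain t1 s1 where 1: "exec (cmp v r e) s t1 s1" "agr v r s s1" "rreg s1 r = eval v e s" "t1 <= ecost e (ireg s)" using e[of s] unfolding runs_def by blast
 obtain t2 s2 where 2: "exec (cmp v (Suc r) f) s1 t2 s2" "agr v (Suc r) s1 s2" "rreg s2 (Suc r) = eval v f s1"
  "t2 <= ecost f (ireg s1)" using f[of s1] unfolding runs_def by blast
 have "agr v 20 s s1" using agr_weaken[OF 1(2)] wf by simp
 hence "eval v f s1 = eval v f s" "ecost f (ireg s1) = ecost f (ireg s)" using eval_agr[OF wf(2,3)] ecost_agr[OF wf(2,3)] by auto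
 moreover have "rreg s2 r = rreg s1 r" using 2(2) by (simp add: agr_def)
 moreover have "agr v r s s2" using agr_trans[OF 1(2) agr_weaken[OF 2(2)]] by simp
 ultimately show ?thesis using exec.Seq[OF 1(1) 2(1)] 1 2 by (intro exI[of _ "t1 + t2"] exI[of _ s2]) auto
qed

lemma exec_SeqE:
 assumes "exec (Seq P Q) s t s'"
 obtains t1 u s1 where "exec P s t1 s1" "exec Q s1 u s'" "t = t1 + u" using assms by (cases rule: exec.cases) auto

lemma exec_Seq_assoc:
 assumes "exec (Seq (Seq P Q) R) s t s'"
 shows "exec (Seq P (Seq Q R)) s t s'"
proof -
 obtain t1 u s1 where 1: "exec (Seq P Q) s t1 s1" "exec R s1 u s'" "t = t1 + u" using assms by (rule exec_SeqE)
 obtain t2 w s2 where 2: "exec P s t2 s2" "exec Q s2 w s1" "t1 = t2 + w" using 1(1) by (rule exec_SeqE)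
 show ?thesis using exec.Seq[OF 2(1) exec.Seq[OF 2(2) 1(2)]] 1(3) 2(3) by (simp add: add.assoc)
qed

lemma cmp_op:
 assumes e: "!!s. runs (cmp v r e) v r e s" and f: "!!s. runs (cmp v (Suc r) f) v (Suc r) f s"
  and wf: "wfe v e" "wfe v f" "10 <= v" "20 <= r"
  and step: "!!s. step c s = s\<lparr>rreg := (rreg s)(r := F (rreg s r) (rreg s (Suc r)))\<rparr>"
  and ev: "eval v g s = F (eval v e s) (eval v f s)" and co: "ecost g (ireg s) = ecost e (ireg s) + ecost f (ireg s) + 1"
 shows "runs (Seq (cmp v r e) (Seq (cmp v (Suc r) f) (Instr c))) v r g s"
proof -
 obtain t s' where 1: "exec (Seq (cmp v r e) (cmp v (Suc r) f)) s t s'" "agr v r s s'"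
  "rreg s' r = eval v e s" "rreg s' (Suc r) = eval v f s" "t <= ecost e (ireg s) + ecost f (ireg s)" using cmp_binary[OF e f wf, of s] by blast
 have "exec (Seq (cmp v r e) (Seq (cmp v (Suc r) f) (Instr c))) s (t + 1) (step c s')" by (rule exec_Seq_assoc[OF exec.Seq[OF 1(1) exec_Instr]])
 moreover have "agr v r s (step c s')" using 1(2) by (simp add: step agr_def)
 ultimately show ?thesis unfolding runs_def using 1 ev co by (intro exI[of _ "t + 1"] exI[of _ "step c s'"]) (simp add: step)
qed

lemma cmp_correct: "wfe v e ==> 10 <= v ==> 20 <= r ==> runs (cmp v r e) v r e s"
proof (induction e arbitrary: v r s)
 case (Reg x v r s)
 have "exec (cmp v r (Reg x)) s (1 + 1) (step (RAdd r r x) (step (RSub r r r) s))" unfolding cmp.simps by (rule exec.Seq[OF exec_Instr exec_Instr])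
 thus ?case unfolding runs_def using Reg by (force simp: agr_def)
next
 case (Nt i v r s)
 have "exec (cmp v r (Nt i)) s 1 (step (RCast r i) s)" unfolding cmp.simps by (rule exec_Instr)
 thus ?case unfolding runs_def using Nt by (force simp: agr_def)
next
 case (Con c v r s)
 have "exec (cmp v r (Con c)) s (1 + 1) (step (RCast r 2) (step (IConst 2 c) s))" unfolding cmp.simps by (rule exec.Seq[OF exec_Instr exec_Instr])
 thus ?case unfolding runs_def using Con by (force simp: agr_def)
next
 case (Ld a i j v r s)
 have "exec (cmp v r (Ld a i j)) s (1 + (1 + 1)) (step (RLoad r a 2) (step (IAdd 2 2 j) (step (ILoad 2 0 i) s)))"
  unfolding cmp.simps by (rule exec.Seq[OF exec_Instr exec.Seq[OF exec_Instr exec_Instr]])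
 thus ?case unfolding runs_def using Ld by (force simp: agr_def)
next
 case (Add e f v r s)
 show ?case unfolding cmp.simps by (rule cmp_op[where F = "(+)"]) (use Add in \<open>auto intro: Add.IH\<close>)
next
 case (Sub e f v r s)
 show ?case unfolding cmp.simps by (rule cmp_op[where F = "(-)"]) (use Sub in \<open>auto intro: Sub.IH\<close>)
next
 case (Mul e f v r s)
 show ?case unfolding cmp.simps by (rule cmp_op[where F = "(*)"]) (use Mul in \<open>auto intro: Mul.IH\<close>)
next
 case (Dvd e f v r s)
 show ?case unfolding cmp.simps by (rule cmp_op[where F = "(/)"]) (use Dvd in \<open>auto intro: Dvd.IH\<close>)
next
 case (IfLt a b e f v r s)
 have wf: "wfe v a" "wfe v b" "wfe v e" "wfe v f" using IfLt.prems by auto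
 have ra: "!!s. runs (cmp v r a) v r a s" and rb: "!!s. runs (cmp v (Suc r) b) v (Suc r) b s" using IfLt.IH(1,2) IfLt.prems wf by auto
 obtain t s1 where 1: "exec (Seq (cmp v r a) (cmp v (Suc r) b)) s t s1" "agr v r s s1"
  "rreg s1 r = eval v a s" "rreg s1 (Suc r) = eval v b s" "t <= ecost a (ireg s) + ecost b (ireg s)" using cmp_binary[OF ra rb wf(1,2)] IfLt.prems by blast
 have a20: "agr v 20 s s1" using agr_weaken[OF 1(2)] IfLt.prems by simp
 define g where "g = (if eval v a s < eval v b s then e else f)"
 have "runs (cmp v r g) v r g s1" unfolding g_def using IfLt.IH(3)[of v r s1] IfLt.IH(4)[of v r s1] IfLt.prems wf by auto
 then obtain u s2 where 2: "exec (cmp v r g) s1 u s2" "agr v r s1 s2" "rreg s2 r = eval v g s1" "u <= ecost g (ireg s1)" unfolding runs_def by blast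
 have wg: "wfe v g" using wf by (simp add: g_def)
 have c: "exec (Cond (RLess r (Suc r)) (cmp v r e) (cmp v r f)) s1 (u + 1) s2"
 proof (cases "eval v a s < eval v b s")
  case True
  hence "holds (RLess r (Suc r)) s1" using 1 by simp
  thus ?thesis by (rule exec.CondT) (use 2(1) True in \<open>simp add: g_def\<close>)
 next
  case False
  hence "~ holds (RLess r (Suc r)) s1" using 1 by simp
  thus ?thesis by (rule exec.CondF) (use 2(1) False in \<open>simp add: g_def\<close>)
 qed
 have "exec (cmp v r (IfLt a b e f)) s (t + (u + 1)) s2" unfolding cmp.simps by (rule exec_Seq_assoc[OF exec.Seq[OF 1(1) c]])
 moreover have "rreg s2 r = eval v (IfLt a b e f) s" using 2(3) eval_agr[OF wg _ a20] IfLt.prems by (simp add: g_def)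
 moreover have "ecost g (ireg s1) = ecost g (ireg s)" using ecost_agr[OF wg _ a20] IfLt.prems by simp
 hence "t + (u + 1) <= ecost (IfLt a b e f) (ireg s)" using 1(5) 2(4) by (simp add: g_def split: if_splits)
 ultimately show ?case unfolding runs_def using agr_trans[OF 1(2) 2(2)] by blast
next
 case (Sm k e v r s)
 have wf: "wfe (Suc v) e" "k < 10" "k ~= 2" using Sm.prems by auto
 let ?P = "Seq (cmp (Suc v) (Suc r) e) (Instr (RAdd r r (Suc r)))"
 let ?s = "step (RSub r r r) s"
 define I where "I = (%i s'. agr v r s s' & rreg s' r = (SUM j<i. eval (Suc v) e (seti v j s)))"
 have "EX t s'. exec (For v k ?P) ?s t s' & t <= 2 + ireg s k * (ecost e (ireg s) + 1 + 3) & I (ireg s k) s'"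
 proof (rule for_loop)
  fix i s1 assume i: "i < ireg s k" and I: "I i s1" and v: "ireg s1 v = i"
  have a: "agr (Suc v) 20 (seti v i s) s1" using I v Sm.prems by (auto simp: I_def agr_def less_Suc_eq)
  obtain t s2 where 2: "exec (cmp (Suc v) (Suc r) e) s1 t s2" "agr (Suc v) (Suc r) s1 s2"
   "rreg s2 (Suc r) = eval (Suc v) e s1" "t <= ecost e (ireg s1)" using Sm.IH[of "Suc v" "Suc r" s1] Sm.prems wf unfolding runs_def by auto
  have ev: "eval (Suc v) e s1 = eval (Suc v) e (seti v i s)" by (rule eval_agr[OF wf(1) _ a]) (use Sm.prems in simp)
  have "ecost e (ireg s1) = ecost e (ireg (seti v i s))" by (rule ecost_agr[OF wf(1) _ a]) (use Sm.prems in simp)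
  also have "... = ecost e (ireg s)" using Sm.prems wf by (intro ecost_cong) (auto dest: wfe_ebounds)
  finally have co: "t + 1 <= ecost e (ireg s) + 1" using 2(4) by simp
  let ?s2 = "step (RAdd r r (Suc r)) s2"
  have "exec ?P s1 (t + 1) ?s2" by (rule exec.Seq[OF 2(1) exec_Instr])
  moreover have "I (Suc i) ?s2" using I 2(2,3) ev by (auto simp: I_def agr_def)
  moreover have "ireg ?s2 v = i" using v 2(2) Sm.prems by (auto simp: agr_def)
  ultimately show "EX t s'. exec ?P s1 t s' & t <= ecost e (ireg s) + 1 & I (Suc i) s' & ireg s' v = i" using co by blast
 qed (use Sm.prems wf in \<open>auto simp: I_def agr_def\<close>)
 then obtain t s' where 1: "exec (For v k ?P) ?s t s'" "t <= 2 + ireg s k * (ecost e (ireg s) + 1 + 3)" "I (ireg s k) s'" by blast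
 have "exec (cmp v r (Sm k e)) s (1 + t) s'" unfolding cmp.simps by (rule exec.Seq[OF exec_Instr 1(1)])
 thus ?case unfolding runs_def using 1(2,3) by (intro exI[of _ "1 + t"] exI[of _ s']) (auto simp: I_def add.commute)
qed

datatype stm = Set nat rex | Tab nat nat nat rex | Inc nat | ISet nat nat
 | Sq stm stm | Ite rex rex stm stm | Rep nat stm

definition tab :: "(nat => nat) => (nat => nat => real) => nat => nat => (nat => real) => nat => real" where
 "tab off f k l A = fold (%i A. fold (%j A. A(off i + j := f i j)) [0..<l] A) [0..<k] A"

text \<open>\<open>Tab\<close> evaluates all entries in the state before the assignment. The
  compiled loop writes entry by entry and still agrees, because \<open>wfs\<close> keeps the
  expression from reading the array being written.\<close>

primrec sem :: "nat => stm => state => state" where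
 "sem v (Set x e) s = s\<lparr>rreg := (rreg s)(x := eval v e s)\<rparr>"
| "sem v (Tab a k l e) s = s\<lparr>rarr := (rarr s)(a := tab (iarr s 0)
   (%i j. eval (Suc (Suc v)) e (seti (Suc v) j (seti v i s))) (ireg s k) (ireg s l) (rarr s a))\<rparr>"
| "sem v (Inc q) s = seti q (Suc (ireg s q)) s"
| "sem v (ISet q c) s = seti q c s"
| "sem v (Sq P Q) s = sem v Q (sem v P s)"
| "sem v (Ite a b P Q) s = (if eval v a s < eval v b s then sem v P s else sem v Q s)"
| "sem v (Rep k P) s = fold (%i s. sem (Suc v) P (seti v i s)) [0..<ireg s k] s"

primrec incs :: "stm => nat set" where
 "incs (Set x e) = {}" | "incs (Tab a k l e) = {}" | "incs (Inc q) = {q}" | "incs (ISet q c) = {q}"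
| "incs (Sq P Q) = incs P \<union> incs Q" | "incs (Ite a b P Q) = incs P \<union> incs Q" | "incs (Rep k P) = incs P"

primrec sbounds :: "stm => nat set" where
 "sbounds (Set x e) = ebounds e" | "sbounds (Tab a k l e) = {k, l} \<union> ebounds e" | "sbounds (Inc q) = {}"
| "sbounds (ISet q c) = {}" | "sbounds (Sq P Q) = sbounds P \<union> sbounds Q"
| "sbounds (Ite a b P Q) = ebounds a \<union> ebounds b \<union> sbounds P \<union> sbounds Q" | "sbounds (Rep k P) = insert k (sbounds P)"

text \<open>The conditions on \<open>sbounds\<close> and \<open>incs\<close> keep loop bounds
  unchanged by the preceding code or by the loop body, so that \<open>scost\<close>, computed from
  the initial registers, stays a valid bound.\<close>

primrec wfs :: "nat => stm => bool" where
 "wfs v (Set x e) = (x < 20 & wfe v e)"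
| "wfs v (Tab a k l e) = (k < 10 & k ~= 2 & l < 10 & l ~= 2 & a \<notin> reads e & wfe (Suc (Suc v)) e)"
| "wfs v (Inc q) = (q < 10 & q ~= 2)"
| "wfs v (ISet q c) = (q < 10 & q ~= 2)"
| "wfs v (Sq P Q) = (wfs v P & wfs v Q & sbounds Q \<inter> incs P = {})"
| "wfs v (Ite a b P Q) = (wfe v a & wfe v b & wfs v P & wfs v Q)"
| "wfs v (Rep k P) = (k < 10 & k ~= 2 & wfs (Suc v) P & insert k (sbounds P) \<inter> incs P = {})"

primrec scost :: "stm => (nat => nat) => nat" where
 "scost (Set x e) b = ecost e b + 2"
| "scost (Tab a k l e) b = 2 + b k * (2 + b l * (ecost e b + 6) + 3)"
| "scost (Inc q) b = 2" | "scost (ISet q c) b = 1"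
| "scost (Sq P Q) b = scost P b + scost Q b"
| "scost (Ite c d P Q) b = ecost c b + ecost d b + 1 + max (scost P b) (scost Q b)"
| "scost (Rep k P) b = 2 + b k * (scost P b + 3)"

primrec cmps :: "nat => stm => program" where
 "cmps v (Set x e) = Seq (cmp v 20 e) (Seq (Instr (RSub x x x)) (Instr (RAdd x x 20)))"
| "cmps v (Tab a k l e) = For v k (For (Suc v) l (Seq (cmp (Suc (Suc v)) 20 e)
   (Seq (Instr (ILoad 2 0 v)) (Seq (Instr (IAdd 2 2 (Suc v))) (Instr (RStore a 2 20))))))"
| "cmps v (Inc q) = Seq (Instr (IConst 2 1)) (Instr (IAdd q q 2))"
| "cmps v (ISet q c) = Instr (IConst q c)"
| "cmps v (Sq P Q) = Seq (cmps v P) (cmps v Q)"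
| "cmps v (Ite a b P Q) = Seq (cmp v 20 a) (Seq (cmp v 21 b) (Cond (RLess 20 21) (cmps v P) (cmps v Q)))"
| "cmps v (Rep k P) = For v k (cmps (Suc v) P)"

lemma scost_cong: "(!!k. k : sbounds P ==> b k = b' k) ==> scost P b = scost P b'"
proof (induction P)
 case (Set x e) thus ?case using ecost_cong[of e b b'] by simp
next
 case (Tab a k l e) thus ?case using ecost_cong[of e b b'] by simp
next
 case (Ite c d P Q) thus ?case using ecost_cong[of c b b'] ecost_cong[of d b b'] by simp
qed auto

lemma wfs_sbounds: "wfs v P ==> k : sbounds P ==> k < 10 & k ~= 2" by (induction P arbitrary: v) (auto dest: wfe_ebounds)

lemma wfs_incs: "wfs v P ==> k : incs P ==> k < 10 & k ~= 2" by (induction P arbitrary: v) auto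

lemma sem_ireg: "wfs v P ==> i < v ==> i \<notin> incs P ==> ireg (sem v P s) i = ireg s i"
proof (induction P arbitrary: v s)
 case (Rep k P v s)
 have "ireg (fold (%i s. sem (Suc v) P (seti v i s)) xs s) i = ireg s i" for xs s using Rep by (induction xs arbitrary: s) auto
 thus ?case by simp
qed auto

lemma sem_iarr: "iarr (sem v P s) = iarr s"
proof (induction P arbitrary: v s)
 case (Rep k P v s)
 have "iarr (fold (%i s. sem (Suc v) P (seti v i s)) xs s) = iarr s" for xs s using Rep by (induction xs arbitrary: s) auto
 thus ?case by simp
qed auto

lemma eval_rarr_cong:
 "a \<notin> reads e ==> eval v e (s\<lparr>rarr := (rarr s)(a := A)\<rparr>) = eval v e s"
proof (induction e arbitrary: v s)
 case (Sm k e v s)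
 have "seti v i (s\<lparr>rarr := (rarr s)(a := A)\<rparr>) = (seti v i s)\<lparr>rarr := (rarr (seti v i s))(a := A)\<rparr>" for i by (simp add: seti_def)
 moreover have "eval (Suc v) e ((seti v i s)\<lparr>rarr := (rarr (seti v i s))(a := A)\<rparr>) = eval (Suc v) e (seti v i s)" for i using Sm by (intro Sm.IH) simp
 ultimately have h: "eval (Suc v) e (seti v i (s\<lparr>rarr := (rarr s)(a := A)\<rparr>)) = eval (Suc v) e (seti v i s)" for i by (simp only:)
 show ?case unfolding eval.simps h by simp
qed auto

lemma tab_Suc: "tab off f (Suc k) l A = fold (%j A. A(off k + j := f k j)) [0..<l] (tab off f k l A)" by (simp add: tab_def)

lemma tab_correct:
 assumes wf: "wfs v (Tab a k l e)" and v: "10 <= v" and s1: "agr v 20 s s1"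
 shows "EX t s2. exec (cmps v (Tab a k l e)) s1 t s2 & agr v 20 (sem v (Tab a k l e) s) s2 & t <= scost (Tab a k l e) (ireg s)"
proof -
 let ?f = "%i j. eval (Suc (Suc v)) e (seti (Suc v) j (seti v i s))"
 let ?R = "%A. s\<lparr>rarr := (rarr s)(a := A)\<rparr>"
 let ?K = "ireg s k" and ?L = "ireg s l"
 define row where "row = (%i j A. fold (%j A. A(iarr s 0 i + j := ?f i j)) [0..<j] (A :: nat => real))"
 define T where "T = (%i. tab (iarr s 0) ?f i ?L (rarr s a))"
 have T_Suc: "T (Suc i) = row i ?L (T i)" for i by (simp add: T_def row_def tab_Suc)
 have row_Suc: "row i (Suc j) A = (row i j A)(iarr s 0 i + j := ?f i j)" for i j A by (simp add: row_def)
 have wfe: "wfe (Suc (Suc v)) e" and na: "a \<notin> reads e" and kl: "k < 10" "k ~= 2" "l < 10" "l ~= 2" using wf by auto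
 let ?body = "Seq (cmp (Suc (Suc v)) 20 e)
   (Seq (Instr (ILoad 2 0 v)) (Seq (Instr (IAdd 2 2 (Suc v))) (Instr (RStore a 2 20))))"
 have inner: "EX t s'. exec (For (Suc v) l ?body) s0 t s' & t <= 2 + ?L * (ecost e (ireg s) + 3 + 3) &
   (ireg s' v = i & agr v 20 (?R (T (Suc i))) s')"
  if s0: "ireg s0 v = i" "agr v 20 (?R (T i)) s0" for i s0 unfolding T_Suc
 proof (rule for_loop[where I = "%j s'. ireg s' v = i & agr v 20 (?R (row i j (T i))) s'"])
  fix j s' assume j: "j < ?L" and I: "ireg s' v = i & agr v 20 (?R (row i j (T i))) s'" and vj: "ireg s' (Suc v) = j"
  let ?u = "Suc (Suc v)" and ?A = "row i j (T i)"
  have ag: "agr ?u 20 (seti (Suc v) j (seti v i (?R ?A))) s'" using I vj v by (auto simp: agr_def less_Suc_eq)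
  have "runs (cmp ?u 20 e) ?u 20 e s'" using wfe v by (intro cmp_correct) auto
  then obtain t s2 where 2: "exec (cmp ?u 20 e) s' t s2" "agr ?u 20 s' s2" "rreg s2 20 = eval ?u e s'" "t <= ecost e (ireg s')" unfolding runs_def by blast
  have "eval ?u e s' = eval ?u e (seti (Suc v) j (seti v i (?R ?A)))" by (rule eval_agr[OF wfe _ ag]) (use v in simp)
  also have "seti (Suc v) j (seti v i (?R ?A)) = (seti (Suc v) j (seti v i s))\<lparr>rarr := (rarr (seti (Suc v) j (seti v i s)))(a := ?A)\<rparr>"
   by (simp add: seti_def)
  also have "eval ?u e ... = ?f i j" by (rule eval_rarr_cong[OF na])
  finally have ev: "rreg s2 20 = ?f i j" using 2(3) by simp
  have "ecost e (ireg s') = ecost e (ireg (seti (Suc v) j (seti v i (?R ?A))))" by (rule ecost_agr[OF wfe _ ag]) (use v in simp)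
  also have "... = ecost e (ireg s)" using wfe v by (intro ecost_cong) (auto dest: wfe_ebounds)
  finally have co: "t <= ecost e (ireg s)" using 2(4) by simp
  let ?s3 = "step (RStore a 2 20) (step (IAdd 2 2 (Suc v)) (step (ILoad 2 0 v) s2))"
  have ex: "exec ?body s' (t + (1 + (1 + 1))) ?s3" by (rule exec.Seq[OF 2(1) exec.Seq[OF exec_Instr exec.Seq[OF exec_Instr exec_Instr]]])
  have regs: "ireg s2 v = i" "ireg s2 (Suc v) = j" "iarr s2 = iarr s" "rarr s2 = (rarr s)(a := ?A)" using 2(2) I vj v by (auto simp: agr_def)
  have "rarr ?s3 = (rarr s)(a := row i (Suc j) (T i))" unfolding row_Suc using regs ev v by (simp add: fun_eq_iff)
  hence "agr v 20 (?R (row i (Suc j) (T i))) ?s3" using 2(2) I v by (auto simp: agr_def)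
  moreover have "ireg ?s3 v = i" "ireg ?s3 (Suc v) = j" using regs v by auto
  ultimately show "EX t s''. exec ?body s' t s'' & t <= ecost e (ireg s) + 3 &
    (ireg s'' v = i & agr v 20 (?R (row i (Suc j) (T i))) s'') & ireg s'' (Suc v) = j" using ex co by (intro exI[of _ "t + (1 + (1 + 1))"] exI[of _ ?s3]) auto
 next
  show "ireg s0 v = i & agr v 20 (?R (row i 0 (T i))) s0" using s0 by (simp add: row_def)
 qed (use v kl in \<open>auto simp: agr_def\<close>)
 have "EX t s2. exec (For v k (For (Suc v) l ?body)) s1 t s2 &
   t <= 2 + ?K * (2 + ?L * (ecost e (ireg s) + 3 + 3) + 3) & agr v 20 (?R (T ?K)) s2"
 proof (rule for_loop[where I = "%i s'. agr v 20 (?R (T i)) s'"])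
  fix i s' assume "i < ?K" and I: "agr v 20 (?R (T i)) s'" and vi: "ireg s' v = i"
  from inner[OF vi I] show "EX t s''. exec (For (Suc v) l ?body) s' t s'' &
    t <= 2 + ?L * (ecost e (ireg s) + 3 + 3) & agr v 20 (?R (T (Suc i))) s'' & ireg s'' v = i" by blast
 next
  have "?R (T 0) = s" by (simp add: T_def tab_def)
  thus "agr v 20 (?R (T 0)) s1" using s1 by simp
 qed (use v kl in \<open>auto simp: agr_def\<close>)
 thus ?thesis by (simp add: T_def ac_simps)
qed

lemma cmps_correct:
 "wfs v P ==> 10 <= v ==> agr v 20 s s1 ==>
  EX t s2. exec (cmps v P) s1 t s2 & agr v 20 (sem v P s) s2 & t <= scost P (ireg s)"
proof (induction P arbitrary: v s s1)
 case (Set x e v s s1)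
 have wf: "wfe v e" "x < 20" using Set.prems by auto
 have "runs (cmp v 20 e) v 20 e s1" using wf Set.prems by (intro cmp_correct) auto
 then obtain t s2 where 2: "exec (cmp v 20 e) s1 t s2" "agr v 20 s1 s2" "rreg s2 20 = eval v e s1" "t <= ecost e (ireg s1)" unfolding runs_def by blast
 have e: "eval v e s1 = eval v e s" "ecost e (ireg s1) = ecost e (ireg s)" using eval_agr[OF wf(1) Set.prems(2,3)] ecost_agr[OF wf(1) Set.prems(2,3)] .
 let ?s3 = "step (RAdd x x 20) (step (RSub x x x) s2)"
 have "exec (cmps v (Set x e)) s1 (t + (1 + 1)) ?s3" unfolding cmps.simps by (rule exec.Seq[OF 2(1) exec.Seq[OF exec_Instr exec_Instr]])
 moreover have "agr v 20 (sem v (Set x e) s) ?s3" using agr_trans[OF Set.prems(3) 2(2)] 2(3) e(1) wf by (auto simp: agr_def)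
 ultimately show ?case using 2(4) e(2) by (intro exI[of _ "t + (1 + 1)"] exI[of _ ?s3]) auto
next
 case (Tab a k l e v s s1)
 thus ?case by (intro tab_correct)
next
 case (Inc q v s s1)
 have "exec (cmps v (Inc q)) s1 (1 + 1) (step (IAdd q q 2) (step (IConst 2 1) s1))" unfolding cmps.simps by (rule exec.Seq[OF exec_Instr exec_Instr])
 moreover have "agr v 20 (sem v (Inc q) s) (step (IAdd q q 2) (step (IConst 2 1) s1))" using Inc by (auto simp: agr_def)
 ultimately show ?case by (intro exI[of _ "1 + 1"] exI[of _ "step (IAdd q q 2) (step (IConst 2 1) s1)"]) auto
next
 case (ISet q c v s s1)
 have "exec (cmps v (ISet q c)) s1 1 (step (IConst q c) s1)" unfolding cmps.simps by (rule exec_Instr)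
 moreover have "agr v 20 (sem v (ISet q c) s) (step (IConst q c) s1)" using ISet by (auto simp: agr_def)
 ultimately show ?case by (intro exI[of _ 1] exI[of _ "step (IConst q c) s1"]) auto
next
 case (Sq P Q v s s1)
 have wf: "wfs v P" "wfs v Q" "sbounds Q \<inter> incs P = {}" using Sq.prems by auto
 obtain t s2 where 1: "exec (cmps v P) s1 t s2" "agr v 20 (sem v P s) s2" "t <= scost P (ireg s)" using Sq.IH(1)[OF wf(1) Sq.prems(2,3)] by blast
 obtain u s3 where 2: "exec (cmps v Q) s2 u s3" "agr v 20 (sem v Q (sem v P s)) s3" "u <= scost Q (ireg (sem v P s))"
  using Sq.IH(2)[OF wf(2) Sq.prems(2) 1(2)] by blast
 have "scost Q (ireg (sem v P s)) = scost Q (ireg s)"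
 proof (rule scost_cong)
  fix k assume k: "k : sbounds Q"
  hence "k < v" "k \<notin> incs P" using wfs_sbounds[OF wf(2) k] Sq.prems(2) wf(3) by auto
  thus "ireg (sem v P s) k = ireg s k" by (rule sem_ireg[OF wf(1)])
 qed
 thus ?case using exec.Seq[OF 1(1) 2(1)] 1(3) 2(2,3) by (intro exI[of _ "t + u"] exI[of _ s3]) auto
next
 case (Ite a b P Q v s s1)
 have wf: "wfe v a" "wfe v b" "wfs v P" "wfs v Q" using Ite.prems by auto
 have "!!s. runs (cmp v 20 a) v 20 a s" "!!s. runs (cmp v (Suc 20) b) v (Suc 20) b s"
  using cmp_correct[OF wf(1) Ite.prems(2)] cmp_correct[OF wf(2) Ite.prems(2)] by auto
 from cmp_binary[OF this wf(1,2) Ite.prems(2) order_refl, of s1]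
 obtain t s2 where 1: "exec (Seq (cmp v 20 a) (cmp v (Suc 20) b)) s1 t s2" "agr v 20 s1 s2"
  "rreg s2 20 = eval v a s1" "rreg s2 (Suc 20) = eval v b s1" "t <= ecost a (ireg s1) + ecost b (ireg s1)" by (elim exE conjE)
 have e: "eval v a s1 = eval v a s" "eval v b s1 = eval v b s"
   "ecost a (ireg s1) = ecost a (ireg s)" "ecost b (ireg s1) = ecost b (ireg s)" using eval_agr[OF wf(1) Ite.prems(2,3)] ecost_agr[OF wf(1) Ite.prems(2,3)]
   eval_agr[OF wf(2) Ite.prems(2,3)] ecost_agr[OF wf(2) Ite.prems(2,3)] by auto
 have a2: "agr v 20 s s2" by (rule agr_trans[OF Ite.prems(3) 1(2)])
 define R where "R = (if eval v a s < eval v b s then P else Q)"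
 have "EX u s3. exec (cmps v R) s2 u s3 & agr v 20 (sem v R s) s3 & u <= scost R (ireg s)"
  unfolding R_def using Ite.IH(1)[OF wf(3) Ite.prems(2) a2] Ite.IH(2)[OF wf(4) Ite.prems(2) a2] by auto
 then obtain u s3 where 2: "exec (cmps v R) s2 u s3" "agr v 20 (sem v R s) s3" "u <= scost R (ireg s)" by (elim exE conjE)
 have c: "exec (Cond (RLess 20 21) (cmps v P) (cmps v Q)) s2 (u + 1) s3"
 proof (cases "eval v a s < eval v b s")
  case True
  hence "holds (RLess 20 21) s2" using 1 e by simp
  thus ?thesis by (rule exec.CondT) (use 2(1) True in \<open>simp add: R_def\<close>)
 next
  case False
  hence "~ holds (RLess 20 21) s2" using 1 e by simp
  thus ?thesis by (rule exec.CondF) (use 2(1) False in \<open>simp add: R_def\<close>)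
 qed
 have ss: "Suc 20 = 21" by simp
 have "exec (cmps v (Ite a b P Q)) s1 (t + (u + 1)) s3" unfolding cmps.simps by (rule exec_Seq_assoc[OF exec.Seq[OF 1(1)[unfolded ss] c]])
 moreover have "sem v (Ite a b P Q) s = sem v R s" by (simp add: R_def)
 moreover have "t + (u + 1) <= scost (Ite a b P Q) (ireg s)"
 proof -
  have "scost R (ireg s) <= max (scost P (ireg s)) (scost Q (ireg s))" by (simp add: R_def)
  thus ?thesis using 1(5) 2(3) e by simp
 qed
 ultimately show ?case using 2(2) by metis
next
 case (Rep k P v s s1)
 have wf: "k < 10" "k ~= 2" "wfs (Suc v) P" "k \<notin> incs P" "sbounds P \<inter> incs P = {}" using Rep.prems by auto
 let ?F = "%i. fold (%i s. sem (Suc v) P (seti v i s)) [0..<i] s"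
 have reg: "ireg (?F i) q = ireg s q" if "q < v" "q \<notin> incs P" for i q
 proof (induction i)
  case (Suc i)
  have "ireg (sem (Suc v) P (seti v i (?F i))) q = ireg (seti v i (?F i)) q" using that by (intro sem_ireg[OF wf(3)]) auto
  thus ?case using Suc that by simp
 qed simp
 have "EX t s2. exec (For v k (cmps (Suc v) P)) s1 t s2 & t <= 2 + ireg s k * (scost P (ireg s) + 3) & agr v 20 (?F (ireg s k)) s2"
 proof (rule for_loop[where I = "%i s'. agr v 20 (?F i) s'"])
  fix i s' assume "i < ireg s k" and I: "agr v 20 (?F i) s'" and vi: "ireg s' v = i"
  have "agr (Suc v) 20 (seti v i (?F i)) s'" using I vi Rep.prems by (auto simp: agr_def less_Suc_eq)
  from Rep.IH[OF wf(3) le_SucI[OF Rep.prems(2)] this] obtain t s2 where 2: "exec (cmps (Suc v) P) s' t s2"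
   "agr (Suc v) 20 (sem (Suc v) P (seti v i (?F i))) s2" "t <= scost P (ireg (seti v i (?F i)))" by (elim exE conjE)
  have "scost P (ireg (seti v i (?F i))) = scost P (ireg s)"
  proof (rule scost_cong)
   fix q assume q: "q : sbounds P"
   hence "q < v" "q \<notin> incs P" using wfs_sbounds[OF wf(3) q] Rep.prems(2) wf(5) by auto
   thus "ireg (seti v i (?F i)) q = ireg s q" using reg by simp
  qed
  moreover have "ireg s2 v = i"
  proof -
   have "ireg s2 v = ireg (sem (Suc v) P (seti v i (?F i))) v" using 2(2) Rep.prems by (simp add: agr_def)
   also have "... = ireg (seti v i (?F i)) v" using wfs_incs[OF wf(3)] Rep.prems(2) by (intro sem_ireg[OF wf(3)]) force+
   finally show ?thesis by simp
  qed
  moreover have "agr v 20 (?F (Suc i)) s2" using agr_weaken[OF 2(2), of v 20] by simp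
  ultimately show "EX t s''. exec (cmps (Suc v) P) s' t s'' & t <= scost P (ireg s) & agr v 20 (?F (Suc i)) s'' & ireg s'' v = i" using 2 by auto
 next
  fix i s' x y assume "agr v 20 (?F i) s'"
  thus "agr v 20 (?F i) (seti v x (seti 2 y s'))" by (auto simp: agr_def)
 next
  fix i s' assume "agr v 20 (?F i) s'"
  hence "ireg s' k = ireg (?F i) k" using wf Rep.prems by (auto simp: agr_def)
  thus "ireg s' k = ireg s k" using reg[of k i] wf Rep.prems by simp
 qed (use Rep.prems in auto)
 thus ?case unfolding cmps.simps sem.simps scost.simps by blast
qed

section \<open>Frame rules and matrices in memory\<close>

primrec writes :: "stm => nat set" where
 "writes (Set x e) = {}" | "writes (Tab a k l e) = {a}" | "writes (Inc q) = {}" | "writes (ISet q c) = {}"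
| "writes (Sq P Q) = writes P \<union> writes Q" | "writes (Ite a b P Q) = writes P \<union> writes Q" | "writes (Rep k P) = writes P"

primrec assigns :: "stm => nat set" where
 "assigns (Set x e) = {x}" | "assigns (Tab a k l e) = {}" | "assigns (Inc q) = {}" | "assigns (ISet q c) = {}"
| "assigns (Sq P Q) = assigns P \<union> assigns Q" | "assigns (Ite a b P Q) = assigns P \<union> assigns Q" | "assigns (Rep k P) = assigns P"

lemma sem_rarr: "a \<notin> writes P ==> rarr (sem v P s) a = rarr s a"
proof (induction P arbitrary: v s)
 case (Rep k P v s)
 have "rarr (fold (%i s. sem (Suc v) P (seti v i s)) xs s) a = rarr s a" for xs s using Rep by (induction xs arbitrary: s) auto
 thus ?case by simp
qed auto

lemma sem_rreg: "x \<notin> assigns P ==> rreg (sem v P s) x = rreg s x"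
proof (induction P arbitrary: v s)
 case (Rep k P v s)
 have "rreg (fold (%i s. sem (Suc v) P (seti v i s)) xs s) x = rreg s x" for xs s using Rep by (induction xs arbitrary: s) auto
 thus ?case by simp
qed auto

lemma sem_Rep:
 assumes "!!i s. i < m ==> I i s ==> I (Suc i) (sem (Suc v) P (seti v i s))" "I 0 s" "ireg s k = m"
 shows "I m (sem v (Rep k P) s)"
proof -
 have "j <= m ==> I j (fold (%i s. sem (Suc v) P (seti v i s)) [0..<j] s)" for j by (induction j) (use assms in auto)
 thus ?thesis using assms(3) by simp
qed

definition ent :: "state => nat => nat => nat => real" where
 "ent s a i j = rarr s a (iarr s 0 i + j)"

lemma eval_Ld: "eval v (Ld a i j) s = ent s a (ireg s i) (ireg s j)" by (simp add: ent_def)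

lemma ent_seti [simp]: "ent (seti v x s) = ent s" by (simp add: ent_def fun_eq_iff)

lemma ent_sem: "a \<notin> writes P ==> ent (sem v P s) a = ent s a" by (simp add: ent_def sem_rarr sem_iarr fun_eq_iff)

definition mat :: "state => nat => nat => nat => (nat => nat => real) => bool" where
 "mat s a k l M \<longleftrightarrow> (ALL i<k. ALL j<l. ent s a i j = M i j)"

lemma mat_seti [simp]: "mat (seti v x s) = mat s" by (simp add: mat_def fun_eq_iff)

lemma mat_sem: "a \<notin> writes P ==> mat s a k l M ==> mat (sem v P s) a k l M" by (simp add: mat_def ent_sem)

lemma mat_ent: "mat s a k l M ==> i < k ==> j < l ==> ent s a i j = M i j" by (simp add: mat_def)

lemma row_nth:
 "j < l ==> fold (%j A. A(b + j := f j)) [0..<l] A (b + j :: nat) = f j" by (induction l) (auto simp: less_Suc_eq)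

lemma row_other: "ALL j<l. x ~= b + j ==> fold (%j A. A(b + j := f j)) [0..<l] A (x :: nat) = A x"
 by (induction l) (auto simp: less_Suc_eq)

text \<open>Rows start at multiples of \<open>d\<close> and have length at most \<open>d\<close>, so
  filling a later row leaves the earlier ones intact.\<close>

lemma tab_nth:
 assumes off: "!!i. i < k ==> off i = i * d" and l: "l <= d" and i: "i < k" and j: "j < l"
 shows "tab off f k l A (off i + j) = f i j"
proof -
 have "m <= k ==> i < m ==> tab off f m l A (off i + j) = f i j" for m
 proof (induction m)
  case (Suc m)
  show ?case
  proof (cases "i = m")
   case True
   thus ?thesis using row_nth[of j l] j by (simp add: tab_Suc)
  next
   case False
   hence im: "i < m" using Suc by simp
   have "off i + j < m * d"
   proof -
    have "i * d + j < Suc i * d" using j l by simp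
    also have "... <= m * d" using im by (intro mult_right_mono) auto
    finally show ?thesis using off i by simp
   qed
   hence "ALL j'<l. off i + j ~= off m + j'" using off Suc.prems by auto
   thus ?thesis unfolding tab_Suc by (subst row_other) (use Suc im in auto)
  qed
 qed simp
 from this[of k] i show ?thesis by simp
qed

text \<open>Cost of one particular run. \<open>scost\<close> charges the dearer branch of every
  conditional, which is too much for the filter, whose branches have different budgets;
  \<open>achieves_Ite\<close> charges only the branch taken.\<close>

definition achieves :: "nat => stm => state => state => nat => bool" where
 "achieves v P s s' c \<longleftrightarrow> (ALL s1. agr v 20 s s1 --> (EX t s2. exec (cmps v P) s1 t s2 & agr v 20 s' s2 & t <= c))"

lemma achieves_sem: "wfs v P ==> 10 <= v ==> achieves v P s (sem v P s) (scost P (ireg s))"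
 unfolding achieves_def using cmps_correct by blast

lemma achieves_mono: "achieves v P s s' c ==> c <= c' ==> achieves v P s s' c'" unfolding achieves_def by (meson order_trans)

lemma achieves_Sq: 
 assumes P: "achieves v P s s' c" and Q: "achieves v Q s' s'' c'"
 shows "achieves v (Sq P Q) s s'' (c + c')" unfolding achieves_def
proof (intro allI impI)
 fix s1 assume "agr v 20 s s1"
 then obtain t s2 where 1: "exec (cmps v P) s1 t s2" "agr v 20 s' s2" "t <= c" using P unfolding achieves_def by blast
 then obtain u s3 where 2: "exec (cmps v Q) s2 u s3" "agr v 20 s'' s3" "u <= c'" using Q unfolding achieves_def by blast
 show "EX t s2. exec (cmps v (Sq P Q)) s1 t s2 & agr v 20 s'' s2 & t <= c + c'"
  using exec.Seq[OF 1(1) 2(1)] 1(3) 2(2,3) by (intro exI[of _ "t + u"] exI[of _ s3]) auto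
qed

lemma achieves_Ite:
 assumes wf: "wfe v a" "wfe v b" "10 <= v"
  and R: "achieves v (if eval v a s < eval v b s then P else Q) s s' c"
 shows "achieves v (Ite a b P Q) s s' (ecost a (ireg s) + ecost b (ireg s) + 1 + c)" unfolding achieves_def
proof (intro allI impI)
 fix s1 assume s1: "agr v 20 s s1"
 have r: "!!s. runs (cmp v 20 a) v 20 a s" "!!s. runs (cmp v (Suc 20) b) v (Suc 20) b s" using cmp_correct[OF wf(1,3)] cmp_correct[OF wf(2,3)] by auto
 from cmp_binary[OF r wf order_refl, of s1]
 obtain t s2 where 1: "exec (Seq (cmp v 20 a) (cmp v (Suc 20) b)) s1 t s2" "agr v 20 s1 s2"
  "rreg s2 20 = eval v a s1" "rreg s2 (Suc 20) = eval v b s1" "t <= ecost a (ireg s1) + ecost b (ireg s1)" by (elim exE conjE)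
 have e: "eval v a s1 = eval v a s" "eval v b s1 = eval v b s"
   "ecost a (ireg s1) = ecost a (ireg s)" "ecost b (ireg s1) = ecost b (ireg s)"
  using eval_agr[OF wf(1,3) s1] ecost_agr[OF wf(1,3) s1] eval_agr[OF wf(2,3) s1] ecost_agr[OF wf(2,3) s1] by auto
 have a2: "agr v 20 s s2" by (rule agr_trans[OF s1 1(2)])
 obtain u s3 where 2: "exec (cmps v (if eval v a s < eval v b s then P else Q)) s2 u s3" "agr v 20 s' s3" "u <= c" using R a2 unfolding achieves_def by blast
 have c: "exec (Cond (RLess 20 21) (cmps v P) (cmps v Q)) s2 (u + 1) s3"
 proof (cases "eval v a s < eval v b s")
  case True
  hence "holds (RLess 20 21) s2" using 1 e by simp
  thus ?thesis by (rule exec.CondT) (use 2(1) True in simp)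
 next
  case False
  hence "~ holds (RLess 20 21) s2" using 1 e by simp
  thus ?thesis by (rule exec.CondF) (use 2(1) False in simp)
 qed
 have ss: "Suc 20 = 21" by simp
 have "exec (cmps v (Ite a b P Q)) s1 (t + (u + 1)) s3" unfolding cmps.simps by (rule exec_Seq_assoc[OF exec.Seq[OF 1(1)[unfolded ss] c]])
 moreover have "t + (u + 1) <= ecost a (ireg s) + ecost b (ireg s) + 1 + c" using 1(5) 2(3) e by simp
 ultimately show "EX t s2. exec (cmps v (Ite a b P Q)) s1 t s2 & agr v 20 s' s2 & t <= ecost a (ireg s) + ecost b (ireg s) + 1 + c" using 2(2) by blast
qed

section \<open>The program of the tester\<close>

definition delta :: "nat => nat => rex => rex" where
 "delta i j c = IfLt (Nt i) (Nt j) (Con 0) (IfLt (Nt j) (Nt i) (Con 0) c)"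

lemma eval_delta: "eval v (delta i j c) s = (if ireg s i = ireg s j then eval v c s else 0)" by (simp add: delta_def)

text \<open>Array 2 holds the matrix, array 3 its power and array 4 the next product, since a table
  may not read the array that it writes. \<open>r\<close> is the register of the dimension; register
  6 holds the exponent \<open>p\<close>.\<close>

definition power_stm :: "nat => stm" where
 "power_stm r = Sq (Tab 3 r r (delta 13 14 (Con 1)))
  (Rep 6 (Sq (Tab 4 r r (Sm r (Mul (Ld 3 14 16) (Ld 2 16 15)))) (Tab 3 r r (Ld 4 14 15))))"

text \<open>One layer of \<open>cuts\<close>: \<open>Nt 13\<close> is \<open>k\<close>,
  \<open>Reg 12\<close> is \<open>2^k\<close>, \<open>Reg 11\<close> the base threshold, array 5 the
  weights, array 1 the 0/1 column of survivors and array 9 a buffer. Integer registers 3 and 4 are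
  constantly 1 and 0, so a vector is a one-column table. \<open>Set 14 (Con 0)\<close> stands for
  the empty statement.\<close>

definition cut_stm :: stm where
 "cut_stm = Sq (Set 13 (Sm 0 (IfLt (Mul (Reg 11) (Reg 12)) (Ld 5 14 4) (Ld 1 14 4) (Con 0))))
  (Sq (Ite (Dvd (Reg 4) (Mul (Mul (Con 50) (Mul (Add (Nt 13) (Con 1)) (Add (Nt 13) (Con 1)))) (Reg 12))) (Reg 13)
   (Sq (Tab 9 0 3 (IfLt (Mul (Reg 11) (Reg 12)) (Ld 5 14 4) (Con 0) (Ld 1 14 4))) (Tab 1 0 3 (Ld 9 14 4)))
   (Set 14 (Con 0)))
  (Set 12 (Mul (Con 2) (Reg 12))))"

definition tall_stm :: stm where
 "tall_stm = Sq (Tab 2 1 1 (Sub (Sm 0 (Mul (Ld 1 15 4) (Mul (Ld 0 15 13) (Ld 0 15 14))))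
    (delta 13 14 (Sub (Nt 0) (Mul (Con 4) (Mul (Reg 4) (Reg 5)))))))
  (Sq (power_stm 1)
  (Sq (Tab 5 0 3 (Sm 1 (Mul (Sm 1 (Mul (Ld 3 15 16) (Ld 0 13 16))) (Sm 1 (Mul (Ld 3 15 16) (Ld 0 13 16))))))
  (Sq (Set 11 (Mul (Reg 5) (Sm 1 (Sm 1 (Mul (Ld 3 13 14) (Ld 3 13 14))))))
  (Sq (Set 12 (Con 1)) (Rep 8 cut_stm)))))"

definition wide_stm :: stm where
 "wide_stm = Sq (Tab 2 0 0 (Mul (Mul (Ld 1 13 4) (Ld 1 14 4)) (Sub (Sm 1 (Mul (Ld 0 13 15) (Ld 0 14 15))) (delta 13 14 (Nt 1)))))
  (Sq (power_stm 0)
  (Sq (Tab 5 0 3 (Sm 0 (Mul (Ld 3 13 15) (Ld 3 13 15))))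
  (Sq (Set 11 (Dvd (Sm 0 (Sm 0 (Mul (Ld 3 13 14) (Ld 3 13 14)))) (Mul (Con 8) (Reg 4))))
  (Sq (Tab 9 0 3 (IfLt (Reg 11) (Ld 5 13 4) (Con 0) (Ld 1 13 4))) (Tab 1 0 3 (Ld 9 13 4))))))"

definition norm_stm :: "rex => stm" where
 "norm_stm e = Tab 1 0 3 (IfLt e (Sm 1 (Mul (Ld 0 10 12) (Ld 0 10 12))) (Con 0) (Con 1))"

text \<open>The \<open>48 * p^2\<close> rounds come as nested loops because integer registers cannot
  be multiplied.\<close>

definition iter_stm :: "stm => stm" where
 "iter_stm P = Sq (norm_stm (Mul (Nt 0) (Nt 1))) (Rep 6 (Rep 6 (Rep 7 P)))"

definition pairs_stm :: stm where
 "pairs_stm = Sq (Tab 1 0 3 (Con 1))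
  (Sq (Tab 2 0 0 (Sub (Sm 1 (Mul (Ld 0 10 12) (Ld 0 11 12))) (delta 10 11 (Nt 1))))
  (Rep 0 (Rep 0 (Ite (Reg 7) (Mul (Mul (Ld 1 10 4) (Ld 1 11 4)) (IfLt (Ld 2 10 11) (Con 0) (Sub (Con 0) (Ld 2 10 11)) (Ld 2 10 11)))
   (Sq (Tab 9 0 3 (delta 12 10 (Con 1)))
    (Sq (Tab 8 0 3 (Sub (Ld 1 12 4) (IfLt (Con 0) (Add (Ld 9 12 4) (delta 12 11 (Con 1))) (Ld 1 12 4) (Con 0))))
     (Tab 1 0 3 (Ld 8 12 4))))
   (Set 14 (Con 0))))))"

definition final_stm :: stm where
 "final_stm = Sq (Tab 6 3 1 (Sm 0 (Mul (Ld 1 12 4) (Ld 0 12 11))))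
  (Sq (Tab 7 0 3 (Sub (Sm 1 (Mul (Ld 6 4 12) (Ld 0 10 12))) (Nt 1)))
  (Sq (Set 9 (Sub (Sub (Sm 1 (Mul (Ld 6 4 10) (Ld 6 4 10))) (Mul (Nt 1) (Sm 0 (Ld 1 10 4))))
     (Mul (Con 2) (Sm 0 (Mul (Ld 1 10 4) (IfLt (Reg 6) (Ld 7 10 4) (Ld 7 10 4)
       (IfLt (Reg 6) (Sub (Con 0) (Ld 7 10 4)) (Ld 7 10 4) (Con 0))))))))
   (Ite (Reg 8) (Reg 9) (ISet 0 1) (ISet 0 0))))"

text \<open>\<open>n < be^4\<close> is the range in which \<open>p^3\<close> is
  \<open>O(be)\<close>, so that the spectral filters fit the time bound. The pair test costs
  \<open>n * n * d\<close>, which fits only if \<open>be >= 1\<close>; for \<open>be < 1\<close> no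
  sample can have been corrupted.\<close>

definition filter_stm :: stm where
 "filter_stm = (let big = Mul (Mul (Reg 4) (Reg 4)) (Mul (Reg 4) (Reg 4)) in
  Ite (Nt 0) (Nt 1)
   (Ite (Reg 4) (Con 1) (Tab 1 0 3 (Con 1)) (Ite (Nt 0) big (iter_stm wide_stm) pairs_stm))
   (Ite (Nt 0) big (iter_stm tall_stm) (norm_stm (Reg 7))))"

text \<open>Finds \<open>p = lev n\<close> without converting reals to integers: real register 3 is
  doubled while it is below \<open>n\<close>, within a loop of \<open>n\<close> rounds. Integer
  registers 6 and 8 follow with \<open>p\<close> and \<open>2 * p\<close>; register 7 is the round
  factor 48.\<close>

definition prelude_stm :: stm where
 "prelude_stm = Sq (ISet 3 1) (Sq (ISet 6 1) (Sq (ISet 7 48) (Sq (ISet 8 2) (Sq (Set 3 (Con 2))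
  (Rep 0 (Ite (Reg 3) (Nt 0) (Sq (Set 3 (Add (Reg 3) (Reg 3))) (Sq (Inc 6) (Sq (Inc 8) (Inc 8)))) (Set 14 (Con 0))))))))"

text \<open>Real registers 4 to 8 receive \<open>be\<close>, \<open>th\<close>, \<open>ta\<close>,
  \<open>h\<close> and the threshold \<open>(n * \<alpha>)^2 / 2\<close>.\<close>

definition param_stm :: stm where
 "param_stm = Sq (Set 4 (Mul (Reg 0) (Nt 0)))
  (Sq (Set 5 (Mul (Dvd (Reg 1) (Mul (Con 10000) (Reg 0))) (Dvd (Reg 1) (Mul (Con 10000) (Reg 0)))))
  (Sq (Set 6 (Dvd (Mul (Nt 0) (Mul (Reg 1) (Reg 1))) (Mul (Con 100) (Reg 0))))
  (Sq (Set 7 (Dvd (Mul (Dvd (Reg 1) (Reg 0)) (Dvd (Reg 1) (Reg 0))) (Con 1000)))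
   (Set 8 (Dvd (Mul (Mul (Nt 0) (Reg 1)) (Mul (Nt 0) (Reg 1))) (Con 2))))))"

text \<open>The row offsets \<open>i * d\<close> are tabulated by repeated addition, as integers
  have no product. Register 5 starts at 0.\<close>

definition offsets :: program where
 "offsets = For 10 0 (Seq (Instr (IStore 0 10 5)) (Instr (IAdd 5 5 1)))"

definition tester :: program where
 "tester = Seq offsets (cmps 10 (Sq prelude_stm (Sq param_stm (Sq filter_stm final_stm))))"

definition conflict :: "nat => (nat => nat => real) => real => nat => nat => bool" where
 "conflict d Y h i j \<longleftrightarrow> h < \<bar>ip d (Y i) (Y j) - (if i = j then real d else 0)\<bar>"

definition all_pairs :: "nat => (nat \<times> nat) list" where
 "all_pairs n = concat (map (%i. map (Pair i) [0..<n]) [0..<n])"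

text \<open>The set that \<open>filter_stm\<close> leaves in array 1. In \<open>48 = 8 * 6\<close>,
  eight rounds of the Gram filter at least halve the potential above the floor, and
  \<open>6 * p^2\<close> halvings are enough.\<close>

definition survivors :: "nat => nat => (nat => nat => real) => real => real => real => nat => nat set" where
 "survivors n d Y be th h p = (let W = {i\<in>{..<n}. ip d (Y i) (Y i) <= real n * real d} in
  if n < d then
   if be < 1 then {..<n}
   else if real n < be ^ 4 then (wide_round n d Y be p ^^ (48 * p\<^sup>2)) W
   else remove_pairs (conflict d Y h) {..<n} (all_pairs n)
  else if real n < be ^ 4 then (tall_round n d Y th be p ^^ (48 * p\<^sup>2)) W
  else {i\<in>{..<n}. ip d (Y i) (Y i) <= h})"

lemmas stm_defs = power_stm_def cut_stm_def tall_stm_def wide_stm_def norm_stm_def iter_stm_def pairs_stm_def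
 final_stm_def delta_def

section \<open>Correctness of the program pieces\<close>

locale ram =
 fixes n d p :: nat and be th ta h c :: real and Y :: "nat => nat => real"
 assumes n: "n >= 1" and d: "d >= 1"
begin

definition "ok s \<longleftrightarrow> ireg s 0 = n & ireg s 1 = d & ireg s 3 = 1 & ireg s 4 = 0 & ireg s 6 = p & ireg s 7 = 48 &
 ireg s 8 = 2 * p & rreg s 4 = be & rreg s 5 = th & rreg s 6 = ta & rreg s 7 = h & rreg s 8 = c &
 (ALL i<n. iarr s 0 i = i * d) & mat s 0 n d Y"

lemma ok_sem:
 "wfs v P ==> 10 <= v ==> 0 \<notin> writes P ==> assigns P \<inter> {4, 5, 6, 7, 8} = {} ==> incs P = {} ==> ok s ==> ok (sem v P s)"
 unfolding ok_def by (auto simp: sem_ireg sem_rreg sem_iarr mat_sem)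

lemma ok_seti: "10 <= v ==> ok s ==> ok (seti v i s)" unfolding ok_def by auto

lemma okD:
 assumes "ok s"
 shows "ireg s 0 = n" "ireg s 1 = d" "ireg s (Suc 0) = d" "ireg s 3 = 1" "ireg s 4 = 0" "ireg s 6 = p" "ireg s 7 = 48" "ireg s 8 = 2 * p"
  "rreg s 4 = be" "rreg s 5 = th" "rreg s 6 = ta" "rreg s 7 = h" "rreg s 8 = c" "mat s 0 n d Y" using assms by (auto simp: ok_def)

lemma sem_Tab:
 assumes "ok s" "ireg s k <= n" "ireg s l <= d"
  and "!!i j. i < ireg s k ==> j < ireg s l ==> eval (Suc (Suc v)) e (seti (Suc v) j (seti v i s)) = M i j"
 shows "mat (sem v (Tab a k l e) s) a (ireg s k) (ireg s l) M"
proof -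
 have "iarr s 0 i = i * d" if "i < ireg s k" for i using assms(1,2) that by (simp add: ok_def)
 thus ?thesis unfolding mat_def ent_def using assms tab_nth[of "ireg s k" "iarr s 0" d "ireg s l"] by simp
qed

definition "alive s W \<longleftrightarrow> W <= {..<n} & mat s 1 n 1 (%i j. if i : W then 1 else 0)"

lemma alive_ent: "alive s W ==> i < n ==> ent s (Suc 0) i 0 = (if i : W then 1 else 0)" by (auto simp: alive_def mat_def)

lemma alive_sum: "alive s W ==> (SUM i<n. ent s (Suc 0) i 0 * f i) = (SUM i:W. f i)"
proof -
 assume a: "alive s W"
 have "(SUM i<n. ent s (Suc 0) i 0 * f i) = (SUM i<n. if i : W then f i else 0)" by (intro sum.cong) (auto simp: alive_ent[OF a])
 also have "... = (SUM i:{..<n} \<inter> W. f i)" by (simp add: sum.inter_restrict)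
 finally show ?thesis using a by (simp add: alive_def Int_absorb1)
qed

lemma Y_ent: "ok s ==> i < n ==> j < d ==> ent s 0 i j = Y i j" by (simp add: ok_def mat_def)

lemma alive_sem: "alive s W ==> 1 \<notin> writes P ==> alive (sem v P s) W" by (simp add: alive_def mat_sem)

lemma alive_seti [simp]: "alive (seti v i s) = alive s" by (simp add: alive_def fun_eq_iff)

text \<open>The condition \<open>m <= d\<close> lets the square matrix share the row offsets of the
  data, whose stride is \<open>d\<close>; hence the covariance is used only for
  \<open>d <= n\<close> and the Gram matrix only for \<open>n <= d\<close>.\<close>

lemma power_correct:
 assumes s: "ok s" and r: "r = 0 | r = 1" and m: "ireg s r = m" "m <= n" "m <= d" and N: "mat s 2 m m N"
 shows "mat (sem 13 (power_stm r) s) 3 m m (mpow m N p)" "ok (sem 13 (power_stm r) s)"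
proof -
 let ?P = "Tab 3 r r (delta 13 14 (Con 1))"
 let ?Q = "Sq (Tab 4 r r (Sm r (Mul (Ld 3 14 16) (Ld 2 16 15)))) (Tab 3 r r (Ld 4 14 15))"
 define s1 where "s1 = sem 13 ?P s"
 have s1: "ok s1" unfolding s1_def using r by (intro ok_sem s) (auto simp: delta_def)
 have r1: "ireg s1 r = m" using okD[OF s] okD[OF s1] r m(1) by auto
 have K1: "mat s1 3 m m (mpow m N 0)" unfolding s1_def m(1)[symmetric] by (rule sem_Tab) (use s m in \<open>auto simp: eval_delta\<close>)
 have N1: "mat s1 2 m m N" unfolding s1_def by (intro mat_sem N) simp
 define I where "I = (%k s. ok s & ireg s r = m & mat s 2 m m N & mat s 3 m m (mpow m N k))"
 have "I p (sem 13 (Rep 6 ?Q) s1)"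
 proof (rule sem_Rep)
  fix i s assume I: "I i s"
  define t where "t = seti 13 i s"
  have t: "ok t" "mat t 2 m m N" "mat t 3 m m (mpow m N i)" "ireg t r = m" using I r by (auto simp: I_def t_def ok_seti)
  define t1 where "t1 = sem 14 (Tab 4 r r (Sm r (Mul (Ld 3 14 16) (Ld 2 16 15)))) t"
  have t1: "ok t1" unfolding t1_def using r by (intro ok_sem t) auto
  have r1: "ireg t1 r = m" using okD[OF t(1)] okD[OF t1] r t(4) by auto
  have e: "eval 16 (Sm r (Mul (Ld 3 14 16) (Ld 2 16 15))) (seti 15 b (seti 14 a t)) = mpow m N (Suc i) a b" if "a < m" "b < m" for a b
   using r t that by (auto simp: eval_Ld mat_ent simp del: eval.simps(4) intro!: sum.cong)
  have K4: "mat t1 4 m m (mpow m N (Suc i))" unfolding t1_def t(4)[symmetric] by (rule sem_Tab) (use t m e in auto)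
  define t2 where "t2 = sem 14 (Tab 3 r r (Ld 4 14 15)) t1"
  have t2: "ok t2" unfolding t2_def using r by (intro ok_sem t1) auto
  have K3: "mat t2 3 m m (mpow m N (Suc i))"
   unfolding t2_def r1[symmetric] by (rule sem_Tab) (use t1 m r1 K4 in \<open>auto simp: eval_Ld mat_ent simp del: eval.simps(4)\<close>)
  have N2: "mat t2 2 m m N" unfolding t2_def t1_def by (intro mat_sem t) auto
  have "sem (Suc 13) ?Q (seti 13 i s) = t2" by (simp add: t2_def t1_def t_def)
  moreover have "ireg t2 r = m" using okD[OF t1] okD[OF t2] r r1 by auto
  ultimately show "I (Suc i) (sem (Suc 13) ?Q (seti 13 i s))" using t2 K3 N2 by (simp add: I_def)
 next
  show "I 0 s1" using s1 r1 N1 K1 by (simp add: I_def)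
  show "ireg s1 6 = p" using okD[OF s1] by simp
 qed
 thus "mat (sem 13 (power_stm r) s) 3 m m (mpow m N p)" "ok (sem 13 (power_stm r) s)" by (auto simp: I_def power_stm_def s1_def)
qed

lemma cut_correct:
 assumes W: "W0 <= {..<n}" and s: "ok s" "alive s (cuts si H be W0 k)" "mat s 5 n 1 (%i j. si i)" "rreg s 11 = H" "rreg s 12 = 2 ^ k" "ireg s 13 = k"
 defines "t == sem 14 cut_stm s"
 shows "ok t" "alive t (cuts si H be W0 (Suc k))" "mat t 5 n 1 (%i j. si i)" "rreg t 11 = H" "rreg t 12 = 2 ^ Suc k"
proof -
 let ?W = "cuts si H be W0 k"
 let ?C = "Set 13 (Sm 0 (IfLt (Mul (Reg 11) (Reg 12)) (Ld 5 14 4) (Ld 1 14 4) (Con 0)))"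
 let ?T9 = "Tab 9 0 3 (IfLt (Mul (Reg 11) (Reg 12)) (Ld 5 14 4) (Con 0) (Ld 1 14 4))"
 let ?T1 = "Tab 1 0 3 (Ld 9 14 4)"
 let ?cond = "be / (50 * (real k + 1)\<^sup>2 * 2 ^ k) < real (card {i : ?W. H * 2 ^ k < si i})"
 note simps = eval_Ld mat_ent
 show "ok t" unfolding t_def by (intro ok_sem s) (auto simp: cut_stm_def)
 show "mat t 5 n 1 (%i j. si i)" unfolding t_def by (intro mat_sem s) (auto simp: cut_stm_def)
 show "rreg t 11 = H" unfolding t_def by (subst sem_rreg) (use s in \<open>auto simp: cut_stm_def\<close>)
 define s1 where "s1 = sem 14 ?C s"
 have Wn: "?W <= {..<n}" using cuts_subset W by blast
 have "eval 14 (Sm 0 (IfLt (Mul (Reg 11) (Reg 12)) (Ld 5 14 4) (Ld 1 14 4) (Con 0))) s = (SUM i<n. if i : ?W & H * 2 ^ k < si i then 1 else 0)"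
  using s okD[OF s(1)] by (auto simp: simps alive_ent simp del: eval.simps(4) intro!: sum.cong)
 also have "... = real (card {i : ?W. H * 2 ^ k < si i})" using Wn by (subst sum.inter_filter[symmetric]) (auto intro!: arg_cong[where f = card])
 finally have cnt: "rreg s1 13 = real (card {i : ?W. H * 2 ^ k < si i})" by (simp add: s1_def)
 have s1: "ok s1" "alive s1 ?W" "mat s1 5 n 1 (%i j. si i)" "rreg s1 11 = H" "rreg s1 12 = 2 ^ k" "ireg s1 13 = k"
  unfolding s1_def by (intro ok_sem alive_sem mat_sem s; simp)+ (use s in simp_all)
 define s2 where "s2 = sem 14 (Sq ?T9 ?T1) s1"
 have a2: "alive s2 {i : ?W. ~ H * 2 ^ k < si i}"
 proof -
  define u where "u = sem 14 ?T9 s1"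
  have u: "ok u" unfolding u_def by (intro ok_sem s1) auto
  have "mat u 9 (ireg s1 0) (ireg s1 3) (%i j. if i : ?W & ~ H * 2 ^ k < si i then 1 else 0)"
   unfolding u_def by (rule sem_Tab) (use s1 okD[OF s1(1)] d in \<open>auto simp: simps alive_ent simp del: eval.simps(4)\<close>)
  hence 9: "mat u 9 n 1 (%i j. if i : ?W & ~ H * 2 ^ k < si i then 1 else 0)" using okD[OF s1(1)] by simp
  have "mat (sem 14 ?T1 u) 1 (ireg u 0) (ireg u 3) (%i j. if i : ?W & ~ H * 2 ^ k < si i then 1 else 0)"
   by (rule sem_Tab) (use u 9 okD[OF u] d in \<open>auto simp: simps simp del: eval.simps(4)\<close>)
  thus ?thesis using Wn okD[OF u] unfolding alive_def by (auto simp: s2_def u_def)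
 qed
 have al: "alive (if ?cond then s2 else sem 14 (Set 14 (Con 0)) s1) (cuts si H be W0 (Suc k))"
  using a2 s1(2) by (auto intro!: alive_sem simp: cuts.simps simp del: sem.simps)
 have t: "t = sem 14 (Set 12 (Mul (Con 2) (Reg 12))) (if ?cond then s2 else sem 14 (Set 14 (Con 0)) s1)"
 proof -
  let ?e = "Dvd (Reg 4) (Mul (Mul (Con 50) (Mul (Add (Nt 13) (Con 1)) (Add (Nt 13) (Con 1)))) (Reg 12))"
  have "(eval 14 ?e s1 < eval 14 (Reg 13) s1) = ?cond" using s1 cnt okD[OF s1(1)] by (simp add: sq_eq)
  thus ?thesis unfolding t_def cut_stm_def sem.simps(5) s1_def[symmetric] sem.simps(6) s2_def by (simp only:)
 qed
 show "alive t (cuts si H be W0 (Suc k))" unfolding t by (rule alive_sem[OF al]) simp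
 have "rreg s2 12 = 2 ^ k" unfolding s2_def by (subst sem_rreg) (use s1 in auto)
 thus "rreg t 12 = 2 ^ Suc k" unfolding t using s1 by simp
qed

lemma tall_correct:
 assumes dn: "d <= n" and s: "ok s" "alive s W"
 shows "ok (sem 13 tall_stm s)" "alive (sem 13 tall_stm s) (tall_round n d Y th be p W)"
proof -
 note simps = eval_Ld mat_ent eval_delta
 let ?N = "cov d Y (real n - 4 * (be * th)) W"
 let ?K = "mpow d ?N p"
 let ?A = "Tab 2 1 1 (Sub (Sm 0 (Mul (Ld 1 15 4) (Mul (Ld 0 15 13) (Ld 0 15 14))))
    (delta 13 14 (Sub (Nt 0) (Mul (Con 4) (Mul (Reg 4) (Reg 5))))))"
 let ?B = "Tab 5 0 3 (Sm 1 (Mul (Sm 1 (Mul (Ld 3 15 16) (Ld 0 13 16))) (Sm 1 (Mul (Ld 3 15 16) (Ld 0 13 16)))))"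
 let ?C = "Set 11 (Mul (Reg 5) (Sm 1 (Sm 1 (Mul (Ld 3 13 14) (Ld 3 13 14)))))"
 define s1 where "s1 = sem 13 ?A s"
 have s1: "ok s1" "alive s1 W" unfolding s1_def by (intro ok_sem alive_sem s; simp add: delta_def)+
 have "mat s1 2 (ireg s 1) (ireg s 1) ?N" unfolding s1_def
 proof (rule sem_Tab)
  fix i j assume "i < ireg s 1" "j < ireg s 1"
  hence ij: "i < d" "j < d" using okD[OF s(1)] by auto
  have "(SUM k<n. ent s (Suc 0) k 0 * (ent s 0 k i * ent s 0 k j)) = (SUM k:W. Y k i * Y k j)"
   unfolding alive_sum[OF s(2)] using s ij by (intro sum.cong) (auto simp: alive_def Y_ent)
  thus "eval (Suc (Suc 13)) (Sub (Sm 0 (Mul (Ld 1 15 4) (Mul (Ld 0 15 13) (Ld 0 15 14))))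
    (delta 13 14 (Sub (Nt 0) (Mul (Con 4) (Mul (Reg 4) (Reg 5)))))) (seti (Suc 13) j (seti 13 i s)) = ?N i j"
   using okD[OF s(1)] by (simp add: simps cov_def del: eval.simps(4))
 qed (use s okD[OF s(1)] dn in auto)
 hence N: "mat s1 2 d d ?N" using okD[OF s(1)] by simp
 define s2 where "s2 = sem 13 (power_stm 1) s1"
 have K: "mat s2 3 d d ?K" and s2: "ok s2" unfolding s2_def by (intro power_correct[OF s1(1) _ _ dn order_refl N]; use okD[OF s1(1)] in simp)+
 have a2: "alive s2 W" unfolding s2_def by (intro alive_sem s1) (auto simp: power_stm_def)
 define s3 where "s3 = sem 13 ?B s2"
 have s3: "ok s3" "alive s3 W" "mat s3 3 d d ?K" unfolding s3_def by (intro ok_sem alive_sem mat_sem s2 a2 K; simp)+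
 have "mat s3 5 (ireg s2 0) (ireg s2 3) (%i j. weight d Y ?K i)" unfolding s3_def by (rule sem_Tab)
   (use s2 okD(1-5)[OF s2] d K in \<open>simp_all add: simps Y_ent weight_def sq_eq del: eval.simps(4)\<close>)
 hence 5: "mat s3 5 n 1 (%i j. weight d Y ?K i)" using okD[OF s2] by simp
 define s4 where "s4 = sem 13 ?C s3"
 define s5 where "s5 = sem 13 (Set 12 (Con 1)) s4"
 have s5: "ok s5" "alive s5 W" "mat s5 5 n 1 (%i j. weight d Y ?K i)" unfolding s5_def s4_def by (intro ok_sem alive_sem mat_sem s3 5; simp)+
 have H: "rreg s5 11 = th * frob d ?K" "rreg s5 12 = 2 ^ 0"
  unfolding s5_def s4_def using okD(1-10)[OF s3(1)] s3(3) by (simp_all add: simps frob_def sq_eq del: eval.simps(4))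
 define I where "I = (%k s. ok s & alive s (cuts (weight d Y ?K) (th * frob d ?K) be W k) &
   mat s 5 n 1 (%i j. weight d Y ?K i) & rreg s 11 = th * frob d ?K & rreg s 12 = 2 ^ k)"
 have Wn: "W <= {..<n}" using s by (simp add: alive_def)
 have "I (2 * p) (sem 13 (Rep 8 cut_stm) s5)"
 proof (rule sem_Rep)
  fix k s assume I: "I k s"
  show "I (Suc k) (sem (Suc 13) cut_stm (seti 13 k s))" using cut_correct[of W "seti 13 k s" "weight d Y ?K" "th * frob d ?K" k] I Wn by (simp add: I_def ok_seti)
 qed (use s5 H okD[OF s5(1)] in \<open>auto simp: I_def\<close>)
 moreover have "sem 13 tall_stm s = sem 13 (Rep 8 cut_stm) s5" by (simp only: tall_stm_def sem.simps(5) s5_def s4_def s3_def s2_def s1_def)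
 ultimately show "ok (sem 13 tall_stm s)" "alive (sem 13 tall_stm s) (tall_round n d Y th be p W)" by (auto simp: I_def tall_round_def Let_def)
qed

lemma wide_correct:
 assumes dn: "n <= d" and s: "ok s" "alive s W"
 shows "ok (sem 13 wide_stm s)" "alive (sem 13 wide_stm s) (wide_round n d Y be p W)"
proof -
 note simps = eval_Ld mat_ent eval_delta
 let ?N = "gram d Y W"
 let ?K = "mpow n ?N p"
 let ?A = "Tab 2 0 0 (Mul (Mul (Ld 1 13 4) (Ld 1 14 4)) (Sub (Sm 1 (Mul (Ld 0 13 15) (Ld 0 14 15))) (delta 13 14 (Nt 1))))"
 let ?B = "Tab 5 0 3 (Sm 0 (Mul (Ld 3 13 15) (Ld 3 13 15)))"
 let ?C = "Set 11 (Dvd (Sm 0 (Sm 0 (Mul (Ld 3 13 14) (Ld 3 13 14)))) (Mul (Con 8) (Reg 4)))"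
 let ?T9 = "Tab 9 0 3 (IfLt (Reg 11) (Ld 5 13 4) (Con 0) (Ld 1 13 4))"
 let ?T1 = "Tab 1 0 3 (Ld 9 13 4)"
 define s1 where "s1 = sem 13 ?A s"
 have s1: "ok s1" "alive s1 W" unfolding s1_def by (intro ok_sem alive_sem s; simp add: delta_def)+
 have "mat s1 2 (ireg s 0) (ireg s 0) ?N" unfolding s1_def by (rule sem_Tab)
   (use s okD[OF s(1)] dn in \<open>auto simp: simps gram_def alive_ent Y_ent ip_def simp del: eval.simps(4)\<close>)
 hence N: "mat s1 2 n n ?N" using okD[OF s(1)] by simp
 define s2 where "s2 = sem 13 (power_stm 0) s1"
 have K: "mat s2 3 n n ?K" and s2: "ok s2" unfolding s2_def by (intro power_correct[OF s1(1) _ _ order_refl dn N]; use okD[OF s1(1)] in simp)+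
 have a2: "alive s2 W" unfolding s2_def by (intro alive_sem s1) (auto simp: power_stm_def)
 define s3 where "s3 = sem 13 ?B s2"
 have s3: "ok s3" "alive s3 W" "mat s3 3 n n ?K" unfolding s3_def by (intro ok_sem alive_sem mat_sem s2 a2 K; simp)+
 have "mat s3 5 (ireg s2 0) (ireg s2 3) (%i j. row_weight n ?K i)" unfolding s3_def by (rule sem_Tab)
   (use s2 okD(1-5)[OF s2] d K in \<open>simp_all add: simps row_weight_def sq_eq del: eval.simps(4)\<close>)
 hence 5: "mat s3 5 n 1 (%i j. row_weight n ?K i)" using okD[OF s2] by simp
 define s4 where "s4 = sem 13 ?C s3"
 have s4: "ok s4" "alive s4 W" "mat s4 5 n 1 (%i j. row_weight n ?K i)" unfolding s4_def by (intro ok_sem alive_sem mat_sem s3 5; simp)+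
 have H: "rreg s4 11 = frob n ?K / (8 * be)" unfolding s4_def using okD(1-10)[OF s3(1)] s3(3) by (simp_all add: simps frob_def sq_eq del: eval.simps(4))
 define u where "u = sem 13 ?T9 s4"
 have u: "ok u" unfolding u_def by (intro ok_sem s4) auto
 let ?M = "%i (j::nat). if i : wide_round n d Y be p W then 1 else 0 :: real"
 have "mat u 9 (ireg s4 0) (ireg s4 3) ?M" unfolding u_def by (rule sem_Tab)
   (use s4 okD[OF s4(1)] d H in \<open>auto simp: simps alive_ent wide_round_def Let_def simp del: eval.simps(4)\<close>)
 hence 9: "mat u 9 n 1 ?M" using okD[OF s4(1)] by simp
 have t: "sem 13 wide_stm s = sem 13 ?T1 u" by (simp only: wide_stm_def sem.simps(5) s4_def s3_def s2_def s1_def u_def)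
 have "mat (sem 13 ?T1 u) 1 (ireg u 0) (ireg u 3) ?M" by (rule sem_Tab) (use u 9 okD[OF u] d in \<open>auto simp: simps simp del: eval.simps(4)\<close>)
 moreover have "wide_round n d Y be p W <= {..<n}" using s by (auto simp: alive_def wide_round_def Let_def)
 ultimately show "alive (sem 13 wide_stm s) (wide_round n d Y be p W)" unfolding t alive_def using okD[OF u] by simp
 show "ok (sem 13 wide_stm s)" unfolding t by (intro ok_sem u) auto
qed

lemma norm_correct:
 assumes s: "ok s" and e: "!!i j. eval 12 e (seti 11 j (seti 10 i s)) = b" and wf: "wfe 12 e" "reads e = {}"
 shows "ok (sem 10 (norm_stm e) s)" "alive (sem 10 (norm_stm e) s) {i\<in>{..<n}. ip d (Y i) (Y i) <= b}"
proof -
 show "ok (sem 10 (norm_stm e) s)" using wf by (intro ok_sem s) (auto simp: norm_stm_def)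
 have "mat (sem 10 (norm_stm e) s) 1 (ireg s 0) (ireg s 3) (%i j. if i : {i\<in>{..<n}. ip d (Y i) (Y i) <= b} then 1 else 0)"
  unfolding norm_stm_def by (rule sem_Tab)
   (use s okD[OF s] d e in \<open>auto simp: eval_Ld Y_ent ip_def simp del: eval.simps(4)\<close>)
 thus "alive (sem 10 (norm_stm e) s) {i\<in>{..<n}. ip d (Y i) (Y i) <= b}" using okD[OF s] by (auto simp: alive_def)
qed

lemma iter_correct:
 assumes s: "ok s" and P: "!!s W. ok s ==> alive s W ==> ok (sem 13 P s) & alive (sem 13 P s) (F W)"
 shows "ok (sem 10 (iter_stm P) s)"
  "alive (sem 10 (iter_stm P) s) ((F ^^ (48 * p\<^sup>2)) {i\<in>{..<n}. ip d (Y i) (Y i) <= real n * real d})"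
proof -
 define J where "J = (%W s. ok s & alive s W)"
 have 1: "J ((F ^^ 48) W) (sem 12 (Rep 7 P) s)" if "J W s" for s W
 proof (rule sem_Rep[where I = "%i s. J ((F ^^ i) W) s"])
  fix i s assume a: "J ((F ^^ i) W) s"
  show "J ((F ^^ Suc i) W) (sem (Suc 12) P (seti 12 i s))" using P[of "seti 12 i s" "(F ^^ i) W"] a by (simp add: J_def ok_seti)
 qed (use that okD in \<open>auto simp: J_def\<close>)
 have f: "(F ^^ m) ((F ^^ (m * i)) W) = (F ^^ (m * Suc i)) W" for m i W by (simp add: funpow_add)
 have 2: "J ((F ^^ (48 * p)) W) (sem 11 (Rep 6 (Rep 7 P)) s)" if "J W s" for s W
 proof (rule sem_Rep[where I = "%i s. J ((F ^^ (48 * i)) W) s"])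
  fix i s assume a: "J ((F ^^ (48 * i)) W) s"
  have "J ((F ^^ 48) ((F ^^ (48 * i)) W)) (sem 12 (Rep 7 P) (seti 11 i s))" by (rule 1) (use a in \<open>simp add: J_def ok_seti\<close>)
  thus "J ((F ^^ (48 * Suc i)) W) (sem (Suc 11) (Rep 7 P) (seti 11 i s))" unfolding f by simp
 qed (use that okD in \<open>auto simp: J_def\<close>)
 have 3: "J ((F ^^ (48 * p * p)) W) (sem 10 (Rep 6 (Rep 6 (Rep 7 P))) s)" if "J W s" for s W
 proof (rule sem_Rep[where I = "%i s. J ((F ^^ (48 * p * i)) W) s"])
  fix i s assume a: "J ((F ^^ (48 * p * i)) W) s"
  have "J ((F ^^ (48 * p)) ((F ^^ (48 * p * i)) W)) (sem 11 (Rep 6 (Rep 7 P)) (seti 10 i s))" by (rule 2) (use a in \<open>simp add: J_def ok_seti\<close>)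
  thus "J ((F ^^ (48 * p * Suc i)) W) (sem (Suc 10) (Rep 6 (Rep 7 P)) (seti 10 i s))" unfolding f by simp
 qed (use that okD in \<open>auto simp: J_def\<close>)
 have "J {i\<in>{..<n}. ip d (Y i) (Y i) <= real n * real d} (sem 10 (norm_stm (Mul (Nt 0) (Nt 1))) s)"
  unfolding J_def using norm_correct[of s "Mul (Nt 0) (Nt 1)" "real n * real d"] s okD[OF s] by simp
 from 3[OF this] show "ok (sem 10 (iter_stm P) s)"
  "alive (sem 10 (iter_stm P) s) ((F ^^ (48 * p\<^sup>2)) {i\<in>{..<n}. ip d (Y i) (Y i) <= real n * real d})"
  unfolding J_def iter_stm_def by (simp_all add: sq_eq mult.assoc)
qed

lemma pairs_correct:
 assumes nd: "n <= d" and h: "h >= 0" and s: "ok s"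
 shows "ok (sem 10 pairs_stm s)" "alive (sem 10 pairs_stm s) (remove_pairs (conflict d Y h) {..<n} (all_pairs n))"
proof -
 note simps = eval_Ld mat_ent eval_delta
 let ?G = "%i j. ip d (Y i) (Y j) - (if i = j then real d else 0)"
 let ?A = "Tab 1 0 3 (Con 1)"
 let ?B = "Tab 2 0 0 (Sub (Sm 1 (Mul (Ld 0 10 12) (Ld 0 11 12))) (delta 10 11 (Nt 1)))"
 let ?T9 = "Tab 9 0 3 (delta 12 10 (Con 1))"
 let ?T8 = "Tab 8 0 3 (Sub (Ld 1 12 4) (IfLt (Con 0) (Add (Ld 9 12 4) (delta 12 11 (Con 1))) (Ld 1 12 4) (Con 0)))"
 let ?T1 = "Tab 1 0 3 (Ld 8 12 4)"
 let ?g = "Mul (Mul (Ld 1 10 4) (Ld 1 11 4)) (IfLt (Ld 2 10 11) (Con 0) (Sub (Con 0) (Ld 2 10 11)) (Ld 2 10 11))"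
 let ?P = "Ite (Reg 7) ?g (Sq ?T9 (Sq ?T8 ?T1)) (Set 14 (Con 0))"
 let ?c = "conflict d Y h"
 define J where "J = (%W s. ok s & alive s W & mat s 2 n n ?G)"
 have body: "J (remove_pairs ?c W [(i, j)]) (sem 12 ?P s)"
  if J: "J W s" and ij: "i < n" "j < n" "ireg s 10 = i" "ireg s 11 = j" for W s i j
 proof -
  have s: "ok s" "alive s W" "mat s 2 n n ?G" using J by (auto simp: J_def)
  have Wn: "W <= {..<n}" using s by (simp add: alive_def)
  have g: "(eval 12 (Reg 7) s < eval 12 ?g s) = (i : W & j : W & ?c i j)"
   using okD[OF s(1)] s ij h by (auto simp: simps alive_ent conflict_def simp del: eval.simps(4))
  show ?thesis
  proof (cases "i : W & j : W & ?c i j")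
   case False
   hence "sem 12 ?P s = sem 12 (Set 14 (Con 0)) s" unfolding sem.simps(6) g by (rule if_not_P)
   moreover have "ok (sem 12 (Set 14 (Con 0)) s)" "alive (sem 12 (Set 14 (Con 0)) s) W" "mat (sem 12 (Set 14 (Con 0)) s) 2 n n ?G"
    by (intro ok_sem alive_sem mat_sem s; simp)+
   ultimately show ?thesis using False by (auto simp: J_def simp del: sem.simps)
  next
   case True
   define s1 where "s1 = sem 12 ?T9 s"
   have s1: "ok s1" "alive s1 W" "mat s1 2 n n ?G" unfolding s1_def by (intro ok_sem alive_sem mat_sem s; simp add: delta_def)+
   have r1: "ireg s1 10 = i" "ireg s1 11 = j" using ij by (simp_all add: s1_def)
   have "mat s1 9 (ireg s 0) (ireg s 3) (%k l. if k = i then 1 else 0)"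
    unfolding s1_def by (rule sem_Tab) (use s okD[OF s(1)] d ij in \<open>auto simp: simps simp del: eval.simps(4)\<close>)
   hence 9: "mat s1 9 n 1 (%k l. if k = i then 1 else 0)" using okD[OF s(1)] by simp
   define s2 where "s2 = sem 12 ?T8 s1"
   have s2: "ok s2" "mat s2 2 n n ?G" unfolding s2_def by (intro ok_sem mat_sem s1; simp add: delta_def)+
   let ?M = "%k (l::nat). if k : W - {i, j} then 1 else 0 :: real"
   have "mat s2 8 (ireg s1 0) (ireg s1 3) ?M" unfolding s2_def by (rule sem_Tab)
     (use s1 okD[OF s1(1)] d r1 9 in \<open>auto simp: simps alive_ent simp del: eval.simps(4)\<close>)
   hence 8: "mat s2 8 n 1 ?M" using okD[OF s1(1)] by simp
   have "mat (sem 12 ?T1 s2) 1 (ireg s2 0) (ireg s2 3) ?M" by (rule sem_Tab) (use s2 8 okD[OF s2(1)] d in \<open>auto simp: simps simp del: eval.simps(4)\<close>)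
   hence "alive (sem 12 ?T1 s2) (W - {i, j})" using okD[OF s2(1)] Wn by (auto simp: alive_def)
   moreover have "ok (sem 12 ?T1 s2)" "mat (sem 12 ?T1 s2) 2 n n ?G" by (intro ok_sem mat_sem s2; simp)+
   moreover have "sem 12 ?P s = sem 12 ?T1 s2" unfolding sem.simps(6) g if_P[OF True] sem.simps(5) s2_def s1_def ..
   ultimately show ?thesis using True by (simp add: J_def del: sem.simps)
  qed
 qed
 \<comment> \<open>The nested loops visit the pairs in the order of \<open>all_pairs\<close>, so the
   list can be split after every round.\<close>
 have app: "remove_pairs ?c W (xs @ ys) = remove_pairs ?c (remove_pairs ?c W xs) ys" for W xs ys by (induction xs arbitrary: W) auto
 have row: "J (remove_pairs ?c W (map (Pair i) [0..<n])) (sem 11 (Rep 0 ?P) s)" if J: "J W s" and i: "i < n" "ireg s 10 = i" for W s i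
 proof -
  have "J (remove_pairs ?c W (map (Pair i) [0..<n])) (sem 11 (Rep 0 ?P) s) & ireg (sem 11 (Rep 0 ?P) s) 10 = i"
  proof (rule sem_Rep[where I = "%j s. J (remove_pairs ?c W (map (Pair i) [0..<j])) s & ireg s 10 = i"])
   fix j s assume j: "j < n" and a: "J (remove_pairs ?c W (map (Pair i) [0..<j])) s & ireg s 10 = i"
   have "J (remove_pairs ?c (remove_pairs ?c W (map (Pair i) [0..<j])) [(i, j)]) (sem 12 ?P (seti 11 j s))"
    by (rule body) (use a j i in \<open>auto simp: J_def ok_seti\<close>)
   moreover have "ireg (sem 12 ?P (seti 11 j s)) 10 = ireg (seti 11 j s) 10" by (rule sem_ireg) (auto simp: delta_def)
   ultimately show "J (remove_pairs ?c W (map (Pair i) [0..<Suc j])) (sem (Suc 11) ?P (seti 11 j s)) &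
     ireg (sem (Suc 11) ?P (seti 11 j s)) 10 = i" using a by (simp add: app del: sem.simps remove_pairs.simps)
  qed (use J i okD in \<open>auto simp: J_def\<close>)
  thus ?thesis by blast
 qed
 have all: "J (remove_pairs ?c {..<n} (all_pairs n)) (sem 10 (Rep 0 (Rep 0 ?P)) s)" if J: "J {..<n} s" for s unfolding all_pairs_def
 proof (rule sem_Rep[where I = "%i s. J (remove_pairs ?c {..<n} (concat (map (%i. map (Pair i) [0..<n]) [0..<i]))) s"])
  fix i s assume i: "i < n" and a: "J (remove_pairs ?c {..<n} (concat (map (%i. map (Pair i) [0..<n]) [0..<i]))) s"
  have "J (remove_pairs ?c (remove_pairs ?c {..<n} (concat (map (%i. map (Pair i) [0..<n]) [0..<i]))) (map (Pair i) [0..<n]))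
    (sem 11 (Rep 0 ?P) (seti 10 i s))" by (rule row) (use a i in \<open>auto simp: J_def ok_seti\<close>)
  thus "J (remove_pairs ?c {..<n} (concat (map (%i. map (Pair i) [0..<n]) [0..<Suc i]))) (sem (Suc 10) (Rep 0 ?P) (seti 10 i s))"
   by (simp add: app del: sem.simps)
 qed (use J okD in \<open>auto simp: J_def\<close>)
 define s1 where "s1 = sem 10 ?A s"
 have s1: "ok s1" unfolding s1_def by (intro ok_sem s) auto
 have "mat s1 1 (ireg s 0) (ireg s 3) (%i j. if i : {..<n} then 1 else 0)" unfolding s1_def by (rule sem_Tab) (use s okD[OF s] d in auto)
 hence a1: "alive s1 {..<n}" using okD[OF s] by (simp add: alive_def)
 define s2 where "s2 = sem 10 ?B s1"
 have s2: "ok s2" "alive s2 {..<n}" unfolding s2_def by (intro ok_sem alive_sem s1 a1; simp add: delta_def)+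
 have "mat s2 2 (ireg s1 0) (ireg s1 0) ?G"
  unfolding s2_def by (rule sem_Tab) (use s1 okD[OF s1] nd in \<open>auto simp: simps Y_ent ip_def simp del: eval.simps(4)\<close>)
 hence "J {..<n} s2" using s2 okD[OF s1] by (simp add: J_def)
 from all[OF this] show "ok (sem 10 pairs_stm s)" "alive (sem 10 pairs_stm s) (remove_pairs ?c {..<n} (all_pairs n))"
  unfolding J_def pairs_stm_def sem.simps(5) s2_def s1_def by blast+
qed

lemma final_correct:
 assumes s: "ok s" "alive s W"
 shows "ireg (sem 10 final_stm s) 0 = (if c < statistic d ta Y W then 1 else 0)"
proof -
 note simps = eval_Ld mat_ent
 let ?A = "Tab 6 3 1 (Sm 0 (Mul (Ld 1 12 4) (Ld 0 12 11)))"
 let ?B = "Tab 7 0 3 (Sub (Sm 1 (Mul (Ld 6 4 12) (Ld 0 10 12))) (Nt 1))"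
 have Wn: "W <= {..<n}" using s by (simp add: alive_def)
 define s1 where "s1 = sem 10 ?A s"
 have s1: "ok s1" "alive s1 W" unfolding s1_def by (intro ok_sem alive_sem s; simp)+
 have "mat s1 6 (ireg s 3) (ireg s 1) (%i. vsum Y W)" unfolding s1_def
 proof (rule sem_Tab)
  fix i j assume "i < ireg s 3" "j < ireg s 1"
  hence j: "j < d" using okD[OF s(1)] by auto
  have "(SUM k<n. ent s (Suc 0) k 0 * ent s 0 k j) = (SUM k:W. Y k j)" unfolding alive_sum[OF s(2)] using s Wn j by (intro sum.cong) (auto simp: Y_ent)
  thus "eval (Suc (Suc 10)) (Sm 0 (Mul (Ld 1 12 4) (Ld 0 12 11))) (seti (Suc 10) j (seti 10 i s)) = vsum Y W j"
   using okD[OF s(1)] by (simp add: simps vsum_def del: eval.simps(4))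
 qed (use s okD[OF s(1)] n in auto)
 hence 6: "mat s1 6 1 d (%i. vsum Y W)" using okD[OF s(1)] by simp
 define s2 where "s2 = sem 10 ?B s1"
 have s2: "ok s2" "alive s2 W" "mat s2 6 1 d (%i. vsum Y W)" unfolding s2_def by (intro ok_sem alive_sem mat_sem s1 6; simp)+
 have "mat s2 7 (ireg s1 0) (ireg s1 3) (%i j. score d Y W i)" unfolding s2_def by (rule sem_Tab)
   (use s1 6 okD[OF s1(1)] d in \<open>auto simp: simps Y_ent score_def ip_def simp del: eval.simps(4)\<close>)
 hence 7: "mat s2 7 n 1 (%i j. score d Y W i)" using okD[OF s1(1)] by simp
 let ?e = "Sub (Sub (Sm 1 (Mul (Ld 6 4 10) (Ld 6 4 10))) (Mul (Nt 1) (Sm 0 (Ld 1 10 4))))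
     (Mul (Con 2) (Sm 0 (Mul (Ld 1 10 4) (IfLt (Reg 6) (Ld 7 10 4) (Ld 7 10 4)
       (IfLt (Reg 6) (Sub (Con 0) (Ld 7 10 4)) (Ld 7 10 4) (Con 0))))))"
 have v: "(SUM k<d. ent s2 6 0 k * ent s2 6 0 k) = ip d (vsum Y W) (vsum Y W)" unfolding ip_def using s2 by (intro sum.cong) (auto simp: mat_ent)
 have cw: "(SUM i<n. ent s2 (Suc 0) i 0) = real (card W)" using alive_sum[OF s2(2), of "%_. 1"] by simp
 have g: "(if ta < x then x else if ta < - x then x else 0) = (if ta < \<bar>x\<bar> then x else 0)" for x :: real by auto
 have sc: "(SUM i<n. ent s2 (Suc 0) i 0 * (if ta < ent s2 7 i 0 then ent s2 7 i 0 else if ta < - ent s2 7 i 0 then ent s2 7 i 0 else 0))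
   = (SUM i:W. if ta < \<bar>score d Y W i\<bar> then score d Y W i else 0)" unfolding alive_sum[OF s2(2)] g using 7 Wn by (intro sum.cong) (auto simp: mat_ent)
 have "eval 10 ?e s2 = statistic d ta Y W" unfolding statistic_def v[symmetric] cw[symmetric] sc[symmetric]
  using okD[OF s2(1)] by (simp add: eval_Ld cong: if_cong del: eval.simps(4))
 moreover have "sem 10 final_stm s = sem 10 (Sq (Set 9 ?e) (Ite (Reg 8) (Reg 9) (ISet 0 1) (ISet 0 0))) s2" by (simp only: final_stm_def sem.simps(5) s2_def s1_def)
 ultimately show ?thesis using okD[OF s2(1)] by (simp del: eval.simps(2-10))
qed

section \<open>Running time of the pieces and of the filter\<close>

text \<open>As all loop bounds are at least 1, loop overheads are absorbed into the constant, and a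
  table costs a constant times the product of its loop bounds and the size \<open>z\<close> of one
  entry.\<close>

lemma Tab_cost:
 assumes "1 <= b k" "1 <= b l" "1 <= z" "ecost e b <= q * z"
 shows "scost (Tab a k l e) b <= (q + 13) * (b k * b l * z)"
proof -
 have "ecost e b + 6 <= (q + 6) * z" using assms by (simp add: algebra_simps)
 hence "b l * (ecost e b + 6) <= b l * ((q + 6) * z)" by (rule mult_left_mono) simp
 moreover have l: "1 <= b l * z" using mult_le_mono[OF assms(2,3)] by simp
 moreover have "5 + u <= (q + 11) * x" if "u <= (q + 6) * x" "1 <= x" for u x using that by (simp add: algebra_simps)
 ultimately have "5 + b l * (ecost e b + 6) <= (q + 11) * (b l * z)" by (metis mult.left_commute)
 hence "b k * (5 + b l * (ecost e b + 6)) <= b k * ((q + 11) * (b l * z))" by (rule mult_left_mono) simp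
 moreover have "1 <= b k * (b l * z)" using mult_le_mono[OF assms(1) l] by simp
 moreover have "2 + u <= (q + 13) * x" if "u <= (q + 11) * x" "1 <= x" for u x using that by (simp add: algebra_simps)
 ultimately have "2 + b k * (5 + b l * (ecost e b + 6)) <= (q + 13) * (b k * (b l * z))" by (metis mult.left_commute)
 thus ?thesis by (simp only: scost.simps mult.assoc) (simp add: add.commute)
qed

lemma Rep_cost:
 assumes "scost P b <= q * z" "1 <= z" "1 <= b k"
 shows "scost (Rep k P) b <= (q + 5) * (b k * z)"
proof -
 have "scost P b + 3 <= (q + 3) * z" using assms by (simp add: algebra_simps)
 hence "b k * (scost P b + 3) <= b k * ((q + 3) * z)" by (rule mult_left_mono) simp
 moreover have "1 <= b k * z" using mult_le_mono[OF assms(3,2)] by simp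
 moreover have "2 + u <= (q + 5) * x" if "u <= (q + 3) * x" "1 <= x" for u x using that by (simp add: algebra_simps)
 ultimately show ?thesis unfolding scost.simps by (metis mult.left_commute)
qed

lemma costs:
 assumes s: "ok s"
 shows "scost final_stm (ireg s) <= 1000 * (n * d)"
  and "scost (norm_stm (Reg 7)) (ireg s) <= 100 * (n * d)" "scost (norm_stm (Mul (Nt 0) (Nt 1))) (ireg s) <= 100 * (n * d)"
  and "n < d ==> scost pairs_stm (ireg s) <= 1000 * (n * n * d)"
  and "p >= 1 ==> d <= n ==> scost tall_stm (ireg s) <= 2000 * (p * (n * d * d))"
  and "p >= 1 ==> n <= d ==> scost wide_stm (ireg s) <= 2000 * (p * (n * d * n))"
proof -
 note k = okD[OF s]
 obtain a b where ab: "n = Suc a" "d = Suc b" using n d by (metis Suc_le_D One_nat_def)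
 show "scost final_stm (ireg s) <= 1000 * (n * d)" "scost (norm_stm (Reg 7)) (ireg s) <= 100 * (n * d)"
  "scost (norm_stm (Mul (Nt 0) (Nt 1))) (ireg s) <= 100 * (n * d)" using k ab by (simp_all add: stm_defs algebra_simps)
 let ?b = "ireg s"
 have pos: "1 <= n" "1 <= d" using n d by auto
 have b0: "1 <= ?b 0" and b1: "1 <= ?b 1" and b3: "1 <= ?b 3" using k pos by auto
 note num = k(1-8) numeral_plus_numeral add_num_simps
 have sq: "1 <= m * m" if "1 <= m" for m :: nat using mult_le_mono[OF that that] by simp
 show "scost pairs_stm ?b <= 1000 * (n * n * d)" if nd: "n < d"
 proof -
  have B: "ecost (Sub (Sm 1 (Mul (Ld 0 10 12) (Ld 0 11 12))) (delta 10 11 (Nt 1))) ?b <= 60 * d" using k(1-8) pos by (simp add: delta_def)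
  have 1: "scost (Tab 1 0 3 (Con 1)) ?b <= 100 * n" using k(1-8) pos by simp
  have 3: "scost (Ite (Reg 7) (Mul (Mul (Ld 1 10 4) (Ld 1 11 4)) (IfLt (Ld 2 10 11) (Con 0) (Sub (Con 0) (Ld 2 10 11)) (Ld 2 10 11)))
   (Sq (Tab 9 0 3 (delta 12 10 (Con 1)))
    (Sq (Tab 8 0 3 (Sub (Ld 1 12 4) (IfLt (Con 0) (Add (Ld 9 12 4) (delta 12 11 (Con 1))) (Ld 1 12 4) (Con 0))))
     (Tab 1 0 3 (Ld 8 12 4))))
   (Set 14 (Con 0))) ?b <= 300 * n" using k(1-8) pos by (simp add: delta_def)
  note 2 = Tab_cost[OF b0 b0 pos(2) B, where a = 2, unfolded num]
  note 4 = Rep_cost[OF Rep_cost[OF 3 pos(1) b0] mult_le_mono[OF b0 pos(1), simplified mult_1] b0, unfolded num]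
  have m: "n * (n * n) <= n * n * d" "n <= n * n * d" "n * n * d = n * n * d"
   using mult_le_mono[of "n * n" "n * n" n d] mult_le_mono[of n n 1 "n * d"] mult_le_mono[OF pos] nd by (simp_all add: ac_simps)
  show ?thesis unfolding pairs_stm_def scost.simps(5) using 1 2 4 m by linarith
 qed
 have power: "scost (power_stm r) ?b <= 200 * (p * (m * m * m))" if r: "?b r = m" and p: "1 <= p" and m: "1 <= m" for r m
 proof -
  have br: "1 <= ?b r" and b6: "1 <= ?b 6" using r m k p by auto
  have "ecost (delta 13 14 (Con 1)) ?b <= 20 * 1" "ecost (Ld 4 14 15) ?b <= 20 * 1" by (simp_all add: delta_def)
  note 1 = Tab_cost[OF br br order_refl this(1), where a = 3, unfolded r num] and 3 = Tab_cost[OF br br order_refl this(2), where a = 3, unfolded r num]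
  have "ecost (Sm r (Mul (Ld 3 14 16) (Ld 2 16 15))) ?b <= 20 * m" using r m by simp
  note 2 = Tab_cost[OF br br m this, where a = 4, unfolded r num]
  have mm: "1 <= m * m * m" using mult_le_mono[OF sq[OF m] m] by simp
  have m3: "m * m * 1 <= m * m * m" using mult_le_mono[of "m * m" "m * m" 1 m] m by simp
  have body: "scost (Sq (Tab 4 r r (Sm r (Mul (Ld 3 14 16) (Ld 2 16 15)))) (Tab 3 r r (Ld 4 14 15))) ?b <= 66 * (m * m * m)"
   unfolding scost.simps(5) using 2 3 m3 by linarith
  note Rep_cost[OF body mm b6, unfolded num]
  moreover have "m * m * m <= p * (m * m * m)" using mult_le_mono[OF p order_refl[of "m * m * m"]] by simp
  ultimately show ?thesis unfolding power_stm_def scost.simps(5)[of "Tab 3 _ _ _"] using 1 m3 by linarith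
 qed
 show "scost tall_stm ?b <= 2000 * (p * (n * d * d))" if p: "p >= 1" and dn: "d <= n"
 proof -
  have A: "ecost (Sub (Sm 0 (Mul (Ld 1 15 4) (Mul (Ld 0 15 13) (Ld 0 15 14))))
    (delta 13 14 (Sub (Nt 0) (Mul (Con 4) (Mul (Reg 4) (Reg 5)))))) ?b <= 60 * n" using k(1-8) pos by (simp add: delta_def)
  have B: "ecost (Sm 1 (Mul (Sm 1 (Mul (Ld 3 15 16) (Ld 0 13 16))) (Sm 1 (Mul (Ld 3 15 16) (Ld 0 13 16))))) ?b <= 100 * (d * d)"
   using k(1-3) ab(2) by (simp add: algebra_simps)
  have C: "scost (Set 11 (Mul (Reg 5) (Sm 1 (Sm 1 (Mul (Ld 3 13 14) (Ld 3 13 14)))))) ?b <= 100 * (d * d)" using k(1-3) ab(2) by (simp add: algebra_simps)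
  have D: "scost cut_stm ?b <= 300 * n" using k(1-8) pos by (simp add: cut_stm_def)
  note 1 = Tab_cost[OF b1 b1 pos(1) A, where a = 2, unfolded num] and 3 = Tab_cost[OF b0 b3 sq[OF pos(2)] B, where a = 5, unfolded num] and 2 = power[OF k(2) p pos(2)]
  have b8: "1 <= ?b 8" using k p by simp
  note 4 = Rep_cost[OF D pos(1) b8, unfolded num]
  define X where "X = p * (n * d * d)"
  have X0: "n * d * d <= X" unfolding X_def using mult_le_mono[OF p order_refl[of "n * d * d"]] by simp
  have X: "d * d * n <= X" "n * 1 * (d * d) <= X" "d * d <= X" "p * (d * d * d) <= X" "2 * p * n <= 2 * X" "1 <= X"
  proof -
   show a: "d * d * n <= X" "n * 1 * (d * d) <= X" using X0 by (simp_all add: ac_simps)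
   show "d * d <= X" using mult_le_mono[OF order_refl[of "d * d"] pos(1), unfolded mult_1_right] a(1) by linarith
   thus "1 <= X" using sq[OF pos(2)] by linarith
   show "p * (d * d * d) <= X" unfolding X_def using mult_le_mono[OF dn order_refl[of "d * d"]] by (simp add: ac_simps)
   have "X = p * n * (d * d)" by (simp add: X_def ac_simps)
   thus "2 * p * n <= 2 * X" using mult_le_mono[OF order_refl[of "p * n"] sq[OF pos(2)], unfolded mult_1_right] by linarith
  qed
  show ?thesis unfolding tall_stm_def scost.simps(5) X_def[symmetric] using 1 2 3 4 C X scost.simps(1)[of 12 "Con 1" ?b, unfolded ecost.simps(3)] by linarith
 qed
 show "scost wide_stm ?b <= 2000 * (p * (n * d * n))" if p: "p >= 1" and nd: "n <= d"
 proof -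
  have A: "ecost (Mul (Mul (Ld 1 13 4) (Ld 1 14 4)) (Sub (Sm 1 (Mul (Ld 0 13 15) (Ld 0 14 15))) (delta 13 14 (Nt 1)))) ?b <= 60 * d"
   using k(1-8) pos by (simp add: delta_def)
  have B: "ecost (Sm 0 (Mul (Ld 3 13 15) (Ld 3 13 15))) ?b <= 60 * n" using k(1-8) pos by simp
  have C: "scost (Set 11 (Dvd (Sm 0 (Sm 0 (Mul (Ld 3 13 14) (Ld 3 13 14)))) (Mul (Con 8) (Reg 4)))) ?b <= 100 * (n * n)"
   using k(1-3) ab(1) by (simp add: algebra_simps)
  have D: "scost (Sq (Tab 9 0 3 (IfLt (Reg 11) (Ld 5 13 4) (Con 0) (Ld 1 13 4))) (Tab 1 0 3 (Ld 9 13 4))) ?b <= 100 * n" using k(1-8) pos by simp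
  note 1 = Tab_cost[OF b0 b0 pos(2) A, where a = 2, unfolded num] and 3 = Tab_cost[OF b0 b3 pos(1) B, where a = 5, unfolded num] and 2 = power[OF k(1) p pos(1)]
  define X where "X = p * (n * d * n)"
  have X0: "n * d * n <= X" unfolding X_def using mult_le_mono[OF p order_refl[of "n * d * n"]] by simp
  have X: "n * n * d <= X" "n * 1 * n <= X" "n * n <= X" "p * (n * n * n) <= X" "n <= X"
  proof -
   show a: "n * n * d <= X" using X0 by (simp add: ac_simps)
   show nn: "n * n <= X" using mult_le_mono[OF order_refl[of "n * n"] pos(2), unfolded mult_1_right] a by linarith
   thus "n * 1 * n <= X" by simp
   show "n <= X" using nn mult_le_mono[OF order_refl[of n] pos(1), unfolded mult_1_right] by linarith
   show "p * (n * n * n) <= X" unfolding X_def using mult_le_mono[OF nd order_refl[of "n * n"]] by (simp add: ac_simps)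
  qed
  show ?thesis unfolding wide_stm_def scost.simps(5)[of "Tab 2 _ _ _"] scost.simps(5)[of "power_stm 0"] scost.simps(5)[of "Tab 5 _ _ _"]
    scost.simps(5)[of "Set 11 _"] X_def[symmetric] using 1 2 3 C D X by linarith
 qed
qed

text \<open>Of the three factors \<open>p\<close>, one comes from the matrix power inside
  \<open>P\<close> and two from the number of rounds.\<close>

lemma iter_cost:
 assumes s: "ok s" and P: "scost P (ireg s) <= 2000 * (p * x)" and p: "p >= 1" and x: "n * d <= x"
 shows "scost (iter_stm P) (ireg s) <= 100000 * (p ^ 3 * x)"
proof -
 have nd: "1 <= n * d" using n d by (simp add: Suc_le_eq)
 have px: "1 <= p * x" using mult_le_mono[OF p order_trans[OF nd x]] by simp
 have "48 * (u + 3) + 5 <= 97000 * z" if "u <= 2000 * z" "1 <= z" for u z :: nat using that by simp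
 hence "48 * (scost P (ireg s) + 3) + 5 <= 97000 * (p * x)" using P px by blast
 hence "p * (48 * (scost P (ireg s) + 3) + 5) <= p * (97000 * (p * x))" by (rule mult_left_mono) simp
 moreover have "1 <= p * (p * x)" using mult_le_mono[OF p px] by simp
 ultimately have "p * (48 * (scost P (ireg s) + 3) + 5) + 5 <= 98000 * (p * (p * x))" by linarith
 hence "p * (p * (48 * (scost P (ireg s) + 3) + 5) + 5) <= p * (98000 * (p * (p * x)))" by (rule mult_left_mono) simp
 hence "p * (p * (48 * (scost P (ireg s) + 3) + 5) + 5) + 2 <= 98000 * (p ^ 3 * x) + 2" by (simp add: power3_eq_cube ac_simps)
 moreover have "x <= p ^ 3 * x" using p by (simp add: Suc_le_eq)
 hence "n * d <= p ^ 3 * x" using x by linarith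
 moreover have "scost (iter_stm P) (ireg s) = scost (norm_stm (Mul (Nt 0) (Nt 1))) (ireg s) + (p * (p * (48 * (scost P (ireg s) + 3) + 5) + 5) + 2)"
  using okD[OF s] by (simp add: iter_stm_def ac_simps)
 ultimately show ?thesis using costs(3)[OF s] nd by linarith
qed

definition "branch_cost = (if real n < be ^ 4 then p ^ 3 * (n * d * min n d) else 0) + (if n < d & ~ be < 1 then n * n * d else 0)"

lemma filter_correct:
 assumes s: "ok s" and h: "h >= 0" and p: "p >= 1"
 shows "EX s'. achieves 10 filter_stm s s' (200000 * (n * d + branch_cost)) & ok s' & alive s' (survivors n d Y be th h p)"
proof -
 let ?big = "Mul (Mul (Reg 4) (Reg 4)) (Mul (Reg 4) (Reg 4))"
 have nd: "1 <= n * d" using n d by (simp add: Suc_le_eq)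
 have big: "eval 10 ?big s = be ^ 4" using okD[OF s] by (simp add: power4_eq_xxxx)
 define Q where "Q = (if n < d then if be < 1 then Tab 1 0 3 (Con 1) else if real n < be ^ 4 then iter_stm wide_stm else pairs_stm
  else if real n < be ^ 4 then iter_stm tall_stm else norm_stm (Reg 7))"
 have wf: "wfs 10 Q" by (simp add: Q_def stm_defs)
 have Qc: "scost Q (ireg s) <= 100000 * (n * d + branch_cost)"
 proof (cases "n < d")
  case True
  show ?thesis
  proof (cases "be < 1")
   case True
   have "scost (Tab 1 0 3 (Con 1)) (ireg s) <= 1000 * n" using okD[OF s] n by simp
   also have "... <= 100000 * (n * d + branch_cost)" using d by (simp add: trans_le_add1)
   finally show ?thesis using \<open>n < d\<close> True by (simp add: Q_def)
  next
   case False
   have "n * d * n >= n * d" using n by (simp add: Suc_le_eq)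
   thus ?thesis using True False costs(4)[OF s] iter_cost[OF s costs(6)[OF s]] p by (auto simp: Q_def branch_cost_def min_def ac_simps)
  qed
 next
  case False
  have "n * d * d >= n * d" using d by (simp add: Suc_le_eq)
  thus ?thesis using False costs(2)[OF s] iter_cost[OF s costs(5)[OF s]] p by (auto simp: Q_def branch_cost_def min_def ac_simps)
 qed
 have a: "achieves 10 Q s (sem 10 Q s) (100000 * (n * d + branch_cost))" by (rule achieves_mono[OF achieves_sem[OF wf] Qc]) simp
 \<comment> \<open>\<open>Q\<close> is the branch selected by the nested tests; beyond its cost only
   the tests on the path are charged, at most 100 steps.\<close>
 have "achieves 10 filter_stm s (sem 10 Q s) (100 + 100000 * (n * d + branch_cost))"
 proof (cases "n < d")
  case True
  have "achieves 10 (Ite (Nt 0) ?big (iter_stm wide_stm) pairs_stm) s (sem 10 Q s)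
    (ecost (Nt 0) (ireg s) + ecost ?big (ireg s) + 1 + 100000 * (n * d + branch_cost))" if "~ be < 1"
   by (rule achieves_Ite) (use a that True big okD[OF s] in \<open>auto simp: Q_def simp del: sem.simps\<close>)
  note wide = this
  have 2: "achieves 10 (if eval 10 (Reg 4) s < eval 10 (Con 1) s then Tab 1 0 3 (Con 1) else Ite (Nt 0) ?big (iter_stm wide_stm) pairs_stm) s (sem 10 Q s)
    (ecost (Nt 0) (ireg s) + ecost ?big (ireg s) + 1 + 100000 * (n * d + branch_cost))"
  proof (cases "be < 1")
   case b: True
   hence "Q = Tab 1 0 3 (Con 1)" using True by (simp add: Q_def)
   thus ?thesis using achieves_mono[OF a] b okD[OF s] by (simp del: sem.simps)
  next
   case b: False
   thus ?thesis using wide okD[OF s] by (simp del: sem.simps)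
  qed
  have 3: "achieves 10 (Ite (Reg 4) (Con 1) (Tab 1 0 3 (Con 1)) (Ite (Nt 0) ?big (iter_stm wide_stm) pairs_stm)) s (sem 10 Q s)
    (ecost (Reg 4) (ireg s) + ecost (Con 1) (ireg s) + 1 + (ecost (Nt 0) (ireg s) + ecost ?big (ireg s) + 1 + 100000 * (n * d + branch_cost)))"
   by (rule achieves_Ite[OF _ _ _ 2]) auto
  have "achieves 10 filter_stm s (sem 10 Q s) (ecost (Nt 0) (ireg s) + ecost (Nt 1) (ireg s) + 1 +
    (ecost (Reg 4) (ireg s) + ecost (Con 1) (ireg s) + 1 + (ecost (Nt 0) (ireg s) + ecost ?big (ireg s) + 1 + 100000 * (n * d + branch_cost))))"
   unfolding filter_stm_def Let_def by (rule achieves_Ite) (use 3 True okD[OF s] in \<open>auto simp del: sem.simps\<close>)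
  thus ?thesis by (rule achieves_mono) simp
 next
  case False
  have 2: "achieves 10 (Ite (Nt 0) ?big (iter_stm tall_stm) (norm_stm (Reg 7))) s (sem 10 Q s)
    (ecost (Nt 0) (ireg s) + ecost ?big (ireg s) + 1 + 100000 * (n * d + branch_cost))"
   by (rule achieves_Ite) (use a False big okD[OF s] in \<open>auto simp: Q_def simp del: sem.simps\<close>)
  have "achieves 10 filter_stm s (sem 10 Q s) (ecost (Nt 0) (ireg s) + ecost (Nt 1) (ireg s) + 1 +
    (ecost (Nt 0) (ireg s) + ecost ?big (ireg s) + 1 + 100000 * (n * d + branch_cost)))"
   unfolding filter_stm_def Let_def by (rule achieves_Ite) (use 2 False okD[OF s] in \<open>auto simp del: sem.simps\<close>)
  thus ?thesis by (rule achieves_mono) simp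
 qed
 hence "achieves 10 filter_stm s (sem 10 Q s) (200000 * (n * d + branch_cost))"
 proof (rule achieves_mono)
  have "100 + 100000 * (z + w) <= 200000 * (z + w)" if "1 <= z" for z w :: nat using that by simp
  thus "100 + 100000 * (n * d + branch_cost) <= 200000 * (n * d + branch_cost)" using nd .
 qed
 moreover have "ok (sem 10 Q s) & alive (sem 10 Q s) (survivors n d Y be th h p)"
 proof -
  have "ok (sem 10 (Tab 1 0 3 (Con 1)) s)" by (intro ok_sem s) auto
  moreover have "mat (sem 10 (Tab 1 0 3 (Con 1)) s) 1 (ireg s 0) (ireg s 3) (%i j. if i : {..<n} then 1 else 0)" by (rule sem_Tab) (use s okD[OF s] d in auto)
  hence "alive (sem 10 (Tab 1 0 3 (Con 1)) s) {..<n}" using okD[OF s] by (simp add: alive_def)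
  moreover have "ok (sem 10 (norm_stm (Reg 7)) s)" "alive (sem 10 (norm_stm (Reg 7)) s) {i\<in>{..<n}. ip d (Y i) (Y i) <= h}"
   using norm_correct[OF s, of "Reg 7" h] okD[OF s] by auto
  ultimately show ?thesis using pairs_correct[OF _ h s]
    iter_correct[OF s, of wide_stm "wide_round n d Y be p"] iter_correct[OF s, of tall_stm "tall_round n d Y th be p"]
    wide_correct tall_correct by (simp add: Q_def survivors_def Let_def del: sem.simps)
 qed
 ultimately show ?thesis by blast
qed

end

section \<open>The complete run\<close>

lemma offsets_correct:
 fixes ep al de :: real and n d :: nat and Y :: "nat => nat => real"
 defines "s0 == input n d ep al de Y"
 shows "EX t s. exec offsets s0 t s & t <= 2 + n * (2 + 3) & (ireg s 0 = n & ireg s 1 = d & ireg s 4 = 0 & ireg s 5 = n * d &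
  rreg s = rreg s0 & rarr s = rarr s0 & (ALL i<n. iarr s 0 i = i * d))" unfolding offsets_def
proof (rule for_loop[where I = "%m (s :: state). ireg s 0 = n & ireg s 1 = d & ireg s 4 = 0 & ireg s 5 = m * d &
  rreg s = rreg s0 & rarr s = rarr s0 & (ALL i<m. iarr s 0 i = i * d)"])
 fix i and s :: state assume I: "ireg s 0 = n & ireg s 1 = d & ireg s 4 = 0 & ireg s 5 = i * d &
  rreg s = rreg s0 & rarr s = rarr s0 & (ALL k<i. iarr s 0 k = k * d)" and v: "ireg s 10 = i"
 have "exec (Seq (Instr (IStore 0 10 5)) (Instr (IAdd 5 5 1))) s (1 + 1) (step (IAdd 5 5 1) (step (IStore 0 10 5) s))" by (rule exec.Seq[OF exec_Instr exec_Instr])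
 thus "EX t s'. exec (Seq (Instr (IStore 0 10 5)) (Instr (IAdd 5 5 1))) s t s' & t <= 2 &
   (ireg s' 0 = n & ireg s' 1 = d & ireg s' 4 = 0 & ireg s' 5 = Suc i * d &
  rreg s' = rreg s0 & rarr s' = rarr s0 & (ALL k<Suc i. iarr s' 0 k = k * d)) & ireg s' 10 = i"
  using I v by (intro exI[of _ "1 + 1"] exI[of _ "step (IAdd 5 5 1) (step (IStore 0 10 5) s)"]) (simp add: less_Suc_eq)
qed (auto simp: s0_def input_def)

text \<open>\<open>log2 n\<close> rounded up, but at least 1, since the filters take positive
  powers.\<close>

definition lev :: "nat => nat" where
 "lev n = (LEAST q. 1 <= q & n <= 2 ^ q)"

lemma lev: "1 <= lev n" "n <= 2 ^ lev n"
proof -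
 have "1 <= Suc n & n <= 2 ^ Suc n" using less_exp[of "Suc n"] by simp
 hence "1 <= lev n & n <= 2 ^ lev n" unfolding lev_def by (rule LeastI)
 thus "1 <= lev n" "n <= 2 ^ lev n" by auto
qed

lemma lev_upper: "n >= 1 ==> 2 ^ lev n <= 2 * n"
proof (cases "lev n = 1")
 case False
 hence l: "lev n - 1 < lev n" "1 <= lev n - 1" using lev(1)[of n] by auto
 hence "2 ^ (lev n - 1) < n" using not_less_Least[of "lev n - 1" "%q. 1 <= q & n <= 2 ^ q"] by (auto simp: lev_def)
 moreover have "(2::nat) ^ lev n = 2 * 2 ^ (lev n - 1)" using l by (cases "lev n") auto
 ultimately show ?thesis by simp
qed simp

lemma prelude_correct:
 assumes s: "ireg s 0 = n"
 defines "s' == sem 10 prelude_stm s"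
 shows "ireg s' 6 = lev n" "ireg s' 8 = 2 * lev n" "ireg s' 3 = 1" "ireg s' 7 = 48"
proof -
 let ?P = "Ite (Reg 3) (Nt 0) (Sq (Set 3 (Add (Reg 3) (Reg 3))) (Sq (Inc 6) (Sq (Inc 8) (Inc 8)))) (Set 14 (Con 0))"
 define s1 where "s1 = sem 10 (Set 3 (Con 2)) (seti 8 2 (seti 7 48 (seti 6 1 (seti 3 1 s))))"
 \<comment> \<open>Either the search has ended or it has advanced in every round, which is
   \<open>i < q\<close>; since \<open>lev n <= n\<close> for \<open>n >= 1\<close>, it has ended
   after \<open>n\<close> rounds.\<close>
 define I where "I = (%i (s :: state). EX q. 1 <= q & q <= lev n & (q = lev n | i < q) & ireg s 0 = n & ireg s 6 = q & ireg s 8 = 2 * q &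
   rreg s 3 = 2 ^ q & ireg s 3 = 1 & ireg s 7 = 48)"
 have "I n (sem 10 (Rep 0 ?P) s1)"
 proof (rule sem_Rep)
  fix i t assume "I i t"
  then obtain q where q: "1 <= q" "q <= lev n" "q = lev n | i < q" "ireg t 0 = n" "ireg t 6 = q" "ireg t 8 = 2 * q"
   "rreg t 3 = 2 ^ q" "ireg t 3 = 1" "ireg t 7 = 48" unfolding I_def by blast
  show "I (Suc i) (sem (Suc 10) ?P (seti 10 i t))"
  proof (cases "2 ^ q < n")
   case True
   hence "(2::real) ^ q < real n" by (metis of_nat_less_iff of_nat_numeral of_nat_power)
   moreover have "q < lev n" using True q(2) lev(2)[of n] by (metis le_neq_implies_less not_le)
   ultimately show ?thesis unfolding I_def using q by (intro exI[of _ "Suc q"]) auto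
  next
   case False
   hence "~ (2::real) ^ q < real n" by (metis of_nat_less_iff of_nat_numeral of_nat_power)
   moreover have "lev n <= q" unfolding lev_def by (rule Least_le) (use False q in auto)
   ultimately show ?thesis unfolding I_def using q by (intro exI[of _ q]) auto
  qed
 next
  show "I 0 s1" unfolding I_def using lev(1)[of n] s by (intro exI[of _ 1]) (auto simp: s1_def)
  show "ireg s1 0 = n" using s by (simp add: s1_def)
 qed
 moreover have "s' = sem 10 (Rep 0 ?P) s1" unfolding s'_def s1_def prelude_stm_def by (simp only: sem.simps(4,5))
 moreover have "n <= q ==> q <= lev n ==> 1 <= q ==> q = lev n" for q
 proof (rule antisym)
  assume "n <= q" "1 <= q"
  thus "lev n <= q" unfolding lev_def using less_exp[of q] by (intro Least_le conjI) linarith+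
 qed
 ultimately show "ireg s' 6 = lev n" "ireg s' 8 = 2 * lev n" "ireg s' 3 = 1" "ireg s' 7 = 48" unfolding I_def by (metis less_imp_le)+
qed

definition run_cost :: "nat => nat => real => nat" where
 "run_cost n d be = n * d + (if real n < be ^ 4 then lev n ^ 3 * (n * d * min n d) else 0) + (if n < d & ~ be < 1 then n * n * d else 0)"

lemma tester_run:
 fixes ep al de :: real and n d :: nat and Y :: "nat => nat => real"
 assumes n: "n >= 1" and d: "d >= 1"
 defines "be == ep * real n" and "th == (al / (10000 * ep))\<^sup>2" and "ta == real n * al\<^sup>2 / (100 * ep)" and "h == (al / ep)\<^sup>2 / 1000"
 shows "EX t s. exec tester (input n d ep al de Y) t s & t <= 300000 * run_cost n d be &
  ireg s 0 = (if (real n * al)\<^sup>2 / 2 < statistic d ta Y (survivors n d Y be th h (lev n)) then 1 else 0)"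
proof -
 let ?s0 = "input n d ep al de Y" and ?p = "lev n" and ?c = "(real n * al)\<^sup>2 / 2"
 interpret ram n d ?p be th ta h ?c Y by unfold_locales (use n d in auto)
 obtain t0 s0 where 0: "exec offsets ?s0 t0 s0" "t0 <= 2 + n * (2 + 3)" and s0: "ireg s0 0 = n" "ireg s0 1 = d" "ireg s0 4 = 0"
  "rreg s0 = rreg ?s0" "rarr s0 = rarr ?s0" "ALL i<n. iarr s0 0 i = i * d" using offsets_correct[of n d ep al de Y] by blast
 define s1 where "s1 = sem 10 prelude_stm s0"
 have wf1: "wfs 10 prelude_stm" by (auto simp: prelude_stm_def)
 have a1: "achieves 10 prelude_stm s0 s1 (scost prelude_stm (ireg s0))" unfolding s1_def by (rule achieves_sem[OF wf1]) simp
 have c1: "scost prelude_stm (ireg s0) <= 100 * n" using s0 n by (simp add: prelude_stm_def)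
 have i1: "ireg s1 i = ireg s0 i" if "i : {0, 1, 4}" for i unfolding s1_def by (rule sem_ireg[OF wf1]) (use that in \<open>auto simp: prelude_stm_def\<close>)
 have r1: "rreg s1 x = rreg s0 x" if "x : {0, 1}" for x unfolding s1_def by (rule sem_rreg) (use that in \<open>auto simp: prelude_stm_def\<close>)
 have m1: "rarr s1 0 = rarr s0 0" "iarr s1 = iarr s0" unfolding s1_def by (auto simp: sem_rarr sem_iarr prelude_stm_def simp del: sem.simps)
 note p1 = prelude_correct[OF s0(1), folded s1_def]
 define s2 where "s2 = sem 10 param_stm s1"
 have a2: "achieves 10 param_stm s1 s2 (scost param_stm (ireg s1))" unfolding s2_def by (rule achieves_sem) (auto simp: param_stm_def)
 have c2: "scost param_stm (ireg s1) <= 100" by (simp add: param_stm_def)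
 have m2: "mat s2 0 n d Y"
 proof -
  have "rarr s2 0 = rarr ?s0 0" "iarr s2 = iarr s0" unfolding s2_def using m1 s0 by (auto simp: sem_rarr sem_iarr param_stm_def simp del: sem.simps)
  moreover have "i * d + j < n * d" if "i < n" "j < d" for i j
  proof -
   have "i * d + j < Suc i * d" using that by simp
   also have "... <= n * d" using that by (intro mult_right_mono) auto
   finally show ?thesis .
  qed
  ultimately show ?thesis using s0 by (auto simp: mat_def ent_def input_def)
 qed
 have rr: "rreg s1 0 = ep" "rreg s1 1 = al" "ireg s1 0 = n" using r1 i1 s0 by (auto simp: input_def)
 have ii: "ireg s2 = ireg s1" "iarr s2 = iarr s1" by (simp_all add: s2_def param_stm_def)
 have "rreg s2 4 = be" "rreg s2 5 = th" "rreg s2 6 = ta" "rreg s2 7 = h" "rreg s2 8 = ?c"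
  using rr by (simp_all add: s2_def param_stm_def be_def th_def ta_def h_def sq_eq)
 hence ok2: "ok s2" unfolding ok_def using ii i1 p1 s0 m1 m2 by simp
 obtain s3 where 3: "achieves 10 filter_stm s2 s3 (200000 * (n * d + branch_cost))" "ok s3" "alive s3 (survivors n d Y be th h ?p)"
  using filter_correct[OF ok2 _ lev(1)] by (auto simp: h_def)
 have a4: "achieves 10 final_stm s3 (sem 10 final_stm s3) (1000 * (n * d))" by (rule achieves_mono[OF achieves_sem costs(1)[OF 3(2)]]) (auto simp: final_stm_def)
 note all = achieves_Sq[OF a1 achieves_Sq[OF a2 achieves_Sq[OF 3(1) a4]]]
 obtain t s where 4: "exec (cmps 10 (Sq prelude_stm (Sq param_stm (Sq filter_stm final_stm)))) s0 t s" "agr 10 20 (sem 10 final_stm s3) s"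
   "t <= scost prelude_stm (ireg s0) + (scost param_stm (ireg s1) + (200000 * (n * d + branch_cost) + 1000 * (n * d)))"
  using all[unfolded achieves_def, rule_format, OF agr_refl] by (elim exE conjE)
 have "exec tester ?s0 (t0 + t) s" unfolding tester_def by (rule exec.Seq[OF 0(1) 4(1)])
 moreover have "ireg s 0 = ireg (sem 10 final_stm s3) 0" using 4(2) by (simp add: agr_def)
 moreover have "t0 + t <= 300000 * run_cost n d be"
 proof -
  have nn: "n <= n * d" "1 <= n * d" using mult_le_mono[OF order_refl[of n] d] n by auto
  have rc: "run_cost n d be = n * d + branch_cost" by (simp add: run_cost_def branch_cost_def)
  have gen: "t0 + t <= 300000 * (z + w)" if "t0 <= 2 + m * (2 + 3)" "t <= a + (b + (200000 * (z + w) + 1000 * z))"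
   "a <= 100 * m" "b <= 100" "m <= z" "1 <= z" for a b m z w :: nat using that by simp
  show ?thesis unfolding rc by (rule gen[OF 0(2) 4(3) c1 c2 nn])
 qed
 ultimately show ?thesis using final_correct[OF 3(2,3)] by (intro exI conjI) auto
qed

section \<open>The parameters and their inequalities\<close>

lemma dev_mono: "0 <= a ==> 0 <= y ==> y <= z ==> dev a y <= dev a z"
 unfolding dev_def by (intro add_mono real_sqrt_le_mono mult_left_mono) auto

lemma dev_le_add: "0 <= a ==> 0 <= y ==> dev a y <= a + 2 * y"
proof -
 assume "0 <= a" "0 <= y"
 hence "sqrt (a * y) <= a + y" by (intro real_le_lsqrt) (auto simp: sq_eq algebra_simps)
 thus ?thesis by (simp add: dev_def)
qed

text \<open>What the hypotheses of the theorem amount to: \<open>P1\<close> is the first term of the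
  sample bound, \<open>P2\<close> the square root of the second with \<open>p^3\<close> in place of
  the polylogarithm, and \<open>P3\<close> the condition on the corruption rate. \<open>P5\<close>
  makes \<open>2^p\<close> dominate \<open>n\<close>, and \<open>P4\<close> keeps \<open>p\<close>
  below a small power of \<open>n\<close>.\<close>

locale regime =
 fixes A al ep L c0 B :: real and n d p :: nat
 assumes n1: "n >= 1" and d1: "d >= 1" and p1: "p >= 1"
  and al: "0 < al" "al <= A" and ep: "0 < ep" and L1: "1 <= L" and c0: "1 <= c0"
  and B: "B = 10 ^ 15 * (1 + A) ^ 6 * c0"
  and P1: "B * (sqrt (real d) * L) <= real n * al\<^sup>2"
  and P2: "B * (ep * real p ^ 3 * sqrt (real n * real d * L)) <= real n * al\<^sup>2"
  and P3: "B * ep * sqrt (lg (1 / ep)) <= al"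
  and P4: "real p ^ 4 <= c0 * real n" and P5: "n <= 2 ^ p"
begin

definition "s = 1 + A"
definition "be = ep * real n"
definition "th = (al / (10000 * ep))\<^sup>2"
definition "ta = real n * al\<^sup>2 / (100 * ep)"
definition "h = (al / ep)\<^sup>2 / 1000"
definition "N = real n * al"

lemma s1: "1 <= s" "A <= s" "al <= s" using al by (auto simp: s_def)

lemma B_ge: "10 ^ 15 * s ^ k * c0 <= B" if "k <= 6" unfolding B s_def[symmetric] using s1 c0 that by (intro mult_right_mono mult_left_mono power_increasing) auto

lemma B_s: "10 ^ 15 * s ^ k <= B" if "k <= 6"
proof -
 have "10 ^ 15 * s ^ k * 1 <= 10 ^ 15 * s ^ k * c0" using c0 s1 by (intro mult_left_mono) auto
 thus ?thesis using B_ge[OF that] by linarith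
qed

lemma B15: "10 ^ 15 <= B" using B_s[of 0] by simp

lemma lg_ge: "1 <= lg x" by (simp add: lg_def)

lemma e_small: "B * ep <= al"
proof -
 have "B * ep * 1 <= B * ep * sqrt (lg (1 / ep))" using B15 ep lg_ge[of "1 / ep"] by (intro mult_left_mono) auto
 thus ?thesis using P3 by simp
qed

lemma eps_le: "ep * 10 ^ 15 <= 1"
proof -
 have "ep * (10 ^ 15 * s) <= ep * B" using B_s[of 1] ep by (intro mult_left_mono) auto
 hence "ep * (10 ^ 15 * s) <= s" using e_small s1 mult.commute[of ep B] by linarith
 hence "s * (ep * 10 ^ 15) <= s * 1" by (simp only: mult_ac mult_1_left mult_1_right)
 thus ?thesis by (rule mult_left_le_imp_le) (use s1 in simp)
qed

lemma nA: "B * L <= real n * al\<^sup>2"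
proof -
 have "B * (1 * L) <= B * (sqrt (real d) * L)" using B15 L1 d1 by (intro mult_left_mono mult_right_mono) auto
 thus ?thesis using P1 by simp
qed

lemma n_ge: "10 ^ 15 * s ^ 4 * c0 * L <= real n"
proof -
 have "al\<^sup>2 <= s\<^sup>2" using s1 al by (intro power_mono) auto
 hence "B * L <= real n * s\<^sup>2" using nA mult_left_mono[of "al\<^sup>2" "s\<^sup>2" "real n"] by linarith
 moreover have "B * L = 10 ^ 15 * s ^ 4 * c0 * L * s\<^sup>2" unfolding B s_def by (simp add: sq_eq eval_nat_numeral)
 ultimately show ?thesis using s1 by simp
qed

lemma n_ge': "10 ^ 15 * s ^ 4 <= real n" "c0 <= real n" "L * 10 ^ 15 * s\<^sup>2 <= real n" "L <= real n"
proof -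
 have g: "1 <= s ^ 4" "1 <= s\<^sup>2" "s\<^sup>2 <= s ^ 4" using s1 by (auto intro: one_le_power power_increasing)
 have "10 ^ 15 * s ^ 4 * 1 * 1 <= 10 ^ 15 * s ^ 4 * c0 * L" using c0 L1 s1 by (intro mult_mono) auto
 thus "10 ^ 15 * s ^ 4 <= real n" using n_ge by simp
 have "1 * 1 * c0 * 1 <= 10 ^ 15 * s ^ 4 * c0 * L" using c0 L1 s1 g by (intro mult_mono) auto
 thus "c0 <= real n" using n_ge by simp
 have "10 ^ 15 * s\<^sup>2 * 1 * L <= 10 ^ 15 * s ^ 4 * c0 * L" using c0 L1 s1 g by (intro mult_mono) auto
 thus a: "L * 10 ^ 15 * s\<^sup>2 <= real n" using n_ge by (simp add: mult_ac)
 have "L * 1 * 1 <= L * 10 ^ 15 * s\<^sup>2" using L1 g by (intro mult_mono) auto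
 thus "L <= real n" using a by simp
qed

lemma p_sqrt: "(real p)\<^sup>2 <= c0 * sqrt (real n)" "real p <= c0 * sqrt (real n)" "real p <= sqrt (real n)" "100 * s\<^sup>2 * real p <= real n"
proof -
 have p: "1 <= real p" using p1 by simp
 have "((real p)\<^sup>2)\<^sup>2 <= (c0 * sqrt (real n))\<^sup>2"
 proof -
  have "((real p)\<^sup>2)\<^sup>2 <= c0 * real n" using P4 by simp
  also have "... <= c0 * c0 * real n" using c0 by (intro mult_right_mono) auto
  finally show ?thesis by (simp add: power_mult_distrib sq_eq[of c0])
 qed
 thus a: "(real p)\<^sup>2 <= c0 * sqrt (real n)" using c0 by (intro power2_le_imp_le[of "(real p)\<^sup>2"]) auto
 have "real p <= (real p)\<^sup>2" using p by (simp add: sq_eq)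
 thus "real p <= c0 * sqrt (real n)" using a by linarith
 have "((real p)\<^sup>2)\<^sup>2 <= (real n)\<^sup>2" using P4 n_ge'(2) mult_right_mono[of c0 "real n" "real n"] by (simp add: sq_eq eval_nat_numeral)
 hence "(real p)\<^sup>2 <= real n" by (intro power2_le_imp_le[of "(real p)\<^sup>2"]) auto
 thus b: "real p <= sqrt (real n)" by (intro real_le_rsqrt)
 have "100 * s\<^sup>2 <= sqrt (real n)"
 proof (rule real_le_rsqrt)
  have "(100 * s\<^sup>2)\<^sup>2 = 10 ^ 4 * s ^ 4" by (simp add: power_mult_distrib)
  also have "... <= 10 ^ 15 * s ^ 4" using s1 by (intro mult_right_mono) auto
  finally show "(100 * s\<^sup>2)\<^sup>2 <= real n" using n_ge'(1) by linarith
 qed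
 hence "100 * s\<^sup>2 * real p <= sqrt (real n) * sqrt (real n)" using b s1 by (intro mult_mono) auto
 thus "100 * s\<^sup>2 * real p <= real n" by simp
qed

lemma E2: "0 <= x ==> x <= real p ^ 3 * sqrt (real n * real d * L) ==> B * (ep * x) <= real n * al\<^sup>2"
proof -
 assume "0 <= x" "x <= real p ^ 3 * sqrt (real n * real d * L)"
 hence "B * (ep * x) <= B * (ep * (real p ^ 3 * sqrt (real n * real d * L)))" using B15 ep by (intro mult_left_mono) auto
 thus ?thesis using P2 by (simp add: mult.assoc)
qed

lemma root_ge: "1 <= sqrt (real n * real d * L)" "L <= sqrt (real n * real d * L)" "sqrt (real n * real d) <= sqrt (real n * real d * L)"
  "d <= n ==> real d <= sqrt (real n * real d * L)"
proof -
 have nd: "1 <= real n * real d" using n1 d1 mult_mono[of 1 "real n" 1 "real d"] by simp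
 have "1 * 1 <= real n * real d * L" using nd L1 by (intro mult_mono) auto
 thus "1 <= sqrt (real n * real d * L)" by simp
 have "L * 1 * L <= real n * real d * L" using n_ge'(4) d1 L1 by (intro mult_mono) auto
 thus "L <= sqrt (real n * real d * L)" by (intro real_le_rsqrt) (simp add: sq_eq)
 have "real n * real d * 1 <= real n * real d * L" using L1 by (intro mult_left_mono) auto
 thus nl: "sqrt (real n * real d) <= sqrt (real n * real d * L)" by simp
 assume "d <= n"
 hence "real d * real d <= real n * real d" by (intro mult_right_mono) auto
 hence "real d <= sqrt (real n * real d)" by (intro real_le_rsqrt) (simp add: sq_eq)
 thus "real d <= sqrt (real n * real d * L)" using nl by linarith
qed

text \<open>The budget equations. Unflagged scores of \<open>be\<close> corrupted samples cost at
  most \<open>be * ta\<close>, and the sum of \<open>be\<close> vectors with second moments of order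
  \<open>be * th\<close> has squared norm of order \<open>be^2 * th\<close>. For few corruptions,
  \<open>h\<close> as entry bound plays the corresponding part.\<close>

lemma par: "0 < be" "0 < N" "0 < th" "0 < ta" "0 <= h" "be * ta = N\<^sup>2 / 100" "be\<^sup>2 * th = N\<^sup>2 / 10 ^ 8" "be\<^sup>2 * h = N\<^sup>2 / 1000"
  "be * h = ta / 10" "be * th = real n * al\<^sup>2 / (10 ^ 8 * ep)"
proof -
 have n0: "0 < real n" using n1 by simp
 show "0 < be" "0 < N" "0 < th" "0 < ta" "0 <= h" using al ep n0 by (simp_all add: be_def N_def th_def ta_def h_def)
 show "be * ta = N\<^sup>2 / 100" using ep by (simp add: be_def N_def ta_def sq_eq)
 show "be\<^sup>2 * th = N\<^sup>2 / 10 ^ 8" using ep by (simp add: be_def N_def th_def power_mult_distrib power_divide)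
 show "be\<^sup>2 * h = N\<^sup>2 / 1000" using ep by (simp add: be_def N_def h_def power_mult_distrib power_divide)
 show "be * h = ta / 10" using ep by (simp add: be_def ta_def h_def sq_eq)
 show "be * th = real n * al\<^sup>2 / (10 ^ 8 * ep)" using ep by (simp add: be_def th_def sq_eq)
qed

text \<open>Here the square root of the logarithm in \<open>P3\<close> is used: \<open>th\<close>
  exceeds a large multiple of \<open>lg (1 / ep)\<close>, so Gaussian tails beyond \<open>th\<close>
  are negligible against \<open>ep\<close>.\<close>

lemma theta_ge: "10 ^ 20 * s\<^sup>2 * lg (1 / ep) <= th"
proof -
 have l: "0 <= lg (1 / ep)" using lg_ge[of "1 / ep"] by simp
 have "10 ^ 10 * s * sqrt (lg (1 / ep)) <= al / (10000 * ep)"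
 proof -
  define w where "w = s * (ep * sqrt (lg (1 / ep)))"
  have "10 ^ 15 * s * (ep * sqrt (lg (1 / ep))) <= B * (ep * sqrt (lg (1 / ep)))" using B_s[of 1] ep l by (intro mult_right_mono) auto
  hence "10 ^ 15 * w <= al" using P3 by (simp add: w_def mult.assoc)
  moreover have "0 <= w" using s1 ep l by (simp add: w_def)
  ultimately have "10 ^ 14 * w <= al" by simp
  thus ?thesis using ep by (simp add: pos_le_divide_eq w_def mult_ac)
 qed
 hence "(10 ^ 10 * s * sqrt (lg (1 / ep)))\<^sup>2 <= th" unfolding th_def using s1 l by (intro power_mono) auto
 thus ?thesis using l by (simp add: power_mult_distrib)
qed

lemma theta_ge': "10 ^ 20 * s\<^sup>2 <= th" "1 <= th"
proof -
 have s2: "1 <= s\<^sup>2" using s1 by (simp add: one_le_power)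
 have "10 ^ 20 * s\<^sup>2 * 1 <= 10 ^ 20 * s\<^sup>2 * lg (1 / ep)" using lg_ge[of "1 / ep"] by (intro mult_left_mono) auto
 thus a: "10 ^ 20 * s\<^sup>2 <= th" using theta_ge by simp
 thus "1 <= th" using s2 mult_mono[of 1 "10 ^ 20" 1 "s\<^sup>2"] by simp
qed

end

section \<open>Clean samples on the good event\<close>

text \<open>\<open>a = al\<close> and \<open>a = 0\<close> are the two cases to be told apart; one
  analysis serves both because the estimates rely only on \<open>a <= al\<close>. The truncation
  level for layer \<open>k\<close> is \<open>th * 2^k / 64\<close>.\<close>

locale sample = regime +
 fixes mm :: "nat => real" and ga X :: "nat => nat => real" and a :: real
 assumes mu: "ip d mm mm = a\<^sup>2" and a: "0 <= a" "a <= al"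
  and good: "good n d mm (L + 4) (2 * p) (%k. th * 2 ^ k / 64) ga"
  and X: "!!i j. i < n ==> j < d ==> X i j = mm j + ga i j"
begin

abbreviation "GG == (%j. SUM i<n. ga i j)"
abbreviation "Z == vsum X {..<n}"
definition "y = L + 4"
definition "y' = y + 2 * ln (real n)"

lemmas goodD = good[unfolded good_def, folded y_def, folded y'_def]
lemmas gd3 = goodD[THEN conjunct2, THEN conjunct2, THEN conjunct1, rule_format]
lemmas gd6 = goodD[THEN conjunct2, THEN conjunct2, THEN conjunct2, THEN conjunct2, THEN conjunct2, THEN conjunct1, rule_format]
lemmas gd7 = goodD[THEN conjunct2, THEN conjunct2, THEN conjunct2, THEN conjunct2, THEN conjunct2, THEN conjunct2, THEN conjunct1, rule_format]
lemmas gd8 = goodD[THEN conjunct2, THEN conjunct2, THEN conjunct2, THEN conjunct2, THEN conjunct2, THEN conjunct2, THEN conjunct2, rule_format]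

lemma y: "1 <= y" "y <= 5 * L" "y <= y'" "1 <= y'" "y' <= 5 * L + 2 * real p" "y' <= 7 * (L * real p)"
proof -
 show a: "1 <= y" "y <= 5 * L" using L1 by (auto simp: y_def)
 show b: "y <= y'" using n1 by (simp add: y'_def)
 thus "1 <= y'" using a by simp
 have "ln (real n) <= real p"
 proof -
  have "real n <= 2 ^ p" using P5 by (metis of_nat_le_iff of_nat_numeral of_nat_power)
  hence "ln (real n) <= ln (2 ^ p)" using n1 by (intro ln_mono) auto
  also have "... = real p * ln 2" by (simp add: ln_realpow)
  also have "... <= real p * 1" using ln_2_less_1 by (intro mult_left_mono) auto
  finally show ?thesis by simp
 qed
 thus c: "y' <= 5 * L + 2 * real p" using a by (simp add: y'_def)
 have "L * 1 <= L * real p" "1 * real p <= L * real p" using L1 p1 by (intro mult_mono; simp)+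
 thus "y' <= 7 * (L * real p)" using c by simp
qed

lemma dev_bounds:
 "dev 1 y <= 10 * L" "dev 1 y' <= 14 * (L * real p)"
 "dev (real d) y <= 8 * (sqrt (real d) * L)" "dev (real d) y' <= 3 * sqrt (real d * L * real p) + 7 * (L * real p)"
proof -
 have one: "dev 1 z <= 2 * z" if "1 <= z" for z
 proof -
  have "sqrt z <= z" using that by (intro real_le_lsqrt) (auto simp: sq_eq)
  thus ?thesis by (simp add: dev_def)
 qed
 show "dev 1 y <= 10 * L" "dev 1 y' <= 14 * (L * real p)" using one[OF y(1)] one[OF y(4)] y by linarith+
 have "dev (real d) y <= dev (real d) (5 * L)" using y by (intro dev_mono) auto
 also have "... <= 3 * (sqrt (real d) * L) + 5 * (sqrt (real d) * L)" unfolding dev_def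
 proof (rule add_mono)
  have "real d * (5 * L) <= real d * (9 * L * L)" using L1 by (intro mult_left_mono) auto
  hence "sqrt (real d * (5 * L)) <= sqrt (real d * (9 * L * L))" by simp
  also have "... = 3 * (sqrt (real d) * L)" using L1 by (simp add: real_sqrt_mult)
  finally show "sqrt (real d * (5 * L)) <= 3 * (sqrt (real d) * L)" .
  have "1 * L <= sqrt (real d) * L" using d1 L1 by (intro mult_right_mono) auto
  thus "5 * L <= 5 * (sqrt (real d) * L)" by simp
 qed
 finally show "dev (real d) y <= 8 * (sqrt (real d) * L)" by linarith
 have "dev (real d) y' <= dev (real d) (7 * (L * real p))" using y by (intro dev_mono) auto
 also have "... <= 3 * sqrt (real d * L * real p) + 7 * (L * real p)" unfolding dev_def
 proof (rule add_right_mono)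
  have "sqrt (real d * (7 * (L * real p))) <= sqrt (9 * (real d * L * real p))" using L1 by (simp add: mult_ac)
  also have "... = 3 * sqrt (real d * L * real p)" by (simp add: real_sqrt_mult)
  finally show "sqrt (real d * (7 * (L * real p))) <= 3 * sqrt (real d * L * real p)" .
 qed
 finally show "dev (real d) y' <= 3 * sqrt (real d * L * real p) + 7 * (L * real p)" .
qed

lemma ip_X: "i < n ==> ip d u (X i) = ip d u mm + ip d u (ga i)"
 using ip_cong[of d u u "X i" "%j. mm j + ga i j"] X by (simp add: ip_add_right)

lemma Z_eq: "j < d ==> Z j = GG j + real n * mm j" using X by (simp add: vsum_def sum.distrib)

lemma ip_nmu: "ip d (%j. c * mm j) u = c * ip d mm u" by (simp add: ip_def sum_distrib_left mult.assoc)

lemma ip_Z: "ip d Z u = ip d GG u + real n * ip d mm u"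
 using ip_cong[of d Z "%j. GG j + real n * mm j" u u] Z_eq by (simp add: ip_add_left ip_nmu)

lemma mu_Gamma: "\<bar>ip d mm GG\<bar> <= 8 * (al * (sqrt (real n) * sqrt L))"
proof (rule power2_le_imp_le[of "\<bar>ip d mm GG\<bar>"])
 have "(ip d mm GG)\<^sup>2 <= real n * ip d mm mm * (1 + 5 * dev 1 y)" using goodD by blast
 also have "... <= real n * al\<^sup>2 * (64 * L)" unfolding mu using a dev_bounds(1) L1 y by (intro mult_mono power_mono) (auto simp: dev_def)
 finally show "\<bar>ip d mm GG\<bar>\<^sup>2 <= (8 * (al * (sqrt (real n) * sqrt L)))\<^sup>2" using L1 by (simp add: power_mult_distrib mult_ac)
qed (use al L1 in auto)

lemma mu_gamma: "i < n ==> \<bar>ip d mm (ga i)\<bar> <= 9 * (al * sqrt (L * real p))"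
proof (rule power2_le_imp_le[of "\<bar>ip d mm (ga i)\<bar>"])
 assume i: "i < n"
 have Lp: "1 * 1 <= L * real p" using L1 p1 by (intro mult_mono) auto
 have "(ip d mm (ga i))\<^sup>2 <= ip d mm mm * (1 + 5 * dev 1 y')" using goodD i by blast
 also have "... <= al\<^sup>2 * (81 * (L * real p))" unfolding mu using a dev_bounds(2) Lp y by (intro mult_mono power_mono) (auto simp: dev_def)
 finally show "\<bar>ip d mm (ga i)\<bar>\<^sup>2 <= (9 * (al * sqrt (L * real p)))\<^sup>2" using Lp by (simp add: power_mult_distrib)
qed (use al L1 in auto)

lemma sqrtL: "sqrt L * 1000000 <= sqrt (real n) * al"
proof -
 have "10 ^ 12 * L <= B * L" using B15 L1 by (intro mult_right_mono) auto
 hence "sqrt (10 ^ 12 * L) <= sqrt (real n * al\<^sup>2)" using nA by (intro real_sqrt_le_mono) linarith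
 moreover have "sqrt (10 ^ 12) = (1000000 :: real)" by (rule real_sqrt_unique) auto
 ultimately show ?thesis using al by (simp add: real_sqrt_mult mult.commute)
qed

text \<open>\<open>P1\<close> controls the chi-square fluctuation. The cross term is of order
  \<open>n * al * sqrt (n * L)\<close>, small against \<open>N^2\<close> because \<open>L\<close> is
  small against \<open>n * al^2\<close>.\<close>

lemma mean_norm: "\<bar>ip d Z Z - real n * real d - (real n)\<^sup>2 * a\<^sup>2\<bar> <= N\<^sup>2 / 50"
proof -
 have "ip d Z Z = ip d GG GG + 2 * real n * ip d mm GG + (real n)\<^sup>2 * a\<^sup>2"
  unfolding ip_Z ip_commute[of d GG Z] ip_commute[of d mm Z] mu ip_commute[of d GG mm] by (simp add: algebra_simps sq_eq)
 moreover have "\<bar>ip d GG GG - real n * real d\<bar> <= 5 * real n * dev (real d) y" using goodD by blast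
 moreover have "5 * real n * dev (real d) y <= N\<^sup>2 / 100"
 proof -
  have "4000 * (sqrt (real d) * L) <= B * (sqrt (real d) * L)" using B15 L1 by (intro mult_right_mono) auto
  hence "4000 * (sqrt (real d) * L) <= real n * al\<^sup>2" using P1 by linarith
  hence "real n * (4000 * (sqrt (real d) * L)) <= real n * (real n * al\<^sup>2)" by (intro mult_left_mono) auto
  moreover have "5 * real n * dev (real d) y <= 5 * real n * (8 * (sqrt (real d) * L))" using dev_bounds(3) by (intro mult_left_mono) auto
  ultimately show ?thesis by (simp add: N_def sq_eq mult_ac)
 qed
 moreover have "\<bar>2 * real n * ip d mm GG\<bar> <= N\<^sup>2 / 100"
 proof -
  have "2 * real n * \<bar>ip d mm GG\<bar> <= 2 * real n * (8 * (al * (sqrt (real n) * sqrt L)))" using mu_Gamma by (intro mult_left_mono) auto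
  also have "... = 16 * real n * al * sqrt (real n) * sqrt L" by simp
  also have "... <= 16 * real n * al * sqrt (real n) * (sqrt (real n) * al / 1000000)" using sqrtL al by (intro mult_left_mono) auto
  also have "... = 16 * N\<^sup>2 / 1000000" by (simp add: N_def sq_eq mult_ac)
  also have "... <= N\<^sup>2 / 100" by simp
  finally show ?thesis by (simp add: abs_mult)
 qed
 ultimately show ?thesis by linarith
qed

text \<open>Since \<open>ta = n * al^2 / (100 * ep)\<close>, multiplying by \<open>ep * M\<close>
  reduces everything to a comparison with \<open>n * al^2\<close>. \<open>M\<close> is the loss
  factor of the Gram filter, and 1 in the other branches.\<close>

lemma Gamma_X:
 assumes i: "i < n" and M: "1 <= M" and m1: "ep * M <= 1 / 1000000"
  and m3: "ep * M * sqrt (real d * L * real p) <= sqrt (real n) * al\<^sup>2 / 1000000"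
  and m4: "ep * M * (L * real p) <= sqrt (real n) * al\<^sup>2 / 1000000"
 shows "\<bar>ip d GG (X i) - real d\<bar> <= ta / (32 * M)"
proof -
 define T where "T = real n * al\<^sup>2"
 have eM: "0 < ep * M" using ep M by simp
 have T: "sqrt (real n) * (sqrt (real n) * al\<^sup>2) = T" by (simp add: T_def)
 let ?D = "dev (real d) y'"
 have b: "\<bar>ip d GG (X i) - real d\<bar> <= 8 * (al * (sqrt (real n) * sqrt L)) + 5 * sqrt (real n) * ?D"
 proof -
  have "\<bar>ip d GG (ga i) - real d\<bar> <= 5 * sqrt (real n) * ?D" using goodD i by blast
  thus ?thesis using mu_Gamma ip_X[OF i, of GG] ip_commute[of d GG mm] by linarith
 qed
 have "(ep * M) * (8 * (al * (sqrt (real n) * sqrt L))) <= T / 1000000"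
 proof -
  have "al * (sqrt (real n) * sqrt L) <= al * (sqrt (real n) * (sqrt (real n) * al / 1000000))" using sqrtL al by (intro mult_left_mono) auto
  also have "... = T / 1000000" by (simp add: T_def sq_eq mult_ac)
  finally have "al * (sqrt (real n) * sqrt L) <= T / 1000000" .
  moreover have "0 <= al * (sqrt (real n) * sqrt L)" using al L1 by simp
  ultimately have "8 * (al * (sqrt (real n) * sqrt L)) <= T" by linarith
  hence "(ep * M) * (8 * (al * (sqrt (real n) * sqrt L))) <= 1 / 1000000 * T" using m1 eM al L1 by (intro mult_mono) auto
  thus ?thesis by simp
 qed
 moreover have "(ep * M) * (5 * sqrt (real n) * ?D) <= 50 * T / 1000000"
 proof -
  have "(ep * M) * ?D <= (ep * M) * (3 * sqrt (real d * L * real p) + 7 * (L * real p))" using dev_bounds(4) eM by (intro mult_left_mono) auto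
  also have "... = 3 * (ep * M * sqrt (real d * L * real p)) + 7 * (ep * M * (L * real p))" by (simp add: distrib_left)
  also have "... <= 10 * (sqrt (real n) * al\<^sup>2) / 1000000" using m3 m4 by simp
  finally have "sqrt (real n) * ((ep * M) * ?D) <= sqrt (real n) * (10 * (sqrt (real n) * al\<^sup>2) / 1000000)" by (intro mult_left_mono) auto
  hence "sqrt (real n) * ((ep * M) * ?D) <= 10 * T / 1000000" using T by (simp add: mult_ac)
  thus ?thesis by (simp add: mult_ac)
 qed
 ultimately have "(ep * M) * \<bar>ip d GG (X i) - real d\<bar> <= 51 * T / 1000000"
  using mult_left_mono[OF b less_imp_le[OF eM]] unfolding distrib_left by linarith
 also have "... <= T / 3200" using al by (simp add: T_def)
 finally show ?thesis using eM M ep by (simp add: ta_def T_def field_simps)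
qed

lemma Z_X:
 assumes i: "i < n" and M: "1 <= M" and m1: "ep * M <= 1 / 1000000" and m2: "ep * M * sqrt (L * real p) <= al / 1000000"
  and m3: "ep * M * sqrt (real d * L * real p) <= sqrt (real n) * al\<^sup>2 / 1000000"
  and m4: "ep * M * (L * real p) <= sqrt (real n) * al\<^sup>2 / 1000000"
 shows "\<bar>ip d Z (X i) - real d\<bar> <= ta / (16 * M)"
proof -
 define T where "T = real n * al\<^sup>2"
 have T0: "0 <= T" by (simp add: T_def)
 have eM: "0 < ep * M" using ep M by simp
 have b: "\<bar>real n * ip d mm (X i)\<bar> <= T + real n * (9 * (al * sqrt (L * real p)))"
 proof -
  have "ip d mm mm <= al\<^sup>2" unfolding mu using a by (intro power_mono) auto
  hence "\<bar>ip d mm (X i)\<bar> <= al\<^sup>2 + 9 * (al * sqrt (L * real p))" using ip_X[OF i, of mm] mu_gamma[OF i] ip_nonneg[of d mm] by linarith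
  hence "real n * \<bar>ip d mm (X i)\<bar> <= real n * (al\<^sup>2 + 9 * (al * sqrt (L * real p)))" by (intro mult_left_mono) auto
  thus ?thesis by (simp add: abs_mult T_def distrib_left)
 qed
 have "(ep * M) * T <= 1 / 1000000 * T" using m1 T0 by (intro mult_right_mono) auto
 moreover have "(ep * M) * (real n * (9 * (al * sqrt (L * real p)))) <= 9 * T / 1000000"
 proof -
  have "real n * al * (ep * M * sqrt (L * real p)) <= real n * al * (al / 1000000)" using m2 al by (intro mult_left_mono) auto
  thus ?thesis by (simp add: T_def sq_eq mult_ac)
 qed
 ultimately have "(ep * M) * \<bar>real n * ip d mm (X i)\<bar> <= 10 * T / 1000000"
  using mult_left_mono[OF b less_imp_le[OF eM]] unfolding distrib_left by linarith
 also have "... <= T / 3200" using al by (simp add: T_def)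
 finally have "\<bar>real n * ip d mm (X i)\<bar> <= ta / (32 * M)" using eM M ep by (simp add: ta_def T_def field_simps)
 moreover have "ta / (16 * M) = ta / (32 * M) + ta / (32 * M)" by simp
 ultimately show ?thesis using Gamma_X[OF i M m1 m3 m4] ip_Z[of "X i"] by linarith
qed

lemma entry_X:
 assumes i: "i < n" "j < n"
 shows "\<bar>ip d (X i) (X j) - (if i = j then real d else 0)\<bar> <= 5 * dev (real d) y' + \<bar>ip d mm (ga i)\<bar> + \<bar>ip d mm (ga j)\<bar> + al\<^sup>2"
proof -
 define e where "e = (if i = j then real d else 0)"
 have left: "ip d (X i) v = ip d mm v + ip d (ga i) v" for v
  using ip_X[OF i(1), of v] ip_commute[of d v "X i"] ip_commute[of d v mm] ip_commute[of d v "ga i"] by linarith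
 have "ip d (X i) (X j) = a\<^sup>2 + ip d mm (ga i) + ip d mm (ga j) + ip d (ga i) (ga j)"
  using ip_X[OF i(2), of "X i"] left[of mm] left[of "ga j"] mu ip_commute[of d "ga i" mm] by linarith
 moreover have "a\<^sup>2 <= al\<^sup>2" "0 <= a\<^sup>2" using a by (simp_all add: power_mono)
 moreover have "\<bar>ip d (ga i) (ga j) - e\<bar> <= 5 * dev (real d) y'" unfolding e_def by (rule gd3[OF i])
 moreover have "\<bar>w + b + c + v - e\<bar> <= v' + \<bar>b\<bar> + \<bar>c\<bar> + w'" if "w <= w'" "0 <= w" "\<bar>v - e\<bar> <= v'" for w b c v w' v' :: real
  using that by linarith
 ultimately show ?thesis unfolding e_def[symmetric] by simp
qed

lemma entry_X': "i < n ==> j < n ==> \<bar>ip d (X i) (X j) - (if i = j then real d else 0)\<bar> <= 50 * s\<^sup>2 * (sqrt (real d) * L * real p)"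
proof -
 assume i: "i < n" "j < n"
 define w where "w = sqrt (real d) * L * real p"
 have Lp: "1 <= L * real p" using mult_mono[of 1 L 1 "real p"] L1 p1 by simp
 have d: "1 <= sqrt (real d)" using d1 by simp
 have w: "L * real p <= w" "1 <= w"
 proof -
  have "1 * (L * real p) <= sqrt (real d) * (L * real p)" using Lp d by (intro mult_right_mono) auto
  thus "L * real p <= w" by (simp add: w_def mult.assoc)
  thus "1 <= w" using Lp by simp
 qed
 have r: "sqrt (L * real p) <= L * real p" using Lp mult_left_mono[OF Lp, of "L * real p"] by (intro real_le_lsqrt) (simp_all add: sq_eq)
 have "sqrt (real d * L * real p) = sqrt (real d) * sqrt (L * real p)" by (simp add: real_sqrt_mult mult.assoc)
 also have "... <= sqrt (real d) * (L * real p)" using r by (intro mult_left_mono) auto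
 finally have "sqrt (real d * L * real p) <= w" by (simp add: w_def mult.assoc)
 hence "5 * dev (real d) y' <= 50 * w" using dev_bounds(4) w by linarith
 moreover have mg: "\<bar>ip d mm (ga k)\<bar> <= 9 * (A * w)" if "k < n" for k
 proof -
  have "al * sqrt (L * real p) <= A * w" using al r w Lp by (intro mult_mono) auto
  thus ?thesis using mu_gamma[OF that] by linarith
 qed
 moreover have "al\<^sup>2 <= A\<^sup>2 * w"
 proof -
  have "al\<^sup>2 * 1 <= A\<^sup>2 * w" using al w by (intro mult_mono power_mono) auto
  thus ?thesis by simp
 qed
 ultimately have "\<bar>ip d (X i) (X j) - (if i = j then real d else 0)\<bar> <= 50 * w + 18 * (A * w) + A\<^sup>2 * w"
  using entry_X[OF i] mg[OF i(1)] mg[OF i(2)] by linarith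
 also have "... <= 50 * s\<^sup>2 * w"
 proof -
  have "50 + 18 * A + A\<^sup>2 <= 50 * s\<^sup>2" unfolding s_def using al by (simp add: sq_eq algebra_simps)
  hence "(50 + 18 * A + A\<^sup>2) * w <= 50 * s\<^sup>2 * w" using w by (intro mult_right_mono) auto
  thus ?thesis by (simp add: algebra_simps)
 qed
 finally show ?thesis by (simp add: w_def)
qed

text \<open>Crude, but enough for the initial pruning at squared norm \<open>n * d\<close> to keep
  every good sample; the pruning is what bounds the initial potential.\<close>

lemma norm_X: "i < n ==> ip d (X i) (X i) <= real n * real d"
proof -
 assume i: "i < n"
 have m: "\<bar>ip d mm (ga i)\<bar> <= A * (1 + 10 * y')"
 proof (rule power2_le_imp_le[of "\<bar>ip d mm (ga i)\<bar>"])
  have "dev 1 y' <= 2 * y'" using y(4) by (auto simp: dev_def intro!: real_le_lsqrt simp: sq_eq)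
  have "(ip d mm (ga i))\<^sup>2 <= ip d mm mm * (1 + 5 * dev 1 y')" using goodD i by blast
  also have "... <= A\<^sup>2 * ((1 + 10 * y') * (1 + 10 * y'))" unfolding mu
  proof (rule mult_mono)
   show "a\<^sup>2 <= A\<^sup>2" using a al by (intro power_mono) auto
   have "1 * (1 + 10 * y') <= (1 + 10 * y') * (1 + 10 * y')" using y by (intro mult_right_mono) auto
   moreover have "1 + 5 * dev 1 y' <= 1 * (1 + 10 * y')" using \<open>dev 1 y' <= 2 * y'\<close> by simp
   ultimately show "1 + 5 * dev 1 y' <= (1 + 10 * y') * (1 + 10 * y')" by (rule order_trans[rotated])
  qed (use y in \<open>auto simp: dev_def\<close>)
  finally show "\<bar>ip d mm (ga i)\<bar>\<^sup>2 <= (A * (1 + 10 * y'))\<^sup>2" by (simp add: sq_eq mult_ac)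
 qed (use al y in auto)
 have "al\<^sup>2 <= A\<^sup>2" using al by (intro power_mono) auto
 hence "ip d (X i) (X i) <= real d + 5 * (real d + 2 * y') + 2 * (A * (1 + 10 * y')) + A\<^sup>2" using entry_X[OF i i] m dev_le_add[of "real d" y'] y(4) by simp
 also have "... <= 6 * real d + 22 * s\<^sup>2 * y'"
 proof -
  have "10 + 22 * A + A\<^sup>2 <= 22 * s\<^sup>2" unfolding s_def using al by (simp add: sq_eq algebra_simps)
  hence "(10 + 22 * A + A\<^sup>2) * y' <= 22 * s\<^sup>2 * y'" using y by (intro mult_right_mono) auto
  moreover have "A * 1 <= A * y'" "A\<^sup>2 * 1 <= A\<^sup>2 * y'" using y al by (intro mult_left_mono; simp)+
  ultimately show ?thesis by (simp add: algebra_simps)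
 qed
 also have "... <= real n * real d"
 proof -
  have "s\<^sup>2 * y' <= s\<^sup>2 * (5 * L + 2 * real p)" using y by (intro mult_left_mono) auto
  hence "s\<^sup>2 * y' <= 5 * (s\<^sup>2 * L) + 2 * (s\<^sup>2 * real p)" by (simp add: distrib_left mult_ac)
  moreover have "10 ^ 15 * (s\<^sup>2 * L) <= real n" "100 * (s\<^sup>2 * real p) <= real n" using n_ge'(3) p_sqrt(4) by (simp_all add: mult_ac)
  ultimately have 1: "22 * s\<^sup>2 * y' <= real n / 2" by (simp add: mult.assoc)
  have "1 <= s ^ 4" using s1 by (simp add: one_le_power)
  hence n12: "12 <= real n" using n_ge'(1) by simp
  have "12 * real d <= real n * real d" "real n * 1 <= real n * real d" using n12 d1 by (intro mult_mono; simp)+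
  thus ?thesis using 1 by linarith
 qed
 finally show ?thesis .
qed

lemma le_of_sqrt_mult: "sqrt (real n) * x <= sqrt (real n) * z ==> x <= z" by (erule mult_left_le_imp_le) (use n1 in simp)

lemma root_p: "sqrt (real n * real d * L) * real p ^ 3 >= sqrt (real n) * ((real p)\<^sup>2 * sqrt (real d * L * real p))"
proof -
 have p: "sqrt (real p) <= real p" using p1 by (intro real_le_lsqrt) (auto simp: sq_eq)
 have "sqrt (real n) * ((real p)\<^sup>2 * sqrt (real d * L * real p)) = sqrt (real n * real d * L) * ((real p)\<^sup>2 * sqrt (real p))"
  by (simp add: real_sqrt_mult mult_ac)
 also have "... <= sqrt (real n * real d * L) * ((real p)\<^sup>2 * real p)" using p L1 by (intro mult_left_mono) auto
 finally show ?thesis by (simp add: power3_eq_cube sq_eq)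
qed

text \<open>\<open>386 = 2 + 8 * 48\<close>, because the loss factor of the Gram filter is
  \<open>2 + 8 * (48 * p^2)\<close>.\<close>

lemma m3:
 assumes M: "0 <= M" "M <= 386 * (real p)\<^sup>2"
 shows "ep * M * sqrt (real d * L * real p) <= sqrt (real n) * al\<^sup>2 / 1000000"
proof (rule le_of_sqrt_mult)
 define w where "w = sqrt (real n) * ((real p)\<^sup>2 * sqrt (real d * L * real p))"
 have w0: "0 <= w" using L1 by (simp add: w_def)
 have "B * (ep * w) <= real n * al\<^sup>2" using root_p w0 by (intro E2) (auto simp: w_def mult.commute)
 moreover have "10 ^ 15 * (ep * w) <= B * (ep * w)" using B15 w0 ep by (intro mult_right_mono) auto
 ultimately have b: "10 ^ 15 * (ep * w) <= real n * al\<^sup>2" by linarith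
 have "ep * (sqrt (real n) * sqrt (real d * L * real p)) * M <= ep * (sqrt (real n) * sqrt (real d * L * real p)) * (386 * (real p)\<^sup>2)"
  using M ep L1 by (intro mult_left_mono) auto
 hence "sqrt (real n) * (ep * M * sqrt (real d * L * real p)) <= 386 * (ep * w)" by (simp add: w_def mult_ac)
 also have "... <= real n * al\<^sup>2 / 1000000" using b mult_nonneg_nonneg[OF less_imp_le[OF ep] w0] by simp
 also have "... = sqrt (real n) * (sqrt (real n) * al\<^sup>2 / 1000000)" by simp
 finally show "sqrt (real n) * (ep * M * sqrt (real d * L * real p)) <= sqrt (real n) * (sqrt (real n) * al\<^sup>2 / 1000000)" .
qed

lemma eps6: "ep * 1 <= 1 / 1000000" using eps_le ep by simp

lemma p2: "1 <= (real p)\<^sup>2" "1 <= real p ^ 3" "real p <= real p ^ 3" "(real p)\<^sup>2 <= real p ^ 3"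
proof -
 have p: "1 <= real p" using p1 by simp
 show "1 <= (real p)\<^sup>2" "1 <= real p ^ 3" using p by (rule one_le_power)+
 show "real p <= real p ^ 3" using power_increasing[OF _ p, of 1 3] by simp
 show "(real p)\<^sup>2 <= real p ^ 3" using power_increasing[OF _ p, of 2 3] by simp
qed

lemma M1: "(1::real) <= 386 * (real p)\<^sup>2" using p2 by linarith

section \<open>Few corruptions: \<open>be^4 <= n\<close>\<close>

context
 assumes small: "be ^ 4 <= real n"
begin

lemma small': "ep ^ 4 * real n ^ 3 <= 1"
proof -
 have "(ep ^ 4 * real n ^ 3) * real n <= 1 * real n" using small by (simp add: be_def power_mult_distrib eval_nat_numeral mult_ac)
 thus ?thesis by (rule mult_right_le_imp_le) (use n1 in simp)
qed

lemma c0L: "10 ^ 15 * (c0 * L) <= real n * al\<^sup>2"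
proof -
 have "10 ^ 15 * s ^ 0 * c0 * L <= B * L" using B_ge[of 0] L1 by (intro mult_right_mono) auto
 thus ?thesis using nA by simp
qed

text \<open>\<open>ep^4 * n^3 <= 1\<close> enters after squaring, or raising to the fourth power,
  the quantities to be bounded; \<open>P4\<close> then absorbs the powers of \<open>p\<close>, and
  what remains is at most \<open>c0 * L\<close>.\<close>

lemma Z_X_small: "i < n ==> \<bar>ip d Z (X i) - real d\<bar> <= ta / 16"
proof -
 assume i: "i < n"
 define T where "T = real n * al\<^sup>2"
 have T: "10 ^ 15 * (c0 * L) <= T" "0 <= T" using c0L by (auto simp: T_def)
 have cL: "1 <= c0 * L" using mult_mono[of 1 c0 1 L] c0 L1 by simp
 have "real n * (ep\<^sup>2 * (L * real p)) <= T / 10 ^ 15"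
 proof -
  have "(real n * (ep\<^sup>2 * (L * real p)))\<^sup>2 = (real n)\<^sup>2 * ep ^ 4 * L\<^sup>2 * (real p)\<^sup>2" by (simp add: power_mult_distrib mult_ac)
  also have "... <= (real n)\<^sup>2 * ep ^ 4 * L\<^sup>2 * (c0 * real n)"
  proof (rule mult_left_mono)
   have "(real p)\<^sup>2 <= real p ^ 4" using p1 by (intro power_increasing) auto
   thus "(real p)\<^sup>2 <= c0 * real n" using P4 by linarith
  qed auto
  also have "... = (ep ^ 4 * real n ^ 3) * (c0 * L\<^sup>2)" by (simp add: eval_nat_numeral mult_ac)
  also have "... <= 1 * (c0\<^sup>2 * L\<^sup>2)" using small' c0 by (intro mult_mono) (auto simp: sq_eq)
  finally have "(real n * (ep\<^sup>2 * (L * real p)))\<^sup>2 <= (c0 * L)\<^sup>2" by (simp add: power_mult_distrib)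
  hence "real n * (ep\<^sup>2 * (L * real p)) <= c0 * L" using cL by (intro power2_le_imp_le[of "real n * (ep\<^sup>2 * (L * real p))"]) auto
  thus ?thesis using T by simp
 qed
 hence "real n * (ep\<^sup>2 * (L * real p)) <= real n * (al\<^sup>2 / 10 ^ 15)" by (simp add: T_def)
 hence "ep\<^sup>2 * (L * real p) <= al\<^sup>2 / 10 ^ 15" by (rule mult_left_le_imp_le) (use n1 in simp)
 also have "... <= (al / 1000000)\<^sup>2" by (simp add: power_divide)
 finally have "(ep * 1 * sqrt (L * real p))\<^sup>2 <= (al / 1000000)\<^sup>2" using L1 by (simp add: power_mult_distrib)
 hence m2: "ep * 1 * sqrt (L * real p) <= al / 1000000" using al by (intro power2_le_imp_le[of "ep * 1 * sqrt (L * real p)"]) auto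
 have "sqrt (real n) * (ep * (L * real p)) <= T / 10 ^ 15"
 proof -
  have sn: "sqrt (real n) ^ 4 = (real n)\<^sup>2" by (simp add: power4_eq_xxxx sq_eq)
  have "(sqrt (real n) * (ep * (L * real p))) ^ 4 = (real n)\<^sup>2 * ep ^ 4 * L ^ 4 * real p ^ 4" by (simp add: power_mult_distrib sn mult_ac)
  also have "... <= (real n)\<^sup>2 * ep ^ 4 * L ^ 4 * (c0 * real n)" using P4 by (intro mult_left_mono) auto
  also have "... = (ep ^ 4 * real n ^ 3) * (c0 * L ^ 4)" by (simp add: eval_nat_numeral mult_ac)
  also have "... <= 1 * (c0 ^ 4 * L ^ 4)" using small' c0 power_increasing[of 1 4 c0] by (intro mult_mono) auto
  finally have "(sqrt (real n) * (ep * (L * real p))) ^ 4 <= (c0 * L) ^ 4" by (simp add: power_mult_distrib)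
  hence "sqrt (real n) * (ep * (L * real p)) <= c0 * L" using cL power_mono_iff[of "sqrt (real n) * (ep * (L * real p))" "c0 * L" 4] ep L1 by simp
  thus ?thesis using T by simp
 qed
 hence "sqrt (real n) * (ep * 1 * (L * real p)) <= T / 1000000" using T(2) by simp
 also have "... = sqrt (real n) * (sqrt (real n) * al\<^sup>2 / 1000000)" by (simp add: T_def)
 finally have "sqrt (real n) * (ep * 1 * (L * real p)) <= sqrt (real n) * (sqrt (real n) * al\<^sup>2 / 1000000)" .
 hence m4: "ep * 1 * (L * real p) <= sqrt (real n) * al\<^sup>2 / 1000000" by (rule le_of_sqrt_mult)
 show ?thesis using Z_X[OF i order_refl eps6 m2 m3[OF _ M1] m4] by simp
qed

text \<open>\<open>ep^2 * n^(3/2) <= 1\<close> yields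
  \<open>(al / ep)^2 >= sqrt n * (n * al^2)\<close>, and \<open>P1\<close> bounds
  \<open>n * al^2\<close> from below. The gained factor \<open>sqrt n\<close> dominates the
  \<open>p\<close> in the entry bound.\<close>

lemma h_ge: "sqrt (real n) * (B * (sqrt (real d) * L)) / 1000 <= h"
proof -
 have "(ep\<^sup>2 * (real n * sqrt (real n)))\<^sup>2 = ep ^ 4 * real n ^ 3" by (simp add: power_mult_distrib sq_eq[of "real n"] power3_eq_cube mult_ac)
 hence "(ep\<^sup>2 * (real n * sqrt (real n)))\<^sup>2 <= 1\<^sup>2" using small' by simp
 hence e: "ep\<^sup>2 * (real n * sqrt (real n)) <= 1" by (rule power2_le_imp_le) simp
 have "sqrt (real n) * (B * (sqrt (real d) * L)) <= sqrt (real n) * (real n * al\<^sup>2)" using P1 by (intro mult_left_mono) auto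
 also have "... <= (al / ep)\<^sup>2"
 proof -
  have "al\<^sup>2 * (ep\<^sup>2 * (real n * sqrt (real n))) <= al\<^sup>2 * 1" using e by (intro mult_left_mono) auto
  thus ?thesis using ep by (simp add: power_divide pos_le_divide_eq mult_ac)
 qed
 finally show ?thesis by (simp add: h_def)
qed

lemma entry_small: "i < n ==> j < n ==> \<bar>ip d (X i) (X j) - (if i = j then real d else 0)\<bar> <= h / 2"
proof -
 assume i: "i < n" "j < n"
 let ?w = "sqrt (real d) * L"
 have w: "0 <= ?w" using L1 by simp
 have "100000 * (50 * s\<^sup>2 * real p) <= B * sqrt (real n)"
 proof -
  have "100000 * (50 * s\<^sup>2 * real p) <= 100000 * (50 * s\<^sup>2 * (c0 * sqrt (real n)))" using p_sqrt(2) by (intro mult_left_mono) auto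
  also have "... = 5000000 * s\<^sup>2 * c0 * sqrt (real n)" by simp
  also have "... <= 10 ^ 15 * s\<^sup>2 * c0 * sqrt (real n)" using c0 by (intro mult_right_mono) auto
  also have "... <= B * sqrt (real n)" using B_ge[of 2] by (intro mult_right_mono) auto
  finally show ?thesis .
 qed
 hence "100000 * (50 * s\<^sup>2 * real p) * ?w <= B * sqrt (real n) * ?w" using w by (intro mult_right_mono) auto
 moreover have "B * sqrt (real n) * ?w / 1000 <= h" using h_ge by (simp add: mult_ac)
 ultimately have "100 * (50 * s\<^sup>2 * (sqrt (real d) * L * real p)) <= h" by (simp add: mult_ac)
 thus ?thesis using entry_X'[OF i] by linarith
qed

text \<open>Together with \<open>entry_small\<close> this lets all good samples pass the norm test
  at \<open>h\<close>. That test alone is enough for \<open>d <= n\<close>, since small norms bound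
  all inner products.\<close>

lemma d_small: "d <= n ==> real d <= h / 2"
proof -
 assume dn: "d <= n"
 have dd: "real d <= sqrt (real n) * sqrt (real d)"
 proof -
  have "sqrt (real d) * sqrt (real d) <= sqrt (real n) * sqrt (real d)" using dn by (intro mult_right_mono) auto
  thus ?thesis by simp
 qed
 have "10 ^ 15 * (sqrt (real n) * sqrt (real d)) * 1 <= B * (sqrt (real n) * sqrt (real d)) * L" using B15 L1 by (intro mult_mono) auto
 hence "10 ^ 12 * (sqrt (real n) * sqrt (real d)) <= h" using h_ge by (simp add: mult_ac)
 thus ?thesis using dd by simp
qed

lemma statistic_of_small:
 assumes W: "W <= {..<n}" and S: "!!i j. i : S ==> j < d ==> Y i j = X i j"
  and eY: "!!i j. i : W ==> j : W ==> \<bar>gram d Y W i j\<bar> <= h" and cD: "real (card ({..<n} - W \<inter> S)) <= 2 * be"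
 shows "\<bar>statistic d ta Y W - (real n)\<^sup>2 * a\<^sup>2\<bar> <= 9 * (N\<^sup>2 / 50)"
proof (rule statistic_small[where r = h, OF W S])
 let ?D = "real (card ({..<n} - W \<inter> S))"
 show "0 < N" "0 < ta" "0 <= h" by (rule par)+
 show "\<bar>ip d Z (X i) - real d\<bar> <= ta / 16" if "i < n" for i by (rule Z_X_small[OF that])
 show "\<bar>gram d X {..<n} i j\<bar> <= h" if "i < n" "j < n" for i j using entry_small[OF that] that par(5) by (simp add: gram_def)
 show "?D * ta <= N\<^sup>2 / 50" using mult_right_mono[OF cD less_imp_le[OF par(4)]] par(6) by simp
 have "?D * ?D <= (2 * be) * (2 * be)" using cD by (intro mult_mono) auto
 hence "?D * ?D * h <= (2 * be) * (2 * be) * h" using par(5) by (intro mult_right_mono) auto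
 also have "... = 4 * (be\<^sup>2 * h)" by (simp add: sq_eq)
 also have "... <= N\<^sup>2 / 50" unfolding par(8) by simp
 finally show "?D * ?D * h <= N\<^sup>2 / 50" .
 have "?D * h <= 2 * be * h" using cD par(5) by (intro mult_right_mono) auto
 thus "?D * h <= ta / 4" using par(4,9) by simp
 show "real (card (W - S)) <= ?D" using W by (intro of_nat_mono card_mono) auto
 show "\<bar>ip d Z Z - real n * real d - (real n)\<^sup>2 * a\<^sup>2\<bar> <= N\<^sup>2 / 50" by (rule mean_norm)
 show "\<bar>gram d Y W i j\<bar> <= h" if "i : W" "j : W" for i j by (rule eY[OF that])
qed

end

end

section \<open>Second moments of the clean samples, and the error in every branch\<close>

context sample
begin

text \<open>The mean adds \<open>n * m^2 + 2 * m * G\<close>, bounded by Cauchy-Schwarz by multiples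
  of \<open>n * al^2\<close> and \<open>n * al\<close>. The right side
  \<open>be * th = n * al^2 / (10^8 * ep)\<close> exceeds both, thanks to the factor
  \<open>1 / ep\<close> and the smallness of \<open>ep / al\<close>; the noise fluctuation is
  covered by \<open>P2\<close>.\<close>

lemma full_X:
 assumes dn: "d <= n"
 shows "\<bar>(SUM i<n. (ip d u (X i))\<^sup>2) - real n * ip d u u\<bar> <= be * th * ip d u u"
proof -
 define q where "q = ip d u u"
 define m where "m = ip d u mm"
 define V where "V = (SUM i<n. (ip d u (ga i))\<^sup>2)"
 define G where "G = (SUM i<n. ip d u (ga i))"
 define g where "g = 20 * dev (real n) (27 * real d + y)"
 define r where "r = sqrt (real n * real d * L)"
 have q0: "0 <= q" unfolding q_def by (rule ip_nonneg)
 have g0: "0 <= g" using y by (simp add: g_def dev_def)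
 have m2: "m\<^sup>2 <= q * al\<^sup>2"
 proof -
  have "m\<^sup>2 <= q * a\<^sup>2" unfolding m_def q_def mu[symmetric] by (rule ip_Cauchy_Schwarz)
  also have "... <= q * al\<^sup>2" using a q0 by (intro mult_left_mono power_mono) auto
  finally show ?thesis .
 qed
 have V: "\<bar>V - real n * q\<bar> <= g * q" unfolding V_def q_def g_def by (rule gd6)
 have G2: "G\<^sup>2 <= (real n + g)\<^sup>2 * q"
 proof -
  have "(SUM i<n. 1 * ip d u (ga i))\<^sup>2 <= (SUM i<n. 1\<^sup>2) * V" unfolding V_def by (rule Cauchy_Schwarz_ineq_sum)
  hence "G\<^sup>2 <= real n * V" by (simp add: G_def)
  also have "... <= real n * ((real n + g) * q)" using V by (intro mult_left_mono) (auto simp: distrib_right)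
  also have "... <= (real n + g) * ((real n + g) * q)" using g0 q0 by (intro mult_right_mono) auto
  finally show ?thesis by (simp add: sq_eq mult.assoc)
 qed
 have mG: "\<bar>m * G\<bar> <= al * (real n + g) * q"
 proof (rule power2_le_imp_le[of "\<bar>m * G\<bar>"])
  have "m\<^sup>2 * G\<^sup>2 <= (q * al\<^sup>2) * ((real n + g)\<^sup>2 * q)" using m2 G2 q0 by (intro mult_mono) auto
  thus "\<bar>m * G\<bar>\<^sup>2 <= (al * (real n + g) * q)\<^sup>2" by (simp add: power_mult_distrib sq_eq[of q] mult_ac)
 qed (use al g0 q0 in auto)
 have "(SUM i<n. (ip d u (X i))\<^sup>2) = (SUM i<n. m\<^sup>2 + 2 * m * ip d u (ga i) + (ip d u (ga i))\<^sup>2)"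
  by (intro sum.cong) (auto simp: ip_X m_def sq_eq algebra_simps)
 also have "... = real n * m\<^sup>2 + 2 * (m * G) + V" by (simp add: sum.distrib G_def V_def sum_distrib_left mult.assoc)
 finally have e: "(SUM i<n. (ip d u (X i))\<^sup>2) = real n * m\<^sup>2 + 2 * (m * G) + V" .
 have nm: "0 <= real n * m\<^sup>2" "real n * m\<^sup>2 <= real n * (q * al\<^sup>2)" using m2 by (auto intro: mult_left_mono)
 have "\<bar>(SUM i<n. (ip d u (X i))\<^sup>2) - real n * q\<bar> <= real n * (q * al\<^sup>2) + 2 * (al * (real n + g) * q) + g * q"
  unfolding e using nm mG V by linarith
 also have "... = (real n * al\<^sup>2 + 2 * al * real n + (2 * al + 1) * g) * q" by (simp add: algebra_simps)
 also have "... <= be * th * q"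
 proof (rule mult_right_mono[OF _ q0])
  define T where "T = real n * al\<^sup>2"
  have T0: "0 <= T" by (simp add: T_def)
  have r0: "0 <= r" using L1 by (simp add: r_def)
  have d: "real d <= r" "L <= r" using root_ge dn by (auto simp: r_def)
  have gr: "g <= 760 * r"
  proof -
   have "dev (real n) (27 * real d + y) <= dev (real n) (27 * real d + 5 * L)" using y by (intro dev_mono) auto
   also have "... <= 6 * r + (27 * real d + 5 * L)" unfolding dev_def
   proof (rule add_right_mono)
    have "real d * 1 <= real d * L" "1 * L <= real d * L" using d1 L1 by (intro mult_mono; simp)+
    hence "27 * real d + 5 * L <= 36 * (real d * L)" using L1 by linarith
    hence "real n * (27 * real d + 5 * L) <= real n * (36 * (real d * L))" by (intro mult_left_mono) auto
    hence "sqrt (real n * (27 * real d + 5 * L)) <= sqrt (36 * (real n * real d * L))" by (simp add: mult_ac)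
    also have "... = 6 * r" by (simp add: r_def real_sqrt_mult)
    finally show "sqrt (real n * (27 * real d + 5 * L)) <= 6 * r" .
   qed
   finally show ?thesis using d by (simp add: g_def)
  qed
  have "ep * T <= T / 10 ^ 15" using mult_right_mono[OF eps_le T0] by (simp add: mult_ac)
  moreover have "ep * (al * real n) <= T / 10 ^ 15"
  proof -
   have "10 ^ 15 * ep <= B * ep" using B15 ep by (intro mult_right_mono) auto
   hence "10 ^ 15 * ep <= al" using e_small by linarith
   hence "(10 ^ 15 * ep) * (al * real n) <= al * (al * real n)" using al by (intro mult_right_mono) auto
   thus ?thesis by (simp add: T_def sq_eq mult_ac)
  qed
  moreover have "ep * ((2 * al + 1) * g) <= 1520 * T / 10 ^ 15"
  proof -
   have "(2 * al + 1) * g <= (2 * s) * (760 * r)" using s1 al g0 gr by (intro mult_mono) (auto simp: s_def)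
   hence "ep * ((2 * al + 1) * g) <= ep * ((2 * s) * (760 * r))" using ep by (intro mult_left_mono) auto
   also have "... = 1520 * (s * (ep * r))" by simp
   finally have 1: "ep * ((2 * al + 1) * g) <= 1520 * (s * (ep * r))" .
   have "10 ^ 15 * s * (ep * r) <= B * (ep * r)" using B_s[of 1] ep r0 by (intro mult_right_mono) auto
   moreover have "B * (ep * r) <= T" unfolding T_def
   proof (rule E2[OF r0])
    have "1 * r <= real p ^ 3 * r" using p2 r0 by (intro mult_right_mono) auto
    thus "r <= real p ^ 3 * sqrt (real n * real d * L)" by (simp add: r_def)
   qed
   ultimately have "s * (ep * r) <= T / 10 ^ 15" by (simp add: mult_ac)
   thus ?thesis using 1 by linarith
  qed
  ultimately have "ep * (T + 2 * al * real n + (2 * al + 1) * g) * 10 ^ 8 <= T" using T0 by (simp add: distrib_left mult_ac)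
  thus "real n * al\<^sup>2 + 2 * al * real n + (2 * al + 1) * g <= be * th"
   unfolding par(10) T_def using ep by (simp add: pos_le_divide_eq mult_ac)
 qed
 finally show ?thesis by (simp add: q_def)
qed

text \<open>\<open>th * 2^k / 256 >= (k + 1) + lg (1 / ep)\<close>, so the exponential is at most
  \<open>exp (- (k + 1)) * ep\<close>, whose first factor absorbs the polynomial.\<close>

lemma exp_tail: "25600 * (real k + 1)\<^sup>2 * exp (- (th * 2 ^ k / 64) / 4) <= ep * th"
proof -
 define l where "l = lg (1 / ep)"
 define z where "z = real k + 1"
 have l: "1 <= l" "ln (1 / ep) <= l" by (auto simp: l_def lg_def)
 have z: "1 <= z" by (simp add: z_def)
 have zk: "z <= 2 ^ k" unfolding z_def by (induction k) auto
 have "1 <= s\<^sup>2" using s1 by (simp add: one_le_power)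
 hence "10 ^ 20 * 1 * l <= 10 ^ 20 * s\<^sup>2 * l" using l by (intro mult_right_mono mult_left_mono) auto
 hence th: "10 ^ 20 * l <= th" using theta_ge by (simp add: l_def)
 have "z + l <= 3 * l * z"
 proof -
  have "1 * z <= l * z" "l * 1 <= l * z" using l z by (intro mult_mono; simp)+
  moreover have "0 <= l * z" using l z by simp
  ultimately show ?thesis by linarith
 qed
 also have "... <= th / 256 * 2 ^ k"
 proof (rule mult_mono)
  show "3 * l <= th / 256" using th l by simp
 qed (use zk z th l in auto)
 finally have "exp (- (th * 2 ^ k / 64) / 4) <= exp (- z - l)" by simp
 also have "... = exp (- z) * exp (- l)" by (simp add: exp_diff exp_minus divide_inverse)
 also have "... <= exp (- z) * ep"
 proof (rule mult_left_mono)
  have "exp (- l) <= exp (- ln (1 / ep))" using l by simp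
  thus "exp (- l) <= ep" using ep by (simp add: ln_div)
 qed simp
 finally have "z\<^sup>2 * exp (- (th * 2 ^ k / 64) / 4) <= z\<^sup>2 * (exp (- z) * ep)" by (intro mult_left_mono) auto
 also have "... <= 2 * ep"
 proof -
  have "1 + z + z\<^sup>2 / 2 <= exp z" using z by (intro exp_lower_Taylor_quadratic) simp
  hence "z\<^sup>2 <= 2 * exp z" using z by linarith
  hence "z\<^sup>2 * exp (- z) <= 2" by (simp add: exp_minus field_simps)
  hence "z\<^sup>2 * exp (- z) * ep <= 2 * ep" using ep by (intro mult_right_mono) auto
  thus ?thesis by (simp add: mult.assoc)
 qed
 finally have "z\<^sup>2 * exp (- (th * 2 ^ k / 64) / 4) <= 2 * ep" .
 moreover have "51200 * ep <= th * ep" using th l ep by (intro mult_right_mono) auto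
 ultimately show ?thesis unfolding z_def by (simp add: mult_ac)
qed

text \<open>After splitting mean and noise with a factor 2, the terms proportional to
  \<open>card R\<close> stay below half of \<open>th * 2^k\<close>. The Gaussian tail and the cost
  of the net share the remainder equally.\<close>

lemma restricted_X:
 assumes dn: "d <= n" and k: "k < 2 * p" and R: "R <= {..<n}"
 shows "(SUM i:R. (ip d u (X i))\<^sup>2) <= (real (card R) * (th * 2 ^ k) / 2 + be * th / (200 * (real k + 1)\<^sup>2)) * ip d u u"
proof -
 define q where "q = ip d u u"
 define t where "t = th * 2 ^ k / 64"
 define z where "z = (real k + 1)\<^sup>2"
 define c where "c = real (card R)"
 define T where "T = real n * al\<^sup>2"
 have q0: "0 <= q" unfolding q_def by (rule ip_nonneg)
 have z0: "0 < z" by (simp add: z_def)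
 have "(SUM i:R. (ip d u (X i))\<^sup>2) <= (SUM i:R. 2 * (al\<^sup>2 * q) + 2 * (ip d u (ga i))\<^sup>2)"
 proof (rule sum_mono)
  fix i assume "i : R"
  hence i: "i < n" using R by auto
  have "(ip d u mm)\<^sup>2 <= q * a\<^sup>2" unfolding q_def mu[symmetric] by (rule ip_Cauchy_Schwarz)
  also have "... <= q * al\<^sup>2" using a q0 by (intro mult_left_mono power_mono) auto
  finally have m: "(ip d u mm)\<^sup>2 <= al\<^sup>2 * q" by (simp add: mult.commute)
  have "0 <= (ip d u mm - ip d u (ga i))\<^sup>2" by simp
  hence "(ip d u mm + ip d u (ga i))\<^sup>2 <= 2 * (ip d u mm)\<^sup>2 + 2 * (ip d u (ga i))\<^sup>2" by (simp add: sq_eq algebra_simps)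
  thus "(ip d u (X i))\<^sup>2 <= 2 * (al\<^sup>2 * q) + 2 * (ip d u (ga i))\<^sup>2" using m by (simp add: ip_X[OF i])
 qed
 also have "... = c * (2 * (al\<^sup>2 * q)) + 2 * (SUM i:R. (ip d u (ga i))\<^sup>2)" by (simp add: sum.distrib sum_distrib_left c_def)
 also have "... <= c * (2 * (al\<^sup>2 * q)) + 2 * (4 * (c * t + 8 * real n * exp (- t / 4) + 4 * (27 * real d + (y + ln (real (2 * p))))) * q)"
 proof -
  have "(SUM i:R. (ip d u (ga i))\<^sup>2) <= 4 * (c * t + 8 * real n * exp (- t / 4) + 4 * (27 * real d + (y + ln (real (2 * p))))) * q"
   unfolding c_def t_def q_def by (rule gd7[OF k R])
  thus ?thesis by linarith
 qed
 also have "... = (c * (2 * al\<^sup>2 + 8 * t) + (64 * real n * exp (- t / 4) + 32 * (27 * real d + (y + ln (real (2 * p)))))) * q"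
  by (simp add: algebra_simps)
 also have "... <= (c * (th * 2 ^ k / 2) + (be * th / (400 * z) + be * th / (400 * z))) * q"
 proof (intro mult_right_mono[OF _ q0] add_mono mult_left_mono)
  have "al\<^sup>2 <= s\<^sup>2" using s1 al by (intro power_mono) auto
  moreover have "16 * s\<^sup>2 <= 10 ^ 20 * s\<^sup>2" by (intro mult_right_mono) auto
  ultimately have "16 * al\<^sup>2 <= th" using theta_ge'(1) by linarith
  also have "th * 1 <= th * 2 ^ k" using theta_ge'(2) by (intro mult_left_mono) auto
  finally have "16 * al\<^sup>2 <= th * 2 ^ k" by simp
  moreover have "2 * al\<^sup>2 + 8 * (x / 64) <= x / 2" if "16 * al\<^sup>2 <= x" for x using that zero_le_power2[of al] by linarith
  ultimately show "2 * al\<^sup>2 + 8 * t <= th * 2 ^ k / 2" unfolding t_def by blast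
  show "0 <= c" by (simp add: c_def)
  have "25600 * z * exp (- t / 4) <= ep * th" unfolding z_def t_def by (rule exp_tail)
  hence "real n * (25600 * z * exp (- t / 4)) <= real n * (ep * th)" by (intro mult_left_mono) auto
  thus "64 * real n * exp (- t / 4) <= be * th / (400 * z)" using z0 by (simp add: be_def pos_le_divide_eq mult_ac)
  define P where "P = real p ^ 3 * sqrt (real n * real d * L)"
  have P: "(real p)\<^sup>2 * real d <= P" "(real p)\<^sup>2 * L <= P" "(real p)\<^sup>2 * real p <= P" "0 <= P"
  proof -
   show "(real p)\<^sup>2 * real d <= P" "(real p)\<^sup>2 * L <= P" unfolding P_def using p2 root_ge dn L1 by (intro mult_mono; simp)+
   have "real p ^ 3 * 1 <= P" unfolding P_def using root_ge by (intro mult_left_mono) auto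
   thus "(real p)\<^sup>2 * real p <= P" by (simp add: sq_eq power3_eq_cube)
   show "0 <= P" using L1 by (simp add: P_def)
  qed
  have BP: "10 ^ 15 * (ep * P) <= T"
  proof -
   have "10 ^ 15 * (ep * P) <= B * (ep * P)" using B15 ep P by (intro mult_right_mono) auto
   also have "... <= T" unfolding T_def by (rule E2) (use P in \<open>auto simp: P_def\<close>)
   finally show ?thesis .
  qed
  have "ln (real (2 * p)) <= real (2 * p) - 1" using p1 by (intro ln_le_minus_one) simp
  hence w: "27 * real d + (y + ln (real (2 * p))) <= 27 * real d + 5 * L + 2 * real p" using y by simp
  \<comment> \<open>There are \<open>2 * p\<close> layers, so the denominators
    \<open>(k + 1)^2\<close> cost a factor up to \<open>4 * p^2\<close>, which the
    \<open>p^3\<close> in \<open>P2\<close> covers.\<close>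
  have "z <= (2 * real p)\<^sup>2" unfolding z_def using k by (intro power_mono) auto
  hence zp: "z <= 4 * (real p)\<^sup>2" by (simp add: power_mult_distrib)
  have "(27 * real d + (y + ln (real (2 * p)))) * z <= (27 * real d + 5 * L + 2 * real p) * (4 * (real p)\<^sup>2)" using w zp z0 L1 by (intro mult_mono) auto
  also have "... <= 136 * P" using P by (simp add: algebra_simps)
  finally have "ep * ((27 * real d + (y + ln (real (2 * p)))) * z) <= ep * (136 * P)" using ep by (intro mult_left_mono) auto
  hence "12800 * 10 ^ 8 * (ep * ((27 * real d + (y + ln (real (2 * p)))) * z)) <= T" using BP mult_nonneg_nonneg[OF less_imp_le[OF ep] P(4)] by simp
  thus "32 * (27 * real d + (y + ln (real (2 * p)))) <= be * th / (400 * z)"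
   unfolding par(10) T_def using ep z0 by (simp add: pos_le_divide_eq mult_ac)
 qed
 also have "be * th / (400 * z) + be * th / (400 * z) = be * th / (200 * z)" by simp
 finally show ?thesis by (simp add: q_def z_def c_def)
qed

lemma two_p: "real n <= 2 ^ p" using P5 by (metis of_nat_le_iff of_nat_numeral of_nat_power)

lemma beta_theta_ge: "1 <= be * th"
proof -
 have "10 ^ 15 * 1 <= B * L" using B15 L1 by (intro mult_mono) auto
 hence "10 ^ 15 <= real n * al\<^sup>2" using nA by linarith
 moreover have "10 ^ 8 * ep <= 10 ^ 8 * 1" using eps_le ep by simp
 ultimately have "10 ^ 8 * ep <= real n * al\<^sup>2" by simp
 thus ?thesis unfolding par(10) using ep by (simp add: pos_le_divide_eq)
qed

lemma statistic_of_tall: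
 assumes dn: "d <= n" and S: "S <= {..<n}" "!!i j. i : S ==> j < d ==> Y i j = X i j" and bad: "real (card ({..<n} - S)) <= be"
 defines "W == (tall_round n d Y th be p ^^ (48 * p\<^sup>2)) {i\<in>{..<n}. ip d (Y i) (Y i) <= real n * real d}"
 shows "\<bar>statistic d ta Y W - (real n)\<^sup>2 * a\<^sup>2\<bar> <= 9 * (N\<^sup>2 / 50)"
proof -
 interpret tall_filter n d X Y S be th p
 proof
  show "real n * real d <= th * 2 ^ (2 * p)"
  proof -
   have "real n * real d <= 2 ^ p * 2 ^ p" using two_p dn by (intro mult_mono) auto
   also have "... = 1 * 2 ^ (2 * p)" by (simp add: power_add[symmetric] mult_2)
   also have "... <= th * 2 ^ (2 * p)" using theta_ge' by (intro mult_right_mono) auto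
   finally show ?thesis .
  qed
  have "(2::nat) ^ p <= 2 ^ (2 * p + 1)" by (intro power_increasing) auto
  thus "d <= 2 ^ (2 * p + 1)" using P5 dn by linarith
 qed (use S bad par p1 full_X[OF dn] restricted_X[OF dn] in auto)
 let ?g = "be * th"
 \<comment> \<open>Before taking powers, the initial bound exceeds the floor by a factor of at most
   \<open>2^(3p)\<close>, so \<open>3 * p * (2 * p + 1) <= 48 * p^2\<close> halvings
   suffice.\<close>
 have J: "(real n * (real n * real d) + 4 * ?g) ^ (2 * p + 1) <= 2 ^ (48 * p\<^sup>2) * (28 * ?g) ^ (2 * p + 1)"
 proof -
  have "real n * (real n * real d) <= 2 ^ p * (2 ^ p * 2 ^ p)" using two_p dn by (intro mult_mono) auto
  also have "... = 2 ^ (3 * p) * 1" by (simp add: power_add[symmetric] mult.commute numeral_3_eq_3)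
  also have "... <= 2 ^ (3 * p) * ?g" using beta_theta_ge by (intro mult_left_mono) auto
  finally have "real n * (real n * real d) + 4 * ?g <= 2 ^ (3 * p) * ?g + 4 * (2 ^ (3 * p) * ?g)"
   using mult_right_mono[of 1 "2 ^ (3 * p)" ?g] beta_theta_ge one_le_power[of "2::real" "3 * p"] by linarith
  also have "... <= 2 ^ (3 * p) * (28 * ?g)"
  proof -
   have "z + 4 * z <= 28 * z" if "0 <= z" for z :: real using that by simp
   moreover have "0 <= 2 ^ (3 * p) * ?g" using par(1,3) by simp
   ultimately show ?thesis by (metis mult.left_commute)
  qed
  finally have "(real n * (real n * real d) + 4 * ?g) ^ (2 * p + 1) <= (2 ^ (3 * p) * (28 * ?g)) ^ (2 * p + 1)" using beta_theta_ge by (intro power_mono) auto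
  also have "... = 2 ^ (3 * p * (2 * p + 1)) * (28 * ?g) ^ (2 * p + 1)" by (simp only: power_mult_distrib power_mult)
  also have "... <= 2 ^ (48 * p\<^sup>2) * (28 * ?g) ^ (2 * p + 1)"
  proof (intro mult_right_mono power_increasing)
   have "p * 1 <= p * p" using p1 by (intro mult_le_mono) auto
   thus "3 * p * (2 * p + 1) <= 48 * p\<^sup>2" by (simp add: sq_eq algebra_simps)
  qed (use beta_theta_ge in auto)
  finally show ?thesis .
 qed
 have nX: "ip d (X i) (X i) <= real n * real d" if "i : S" for i using norm_X that S by auto
 note res = filter_result[OF nX J, folded W_def]
 have rs: "(SUM i:R. (ip d u (X i))\<^sup>2) <= (real (card R) * th + be * th / 200) * ip d u u" if "R <= {..<n}" for R u
 proof -
  have "(SUM i:R. (ip d u (X i))\<^sup>2) <= (real (card R) * th / 2 + be * th / 200) * ip d u u" using restricted_X[OF dn _ that, of 0 u] p1 by simp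
  also have "... <= (real (card R) * th + be * th / 200) * ip d u u" using par by (intro mult_right_mono ip_nonneg add_right_mono) auto
  finally show ?thesis .
 qed
 have YB: "ip d (vsum Y (W - S)) (vsum Y (W - S)) <= (N / 100)\<^sup>2" 
 proof (rule order_trans[OF res(4)[unfolded par(7)]])
  have g: "56 * (z / 10 ^ 8) <= z / 10000" if "0 <= z" for z :: real using that by simp
  have eq: "(N / 100)\<^sup>2 = N\<^sup>2 / 10000" by (simp add: sq_eq)
  show "56 * (N\<^sup>2 / 10 ^ 8) <= (N / 100)\<^sup>2" unfolding eq by (rule g) simp
 qed
 have "B * (ep * real d) <= real n * al\<^sup>2"
 proof (rule E2)
  show "real d <= real p ^ 3 * sqrt (real n * real d * L)" using mult_mono[OF p2(2) root_ge(4)[OF dn]] by simp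
 qed simp
 moreover have "10 ^ 15 * (ep * real d) <= B * (ep * real d)" using B15 ep by (intro mult_right_mono) auto
 ultimately have ed: "10 ^ 15 * (ep * real d) <= real n * al\<^sup>2" by linarith
 have gen: "1000 * x <= z & 1600 * x <= z" if "10 ^ 15 * x <= z" "0 <= x" for x z :: real using that by simp
 have ed': "1000 * (ep * real d) <= real n * al\<^sup>2" "1600 * (ep * real d) <= real n * al\<^sup>2" using gen[OF ed] ep by auto
 have "real n * (1000 * (ep * real d)) <= real n * (real n * al\<^sup>2)" using ed'(1) by (rule mult_left_mono) simp
 hence bd: "be * real d <= N\<^sup>2 / 1000" using par(2) by (simp add: be_def N_def sq_eq mult_ac)
 \<comment> \<open>For \<open>d > L\<close> the noise sum \<open>GG\<close> is tame against every
   sample and \<open>f = n * mm\<close>. For \<open>d <= L\<close> the bound on \<open>GG\<close> is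
   out of reach, but then \<open>y = 0\<close> works: \<open>d\<close> is at most
   \<open>ta / 16\<close>, and \<open>Z\<close> itself has norm at most \<open>2 * N\<close> because
   \<open>n * d <= N^2\<close>.\<close>
 define yv where "yv = (if L < real d then GG else (%_. 0))"
 define f where "f = (%j. Z j - yv j)"
 have fN: "ip d f f <= (2 * N)\<^sup>2"
 proof (cases "L < real d")
  case True
  have "ip d f f = ip d (%j. real n * mm j) (%j. real n * mm j)" by (rule ip_cong) (auto simp: f_def yv_def True Z_eq)
  also have "... = (real n * a)\<^sup>2" by (simp add: ip_nmu ip_commute[of d mm "%j. real n * mm j"] mu sq_eq)
  also have "... <= (2 * N)\<^sup>2" unfolding N_def using a by (intro power_mono) (auto simp: mult_left_mono intro: order_trans[of _ "real n * al"])
  finally show ?thesis .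
 next
  case False
  have "ip d f f = ip d Z Z" by (simp add: f_def yv_def False)
  moreover have "(real n)\<^sup>2 * a\<^sup>2 <= N\<^sup>2" unfolding N_def power_mult_distrib using a by (intro mult_left_mono power_mono) auto
  moreover have "real n * real d <= N\<^sup>2"
  proof -
   have "real d <= B * L" using False B15 L1 mult_mono[of 1 B "real d" L] by simp
   hence "real d <= real n * al\<^sup>2" using nA by linarith
   hence "real n * real d <= real n * (real n * al\<^sup>2)" by (intro mult_left_mono) auto
   thus ?thesis by (simp add: N_def sq_eq mult_ac)
  qed
  moreover have "(2 * N)\<^sup>2 = 4 * N\<^sup>2" by simp
  ultimately show ?thesis using mean_norm zero_le_power2[of N] by linarith
 qed
 have yX: "\<bar>ip d yv (X i) - real d\<bar> <= ta / 16" if i: "i < n" for i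
 proof (cases "L < real d")
  case True
  have m4: "ep * 1 * (L * real p) <= sqrt (real n) * al\<^sup>2 / 1000000"
  proof (rule le_of_sqrt_mult)
   have "L <= sqrt (real d * L)" using True L1 by (intro real_le_rsqrt) (auto simp: sq_eq)
   hence "sqrt (real n) * (L * real p) <= sqrt (real n) * (sqrt (real d * L) * real p ^ 3)" using p2 L1 by (intro mult_left_mono mult_mono) auto
   hence "sqrt (real n) * (L * real p) <= real p ^ 3 * sqrt (real n * real d * L)" by (simp add: real_sqrt_mult mult_ac)
   hence "B * (ep * (sqrt (real n) * (L * real p))) <= real n * al\<^sup>2" using L1 by (intro E2) auto
   moreover have "10 ^ 15 * (ep * (sqrt (real n) * (L * real p))) <= B * (ep * (sqrt (real n) * (L * real p)))"
    using B15 ep L1 by (intro mult_right_mono) auto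
   ultimately have "10 ^ 15 * (ep * (sqrt (real n) * (L * real p))) <= real n * al\<^sup>2" by linarith
   moreover have "0 <= ep * (sqrt (real n) * (L * real p))" using ep L1 by simp
   ultimately have "ep * (sqrt (real n) * (L * real p)) <= real n * al\<^sup>2 / 1000000" by simp
   moreover have eq: "sqrt (real n) * (sqrt (real n) * al\<^sup>2 / 1000000) = real n * al\<^sup>2 / 1000000" by simp
   ultimately show "sqrt (real n) * (ep * 1 * (L * real p)) <= sqrt (real n) * (sqrt (real n) * al\<^sup>2 / 1000000)"
    unfolding eq by (simp add: mult_ac)
  qed
  have "\<bar>ip d GG (X i) - real d\<bar> <= ta / (32 * 1)" by (rule Gamma_X[OF i order_refl eps6 m3[OF _ M1] m4]) simp
  thus ?thesis using True par(4) by (simp add: yv_def)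
 next
  case False
  have "real d <= ta / 16" using ep ed'(2) by (simp add: ta_def pos_le_divide_eq mult_ac)
  thus ?thesis using False by (simp add: yv_def ip_def)
 qed
 show ?thesis
 proof (rule statistic_tall[where y = yv and f = f, OF res(1) XY])
  show "Z j = yv j + f j" for j by (simp add: f_def)
 qed (use par YB bd fN yX rs res mean_norm in auto)
qed

text \<open>For pure noise the deviation from \<open>d * I\<close> is at most
  \<open>760 * sqrt (n * d)\<close>, where \<open>760 = 20 * (6 + 32)\<close> comes from
  \<open>dev\<close>. The mean adds a rank-one part and a cross term, both bounded by Cauchy-Schwarz
  and collected in the factor \<open>s^2\<close>.\<close>

lemma gram_X:
 assumes nd: "n <= d"
 shows "\<bar>bil n (gram d X {..<n}) x x\<bar> <= 760 * s\<^sup>2 * sqrt (real n * real d) * ip n x x"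
proof -
 define x' where "x' = (%i. if i < n then x i else 0)"
 define q where "q = ip n x' x'"
 define v where "v = (%j. SUM i<n. x' i * ga i j)"
 define si where "si = (SUM i<n. x' i)"
 define g where "g = 20 * dev (real d) (27 * real n + y)"
 define r where "r = sqrt (real n * real d)"
 have bx: "bil n M x x = bil n M x' x'" for M unfolding bil_def by (intro sum.cong) (auto simp: x'_def)
 have qx: "ip n x x = q" unfolding q_def ip_def by (intro sum.cong) (auto simp: x'_def)
 have q0: "0 <= q" unfolding q_def by (rule ip_nonneg)
 have r: "real n <= r" "r <= real d" "0 <= r"
 proof -
  have "real n * real n <= real n * real d" using nd by (intro mult_left_mono) auto
  thus "real n <= r" unfolding r_def by (intro real_le_rsqrt) (simp add: sq_eq)
  have "real n * real d <= real d * real d" using nd by (intro mult_right_mono) auto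
  thus "r <= real d" unfolding r_def by (intro real_le_lsqrt) (auto simp: sq_eq)
  show "0 <= r" by (simp add: r_def)
 qed
 have g: "0 <= g" "g <= 760 * r"
 proof -
  show "0 <= g" using y by (simp add: g_def dev_def)
  have "dev (real d) (27 * real n + y) <= dev (real d) (32 * real n)" using y n_ge'(4) by (intro dev_mono) auto
  also have "... <= 6 * r + 32 * r" unfolding dev_def
  proof (rule add_mono)
   have "sqrt (real d * (32 * real n)) <= sqrt (36 * (real n * real d))" by (simp add: mult_ac)
   also have "... = 6 * r" by (simp add: r_def real_sqrt_mult)
   finally show "sqrt (real d * (32 * real n)) <= 6 * r" .
  qed (use r in simp)
  finally show "g <= 760 * r" by (simp add: g_def)
 qed
 have V: "\<bar>ip d v v - real d * q\<bar> <= g * q" unfolding v_def q_def g_def by (rule gd8)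
 have s2: "si\<^sup>2 <= real n * q"
 proof -
  have "(SUM i<n. 1 * x' i)\<^sup>2 <= (SUM i<n. 1\<^sup>2) * (SUM i<n. (x' i)\<^sup>2)" by (rule Cauchy_Schwarz_ineq_sum)
  thus ?thesis by (simp add: si_def q_def ip_def sq_eq)
 qed
 define m where "m = ip d mm v"
 have m2: "m\<^sup>2 <= al\<^sup>2 * (784 * real d * q)"
 proof -
  have "m\<^sup>2 <= a\<^sup>2 * ip d v v" unfolding m_def mu[symmetric] by (rule ip_Cauchy_Schwarz)
  also have "... <= al\<^sup>2 * (784 * real d * q)"
  proof (rule mult_mono)
   show "a\<^sup>2 <= al\<^sup>2" using a by (intro power_mono) auto
   have "g * q <= 760 * real d * q" using g r q0 by (intro mult_right_mono) auto
   thus "ip d v v <= 784 * real d * q" using V q0 mult_nonneg_nonneg[of "real d" q] by simp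
  qed (auto intro: ip_nonneg)
  finally show ?thesis .
 qed
 have sm: "\<bar>si * m\<bar> <= 28 * al * r * q"
 proof (rule power2_le_imp_le[of "\<bar>si * m\<bar>"])
  have "si\<^sup>2 * m\<^sup>2 <= (real n * q) * (al\<^sup>2 * (784 * real d * q))" using s2 m2 q0 by (intro mult_mono) auto
  moreover have "r\<^sup>2 = real n * real d" by (simp add: r_def)
  ultimately show "\<bar>si * m\<bar>\<^sup>2 <= (28 * al * r * q)\<^sup>2" by (simp add: power_mult_distrib sq_eq[of q] mult_ac)
 qed (use al r q0 in auto)
 have "bil n (gram d X {..<n}) x' x' = ip d (%j. SUM i<n. x' i * X i j) (%j. SUM i<n. x' i * X i j) - real d * q"
  unfolding q_def by (rule bil_gram) (auto simp: x'_def)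
 also have "ip d (%j. SUM i<n. x' i * X i j) (%j. SUM i<n. x' i * X i j) = ip d (%j. si * mm j + v j) (%j. si * mm j + v j)"
  by (intro ip_cong) (auto simp: X si_def v_def distrib_left sum.distrib sum_distrib_right)
 also have "... = si * (si * a\<^sup>2) + 2 * (si * m) + ip d v v"
  unfolding ip_add_left ip_add_right ip_nmu ip_commute[of d v "%j. si * mm j"] ip_commute[of d mm "%j. si * mm j"] mu m_def by simp
 finally have e: "bil n (gram d X {..<n}) x x = si\<^sup>2 * a\<^sup>2 + 2 * (si * m) + (ip d v v - real d * q)" unfolding bx by (simp add: sq_eq)
 have sa: "0 <= si\<^sup>2 * a\<^sup>2" "si\<^sup>2 * a\<^sup>2 <= A\<^sup>2 * r * q"
 proof -
  have "si\<^sup>2 * a\<^sup>2 <= (r * q) * A\<^sup>2"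
  proof (rule mult_mono)
   have "real n * q <= r * q" using r q0 by (intro mult_right_mono) auto
   thus "si\<^sup>2 <= r * q" using s2 by linarith
   show "a\<^sup>2 <= A\<^sup>2" using a al by (intro power_mono) auto
  qed (use r q0 in auto)
  thus "si\<^sup>2 * a\<^sup>2 <= A\<^sup>2 * r * q" by (simp add: mult_ac)
 qed simp
 have "28 * al * r * q <= 28 * A * r * q" using al r q0 by (intro mult_right_mono mult_left_mono) auto
 moreover have "g * q <= 760 * r * q" using g q0 by (intro mult_right_mono) auto
 ultimately have "\<bar>bil n (gram d X {..<n}) x x\<bar> <= A\<^sup>2 * r * q + 2 * (28 * A * r * q) + 760 * r * q" unfolding e using sa sm V by linarith
 also have "... = (A\<^sup>2 + 56 * A + 760) * (r * q)" by (simp add: algebra_simps)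
 also have "... <= 760 * s\<^sup>2 * (r * q)"
 proof (rule mult_right_mono)
  show "A\<^sup>2 + 56 * A + 760 <= 760 * s\<^sup>2" unfolding s_def using al by (simp add: sq_eq algebra_simps)
 qed (use r q0 in auto)
 finally show ?thesis by (simp add: qx r_def mult.assoc)
qed

lemma statistic_of_wide:
 assumes nd: "n < d" and S: "S <= {..<n}" "!!i j. i : S ==> j < d ==> Y i j = X i j" and bad: "real (card ({..<n} - S)) <= be"
 defines "W == (wide_round n d Y be p ^^ (48 * p\<^sup>2)) {i\<in>{..<n}. ip d (Y i) (Y i) <= real n * real d}"
 shows "\<bar>statistic d ta Y W - (real n)\<^sup>2 * a\<^sup>2\<bar> <= 9 * (N\<^sup>2 / 50)"
proof -
 define rh where "rh = 760 * s\<^sup>2 * sqrt (real n * real d)"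
 define M where "M = 2 + 8 * real (48 * p\<^sup>2)"
 have s2: "1 <= s\<^sup>2" using s1 by (simp add: one_le_power)
 have r1: "1 <= sqrt (real n * real d)" using n1 d1 mult_mono[of 1 "real n" 1 "real d"] by simp
 have rho: "760 * sqrt (real n * real d) <= rh" "0 < rh"
 proof -
  have "760 * 1 * sqrt (real n * real d) <= rh" unfolding rh_def using s2 by (intro mult_right_mono mult_left_mono) auto
  thus "760 * sqrt (real n * real d) <= rh" by simp
  thus "0 < rh" using r1 by linarith
 qed
 have M: "1 <= M" "0 <= M" "M <= 386 * (real p)\<^sup>2" using p2(1) by (simp_all add: M_def)
 interpret wide_filter n d X Y S be rh p
 proof
  show "\<bar>bil n (gram d X {..<n}) x x\<bar> <= rh * ip n x x" for x unfolding rh_def using gram_X[of x] nd by simp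
  have "(2::nat) ^ p <= 2 ^ (2 * p)" by (intro power_increasing) auto
  thus "n <= 2 ^ (2 * p)" using P5 by linarith
 qed (use S bad par p1 rho in auto)
 \<comment> \<open>\<open>d\<close> may be much larger than \<open>n\<close> here, but
   \<open>P1\<close> keeps \<open>sqrt d\<close> below \<open>n <= 2^p\<close>. Up to the factor
   \<open>sqrt (n * d)\<close> already present in \<open>rh\<close>, the initial entries are thus
   bounded by a power of \<open>2^p\<close>.\<close>
 have dn: "sqrt (real d) <= real n"
 proof -
  have "al\<^sup>2 <= s\<^sup>2" using s1 al by (intro power_mono) auto
  have "s\<^sup>2 * (sqrt (real d) * 1) <= B * (sqrt (real d) * L)"
  proof (intro mult_mono)
   show "s\<^sup>2 <= B" using B_s[of 2] s2 by simp
  qed (use L1 B15 in auto)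
  also have "... <= real n * al\<^sup>2" by (rule P1)
  also have "... <= real n * s\<^sup>2" using \<open>al\<^sup>2 <= s\<^sup>2\<close> by (intro mult_left_mono) auto
  finally have "s\<^sup>2 * sqrt (real d) <= s\<^sup>2 * real n" by (simp add: mult.commute)
  thus ?thesis by (rule mult_left_le_imp_le) (use s1 in simp)
 qed
 have J: "(real n * (real n * real d + real d)) ^ (2 * p) * (7 / 8) ^ (48 * p\<^sup>2) <= (8 * rh) ^ (2 * p)"
 proof -
  have "real n * (real n * real d + real d) <= 2 * (real n * (real n * real d))"
  proof -
   have "1 * real d <= real n * real d" using n1 by (intro mult_right_mono) auto
   hence d': "real d <= real n * real d" by simp
   have "real n * (real n * real d + real d) <= real n * (real n * real d + real n * real d)" by (rule mult_left_mono[OF add_left_mono[OF d']]) simp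
   thus ?thesis by (simp only: distrib_left mult_2)
  qed
  also have "... = 2 * (real n * (sqrt (real n) * sqrt (real d)) * sqrt (real n * real d))" unfolding real_sqrt_mult[symmetric] by (simp add: mult.assoc)
  also have "... <= 2 * (2 ^ p * (2 ^ p * 2 ^ p) * sqrt (real n * real d))"
  proof -
   have "sqrt (real n) <= real n" using n1 by (intro real_le_lsqrt) (auto simp: sq_eq)
   hence "sqrt (real n) <= 2 ^ p" "sqrt (real d) <= 2 ^ p" using two_p dn by linarith+
   thus ?thesis using two_p by (intro mult_left_mono mult_right_mono mult_mono) auto
  qed
  also have "... <= 2 ^ (3 * p) * (8 * rh)"
  proof -
   have "2 * sqrt (real n * real d) <= 8 * rh" using rho r1 by linarith
   hence "2 ^ (3 * p) * (2 * sqrt (real n * real d)) <= 2 ^ (3 * p) * (8 * rh)" by (intro mult_left_mono) auto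
   moreover have "(2::real) ^ p * (2 ^ p * 2 ^ p) = 2 ^ (3 * p)" by (simp add: power_add[symmetric] mult.commute numeral_3_eq_3)
   ultimately show ?thesis by (simp add: mult_ac)
  qed
  finally have "(real n * (real n * real d + real d)) ^ (2 * p) <= (2 ^ (3 * p) * (8 * rh)) ^ (2 * p)" by (intro power_mono) auto
  also have "... = 2 ^ (6 * p\<^sup>2) * (8 * rh) ^ (2 * p)" by (simp add: power_mult_distrib power_mult[symmetric] sq_eq mult_ac)
  finally have "(real n * (real n * real d + real d)) ^ (2 * p) * (7 / 8) ^ (48 * p\<^sup>2) <= 2 ^ (6 * p\<^sup>2) * (8 * rh) ^ (2 * p) * (7 / 8) ^ (48 * p\<^sup>2)"
   by (intro mult_right_mono) auto
  also have "... = (2 ^ (6 * p\<^sup>2) * (7 / 8) ^ (8 * (6 * p\<^sup>2))) * (8 * rh) ^ (2 * p)" by simp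
  also have "... <= 1 * (8 * rh) ^ (2 * p)"
  proof (rule mult_right_mono)
   \<comment> \<open>\<open>2 * (7/8)^8 <= 1\<close>: eight rounds make up for one factor 2.\<close>
   have "(2::real) ^ (6 * p\<^sup>2) * (7 / 8) ^ (8 * (6 * p\<^sup>2)) = (2 * (7 / 8) ^ 8) ^ (6 * p\<^sup>2)" by (simp only: power_mult_distrib power_mult)
   also have "... <= 1" by (intro power_le_one) (simp_all add: power_divide)
   finally show "(2::real) ^ (6 * p\<^sup>2) * (7 / 8) ^ (8 * (6 * p\<^sup>2)) <= 1" .
  qed (use rho in simp)
  finally show ?thesis by simp
 qed
 have nX: "ip d (X i) (X i) <= real n * real d" if "i : S" for i using norm_X that S by auto
 note res = wide_filter_result[OF nX J, folded W_def]
 define P where "P = real p ^ 3"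
 have P: "1 <= P" "0 <= P" using p2 by (auto simp: P_def)
 \<comment> \<open>For \<open>n < d\<close> the root in \<open>P2\<close> is at least
   \<open>n * sqrt L\<close>. Cancelling \<open>n\<close> leaves a direct bound on
   \<open>ep\<close>, from which the sample-by-sample conditions \<open>m1\<close> and
   \<open>m2\<close> follow.\<close>
 have key: "B * (ep * (P * sqrt L)) <= al\<^sup>2"
 proof -
  have "sqrt (real n * real n * L) <= sqrt (real n * real d * L)" using nd L1 by (intro real_sqrt_le_mono mult_right_mono mult_left_mono) auto
  hence "real n * sqrt L <= sqrt (real n * real d * L)" by (simp add: real_sqrt_mult)
  hence "P * (real n * sqrt L) <= P * sqrt (real n * real d * L)" using P by (intro mult_left_mono) auto
  hence "B * (ep * (P * (real n * sqrt L))) <= real n * al\<^sup>2" using P L1 by (intro E2) (auto simp: P_def)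
  hence "real n * (B * (ep * (P * sqrt L))) <= real n * al\<^sup>2" by (simp add: mult_ac)
  thus ?thesis by (rule mult_left_le_imp_le) (use n1 in simp)
 qed
 have eP0: "0 <= ep * P" using ep P by simp
 have MP: "M <= 386 * P" using M(3) p2(4) unfolding P_def by linarith
 have eP: "10 ^ 15 * (ep * P) <= 1"
 proof -
  have "10 ^ 15 * s\<^sup>2 * (ep * P * 1) <= B * (ep * P * sqrt L)" using B_s[of 2] L1 eP0 B15 by (intro mult_mono mult_left_mono) auto
  hence "10 ^ 15 * s\<^sup>2 * (ep * P) <= al\<^sup>2" using key by (simp add: mult_ac)
  moreover have "al\<^sup>2 <= s\<^sup>2" using s1 al by (intro power_mono) auto
  ultimately have "s\<^sup>2 * (10 ^ 15 * (ep * P)) <= s\<^sup>2 * 1" by (simp only: mult_ac mult_1_left mult_1_right)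
  thus ?thesis by (rule mult_left_le_imp_le) (use s1 in simp)
 qed
 have m1: "ep * M <= 1 / 1000000"
 proof -
  have "ep * M <= ep * (386 * P)" using MP ep by (intro mult_left_mono) auto
  thus ?thesis using eP by simp
 qed
 have m2: "ep * M * sqrt (L * real p) <= al / 1000000"
 proof -
  have pp: "sqrt (real p) <= real p" using p1 by (intro real_le_lsqrt) (auto simp: sq_eq)
  have "M * sqrt (real p) <= 386 * (real p)\<^sup>2 * real p" using M pp by (intro mult_mono) auto
  hence "M * sqrt (real p) <= 386 * P" by (simp add: P_def sq_eq power3_eq_cube)
  hence "(ep * sqrt L) * (M * sqrt (real p)) <= (ep * sqrt L) * (386 * P)" using ep L1 by (intro mult_left_mono) auto
  hence "ep * M * sqrt (L * real p) <= 386 * (ep * (P * sqrt L))" by (simp add: real_sqrt_mult mult_ac)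
  moreover have "10 ^ 15 * (ep * (P * sqrt L)) <= al"
  proof -
   have e0: "0 <= ep * (P * sqrt L)" using ep P L1 by simp
   have "10 ^ 15 * s * (ep * (P * sqrt L)) <= B * (ep * (P * sqrt L))" using B_s[of 1] e0 by (intro mult_right_mono) auto
   also have "... <= al * al" using key by (simp add: sq_eq)
   also have "... <= s * al" using s1 al by (intro mult_right_mono) auto
   finally have "s * (10 ^ 15 * (ep * (P * sqrt L))) <= s * al" by (simp only: mult_ac)
   thus ?thesis by (rule mult_left_le_imp_le) (use s1 in simp)
  qed
  ultimately show ?thesis using al by simp
 qed
 have m4: "ep * M * (L * real p) <= sqrt (real n) * al\<^sup>2 / 1000000"
 proof -
  have "M * real p <= 386 * (real p)\<^sup>2 * real p" using M by (intro mult_right_mono) auto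
  hence "M * real p <= 386 * P" by (simp add: P_def sq_eq power3_eq_cube)
  hence "(ep * L) * (M * real p) <= (ep * L) * (386 * P)" using ep L1 by (intro mult_left_mono) auto
  hence 1: "ep * M * (L * real p) <= 386 * (ep * P * L)" by (simp add: mult_ac)
  have 2: "10 ^ 15 * (ep * P * L) <= L" using mult_right_mono[OF eP, of L] L1 by (simp add: mult_ac)
  have "sqrt (real n) * L <= sqrt (real n) * (sqrt (real n) * al\<^sup>2)"
  proof -
   have "1 * (sqrt (real n) * L) <= B * (sqrt (real d) * L)" using nd L1 B15 by (intro mult_mono) auto
   moreover have "sqrt (real n) * (sqrt (real n) * al\<^sup>2) = real n * al\<^sup>2" by simp
   ultimately show ?thesis using P1 by linarith
  qed
  hence "L <= sqrt (real n) * al\<^sup>2" by (rule le_of_sqrt_mult)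
  moreover have "e <= x / 1000000" if "e <= 386 * z" "10 ^ 15 * z <= L" "L <= x" for e x z :: real using that L1 by simp
  ultimately show ?thesis using 1 2 by blast
 qed
 have rM: "rh * (be * M) <= N\<^sup>2 / 3000"
 proof -
  have "(real p)\<^sup>2 * sqrt (real n * real d) <= real p ^ 3 * sqrt (real n * real d * L)" using p2 root_ge(3) by (intro mult_mono) auto
  hence "B * (ep * ((real p)\<^sup>2 * sqrt (real n * real d))) <= real n * al\<^sup>2" by (intro E2) auto
  moreover have "10 ^ 15 * s\<^sup>2 * (ep * ((real p)\<^sup>2 * sqrt (real n * real d))) <= B * (ep * ((real p)\<^sup>2 * sqrt (real n * real d)))"
   using B_s[of 2] ep by (intro mult_right_mono) auto
  ultimately have b: "10 ^ 15 * s\<^sup>2 * (ep * ((real p)\<^sup>2 * sqrt (real n * real d))) <= real n * al\<^sup>2" by linarith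
  have "rh * (ep * M) <= rh * (ep * (386 * (real p)\<^sup>2))" using M rho ep by (intro mult_left_mono) auto
  also have "... = 293360 * (s\<^sup>2 * (ep * ((real p)\<^sup>2 * sqrt (real n * real d))))" by (simp add: rh_def mult_ac)
  also have "... <= real n * al\<^sup>2 / 3000"
  proof -
   have "0 <= s\<^sup>2 * (ep * ((real p)\<^sup>2 * sqrt (real n * real d)))" using ep by simp
   thus ?thesis using b by (simp add: mult.assoc)
  qed
  finally have "real n * (rh * (ep * M)) <= real n * (real n * al\<^sup>2 / 3000)" by (intro mult_left_mono) auto
  thus ?thesis by (simp add: be_def N_def sq_eq mult_ac)
 qed
 show ?thesis
 proof (rule statistic_wide[where rh = rh and M = M and be = be, OF res(1) XY])
  show "\<bar>ip d Z (X i) - real d\<bar> <= ta / (16 * M)" if "i < n" for i by (rule Z_X[OF that M(1) m1 m2 m3[OF M(2,3)] m4])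
  show "\<bar>bil n (gram d X {..<n}) x x\<bar> <= rh * ip n x x" for x by (rule gX)
  show "\<bar>bil n (gram d Y W) x x\<bar> <= 16 * rh * ip n x x" for x by (rule res(4))
  show "real (card ({..<n} - W \<inter> S)) <= be * M" using res(2) by (simp add: M_def)
  show "\<bar>ip d Z Z - real n * real d - (real n)\<^sup>2 * a\<^sup>2\<bar> <= N\<^sup>2 / 50" by (rule mean_norm)
 qed (use par rho M rM res in simp_all)
qed

text \<open>Follows the branches of \<open>survivors\<close>. For \<open>be < 1\<close> an integer
  count of corruptions is 0; the pair test loses at most one good sample per corrupted one; the norm
  test for \<open>d <= n\<close> loses none.\<close>

lemma statistic_close:
 assumes S: "S <= {..<n}" and XY: "!!i j. i : S ==> j < d ==> Y i j = X i j" and bad: "real (card ({..<n} - S)) <= be"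
 shows "\<bar>statistic d ta Y (survivors n d Y be th h p) - (real n)\<^sup>2 * a\<^sup>2\<bar> <= 9 * (N\<^sup>2 / 50)"
proof -
 have ipS: "ip d (Y i) (Y j) = ip d (X i) (X j)" if "i : S" "j : S" for i j using XY that by (intro ip_cong) auto
 have b0: "be <= 2 * be" using par by simp
 show ?thesis
 proof (cases "real n < be ^ 4")
  case True
  have "~ be < 1"
  proof
   assume "be < 1"
   hence "be ^ 4 <= 1" using par by (intro power_le_one) auto
   thus False using True n1 by linarith
  qed
  thus ?thesis using True statistic_of_wide[OF _ S XY bad] statistic_of_tall[OF _ S XY bad] by (auto simp: survivors_def Let_def not_less)
 next
  case False
  hence small: "be ^ 4 <= real n" by simp
  note st = statistic_of_small[OF small]
  show ?thesis
  proof (cases "n < d")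
   case nd: True
   show ?thesis
   proof (cases "be < 1")
    case b: True
    have "card ({..<n} - S) = 0" using bad b by linarith
    hence SS: "{..<n} = S" using S by auto
    have "\<bar>statistic d ta Y {..<n} - (real n)\<^sup>2 * a\<^sup>2\<bar> <= 9 * (N\<^sup>2 / 50)"
    proof (rule st[where S = S])
     fix i j assume ij: "i : {..<n}" "j : {..<n}"
     hence "gram d Y {..<n} i j = ip d (X i) (X j) - (if i = j then real d else 0)" using ipS[of i j] SS by (simp add: gram_def)
     moreover have "i < n" "j < n" using ij by auto
     ultimately show "\<bar>gram d Y {..<n} i j\<bar> <= h" using entry_small[OF small \<open>i < n\<close> \<open>j < n\<close>] par(5) by linarith
    qed (use XY SS par in auto)
    thus ?thesis using nd b by (simp add: survivors_def Let_def)
   next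
    case b: False
    define W where "W = remove_pairs (conflict d Y h) {..<n} (all_pairs n)"
    have Wn: "W <= {..<n}" unfolding W_def by (rule remove_pairs_subset)
    have pr: "(i, j) : set (all_pairs n)" if "i < n" "j < n" for i j using that by (auto simp: all_pairs_def intro!: bexI[of _ i])
    have ch: "card (S - W) <= card ({..<n} - S - W)" unfolding W_def
    proof (rule remove_pairs_charge)
     fix i j assume ij: "i : S" "j : S"
     hence "i < n" "j < n" using S by auto
     thus "~ conflict d Y h i j" unfolding conflict_def ipS[OF ij] not_less using entry_small[OF small, of i j] par(5) by linarith
    next
     show "card (S - {..<n}) <= card ({..<n} - S - {..<n})" using S by (metis Diff_eq_empty_iff card.empty le0)
    qed (use S in auto)
    have "\<bar>statistic d ta Y W - (real n)\<^sup>2 * a\<^sup>2\<bar> <= 9 * (N\<^sup>2 / 50)"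
    proof (rule st[where S = S])
     show "\<bar>gram d Y W i j\<bar> <= h" if "i : W" "j : W" for i j
     proof -
      have "i < n" "j < n" using that Wn by auto
      hence "~ conflict d Y h i j" using remove_pairs_conflict_free[OF pr] that unfolding W_def by blast
      thus ?thesis using that unfolding conflict_def not_less gram_def by simp
     qed
     have "card ({..<n} - W \<inter> S) <= card (({..<n} - S) \<union> (S - W))" by (intro card_mono) (use S in \<open>auto intro: finite_subset\<close>)
     also have "... <= card ({..<n} - S) + card (S - W)" by (rule card_Un_le)
     also have "... <= card ({..<n} - S) + card ({..<n} - S)" using ch card_mono[of "{..<n} - S" "{..<n} - S - W"] by (intro add_left_mono order_trans[OF ch]) auto
     finally have "real (card ({..<n} - W \<inter> S)) <= 2 * real (card ({..<n} - S))" by linarith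
     thus "real (card ({..<n} - W \<inter> S)) <= 2 * be" using bad by linarith
    qed (use Wn XY in auto)
    thus ?thesis using nd b False by (simp add: survivors_def Let_def W_def)
   qed
  next
   case dn: False
   define W where "W = {i\<in>{..<n}. ip d (Y i) (Y i) <= h}"
   have dh: "real d <= h / 2" using d_small[OF small] dn by simp
   have SW: "S <= W"
   proof
    fix i assume i: "i : S"
    hence i': "i < n" using S by auto
    hence "\<bar>ip d (X i) (X i) - real d\<bar> <= h / 2" using entry_small[OF small, of i i] by simp
    hence "ip d (Y i) (Y i) <= h" using ipS[OF i i] dh by linarith
    thus "i : W" using i' by (simp add: W_def)
   qed
   have "\<bar>statistic d ta Y W - (real n)\<^sup>2 * a\<^sup>2\<bar> <= 9 * (N\<^sup>2 / 50)"
   proof (rule st[where S = S])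
    show "\<bar>gram d Y W i j\<bar> <= h" if ij: "i : W" "j : W" for i j
    proof -
     have "\<bar>ip d (Y i) (Y j)\<bar> <= sqrt h * sqrt h" using ij par(5) by (intro ip_abs_le) (auto simp: W_def)
     moreover have "0 <= ip d (Y i) (Y i)" by (rule ip_nonneg)
     ultimately show ?thesis using ij par(5) dh by (auto simp: gram_def abs_le_iff)
    qed
    have "card ({..<n} - W \<inter> S) <= card ({..<n} - S)" using SW by (intro card_mono) auto
    thus "real (card ({..<n} - W \<inter> S)) <= 2 * be" using bad b0 by linarith
   qed (use XY in \<open>auto simp: W_def\<close>)
   thus ?thesis using dn False by (simp add: survivors_def Let_def W_def)
  qed
 qed
qed

end

section \<open>Absorbing logarithms, and the conclusion\<close>

text \<open>\<open>(1 + x / 12)^12 <= exp x\<close> at \<open>x = p * ln 2 >= p / 2\<close>. The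
  exponent is \<open>12 = 3 * 4\<close>, so that \<open>n < be^4\<close> can bound
  \<open>p^3\<close> by a multiple of \<open>be\<close>.\<close>

lemma power12_le: "real p ^ 12 <= 24 ^ 12 * 2 ^ p"
proof -
 have x0: "0 <= real p * ln 2" by simp
 have half: "real p * (1 / 2) <= real p * ln 2" using ln2_ge_two_thirds by (intro mult_left_mono) auto
 have "(real p / 24) ^ 12 <= (1 + real p * ln 2 / real 12) ^ 12" using half by (intro power_mono) auto
 also have "... <= exp (real p * ln 2)" by (rule exp_ge_one_plus_x_over_n_power_n) (rule order_trans[OF _ x0], simp_all)
 also have "... = 2 ^ p" by (simp add: exp_of_nat_mult)
 finally have "real p ^ 12 / 24 ^ 12 <= 2 ^ p" by (simp only: power_divide)
 thus ?thesis by (simp only: pos_divide_le_eq zero_less_power zero_less_numeral mult.commute)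
qed

text \<open>Put \<open>w = u^(1/12)\<close>. Then \<open>ln u <= 12 * w\<close> and
  \<open>Q <= w\<close>, so \<open>p <= (24 + 13) * w = 37 * w\<close> and
  \<open>B^2 * p^6 <= B^2 * 37^6 * w^6 <= w^12 = u\<close>. This resolves the circularity that
  \<open>p\<close>, a logarithm of \<open>n\<close>, occurs in a lower bound for
  \<open>n\<close>.\<close>

lemma log_powers_absorbed:
 fixes u Q B :: real and p :: nat
 assumes B: "1 <= B" and Q: "1 <= Q" and u: "(B\<^sup>2 * 37 ^ 6)\<^sup>2 * Q ^ 12 <= u" and p: "real p <= 2 * ln u + 13 * Q"
 shows "B\<^sup>2 * real p ^ 6 <= u"
proof -
 define K where "K = B\<^sup>2 * 37 ^ 6"
 have K1: "1 <= K" unfolding K_def using mult_mono[of 1 "B\<^sup>2" 1 "37 ^ 6"] one_le_power[OF B, of 2] by simp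
 have Q12: "1 <= Q ^ 12" using Q by (rule one_le_power)
 have KQ: "K\<^sup>2 * 1 <= K\<^sup>2 * Q ^ 12" "1 * Q ^ 12 <= K\<^sup>2 * Q ^ 12" using Q12 one_le_power[OF K1, of 2] by (intro mult_mono; simp)+
 have uK: "K\<^sup>2 <= u" "Q ^ 12 <= u" using KQ u unfolding K_def[symmetric] by linarith+
 have u1: "1 <= u" using Q12 uK by linarith
 define w where "w = root 12 u"
 have w0: "0 <= w" using u1 by (simp add: w_def)
 have w12: "w ^ 12 = u" unfolding w_def using u1 by (intro real_root_pow_pos2) auto
 have w1: "1 <= w" unfolding w_def using u1 by simp
 have Qw: "Q <= w"
 proof (rule ccontr)
  assume "~ Q <= w"
  hence "w ^ 12 < Q ^ 12" using w0 by (intro power_strict_mono) auto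
  thus False using uK w12 by linarith
 qed
 have "ln u = 12 * ln w" unfolding w12[symmetric] using w1 by (simp add: ln_realpow)
 moreover have "ln w <= w" using ln_le_minus_one[of w] w1 by linarith
 ultimately have "real p <= 37 * w" using p Qw by linarith
 hence "real p ^ 6 <= (37 * w) ^ 6" by (intro power_mono) auto
 hence p6: "real p ^ 6 <= 37 ^ 6 * w ^ 6" by (simp only: power_mult_distrib)
 have ww: "(w ^ 6)\<^sup>2 = u" unfolding w12[symmetric] by (simp only: power_mult[symmetric]) simp
 have "K <= w ^ 6"
 proof (rule power2_le_imp_le)
  show "K\<^sup>2 <= (w ^ 6)\<^sup>2" unfolding ww by (rule uK)
 qed (use w0 in simp)
 hence "K * w ^ 6 <= w ^ 6 * w ^ 6" using w0 by (intro mult_right_mono) auto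
 hence "B\<^sup>2 * (37 ^ 6 * w ^ 6) <= u" unfolding K_def ww[symmetric] sq_eq[of "w ^ 6"] by (simp only: mult.assoc)
 moreover have "B\<^sup>2 * real p ^ 6 <= B\<^sup>2 * (37 ^ 6 * w ^ 6)" using p6 by (intro mult_left_mono) auto
 ultimately show ?thesis by linarith
qed

lemma regime_intro:
 fixes A C al ep de c0 B K :: real and n d :: nat
 assumes A: "A > 0" and d: "d >= 1" and ep: "ep > 0" and al: "al <= A" and C: "B * ep * sqrt (lg (1 / ep)) <= al"
  and c0: "c0 = 2 * 24 ^ 12" and B: "B = 10 ^ 15 * (1 + A) ^ 6 * c0" and K: "K = (B\<^sup>2 * 37 ^ 6)\<^sup>2"
  and n: "real n >= K * (sqrt (real d) * lg (1 / de) / al\<^sup>2 + real d * ep\<^sup>2 * lg (1 / de) / al ^ 4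
           * polylog 12 (real d) (1 / ep) (1 / al) (lg (1 / de)))"
 shows "regime A al ep (lg (1 / de)) c0 B n d (lev n)"
proof -
 define L where "L = lg (1 / de)"
 define Q where "Q = lg (real d) * lg (1 / ep) * lg (1 / al) * lg L"
 have lg1: "1 <= lg x" for x by (simp add: lg_def)
 have L1: "1 <= L" unfolding L_def by (rule lg1)
 have c01: "1 <= c0" unfolding c0 by simp
 have B15: "10 ^ 15 <= B"
 proof -
  have "10 ^ 15 * 1 * 1 <= 10 ^ 15 * (1 + A) ^ 6 * c0" using A c01 by (intro mult_mono one_le_power) auto
  thus ?thesis by (simp add: B)
 qed
 hence B1: "1 <= B" by simp
 have al0: "0 < al"
 proof -
  have "0 < B * ep * sqrt (lg (1 / ep))" using B1 ep lg1[of "1 / ep"] by (intro mult_pos_pos) auto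
  thus ?thesis using C by linarith
 qed
 have e1: "ep <= 1"
 proof -
  have "B * ep * 1 <= B * ep * sqrt (lg (1 / ep))" using B1 ep lg1[of "1 / ep"] by (intro mult_left_mono) auto
  hence "B * ep <= A" using C al by linarith
  moreover have "A <= B"
  proof -
   have "1 * (1 + A) ^ 1 * 1 <= 10 ^ 15 * (1 + A) ^ 6 * c0" using A c01 by (intro mult_mono power_increasing) auto
   thus ?thesis by (simp add: B)
  qed
  ultimately have "B * ep <= B * 1" by simp
  thus ?thesis by (rule mult_left_le_imp_le) (use B1 in simp)
 qed
 have Qs: "lg (real d) <= Q" "lg (1 / al) <= Q" "lg L <= Q" "1 <= Q"
 proof -
  have "lg (real d) * 1 * 1 * 1 <= Q" "1 * 1 * lg (1 / al) * 1 <= Q" "1 * 1 * 1 * lg L <= Q" "1 * 1 * 1 * 1 <= Q"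
   unfolding Q_def using lg1 order_trans[OF zero_le_one lg1] by (intro mult_mono mult_nonneg_nonneg; simp)+
  thus "lg (real d) <= Q" "lg (1 / al) <= Q" "lg L <= Q" "1 <= Q" by simp_all
 qed
 define t1 where "t1 = sqrt (real d) * L / al\<^sup>2"
 define t2 where "t2 = real d * ep\<^sup>2 * L / al ^ 4 * Q ^ 12"
 have t0: "0 <= t1" "0 <= t2" using L1 Qs by (auto simp: t1_def t2_def)
 have K1: "B <= K" "0 <= K"
 proof -
  have "B\<^sup>2 * 1 <= B\<^sup>2 * 37 ^ 6" by (intro mult_left_mono) auto
  moreover have "B * 1 <= B\<^sup>2" using B1 by (simp add: sq_eq)
  ultimately have "B <= B\<^sup>2 * 37 ^ 6" by linarith
  moreover have "(B\<^sup>2 * 37 ^ 6) * 1 <= (B\<^sup>2 * 37 ^ 6) * (B\<^sup>2 * 37 ^ 6)" using calculation B1 by (intro mult_left_mono) auto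
  ultimately show "B <= K" unfolding K sq_eq[of "B\<^sup>2 * 37 ^ 6"] by linarith
  show "0 <= K" by (simp add: K)
 qed
 have "K * (t1 + t2) <= real n" using n by (simp add: polylog_def t1_def t2_def L_def Q_def)
 hence kt: "K * t1 <= real n" "K * t2 <= real n" using mult_nonneg_nonneg[OF K1(2) t0(1)] mult_nonneg_nonneg[OF K1(2) t0(2)] unfolding distrib_left by linarith+
 have P1: "B * (sqrt (real d) * L) <= real n * al\<^sup>2"
 proof -
  have "B * (sqrt (real d) * L) <= K * (sqrt (real d) * L)" using K1 L1 by (intro mult_right_mono) auto
  also have "... = K * t1 * al\<^sup>2" using al0 by (simp add: t1_def)
  also have "... <= real n * al\<^sup>2" using kt by (intro mult_right_mono) auto
  finally show ?thesis .
 qed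
 have n1: "n >= 1"
 proof -
  have "0 < B * (sqrt (real d) * L)" using B1 d L1 by (intro mult_pos_pos) auto
  hence "0 < real n * al\<^sup>2" using P1 by linarith
  thus ?thesis by (cases n) auto
 qed
 \<comment> \<open>The ratio of \<open>n\<close> to the second term of the sample bound without its
   polylogarithm. Solving for \<open>n\<close> expresses \<open>ln n\<close> by \<open>ln u\<close>
   and logarithms of \<open>d\<close>, \<open>ep\<close>, \<open>L\<close> and \<open>al\<close>
   alone.\<close>
 define u where "u = real n * al ^ 4 / (real d * ep\<^sup>2 * L)"
 have D0: "0 < real d * ep\<^sup>2 * L" using d ep L1 by simp
 have "x / z * z = x" if "0 < z" for x z :: real using that by simp
 from this[OF D0] have uD: "u * (real d * ep\<^sup>2 * L) = real n * al ^ 4" unfolding u_def .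
 have uK: "(B\<^sup>2 * 37 ^ 6)\<^sup>2 * Q ^ 12 <= u"
 proof -
  have "K * t2 * al ^ 4 <= real n * al ^ 4" using kt al0 by (intro mult_right_mono) auto
  moreover have "K * t2 * al ^ 4 = K * Q ^ 12 * (real d * ep\<^sup>2 * L)" using al0 by (simp add: t2_def)
  ultimately show ?thesis unfolding u_def K[symmetric] using D0 by (simp add: pos_le_divide_eq)
 qed
 have u0: "0 < u" using n1 al0 D0 by (simp add: u_def)
 \<comment> \<open>\<open>lev n <= 1 + 2 * ln n\<close> and \<open>ln n <= ln u + 6 * Q\<close>: one
   \<open>Q\<close> each for \<open>d\<close> and \<open>L\<close>, four for \<open>1 / al\<close>,
   and the logarithm of \<open>ep\<close> is not positive.\<close>
 have pl: "real (lev n) <= 2 * ln u + 13 * Q"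
 proof -
  have "(2::real) ^ lev n <= 2 * real n" using lev_upper[OF n1] by (metis of_nat_le_iff of_nat_mult of_nat_numeral of_nat_power)
  hence "ln ((2::real) ^ lev n) <= ln (2 * real n)" by (intro ln_mono) (use n1 in auto)
  hence "real (lev n) * ln 2 <= ln 2 + ln (real n)" using n1 by (simp add: ln_realpow ln_mult)
  moreover have "0 <= ln (real n)" using n1 by simp
  ultimately have "(real (lev n) - 1) * ln 2 <= (2 * ln (real n)) * (1 / 2)" by (simp add: algebra_simps)
  also have "... <= (2 * ln (real n)) * ln 2" using ln2_ge_two_thirds n1 by (intro mult_left_mono) auto
  finally have l1: "real (lev n) - 1 <= 2 * ln (real n)" by (rule mult_right_le_imp_le) simp
  have "real n = u * (real d * ep\<^sup>2 * L) / al ^ 4" unfolding uD using al0 by simp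
  hence "ln (real n) = ln u + (ln (real d) + 2 * ln ep + ln L) - 4 * ln al" using u0 d ep L1 al0 by (simp add: ln_div ln_mult ln_realpow)
  moreover have "ln ep <= 0" using e1 ep by simp
  moreover have "ln (real d) <= lg (real d)" "ln L <= lg L" "- ln al <= lg (1 / al)" using al0 by (auto simp: lg_def ln_div)
  ultimately have "ln (real n) <= ln u + 6 * Q" using Qs by linarith
  thus ?thesis using l1 Qs by linarith
 qed
 have up: "B\<^sup>2 * real (lev n) ^ 6 <= u" by (rule log_powers_absorbed[OF B1 Qs(4) uK pl])
 \<comment> \<open>Squared and divided by \<open>n\<close>, the claim is
   \<open>B^2 * p^6 * d * ep^2 * L <= n * al^4\<close>, that is
   \<open>B^2 * p^6 <= u\<close>.\<close>
 have P2: "B * (ep * real (lev n) ^ 3 * sqrt (real n * real d * L)) <= real n * al\<^sup>2"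
 proof (rule power2_le_imp_le)
  have r: "(sqrt (real n * real d * L))\<^sup>2 = real n * real d * L" using L1 by simp
  have "(B * (ep * real (lev n) ^ 3 * sqrt (real n * real d * L)))\<^sup>2 = (B\<^sup>2 * real (lev n) ^ 6) * (real n * (real d * ep\<^sup>2 * L))"
   unfolding power_mult_distrib r by (simp add: mult_ac)
  also have "... <= u * (real n * (real d * ep\<^sup>2 * L))" using up D0 by (intro mult_right_mono) auto
  also have "... = real n * (u * (real d * ep\<^sup>2 * L))" by (simp only: mult.left_commute)
  also have "u * (real d * ep\<^sup>2 * L) = real n * al ^ 4" by (rule uD)
  also have "real n * (real n * al ^ 4) = (real n * al\<^sup>2)\<^sup>2" by (simp add: sq_eq power4_eq_xxxx mult_ac)
  finally show "(B * (ep * real (lev n) ^ 3 * sqrt (real n * real d * L)))\<^sup>2 <= (real n * al\<^sup>2)\<^sup>2" .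
 qed simp
 have P4: "real (lev n) ^ 4 <= c0 * real n"
 proof -
  have "real (lev n) ^ 4 <= real (lev n) ^ 12" using lev(1)[of n] by (intro power_increasing) auto
  also have "... <= 24 ^ 12 * 2 ^ lev n" by (rule power12_le)
  also have "... <= 24 ^ 12 * (2 * real n)"
  proof (rule mult_left_mono)
   show "(2::real) ^ lev n <= 2 * real n" using lev_upper[OF n1] by (metis of_nat_le_iff of_nat_mult of_nat_numeral of_nat_power)
  qed simp
  finally show ?thesis by (simp add: c0)
 qed
 show ?thesis unfolding L_def[symmetric] by unfold_locales (use n1 d lev al0 al ep L1 c01 B P1 P2 C P4 in auto)
qed

text \<open>For \<open>n < be^4\<close>, \<open>power12_le\<close> and
  \<open>2^lev n <= 2 * n\<close> give \<open>p^12 <= c0 * n <= (c0 * be)^4\<close>, hence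
  \<open>p^3 <= c0 * be\<close>. The pair test runs only for \<open>be >= 1\<close>, where
  \<open>n * n * d\<close> is at most \<open>be * n * n * d\<close>.\<close>

lemma run_time:
 assumes n1: "n >= 1" and ep: "ep > 0" and c0: "c0 = 2 * 24 ^ 12"
 shows "real (run_cost n d (ep * real n)) <= (c0 + 2) * (ep * (real n)\<^sup>2 * real d * real (min n d) + real n * real d)"
proof -
 define be where "be = ep * real n"
 define R where "R = ep * (real n)\<^sup>2 * real d * real (min n d)"
 have R0: "0 <= R" using ep by (simp add: R_def)
 have c01: "1 <= c0" unfolding c0 by simp
 have b0: "0 <= be" using ep by (simp add: be_def)
 have R: "R = be * (real n * real d * real (min n d))" by (simp add: R_def be_def sq_eq mult_ac)
 have 1: "real (if real n < be ^ 4 then lev n ^ 3 * (n * d * min n d) else 0) <= c0 * R"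
 proof (cases "real n < be ^ 4")
  case True
  have "(real (lev n) ^ 3) ^ 4 <= (c0 * be) ^ 4"
  proof -
   have "(real (lev n) ^ 3) ^ 4 = real (lev n) ^ 12" by (simp add: power_mult[symmetric])
   also have "... <= 24 ^ 12 * 2 ^ lev n" by (rule power12_le)
   also have "... <= 24 ^ 12 * (2 * real n)"
   proof (rule mult_left_mono)
    show "(2::real) ^ lev n <= 2 * real n" using lev_upper[OF n1] by (metis of_nat_le_iff of_nat_mult of_nat_numeral of_nat_power)
   qed simp
   also have "... = c0 ^ 1 * real n" by (simp add: c0)
   also have "... <= c0 ^ 4 * be ^ 4" using True c01 by (intro mult_mono power_increasing) auto
   finally show ?thesis by (simp add: power_mult_distrib)
  qed
  hence "real (lev n) ^ 3 <= c0 * be" using b0 c01 by (subst (asm) power_mono_iff) auto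
  hence "real (lev n) ^ 3 * (real n * real d * real (min n d)) <= (c0 * be) * (real n * real d * real (min n d))" by (intro mult_right_mono) auto
  thus ?thesis using True by (simp add: R mult.assoc)
 next
  case False
  thus ?thesis using R0 c01 by simp
 qed
 have 2: "real (if n < d & ~ be < 1 then n * n * d else 0) <= R"
 proof (cases "n < d & ~ be < 1")
  case True
  hence "1 * (real n * real d * real n) <= be * (real n * real d * real n)" by (intro mult_right_mono) auto
  thus ?thesis using True by (simp add: R mult_ac)
 next
  case False
  thus ?thesis using R0 by auto
 qed
 have "real (run_cost n d be) <= real n * real d + c0 * R + R" unfolding run_cost_def of_nat_add using 1 2 by simp
 also have "... <= (c0 + 2) * (R + real n * real d)" using R0 mult_nonneg_nonneg[of c0 "real n * real d"] c01 by (simp add: algebra_simps)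
 finally show ?thesis by (simp only: R_def be_def)
qed

lemma robust_output:
 assumes reg: "regime A al ep (lg (1 / de)) c0 B n d (lev n)" and de: "de > 0"
  and mu: "ip d mm mm = a\<^sup>2" and a: "0 <= a" "a <= al" and v: "a = al & v = YES | a = 0 & v = NO"
 shows "robustly_outputs tester n d ep al de mm v"
proof -
 interpret regime A al ep "lg (1 / de)" c0 B n d "lev n" by (rule reg)
 have "EX E:sets (samples n d mm). measure (samples n d mm) E >= 1 - de &
  (ALL X:E. EX ga. good n d mm (lg (1 / de) + 4) (2 * lev n) (%k. th * 2 ^ k / 64) ga & (ALL i<n. ALL j<d. X i j = mm j + ga i j))"
  by (rule good_samples) (use n1 d1 p1 par de in auto)
 then obtain E where E: "E : sets (samples n d mm)" "measure (samples n d mm) E >= 1 - de"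
  "!!X. X : E ==> EX ga. good n d mm (lg (1 / de) + 4) (2 * lev n) (%k. th * 2 ^ k / 64) ga & (ALL i<n. ALL j<d. X i j = mm j + ga i j)"
  by blast
 have "outputs tester (input n d ep al de Y) v" if X: "X : E" and Y: "corruption n d ep X Y" for X Y
 proof -
  obtain ga where ga: "good n d mm (lg (1 / de) + 4) (2 * lev n) (%k. th * 2 ^ k / 64) ga" "ALL i<n. ALL j<d. X i j = mm j + ga i j"
   using E(3)[OF X] by blast
  interpret sample A al ep "lg (1 / de)" c0 B n d "lev n" mm ga X a by unfold_locales (use mu a ga in auto)
  define S where "S = {i\<in>{..<n}. ALL j<d. Y i j = X i j}"
  have "{..<n} - S = {i. i < n & (EX j<d. Y i j ~= X i j)}" by (auto simp: S_def)
  hence bad: "real (card ({..<n} - S)) <= be" using Y by (simp add: corruption_def be_def)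
  have close: "\<bar>statistic d ta Y (survivors n d Y be th h (lev n)) - (real n)\<^sup>2 * a\<^sup>2\<bar> <= 9 * (N\<^sup>2 / 50)"
   by (rule statistic_close[OF _ _ bad]) (auto simp: S_def)
  obtain t s' where run: "exec tester (input n d ep al de Y) t s'"
   "ireg s' 0 = (if (real n * al)\<^sup>2 / 2 < statistic d ta Y (survivors n d Y be th h (lev n)) then 1 else 0)"
   using tester_run[OF n1 d1, of ep al de Y] unfolding be_def th_def ta_def h_def by blast
  have N2: "0 < N\<^sup>2" using par(2) by simp
  \<comment> \<open>The error is at most \<open>9/50 * N^2\<close>, less than the distance
    \<open>N^2 / 2\<close> of the threshold from either of the values 0 and
    \<open>N^2\<close>.\<close>
  have "v = (if ireg s' 0 = 0 then NO else YES)"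
  proof (cases "a = 0")
   case True
   hence "~ N\<^sup>2 / 2 < statistic d ta Y (survivors n d Y be th h (lev n))" using close N2 by simp
   thus ?thesis using run(2) v True al by (simp add: N_def)
  next
   case False
   hence a: "a = al" "v = YES" using v by auto
   have "(real n)\<^sup>2 * a\<^sup>2 = N\<^sup>2" by (simp add: a N_def power_mult_distrib)
   hence "N\<^sup>2 / 2 < statistic d ta Y (survivors n d Y be th h (lev n))" using close N2 by linarith
   thus ?thesis using run(2) a by (simp add: N_def)
  qed
  thus ?thesis unfolding outputs_def using run(1) by blast
 qed
 thus ?thesis unfolding robustly_outputs_def using E(1,2) by blast
qed

theorem theorem8p1:
  fixes A :: real
  assumes "A > 0"
  shows "\<exists>C>0. \<exists>K>0. \<exists>k. \<exists>T>0. \<exists>P.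
    \<forall>(d::nat) (n::nat) (\<delta>::real) (\<alpha>::real) (\<epsilon>::real).
      d \<ge> 1 \<and> \<delta> > 0 \<and> \<epsilon> > 0 \<and> \<alpha> \<le> A \<and> C * \<epsilon> * sqrt (lg (1 / \<epsilon>)) \<le> \<alpha> \<and>
      real n \<ge> K * (sqrt (real d) * lg (1 / \<delta>) / \<alpha>\<^sup>2
                  + real d * \<epsilon>\<^sup>2 * lg (1 / \<delta>) / \<alpha> ^ 4
                      * polylog k (real d) (1 / \<epsilon>) (1 / \<alpha>) (lg (1 / \<delta>)))
      \<longrightarrow>
      (\<forall>Y. runs_within P (input n d \<epsilon> \<alpha> \<delta> Y)
             (T * (\<epsilon> * (real n)\<^sup>2 * real d * real (min n d) + real n * real d))) \<and>
      (\<forall>\<mu>. L2_set \<mu> {..<d} = \<alpha> \<longrightarrow> robustly_outputs P n d \<epsilon> \<alpha> \<delta> \<mu> YES) \<and>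
      robustly_outputs P n d \<epsilon> \<alpha> \<delta> (\<lambda>_. 0) NO"
proof -
 \<comment> \<open>\<open>24^12\<close> is the constant of \<open>power12_le\<close>, doubled
   because of \<open>2^lev n <= 2 * n\<close>.\<close>
 define c0 :: real where "c0 = 2 * 24 ^ 12"
 define B where "B = 10 ^ 15 * (1 + A) ^ 6 * c0"
 \<comment> \<open>The square is what \<open>log_powers_absorbed\<close> requires, as
   \<open>B^2 * 37^6\<close> must not exceed the square root of \<open>u\<close>.\<close>
 define K where "K = (B\<^sup>2 * 37 ^ 6)\<^sup>2"
 have c0: "0 < c0" by (simp add: c0_def)
 have B: "0 < B" using assms c0 by (simp add: B_def)
 have main: "(ALL Y. runs_within tester (input n d ep al de Y)
      (300000 * (c0 + 2) * (ep * (real n)\<^sup>2 * real d * real (min n d) + real n * real d))) &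
   (ALL mm. L2_set mm {..<d} = al --> robustly_outputs tester n d ep al de mm YES) &
   robustly_outputs tester n d ep al de (%_. 0) NO"
  if hyp: "d >= 1" "de > 0" "ep > 0" "al <= A" "B * ep * sqrt (lg (1 / ep)) <= al"
   "real n >= K * (sqrt (real d) * lg (1 / de) / al\<^sup>2 + real d * ep\<^sup>2 * lg (1 / de) / al ^ 4
     * polylog 12 (real d) (1 / ep) (1 / al) (lg (1 / de)))" for d n :: nat and de al ep :: real
 proof -
  have reg: "regime A al ep (lg (1 / de)) c0 B n d (lev n)" by (rule regime_intro[OF assms hyp(1,3,4,5) c0_def B_def K_def hyp(6)])
  then interpret regime A al ep "lg (1 / de)" c0 B n d "lev n" .
  have "runs_within tester (input n d ep al de Y)
    (300000 * (c0 + 2) * (ep * (real n)\<^sup>2 * real d * real (min n d) + real n * real d))" for Y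
  proof -
   obtain t s' where t: "exec tester (input n d ep al de Y) t s'" "t <= 300000 * run_cost n d (ep * real n)"
    using tester_run[OF n1 d1, of ep al de Y] by blast
   have "real t <= real (300000 * run_cost n d (ep * real n))" using t(2) by (rule of_nat_mono)
   also have "... <= 300000 * ((c0 + 2) * (ep * (real n)\<^sup>2 * real d * real (min n d) + real n * real d))"
    using run_time[OF n1 hyp(3) c0_def, of d] by simp
   finally show ?thesis unfolding runs_within_def mult.assoc[of 300000 "c0 + 2"] using t(1) by blast
  qed
  moreover have "robustly_outputs tester n d ep al de mm YES" if mu: "L2_set mm {..<d} = al" for mm
  proof (rule robust_output[OF reg hyp(2)])
   have "ip d mm mm = (L2_set mm {..<d})\<^sup>2" by (simp add: L2_set_def ip_def sq_eq[symmetric] sum_nonneg)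
   thus "ip d mm mm = al\<^sup>2" by (simp add: mu)
  qed (use al in auto)
  moreover have "robustly_outputs tester n d ep al de (%_. 0) NO"
   by (rule robust_output[OF reg hyp(2), where a = 0]) (use al in \<open>auto simp: ip_def\<close>)
  ultimately show ?thesis by blast
 qed
 have K: "0 < K" using B by (simp add: K_def)
 have T: "0 < 300000 * (c0 + 2)" using c0 by simp
 show ?thesis by (rule exI[of _ B], rule conjI[OF B], rule exI[of _ K], rule conjI[OF K], rule exI[of _ 12],
    rule exI[of _ "300000 * (c0 + 2)"], rule conjI[OF T], rule exI[of _ tester]) (intro allI impI, elim conjE, rule main)
qed

end
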